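(* Let $(X,d)$ be a metric space and let $2^X$ be its hyperspace of non-empty closed subsets, endowed with the metric $\min\{1,d_H\}$. Then the following conditions are equivalent: (1) $2^X$ is an ANR; (2) $2^X$ is locally connected; (3) $2^X$ is a uniform ANR; (4) $2^X$ is uniformly locally path equi-connected; (5) $2^X$ is locally chain connected; (6) $2^X$ is locally chain connected at $\mathcal{D}_0(X)$; (7) $X$ is uniformly locally chain equi-connected; (8) $X$ is uniformly locally trace equi-connected; (9) $X$ is weakly convexifiable. Moreover, if $X$ is complete, then the conditions (1)--(9) are equivalent to (10) $X$ is uniformly locally path equi-connected. If $X$ is uniformly locally compact, then the conditions (1)--(10) are equivalent to (11) each subspace $\mathcal{H}\subset 2^X$ containing $\mathcal{D}(X)$ is a uniform ANR. If $X$ is chain equi-connected, then the conditions (1)--(9) are equivalent to each of (12) $2^X$ is an absolute retract; (13) $2^X$ is a uniform absolute retract.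
   Context: Hyperspace. For a metric space $(X,d)$, $2^X$ is the set of all non-empty closed subsets of $X$, and $d_H(A,B)=\max\{\sup_{x\in B}d(x,A),\sup_{x\in A}d(x,B)\}\in[0,\infty]$. The metric $\min\{1,d_H\}$ is used on $2^X$ and its subspaces. $\mathcal{D}(X)=\{D\in 2^X: D\text{ is discrete}\}$. A subset $D\subset X$ is uniformly discrete if there is $\varepsilon>0$ with $|D\cap B(x,\varepsilon)|\le 1$ for all $x\in X$, where $B(x,r)=\{y:d(x,y)<r\}$. $\mathcal{D}_0(X)=\{D\in\mathcal{D}(X): |D|\le\aleph_0$ and $D$ is totally bounded or uniformly discrete in $X\}$. Retracts. For a metric space $(Y,\rho)$: - $Y$ is an ANR (resp. AR, absolute retract) if for each metric space $M$ containing $Y$ isometrically as a closed subset there is a retraction $r:U\to Y$ (continuous, identity on $Y$) from some open neighborhood $U$ of $Y$ in $M$ (resp. from $U=M$). - A uniform neighborhood of $Y$ in $M$ is a set $U\subset M$ containing $\{x\in M:\operatorname{dist}(x,Y)<\varepsilon\}$ for some $\varepsilon>0$. $Y$ is a uniform ANR (resp. uniform absolute retract) if for each metric space $M$ containing $Y$ isometrically as a closed subset there is a retraction $r:U\to Y$ defined on some uniform neighborhood $U$ of $Y$ in $M$ (resp. on $U=M$) which is uniformly continuous at $Y$: for every $\varepsilon>0$ there is $\delta>0$ such that the distance from $r(y)$ to $x$ is $<\varepsilon$ whenever $x\in Y$, $y\in U$ and the distance from $x$ to $y$ is $<\delta$. Connectedness. A topological space $Y$ is locally connected if for each $x_0\in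 Y$ and neighborhood $U$ of $x_0$ there is a connected $C\subset U$ containing a neighborhood of $x_0$. Now let $(Y,\rho)$ be a metric space. For $\eta>0$, an $\eta$-chain of length $l$ linking $x$ and $y$ is a sequence $x=x_0,\dots,x_l=y$ of points of $Y$ with $\rho(x_i,x_{i-1})<\eta$ for $1\le i\le l$; its diameter is $\operatorname{diam}\{x_0,\dots,x_l\}$. - $Y$ is locally chain connected at $Y_0\subset Y$ if for each $x_0\in Y_0$ and $\varepsilon>0$ there is $\delta>0$ such that for each $\eta>0$ and each $x\in Y_0$ with $\rho(x,x_0)<\delta$ there is an $\eta$-chain in $Y$ of diameter $<\varepsilon$ linking $x_0$ and $x$. $Y$ is locally chain connected if this holds with $Y_0=Y$. - $Y$ is uniformly locally chain equi-connected if $\forall\varepsilon>0\ \exists\delta>0\ \forall\eta>0\ \exists l\in\mathbb{N}$ such that any $x,y\in Y$ with $\rho(x,y)<\delta$ can be linked by an $\eta$-chain of diameter $<\varepsilon$ and length $\le l$. - $Y$ is chain equi-connected if for every $\eta>0$ there is $l\in\mathbb{N}$ such that any $x,y\in Y$ can be linked by an $\eta$-chain of length $\le l$. - $Y$ is chain connected im kleinen if there is $\varepsilon>0$ such that any $x,y\in Y$ with $\rho(x,y)<\varepsilon$ can be linked by an $\eta$-chain for every $\eta>0$. - The chain connected component of $x_0$ is $\{x\in Y:$ for every $\eta>0$, $x$ and $x_0$ can be linked by an $\eta$-chain in $Y\}$. - $Y$ is uniformly locally compact if there is $\varepsilon>0$ such that every closed ball $\{y:\rho(x,y)\le\varepsilon\}$,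 $x\in Y$, is compact. Moduli. A continuity modulus is a non-decreasing function $\omega:(0,\infty)\to(0,\infty)$ with $\lim_{t\to+0}\omega(t)=0$. It is concave if, extended by $\omega(0)=0$, it is a concave function on $[0,\infty)$. For a map $f$ between metric spaces, $\omega_f(t)$ is the supremum of the distances between $f(x)$ and $f(x')$ over all $x,x'$ in the domain at distance $\le t$. - $Y$ is uniformly locally path equi-connected if there are $\varepsilon_0>0$ and a continuity modulus $\omega$ such that any $x,y\in Y$ with $\rho(x,y)<\varepsilon_0$ can be connected by a path $f:[0,\rho(x,y)]\to Y$ with $f(0)=x$, $f(\rho(x,y))=y$, $\omega_f\le\omega$. - $Y$ is uniformly locally trace equi-connected if there are $\varepsilon_0>0$ and a continuity modulus $\omega$ such that for any $x,y\in Y$ with $\rho(x,y)<\varepsilon_0$ and any countable dense subset $Q\supset\{0,\rho(x,y)\}$ of $[0,\rho(x,y)]$ there is a uniformly continuous $f:Q\to Y$ with $f(0)=x$, $f(\rho(x,y))=y$, $\omega_f\le\omega$. - For a continuity modulus $\omega$, a metric $\rho$ on $Y$ is $\omega$-convex if for any $x,y\in Y$ and positive reals $s,t$ with $\rho(x,y)<\omega(s+t)$ there is $z\in Y$ with $\rho(x,z)<\omega(s)$ and $\rho(z,y)<\omega(t)$. - $Y$ is weakly convexifiable if $Y$ is chain connected im kleinen and there is a concave continuity modulus $\alpha$ such that for each concave continuity modulus $\omega\ge\alpha$ the uniformity of $Y$ is generated by a metric whose restriction to each chain connected component of $Y$ is $\omega$-convex. *)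

theory Defs
  imports "HOL-Analysis.Analysis"
begin

text \<open>Distances to sets and Hausdorff distances take values in \<open>[0,\<infinity>]\<close>.\<close>

definition set_dist :: "'a metric \<Rightarrow> 'a \<Rightarrow> 'a set \<Rightarrow> ennreal" where
  "set_dist X x A = (INF a\<in>A. ennreal (mdist X x a))"

definition hausdorff_dist :: "'a metric \<Rightarrow> 'a set \<Rightarrow> 'a set \<Rightarrow> ennreal" where
  "hausdorff_dist X A B = max (SUP x\<in>B. set_dist X x A) (SUP x\<in>A. set_dist X x B)"

definition closed_sets :: "'a metric \<Rightarrow> 'a set set" where
  "closed_sets X = {A. closedin (mtopology_of X) A \<and> A \<noteq> {}}"

definition hyperspace :: "'a metric \<Rightarrow> 'a set metric" where
  "hyperspace X = metric (closed_sets X, \<lambda>A B. enn2real (min 1 (hausdorff_dist X A B)))"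

lemma hausdorff_dist_commute: "hausdorff_dist X A B = hausdorff_dist X B A"
  by (simp add: hausdorff_dist_def max.commute)

lemma set_dist_le_hausdorff_dist: "x \<in> A \<Longrightarrow> set_dist X x B \<le> hausdorff_dist X A B"
  unfolding hausdorff_dist_def by (meson SUP_upper le_max_iff_disj)

lemma INF_ennreal_add:
  fixes f :: "'b \<Rightarrow> ennreal"
  assumes "I \<noteq> {}"
  shows "(INF i\<in>I. c + f i) = c + (INF i\<in>I. f i)"
  using continuous_at_Inf_mono[of "\<lambda>x. c + x" "f ` I"] assms
  using continuous_add[of "at_right (Inf (f ` I))", of "\<lambda>x. c" "\<lambda>x. x"]
  by (auto simp: mono_def image_comp add_left_mono)

lemma set_dist_triangle:
  assumes "x \<in> mspace X" "B \<subseteq> mspace X" "C \<subseteq> mspace X"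
  shows "set_dist X x C \<le> set_dist X x B + hausdorff_dist X B C"
proof -
  interpret Metric_space "mspace X" "mdist X" by simp
  have *: "set_dist X x C \<le> ennreal (mdist X x y) + hausdorff_dist X B C" if y: "y \<in> B" for y
  proof -
    have "set_dist X x C \<le> (INF c\<in>C. ennreal (mdist X x y) + ennreal (mdist X y c))"
      unfolding set_dist_def
    proof (rule INF_mono)
      fix c assume c: "c \<in> C"
      have "mdist X x c \<le> mdist X x y + mdist X y c"
        using assms y c by (intro triangle) auto
      then have "ennreal (mdist X x c) \<le> ennreal (mdist X x y) + ennreal (mdist X y c)"
        by (simp add: ennreal_leI flip: ennreal_plus)
      then show "\<exists>a\<in>C. ennreal (mdist X x a) \<le> ennreal (mdist X x y) + ennreal (mdist X y c)"
        using c by blast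
    qed
    also have "\<dots> \<le> ennreal (mdist X x y) + set_dist X y C"
      unfolding set_dist_def
      by (cases "C = {}") (auto simp: INF_ennreal_add)
    also have "\<dots> \<le> ennreal (mdist X x y) + hausdorff_dist X B C"
      using y by (intro add_left_mono set_dist_le_hausdorff_dist)
    finally show ?thesis .
  qed
  show ?thesis
  proof (cases "B = {}")
    case True
    then show ?thesis by (simp add: set_dist_def)
  next
    case False
    have "set_dist X x C \<le> (INF y\<in>B. hausdorff_dist X B C + ennreal (mdist X x y))"
      using * by (intro INF_greatest) (simp add: add.commute)
    also have "\<dots> = hausdorff_dist X B C + set_dist X x B"
      unfolding set_dist_def using False
      by (simp add: INF_ennreal_add)
    finally show ?thesis by (simp add: add.commute)
  qed
qed

lemma hausdorff_dist_triangle: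
  assumes "A \<subseteq> mspace X" "B \<subseteq> mspace X" "C \<subseteq> mspace X"
  shows "hausdorff_dist X A C \<le> hausdorff_dist X A B + hausdorff_dist X B C"
proof -
  have 1: "set_dist X x C \<le> hausdorff_dist X A B + hausdorff_dist X B C" if "x \<in> A" for x
    using set_dist_triangle[of x X B C] set_dist_le_hausdorff_dist[OF that, of X B] assms that
    by (meson add_right_mono order_trans subsetD)
  have 2: "set_dist X x A \<le> hausdorff_dist X A B + hausdorff_dist X B C" if "x \<in> C" for x
  proof -
    have "set_dist X x A \<le> set_dist X x B + hausdorff_dist X B A"
      using set_dist_triangle[of x X B A] assms that by auto
    also have "\<dots> \<le> hausdorff_dist X C B + hausdorff_dist X B A"
      using set_dist_le_hausdorff_dist[OF that, of X B] by (rule add_right_mono)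
    finally show ?thesis
      by (metis hausdorff_dist_commute add.commute)
  qed
  have "(SUP x\<in>C. set_dist X x A) \<le> hausdorff_dist X A B + hausdorff_dist X B C"
    using 2 by (rule SUP_least)
  moreover have "(SUP x\<in>A. set_dist X x C) \<le> hausdorff_dist X A B + hausdorff_dist X B C"
    using 1 by (rule SUP_least)
  ultimately show ?thesis
    unfolding hausdorff_dist_def[of X A C] by simp
qed

lemma set_dist_eq_0_imp_mem:
  assumes "closedin (mtopology_of X) A" "x \<in> mspace X" "set_dist X x A = 0"
  shows "x \<in> A"
proof (rule ccontr)
  interpret Metric_space "mspace X" "mdist X" by simp
  assume "x \<notin> A"
  then obtain r where r: "r > 0" "disjnt A (mball x r)"
    using assms unfolding mtopology_of_def closedin_metric by blast
  have "ennreal r \<le> set_dist X x A"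
    unfolding set_dist_def
  proof (rule INF_greatest)
    fix a assume "a \<in> A"
    moreover have "a \<in> mspace X"
      using \<open>a \<in> A\<close> closedin_subset[OF assms(1)] by auto
    ultimately show "ennreal r \<le> ennreal (mdist X x a)"
      using r assms(2) by (intro ennreal_leI) (force simp: disjnt_iff)
  qed
  then show False using r assms(3) by simp
qed

lemma set_dist_mem: "x \<in> mspace X \<Longrightarrow> x \<in> A \<Longrightarrow> set_dist X x A = 0"
proof -
  interpret Metric_space "mspace X" "mdist X" by simp
  assume "x \<in> mspace X" "x \<in> A"
  then have "set_dist X x A \<le> ennreal (mdist X x x)"
    unfolding set_dist_def by (intro INF_lower)
  then show ?thesis using \<open>x \<in> mspace X\<close> by simp
qed

lemma hausdorff_dist_eq_0_iff:
  assumes "A \<in> closed_sets X" "B \<in> closed_sets X"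
  shows "hausdorff_dist X A B = 0 \<longleftrightarrow> A = B"
proof
  have sub: "A \<subseteq> mspace X" "B \<subseteq> mspace X"
    using assms closedin_subset by (fastforce simp: closed_sets_def)+
  show "A = B" if z: "hausdorff_dist X A B = 0"
  proof -
    have "set_dist X x B = 0" if "x \<in> A" for x
      using set_dist_le_hausdorff_dist[OF that, of X B] z by simp
    moreover have "set_dist X x A = 0" if "x \<in> B" for x
      using set_dist_le_hausdorff_dist[OF that, of X A] z by (simp add: hausdorff_dist_commute)
    ultimately show ?thesis
      using assms sub set_dist_eq_0_imp_mem[of X] unfolding closed_sets_def by blast
  qed
  show "hausdorff_dist X A B = 0" if "A = B"
  proof -
    have "set_dist X x B = 0" if "x \<in> B" for x
      using sub that by (intro set_dist_mem) auto
    with \<open>A = B\<close> show ?thesis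
      using assms by (simp add: hausdorff_dist_def closed_sets_def)
  qed
qed

lemma Metric_space_hyperspace:
  "Metric_space (closed_sets X) (\<lambda>A B. enn2real (min 1 (hausdorff_dist X A B)))"
proof
  fix A B
  show "0 \<le> enn2real (min 1 (hausdorff_dist X A B))" by simp
  show "enn2real (min 1 (hausdorff_dist X A B)) = enn2real (min 1 (hausdorff_dist X B A))"
    by (simp add: hausdorff_dist_commute)
next
  fix A B assume "A \<in> closed_sets X" "B \<in> closed_sets X"
  note eq = hausdorff_dist_eq_0_iff[OF this]
  show "enn2real (min 1 (hausdorff_dist X A B)) = 0 \<longleftrightarrow> A = B"
    unfolding eq[symmetric] by (auto simp: enn2real_eq_0_iff min_def split: if_splits)
next
  fix A B C assume *: "A \<in> closed_sets X" "B \<in> closed_sets X" "C \<in> closed_sets X"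
  let ?m = "\<lambda>A B. min 1 (hausdorff_dist X A B)"
  have "hausdorff_dist X A C \<le> hausdorff_dist X A B + hausdorff_dist X B C"
    using * closedin_subset by (intro hausdorff_dist_triangle) (fastforce simp: closed_sets_def)+
  then have le: "?m A C \<le> ?m A B + ?m B C"
    by (auto simp: min_def add_increasing add_increasing2 intro: order_trans)
  have fin: "?m A B < top" "?m B C < top"
    by (simp_all add: min_less_iff_disj)
  have "enn2real (?m A C) \<le> enn2real (?m A B + ?m B C)"
    using le fin by (intro enn2real_mono) auto
  also have "\<dots> = enn2real (?m A B) + enn2real (?m B C)"
    using fin by (rule enn2real_plus)
  finally show "enn2real (?m A C) \<le> enn2real (?m A B) + enn2real (?m B C)" .
qed

lemma mspace_hyperspace [simp]: "mspace (hyperspace X) = closed_sets X"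
  and mdist_hyperspace:
    "mdist (hyperspace X) = (\<lambda>A B. enn2real (min 1 (hausdorff_dist X A B)))"
  unfolding hyperspace_def
  by (simp_all add: Metric_space.mspace_metric Metric_space.mdist_metric Metric_space_hyperspace)

definition discrete_closed_sets :: "'a metric \<Rightarrow> 'a set set" where
  "discrete_closed_sets X =
    {D \<in> closed_sets X. subtopology (mtopology_of X) D = discrete_topology D}"

definition uniformly_discrete :: "'a metric \<Rightarrow> 'a set \<Rightarrow> bool" where
  "uniformly_discrete X D \<longleftrightarrow>
    (\<exists>\<epsilon>>0. \<forall>x\<in>mspace X. finite (D \<inter> mball_of X x \<epsilon>) \<and> card (D \<inter> mball_of X x \<epsilon>) \<le> 1)"

definition small_discrete_closed_sets :: "'a metric \<Rightarrow> 'a set set" where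
  "small_discrete_closed_sets X =
    {D \<in> discrete_closed_sets X. countable D \<and>
       (Metric_space.mtotally_bounded (mspace X) (mdist X) D \<or> uniformly_discrete X D)}"

definition closed_isometric_embedding :: "'a metric \<Rightarrow> 'm metric \<Rightarrow> ('a \<Rightarrow> 'm) \<Rightarrow> bool" where
  "closed_isometric_embedding Y M e \<longleftrightarrow>
    e \<in> mspace Y \<rightarrow> mspace M \<and>
    (\<forall>x\<in>mspace Y. \<forall>y\<in>mspace Y. mdist M (e x) (e y) = mdist Y x y) \<and>
    closedin (mtopology_of M) (e ` mspace Y)"

definition retraction_onto :: "'m metric \<Rightarrow> 'm set \<Rightarrow> 'm set \<Rightarrow> ('m \<Rightarrow> 'm) \<Rightarrow> bool" where
  "retraction_onto M U S r \<longleftrightarrow>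
    S \<subseteq> U \<and> U \<subseteq> mspace M \<and>
    continuous_map (subtopology (mtopology_of M) U) (subtopology (mtopology_of M) S) r \<and>
    (\<forall>x\<in>S. r x = x)"

definition uniform_neighborhood :: "'m metric \<Rightarrow> 'm set \<Rightarrow> 'm set \<Rightarrow> bool" where
  "uniform_neighborhood M S U \<longleftrightarrow>
    U \<subseteq> mspace M \<and> (\<exists>\<epsilon>>0. {x \<in> mspace M. set_dist M x S < ennreal \<epsilon>} \<subseteq> U)"

definition uniformly_continuous_at_set ::
    "'m metric \<Rightarrow> 'm set \<Rightarrow> 'm set \<Rightarrow> ('m \<Rightarrow> 'm) \<Rightarrow> bool" where
  "uniformly_continuous_at_set M U S r \<longleftrightarrow>
    (\<forall>\<epsilon>>0. \<exists>\<delta>>0. \<forall>x\<in>S. \<forall>y\<in>U. mdist M x y < \<delta> \<longrightarrow> mdist M (r y) x < \<epsilon>)"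

text \<open>HOL formulas cannot quantify over types, so the four notions below carry the type \<open>'m\<close> of
  points of the ambient spaces \<open>M\<close> as a parameter. They are to be used with \<open>'m\<close> of the form
  \<open>'u + ('y \<Rightarrow> real)\<close>, where \<open>'y\<close> is the type of points of \<open>Y\<close> and \<open>'u\<close> is a free type variable:
  the instances of \<open>'u\<close> cover ambient spaces over every type, and the second summand ensures that
  for no instance \<open>'m\<close> is too small, as it accommodates the Kuratowski embedding of \<open>Y\<close> into
  the bounded real functions on \<open>Y\<close> and hence the convex hull of its image.\<close>

definition metric_ANR :: "'m itself \<Rightarrow> 'y metric \<Rightarrow> bool" where
  "metric_ANR _ Y \<longleftrightarrow>
    (\<forall>(M :: 'm metric) e. closed_isometric_embedding Y M e \<longrightarrow>
      (\<exists>U r. openin (mtopology_of M) U \<and> retraction_onto M U (e ` mspace Y) r))"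

definition metric_AR :: "'m itself \<Rightarrow> 'y metric \<Rightarrow> bool" where
  "metric_AR _ Y \<longleftrightarrow>
    (\<forall>(M :: 'm metric) e. closed_isometric_embedding Y M e \<longrightarrow>
      (\<exists>r. retraction_onto M (mspace M) (e ` mspace Y) r))"

definition uniform_ANR :: "'m itself \<Rightarrow> 'y metric \<Rightarrow> bool" where
  "uniform_ANR _ Y \<longleftrightarrow>
    (\<forall>(M :: 'm metric) e. closed_isometric_embedding Y M e \<longrightarrow>
      (\<exists>U r. uniform_neighborhood M (e ` mspace Y) U \<and>
             retraction_onto M U (e ` mspace Y) r \<and>
             uniformly_continuous_at_set M U (e ` mspace Y) r))"

definition uniform_AR :: "'m itself \<Rightarrow> 'y metric \<Rightarrow> bool" where
  "uniform_AR _ Y \<longleftrightarrow>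
    (\<forall>(M :: 'm metric) e. closed_isometric_embedding Y M e \<longrightarrow>
      (\<exists>r. retraction_onto M (mspace M) (e ` mspace Y) r \<and>
           uniformly_continuous_at_set M (mspace M) (e ` mspace Y) r))"

definition chain_linking ::
    "'a metric \<Rightarrow> real \<Rightarrow> nat \<Rightarrow> 'a \<Rightarrow> 'a \<Rightarrow> (nat \<Rightarrow> 'a) \<Rightarrow> bool" where
  "chain_linking Y \<eta> l x y c \<longleftrightarrow>
    c 0 = x \<and> c l = y \<and> (\<forall>i\<le>l. c i \<in> mspace Y) \<and>
    (\<forall>i\<in>{1..l}. mdist Y (c i) (c (i - 1)) < \<eta>)"

definition chain_diam :: "'a metric \<Rightarrow> nat \<Rightarrow> (nat \<Rightarrow> 'a) \<Rightarrow> real" where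
  "chain_diam Y l c = Max ((\<lambda>(i, j). mdist Y (c i) (c j)) ` ({..l} \<times> {..l}))"

definition locally_chain_connected_at :: "'a metric \<Rightarrow> 'a set \<Rightarrow> bool" where
  "locally_chain_connected_at Y Y0 \<longleftrightarrow>
    (\<forall>x0\<in>Y0. \<forall>\<epsilon>>0. \<exists>\<delta>>0. \<forall>\<eta>>0. \<forall>x\<in>Y0. mdist Y x x0 < \<delta> \<longrightarrow>
      (\<exists>l c. chain_linking Y \<eta> l x0 x c \<and> chain_diam Y l c < \<epsilon>))"

definition locally_chain_connected :: "'a metric \<Rightarrow> bool" where
  "locally_chain_connected Y \<longleftrightarrow> locally_chain_connected_at Y (mspace Y)"

definition uniformly_locally_chain_equi_connected :: "'a metric \<Rightarrow> bool" where
  "uniformly_locally_chain_equi_connected Y \<longleftrightarrow>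
    (\<forall>\<epsilon>>0. \<exists>\<delta>>0. \<forall>\<eta>>0. \<exists>l. \<forall>x\<in>mspace Y. \<forall>y\<in>mspace Y. mdist Y x y < \<delta> \<longrightarrow>
      (\<exists>k\<le>l. \<exists>c. chain_linking Y \<eta> k x y c \<and> chain_diam Y k c < \<epsilon>))"

definition chain_equi_connected :: "'a metric \<Rightarrow> bool" where
  "chain_equi_connected Y \<longleftrightarrow>
    (\<forall>\<eta>>0. \<exists>l. \<forall>x\<in>mspace Y. \<forall>y\<in>mspace Y. \<exists>k\<le>l. \<exists>c. chain_linking Y \<eta> k x y c)"

definition chain_connected_im_kleinen :: "'a metric \<Rightarrow> bool" where
  "chain_connected_im_kleinen Y \<longleftrightarrow>
    (\<exists>\<epsilon>>0. \<forall>x\<in>mspace Y. \<forall>y\<in>mspace Y. mdist Y x y < \<epsilon> \<longrightarrow>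
      (\<forall>\<eta>>0. \<exists>l c. chain_linking Y \<eta> l x y c))"

definition chain_component :: "'a metric \<Rightarrow> 'a \<Rightarrow> 'a set" where
  "chain_component Y x0 = {x \<in> mspace Y. \<forall>\<eta>>0. \<exists>l c. chain_linking Y \<eta> l x x0 c}"

definition uniformly_locally_compact :: "'a metric \<Rightarrow> bool" where
  "uniformly_locally_compact Y \<longleftrightarrow>
    (\<exists>\<epsilon>>0. \<forall>x\<in>mspace Y. compactin (mtopology_of Y) (mcball_of Y x \<epsilon>))"

text \<open>A modulus is a function on \<open>(0,\<infinity>)\<close>; the values of \<open>\<omega>\<close> at non-positive arguments are
  irrelevant.\<close>

definition continuity_modulus :: "(real \<Rightarrow> real) \<Rightarrow> bool" where
  "continuity_modulus \<omega> \<longleftrightarrow>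
    (\<forall>t>0. \<omega> t > 0) \<and> mono_on {0<..} \<omega> \<and> (\<omega> \<longlongrightarrow> 0) (at_right 0)"

definition concave_modulus :: "(real \<Rightarrow> real) \<Rightarrow> bool" where
  "concave_modulus \<omega> \<longleftrightarrow>
    continuity_modulus \<omega> \<and> concave_on {0..} (\<lambda>t. if t = 0 then 0 else \<omega> t)"

definition modulus_of :: "'a metric \<Rightarrow> 'b metric \<Rightarrow> ('a \<Rightarrow> 'b) \<Rightarrow> real \<Rightarrow> ennreal" where
  "modulus_of A B f t =
    (SUP (x, x') \<in> {(x, x'). x \<in> mspace A \<and> x' \<in> mspace A \<and> mdist A x x' \<le> t}.
      ennreal (mdist B (f x) (f x')))"

definition uniformly_locally_path_equi_connected :: "'a metric \<Rightarrow> bool" where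
  "uniformly_locally_path_equi_connected Y \<longleftrightarrow>
    (\<exists>\<epsilon>>0. \<exists>\<omega>. continuity_modulus \<omega> \<and>
      (\<forall>x\<in>mspace Y. \<forall>y\<in>mspace Y. mdist Y x y < \<epsilon> \<longrightarrow>
        (\<exists>f. continuous_map (subtopology euclideanreal {0..mdist Y x y}) (mtopology_of Y) f \<and>
             f 0 = x \<and> f (mdist Y x y) = y \<and>
             (\<forall>t>0. modulus_of (submetric euclidean_metric {0..mdist Y x y}) Y f t
                      \<le> ennreal (\<omega> t)))))"

definition uniformly_locally_trace_equi_connected :: "'a metric \<Rightarrow> bool" where
  "uniformly_locally_trace_equi_connected Y \<longleftrightarrow>
    (\<exists>\<epsilon>>0. \<exists>\<omega>. continuity_modulus \<omega> \<and>
      (\<forall>x\<in>mspace Y. \<forall>y\<in>mspace Y. mdist Y x y < \<epsilon> \<longrightarrow>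
        (\<forall>Q. countable Q \<and> Q \<subseteq> {0..mdist Y x y} \<and> {0..mdist Y x y} \<subseteq> closure Q \<and>
             {0, mdist Y x y} \<subseteq> Q \<longrightarrow>
          (\<exists>f. uniformly_continuous_map (submetric euclidean_metric Q) Y f \<and>
               f 0 = x \<and> f (mdist Y x y) = y \<and>
               (\<forall>t>0. modulus_of (submetric euclidean_metric Q) Y f t \<le> ennreal (\<omega> t))))))"

definition omega_convex :: "(real \<Rightarrow> real) \<Rightarrow> 'a metric \<Rightarrow> bool" where
  "omega_convex \<omega> Y \<longleftrightarrow>
    (\<forall>x\<in>mspace Y. \<forall>y\<in>mspace Y. \<forall>s>0. \<forall>t>0. mdist Y x y < \<omega> (s + t) \<longrightarrow>
      (\<exists>z\<in>mspace Y. mdist Y x z < \<omega> s \<and> mdist Y z y < \<omega> t))"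

definition muniformity :: "'a metric \<Rightarrow> ('a \<times> 'a) filter" where
  "muniformity Y =
    (INF e\<in>{0<..}. principal {(x, y). x \<in> mspace Y \<and> y \<in> mspace Y \<and> mdist Y x y < e})"

definition weakly_convexifiable :: "'a metric \<Rightarrow> bool" where
  "weakly_convexifiable Y \<longleftrightarrow>
    chain_connected_im_kleinen Y \<and>
    (\<exists>\<alpha>. concave_modulus \<alpha> \<and>
      (\<forall>\<omega>. concave_modulus \<omega> \<and> (\<forall>t>0. \<alpha> t \<le> \<omega> t) \<longrightarrow>
        (\<exists>Z. mspace Z = mspace Y \<and> muniformity Z = muniformity Y \<and>
             (\<forall>x0\<in>mspace Y. omega_convex \<omega> (submetric Z (chain_component Y x0))))))"

end

theory Submission
  imports Defs
begin

text \<open>Everything passes through one condition on \<open>X\<close>, \<open>trace_connected\<close>: points at distance \<open>t < e\<close>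
  are joined by a map of duration \<open>t\<close>, defined at a dense set of times and with a fixed concave
  modulus \<open>w\<close>.

  The conditions on the hyperspace imply it. A retract of an open subset of a locally connected
  space is locally connected, and the hyperspace is a closed subset of such a space of functions
  (\<open>metric_ANR_imp_locally_connected_space\<close>). Connected neighbourhoods contain chains for every
  step size. A chain in the hyperspace with \<open>l\<close> steps moves all points of a closed set
  simultaneously in \<open>l\<close> steps (\<open>hyperspace_chain_follow\<close>). If chains in \<open>X\<close> could not be chosen
  with uniformly bounded lengths, the points that violate a bound would contain a sequence that
  is separated or Cauchy, and its range would be a discrete closed set at which the hyperspace
  is not locally chain connected. Thus \<open>X\<close> is uniformly locally chain equi-connected
  (\<open>locally_chain_connected_imp_uniformly_locally_chain_equi_connected\<close>). Chains of bounded
  length, subdivided again and again, converge to traces with a common modulus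
  (\<open>uniformly_locally_chain_equi_connected_imp_trace_connected\<close>).

  Conversely, traces move closed sets. Following all traces that start in \<open>A\<close> for a time \<open>t\<close>
  gives a set that grows with \<open>t\<close> at a controlled rate and absorbs the closed sets near \<open>A\<close>.
  Such flows yield paths in the hyperspace (\<open>hyperspace_path\<close>) and retractions onto it
  (\<open>hyperspace_flow_retraction\<close>): a point \<open>m\<close> of an ambient space is sent to the closed union of
  the flows of the closed sets \<open>A\<close> near \<open>m\<close>, for a time that decreases to 0 as the distance from
  \<open>m\<close> to \<open>A\<close> increases. Chain equi-connectedness of \<open>X\<close> provides traces between arbitrary
  points, and the retraction is defined everywhere. The least cost of joining points by traces,
  when a trace of duration \<open>t\<close> costs \<open>W t\<close>, is a convex metric (\<open>convex_metric\<close>); and convexity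
  in turn produces chains of bounded length.

  In a complete space traces extend to paths. In a uniformly locally compact space the value of
  the retraction at \<open>m\<close> can be replaced by a discrete set, made of points of nets and of points
  travelling between them along such paths, in a way that remains continuous in \<open>m\<close> (the locale
  \<open>discretization\<close>).\<close>

section \<open>The hyperspace metric\<close>

text \<open>Below the cap 1 the hyperspace metric is the Hausdorff distance itself, so a bound on it can be
  read off pointwise; this is why small radii are kept below 1 throughout.\<close>

lemma mdist_hyperspace_lessD:
  assumes "mdist (hyperspace X) A B < r" "r \<le> 1" "x \<in> A"
  shows "\<exists>y\<in>B. mdist X x y < r"
proof -
  have "0 < r"
    using assms(1) mdist_nonneg[of "hyperspace X" A B] by linarith
  have "hausdorff_dist X A B < ennreal r"
  proof (rule ccontr)
    assume "\<not> ?thesis"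
    then have "ennreal r \<le> min 1 (hausdorff_dist X A B)"
      using \<open>r \<le> 1\<close> by (auto simp: ennreal_le_1)
    then have "enn2real (ennreal r) \<le> enn2real (min 1 (hausdorff_dist X A B))"
      by (intro enn2real_mono) (auto simp: min_less_iff_disj)
    with assms(1) \<open>0 < r\<close> show False
      by (simp add: mdist_hyperspace)
  qed
  then have "set_dist X x B < ennreal r"
    using set_dist_le_hausdorff_dist[OF assms(3), of X B] by order
  then show ?thesis
    unfolding set_dist_def INF_less_iff by (auto simp: ennreal_less_iff)
qed

lemma mdist_hyperspace_leI:
  assumes "0 \<le> r"
    and "\<And>x e. x \<in> A \<Longrightarrow> r < e \<Longrightarrow> \<exists>y\<in>B. mdist X x y < e"
    and "\<And>y e. y \<in> B \<Longrightarrow> r < e \<Longrightarrow> \<exists>x\<in>A. mdist X y x < e"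
  shows "mdist (hyperspace X) A B \<le> r"
proof -
  have *: "set_dist X x C \<le> ennreal r"
    if h: "\<And>e. r < e \<Longrightarrow> \<exists>y\<in>C. mdist X x y < e" for x C
  proof (rule ennreal_le_epsilon)
    fix e :: real assume "0 < e"
    then obtain y where y: "y \<in> C" "mdist X x y < r + e"
      using h[of "r + e"] by auto
    then have "set_dist X x C \<le> ennreal (mdist X x y)"
      unfolding set_dist_def by (intro INF_lower)
    also have "\<dots> \<le> ennreal r + ennreal e"
      using y \<open>0 < e\<close> assms(1) by (simp flip: ennreal_plus)
    finally show "set_dist X x C \<le> ennreal r + ennreal e" .
  qed
  have "hausdorff_dist X A B \<le> ennreal r"
    unfolding hausdorff_dist_def using assms(2,3) by (auto intro!: SUP_least *)
  then have "enn2real (min 1 (hausdorff_dist X A B)) \<le> enn2real (ennreal r)"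
    by (intro enn2real_mono) (auto simp: min_le_iff_disj)
  then show ?thesis
    using assms(1) by (simp add: mdist_hyperspace)
qed

lemma mdist_self [simp]: "x \<in> mspace X \<Longrightarrow> mdist X x x = 0"
  by simp

lemma mdist_gt_0: "x \<in> mspace X \<Longrightarrow> y \<in> mspace X \<Longrightarrow> x \<noteq> y \<Longrightarrow> 0 < mdist X x y"
  by (metis mdist_nonneg mdist_zero order_le_less)

lemma closed_sets_subset: "A \<in> closed_sets X \<Longrightarrow> A \<subseteq> mspace X"
  using closedin_subset by (fastforce simp: closed_sets_def)

lemma closed_sets_nonempty: "A \<in> closed_sets X \<Longrightarrow> A \<noteq> {}"
  by (simp add: closed_sets_def)

lemma closure_of_mtopology_iff:
  "x \<in> mtopology_of X closure_of G \<longleftrightarrow>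
    x \<in> mspace X \<and> (\<forall>e>0. \<exists>y\<in>G. y \<in> mspace X \<and> mdist X x y < e)"
proof -
  interpret Metric_space "mspace X" "mdist X" by simp
  show ?thesis
    by (auto simp: mtopology_of_def metric_closure_of in_mball)
qed

lemma subset_mclosure: "G \<subseteq> mspace X \<Longrightarrow> G \<subseteq> mtopology_of X closure_of G"
  by (simp add: closure_of_subset)

lemma mclosure_in_closed_sets:
  assumes "G \<subseteq> mspace X" "G \<noteq> {}"
  shows "mtopology_of X closure_of G \<in> closed_sets X"
  using assms subset_mclosure[of G X] by (auto simp: closed_sets_def)

text \<open>Points of the hyperspace are mostly produced as closures of unions. The Hausdorff distance does
  not see the closure, because every estimate is allowed an arbitrarily small loss.\<close>

lemma mdist_hyperspace_closure_leI:
  assumes "0 \<le> r" "A \<subseteq> mspace X" "B \<subseteq> mspace X"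
    and AB: "\<And>x e. x \<in> A \<Longrightarrow> r < e \<Longrightarrow> \<exists>y\<in>B. mdist X x y < e"
    and BA: "\<And>y e. y \<in> B \<Longrightarrow> r < e \<Longrightarrow> \<exists>x\<in>A. mdist X y x < e"
  shows "mdist (hyperspace X) (mtopology_of X closure_of A) (mtopology_of X closure_of B) \<le> r"
proof -
  have *: "\<exists>y\<in>mtopology_of X closure_of D. mdist X x y < e"
    if x: "x \<in> mtopology_of X closure_of C" and e: "r < e" and D: "D \<subseteq> mspace X"
      and CD: "\<And>x e. x \<in> C \<Longrightarrow> r < e \<Longrightarrow> \<exists>y\<in>D. mdist X x y < e" for C D x e
  proof -
    have "x \<in> mspace X" "0 < (e - r) / 2"
      using x e by (auto simp: closure_of_mtopology_iff)
    obtain z where z: "z \<in> C" "z \<in> mspace X" "mdist X x z < (e - r) / 2"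
      using x \<open>0 < (e - r) / 2\<close> unfolding closure_of_mtopology_iff by blast
    obtain y where y: "y \<in> D" "mdist X z y < r + (e - r) / 2"
      using CD[OF z(1), of "r + (e - r) / 2"] e by auto
    have "mdist X x y < e"
      using mdist_triangle[of x X z y] y z D \<open>x \<in> mspace X\<close> by (auto simp: field_simps)
    then show ?thesis
      using y(1) D subset_mclosure[of D X] by blast
  qed
  show ?thesis
    by (rule mdist_hyperspace_leI[OF assms(1)]) (use *[OF _ _ assms(3) AB] *[OF _ _ assms(2) BA] in blast)+
qed

lemma closedin_mclosure_eq: "A \<in> closed_sets X \<Longrightarrow> mtopology_of X closure_of A = A"
  by (simp add: closed_sets_def closure_of_closedin)

lemma singleton_in_closed_sets: "x \<in> mspace X \<Longrightarrow> {x} \<in> closed_sets X"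
proof -
  interpret Metric_space "mspace X" "mdist X" by simp
  show "x \<in> mspace X \<Longrightarrow> {x} \<in> closed_sets X"
    by (simp add: closed_sets_def mtopology_of_def closedin_t1_singleton t1_space_mtopology)
qed

section \<open>Concave moduli and traces\<close>

text \<open>A concave continuity modulus, with the convention \<open>w 0 = 0\<close>: estimates of the form \<open>mdist X (f
  u) (f v) \<le> w |u - v|\<close> then cover \<open>u = v\<close>.\<close>

definition gauge_fun :: "(real \<Rightarrow> real) \<Rightarrow> bool" where
  "gauge_fun w \<longleftrightarrow> concave_on {0..} w \<and> mono_on {0..} w \<and> w 0 = 0 \<and>
    (w \<longlongrightarrow> 0) (at_right 0) \<and> (\<forall>t>0. 0 < w t)"

lemma gauge_fun_0 [simp]: "gauge_fun w \<Longrightarrow> w 0 = 0"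
  by (simp add: gauge_fun_def)

lemma gauge_fun_mono: "gauge_fun w \<Longrightarrow> 0 \<le> s \<Longrightarrow> s \<le> t \<Longrightarrow> w s \<le> w t"
  by (auto simp: gauge_fun_def mono_on_def)

lemma gauge_fun_pos: "gauge_fun w \<Longrightarrow> 0 < t \<Longrightarrow> 0 < w t"
  by (auto simp: gauge_fun_def)

lemma gauge_fun_nonneg: "gauge_fun w \<Longrightarrow> 0 \<le> t \<Longrightarrow> 0 \<le> w t"
  using gauge_fun_mono[of w 0 t] by simp

text \<open>Concavity in the form of decreasing increments; subadditivity is the case \<open>a = 0\<close>.\<close>

lemma gauge_fun_increment:
  assumes "gauge_fun w" "0 \<le> a" "a \<le> b" "0 \<le> h"
  shows "w (b + h) - w b \<le> w (a + h) - w a"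
proof (cases "h = 0 \<or> a = b")
  case False
  then have pos: "0 < h" "a < b" using assms by auto
  define l where "l = h / (b + h - a)"
  have l: "0 \<le> l" "l \<le> 1" using pos by (auto simp: l_def)
  have lh: "l * (b + h - a) = h"
    using pos by (simp add: l_def)
  have conc: "\<And>t x y. 0 \<le> t \<Longrightarrow> t \<le> 1 \<Longrightarrow> x \<ge> 0 \<Longrightarrow> y \<ge> 0 \<Longrightarrow>
      (1 - t) * w x + t * w y \<le> w ((1 - t) * x + t * y)"
    using assms(1) unfolding gauge_fun_def concave_on_iff
    by (metis add.commute atLeast_iff diff_ge_0_iff_ge le_add_diff_inverse real_scaleR_def)
  have e1: "(1 - l) * a + l * (b + h) = a + h"
    using lh by (simp add: algebra_simps)
  have e2: "(1 - (1 - l)) * a + (1 - l) * (b + h) = b"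
    using lh by (simp add: algebra_simps)
  have "(1 - l) * w a + l * w (b + h) \<le> w (a + h)"
    using conc[of l a "b + h"] l assms(2-) unfolding e1 by simp
  moreover have "l * w a + (1 - l) * w (b + h) \<le> w b"
    using conc[of "1 - l" a "b + h"] l assms(2-) unfolding e2 by simp
  ultimately show ?thesis
    by (simp add: algebra_simps)
qed auto

lemma gauge_fun_subadditive:
  assumes "gauge_fun w" "0 \<le> s" "0 \<le> t"
  shows "w (s + t) \<le> w s + w t"
  using gauge_fun_increment[of w 0 s t] assms by simp

lemma gauge_fun_small:
  assumes "gauge_fun w" "0 < e"
  obtains d where "0 < d" "\<And>t. 0 \<le> t \<Longrightarrow> t \<le> d \<Longrightarrow> w t < e"
proof -
  have "eventually (\<lambda>t. w t < e) (at_right 0)"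
    using assms order_tendstoD(2)[of w 0 "at_right 0" e] by (auto simp: gauge_fun_def)
  then obtain b where b: "b > 0" "\<And>t. 0 < t \<Longrightarrow> t < b \<Longrightarrow> w t < e"
    unfolding eventually_at_right_field by auto
  show thesis
  proof (rule that[of "b / 2"])
    fix t assume "0 \<le> t" "t \<le> b / 2"
    then show "w t < e"
      using b assms by (cases "t = 0") auto
  qed (use b in auto)
qed

lemma gauge_fun_dist:
  assumes "gauge_fun w" "0 \<le> s" "0 \<le> t"
  shows "\<bar>w s - w t\<bar> \<le> w \<bar>s - t\<bar>"
  using gauge_fun_subadditive[of w s "t - s"] gauge_fun_subadditive[of w t "s - t"]
    gauge_fun_mono[of w s t] gauge_fun_mono[of w t s] assms
  by (cases "s \<le> t") (auto simp: abs_if)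

lemma gauge_fun_cmult:
  assumes "gauge_fun v" "0 < c"
  shows "gauge_fun (\<lambda>t. c * v t)"
proof -
  have "((\<lambda>t. c * v t) \<longlongrightarrow> c * 0) (at_right 0)"
    using assms by (intro tendsto_mult) (auto simp: gauge_fun_def)
  then show ?thesis
    using assms unfolding gauge_fun_def
    by (auto simp: mono_on_def intro!: concave_on_cmul)
qed

lemma concave_modulus_iff_gauge_fun:
  "concave_modulus w \<longleftrightarrow> gauge_fun (\<lambda>t. if t = 0 then 0 else w t)"
proof -
  have "((\<lambda>t. if t = 0 then 0 else w t) \<longlongrightarrow> 0) (at_right 0) \<longleftrightarrow> (w \<longlongrightarrow> 0) (at_right (0::real))"
    by (rule filterlim_cong) (auto simp: eventually_at_right_field intro: exI[of _ 1])
  then show ?thesis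
    unfolding concave_modulus_def continuity_modulus_def gauge_fun_def
    by (auto simp: mono_on_def less_imp_le)
qed

text \<open>This turns estimates known only at countably many scales into one concave modulus. Typically \<open>r\<close>
  is the distance that a map moves in time \<open>s\<close>: it is at most \<open>C\<close>, and at most \<open>e k\<close> once \<open>s \<le> q
  k\<close>. Then \<open>r\<close> lies below each line \<open>e k + C * s / q k\<close>, hence below their infimum; an infimum
  of affine functions is concave, and it tends to 0 at 0 because \<open>e\<close> tends to 0. The summand \<open>s\<close>
  in the definition of \<open>w\<close> makes the modulus positive.\<close>

lemma concave_majorant:
  fixes q e :: "nat \<Rightarrow> real"
  assumes q: "\<And>k. 0 < q k" and e: "\<And>k. 0 \<le> e k" "e \<longlonglongrightarrow> 0" and C: "0 \<le> C"
  obtains w where "gauge_fun w"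
    "\<And>s r. 0 \<le> s \<Longrightarrow> r \<le> C \<Longrightarrow> (\<And>k. s \<le> q k \<Longrightarrow> r \<le> e k) \<Longrightarrow> r \<le> w s"
proof -
  define g where "g k s = e k + C * s / q k" for k s
  define w where "w s = s + (INF k. g k s)" for s
  have g0: "0 \<le> g k s" if "0 \<le> s" for k s
    using that e C q[of k] by (simp add: g_def)
  have bdd: "bdd_below (range (\<lambda>k. g k s))" if "0 \<le> s" for s
    using g0[OF that] by (intro bdd_belowI[of _ 0]) auto
  have ge: "w s \<ge> r" if "0 \<le> s" "r \<le> C" "\<And>k. s \<le> q k \<Longrightarrow> r \<le> e k" for s r
  proof -
    have "r \<le> g k s" for k
    proof (cases "s \<le> q k")
      case True
      then show ?thesis
        using that(3)[OF True] that(1) C q[of k] by (simp add: g_def add_increasing2)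
    next
      case False
      then have "C * 1 \<le> C * (s / q k)"
        using C q[of k] by (intro mult_left_mono) auto
      then show ?thesis
        using that(2) e(1)[of k] by (simp add: g_def)
    qed
    then have "r \<le> (INF k. g k s)" by (intro cINF_greatest) auto
    then show ?thesis using that by (simp add: w_def)
  qed
  have small: "\<exists>b>0. \<forall>t\<ge>0. t < b \<longrightarrow> w t < c" if "0 < c" for c
  proof -
    have "eventually (\<lambda>k. e k < c / 2) sequentially"
      using order_tendstoD(2)[OF e(2), of "c / 2"] that by simp
    then obtain k where k: "e k < c / 2"
      using eventually_happens[of _ sequentially] by auto
    define b where "b = (c / 2) / (1 + C / q k)"
    have den: "0 < 1 + C / q k" using C q[of k] by (simp add: add_pos_nonneg)
    have "w t < c" if t: "0 \<le> t" "t < b" for t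
    proof -
      have "w t \<le> t + g k t"
        unfolding w_def using bdd[OF t(1)] by (auto intro: cINF_lower)
      also have "\<dots> = e k + t * (1 + C / q k)" by (simp add: g_def algebra_simps)
      also have "\<dots> < c / 2 + c / 2"
        using k pos_less_divide_eq[OF den, of t "c / 2"] t unfolding b_def
        by (intro add_strict_mono) auto
      finally show ?thesis by simp
    qed
    then show ?thesis using den that by (intro exI[of _ b]) (auto simp: b_def)
  qed
  have nn: "0 \<le> w s" if "0 \<le> s" for s
    using g0[OF that] that unfolding w_def by (intro add_nonneg_nonneg cINF_greatest) auto
  have w0: "w 0 = 0"
  proof -
    have "w 0 < c" if "0 < c" for c using small[OF that] by auto
    then show ?thesis using nn[of 0] by (metis less_irrefl order_le_less order_refl)
  qed
  have mono: "w s \<le> w t" if "0 \<le> s" "s \<le> t" for s t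
  proof -
    have "(INF k. g k s) \<le> (INF k. g k t)"
    proof (rule cINF_mono)
      fix k :: nat
      have "g k s \<le> g k t"
        using that C q[of k] by (simp add: g_def mult_left_mono divide_right_mono)
      then show "\<exists>n\<in>UNIV. g n s \<le> g k t" by blast
    qed (use that bdd[of s] in auto)
    then show ?thesis using that by (simp add: w_def)
  qed
  have pos: "0 < w t" if "0 < t" for t
  proof -
    have "0 \<le> (INF k. g k t)" using g0[of t] that by (intro cINF_greatest) auto
    then show ?thesis using that by (simp add: w_def)
  qed
  have tend: "(w \<longlongrightarrow> 0) (at_right 0)"
  proof (rule order_tendstoI)
    fix a :: real assume "a < 0"
    then show "\<forall>\<^sub>F x in at_right 0. a < w x"
      using pos by (auto simp: eventually_at_right_field intro!: exI[of _ 1] intro: less_trans)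
  next
    fix a :: real assume "0 < a"
    then show "\<forall>\<^sub>F x in at_right 0. w x < a"
      using small[of a] by (auto simp: eventually_at_right_field)
  qed
  have conc: "concave_on {0..} w"
    unfolding concave_on_iff
  proof (intro conjI ballI allI impI)
    fix x y u v :: real
    assume *: "x \<in> {0..}" "y \<in> {0..}" "0 \<le> u" "0 \<le> v" "u + v = 1"
    have "u * (INF k. g k x) + v * (INF k. g k y) \<le> g k (u * x + v * y)" for k
    proof -
      have "u * (INF k. g k x) + v * (INF k. g k y) \<le> u * g k x + v * g k y"
        using * bdd by (intro add_mono mult_left_mono cINF_lower) auto
      also have "\<dots> = (u + v) * e k + C * (u * x + v * y) / q k"
        unfolding g_def using q[of k] by (simp add: field_simps)
      finally show ?thesis using * by (simp add: g_def)
    qed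
    then have "u * (INF k. g k x) + v * (INF k. g k y) \<le> (INF k. g k (u * x + v * y))"
      by (intro cINF_greatest) auto
    then show "u * w x + v * w y \<le> w (u *\<^sub>R x + v *\<^sub>R y)"
      by (simp add: w_def algebra_simps)
  qed simp
  show thesis
    using that[of w] ge conc mono w0 tend pos unfolding gauge_fun_def mono_on_def by auto
qed

lemma dense_pick:
  fixes D :: "real set"
  assumes "{0..T} \<subseteq> closure D" "0 \<le> a" "a < b" "b \<le> T"
  obtains u where "u \<in> D" "a < u" "u < b"
proof -
  have "(a + b) / 2 \<in> closure D" using assms by auto
  moreover have "0 < (b - a) / 2" using assms by simp
  ultimately obtain u where u: "u \<in> D" "dist u ((a + b) / 2) < (b - a) / 2"
    using closure_approachable by blast
  have "a < u \<and> u < b"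
    using u(2) by (simp add: dist_real_def abs_if field_simps split: if_splits)
  then show thesis using that u(1) by blast
qed

text \<open>A trace is what remains of a path of duration \<open>T\<close> with modulus \<open>w\<close> when the space has holes: it
  is defined only at a dense set \<open>D\<close> of times, including both ends. In a complete space it
  extends to a path.\<close>

definition is_trace :: "'a metric \<Rightarrow> (real \<Rightarrow> real) \<Rightarrow> real \<Rightarrow> real set \<Rightarrow> (real \<Rightarrow> 'a) \<Rightarrow> bool" where
  "is_trace X w T D f \<longleftrightarrow> 0 \<le> T \<and> D \<subseteq> {0..T} \<and> {0..T} \<subseteq> closure D \<and> 0 \<in> D \<and> T \<in> D \<and>
    f ` D \<subseteq> mspace X \<and> (\<forall>u\<in>D. \<forall>v\<in>D. mdist X (f u) (f v) \<le> w \<bar>u - v\<bar>)"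

text \<open>Trace equi-connectedness with the dense sets of times not prescribed but existing for each pair,
  and with a concave modulus; the duration of the trace is the distance of its ends.\<close>

definition trace_connected :: "'a metric \<Rightarrow> (real \<Rightarrow> real) \<Rightarrow> real \<Rightarrow> bool" where
  "trace_connected X w e \<longleftrightarrow> gauge_fun w \<and> 0 < e \<and>
    (\<forall>x\<in>mspace X. \<forall>y\<in>mspace X. mdist X x y < e \<longrightarrow>
      (\<exists>D f. is_trace X w (mdist X x y) D f \<and> f 0 = x \<and> f (mdist X x y) = y))"

lemma trace_reverse:
  assumes "is_trace X w T D f"
  shows "is_trace X w T ((\<lambda>u. T - u) ` D) (\<lambda>u. f (T - u))"
proof -
  have tr: "0 \<le> T" "D \<subseteq> {0..T}" "{0..T} \<subseteq> closure D" "0 \<in> D" "T \<in> D" "f ` D \<subseteq> mspace X"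
      "\<And>u v. u \<in> D \<Longrightarrow> v \<in> D \<Longrightarrow> mdist X (f u) (f v) \<le> w \<bar>u - v\<bar>"
    using assms by (auto simp: is_trace_def)
  have "x \<in> closure ((\<lambda>u. T - u) ` D)" if "x \<in> {0..T}" for x
  proof (unfold closure_approachable, intro allI impI)
    fix e :: real assume "0 < e"
    have "T - x \<in> closure D" using that tr(3) by auto
    then obtain y where "y \<in> D" "dist y (T - x) < e"
      using \<open>0 < e\<close> closure_approachable by blast
    then show "\<exists>y\<in>(\<lambda>u. T - u) ` D. dist y x < e"
      by (intro bexI[of _ "T - y"]) (auto simp: dist_real_def)
  qed
  moreover have "mdist X (f (T - (T - u))) (f (T - (T - v))) \<le> w \<bar>(T - u) - (T - v)\<bar>"
    if "u \<in> D" "v \<in> D" for u v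
    using tr(7)[OF that] by (simp add: abs_minus_commute)
  moreover have "0 \<in> (\<lambda>u. T - u) ` D" "T \<in> (\<lambda>u. T - u) ` D"
    using tr(4,5) by force+
  ultimately show ?thesis
    unfolding is_trace_def using tr(1,2,6) by auto
qed

section \<open>Chains, separated sets and Cauchy sequences\<close>

text \<open>Each term is chosen against the finitely many earlier ones. With \<open>Q v u\<close> a lower bound on the
  distance of \<open>v\<close> and \<open>u\<close>, this produces separated sequences.\<close>

lemma greedy_sequence:
  assumes "\<And>k F. finite F \<Longrightarrow> (\<And>v. v \<in> F \<Longrightarrow> \<exists>j. P j v) \<Longrightarrow> \<exists>u. P k u \<and> (\<forall>v\<in>F. Q v u)"
  obtains f :: "nat \<Rightarrow> 'b" where "\<And>k. P k (f k)" "\<And>j k. j < k \<Longrightarrow> Q (f j) (f k)"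
proof -
  have "\<exists>f. \<forall>k. P k (f k) \<and> (\<forall>j<k. Q (f j) (f k))"
  proof (rule dependent_wellorder_choice)
    fix k :: nat and f :: "nat \<Rightarrow> 'b"
    assume IH: "\<And>y. y < k \<Longrightarrow> P y (f y) \<and> (\<forall>j<y. Q (f j) (f y))"
    have "\<exists>u. P k u \<and> (\<forall>v\<in>f ` {..<k}. Q v u)"
      using IH by (intro assms) auto
    then show "\<exists>r. P k r \<and> (\<forall>j<k. Q (f j) r)" by auto
  qed auto
  then show thesis using that by blast
qed

text \<open>If every \<open>f\<close> in \<open>F\<close> failed from some index on, then a point of \<open>B\<close> beyond these finitely many
  indices would be related to no \<open>f\<close>.\<close>

lemma antitone_pigeonhole:
  fixes B :: "nat \<Rightarrow> 'b set"
  assumes anti: "\<And>l l'. l \<le> l' \<Longrightarrow> B l' \<subseteq> B l" and ne: "\<And>l. B l \<noteq> {}"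
    and F: "finite F" "\<And>b. b \<in> B l0 \<Longrightarrow> \<exists>f\<in>F. P f b"
  obtains f where "f \<in> F" "\<And>l. \<exists>b\<in>B l. P f b"
proof (rule ccontr)
  assume "\<not> thesis"
  then have "\<forall>f\<in>F. \<exists>l. \<forall>b\<in>B l. \<not> P f b" using that by blast
  then obtain m where m: "\<And>f b. f \<in> F \<Longrightarrow> b \<in> B (m f) \<Longrightarrow> \<not> P f b" by metis
  define l where "l = Max (insert l0 (m ` F))"
  obtain b where b: "b \<in> B l" using ne by blast
  have "b \<in> B l0" "\<And>f. f \<in> F \<Longrightarrow> b \<in> B (m f)"
    using b anti[of l0 l] anti[of "m _" l] F(1) unfolding l_def by (auto simp: Max_ge_iff)
  then show False using F(2) m by blast
qed

text \<open>The powers of \<open>near X \<eta> S\<close> are the chains of a given length and with steps below \<open>\<eta>\<close> that stay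
  in \<open>S\<close>; concatenating and reversing chains becomes relation algebra.\<close>

definition near :: "'a metric \<Rightarrow> real \<Rightarrow> 'a set \<Rightarrow> ('a \<times> 'a) set" where
  "near X \<eta> S = {(x, y). x \<in> S \<and> y \<in> S \<and> mdist X x y < \<eta>}"

lemma near_mono: "\<eta> \<le> \<eta>' \<Longrightarrow> S \<subseteq> S' \<Longrightarrow> near X \<eta> S \<subseteq> near X \<eta>' S'"
  by (auto simp: near_def)

lemma relpow_subset: "(R :: ('a \<times> 'a) set) \<subseteq> R' \<Longrightarrow> R ^^ n \<subseteq> R' ^^ n"
  by (induction n) (simp_all add: relcomp_mono)

lemma near_relpow_mono:
  "(x, y) \<in> near X \<eta> S ^^ l \<Longrightarrow> \<eta> \<le> \<eta>' \<Longrightarrow> S \<subseteq> S' \<Longrightarrow> (x, y) \<in> near X \<eta>' S' ^^ l"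
  using relpow_subset[OF near_mono] by blast

lemma near_relpow_sym: "(x, y) \<in> near X \<eta> S ^^ l \<Longrightarrow> (y, x) \<in> near X \<eta> S ^^ l"
proof (induction l arbitrary: y)
  case (Suc l)
  then obtain z where "(x, z) \<in> near X \<eta> S ^^ l" "(z, y) \<in> near X \<eta> S" by auto
  then have "(y, z) \<in> near X \<eta> S" "(z, x) \<in> near X \<eta> S ^^ l"
    using Suc.IH by (auto simp: near_def mdist_commute)
  then show ?case by (rule relpow_Suc_I2)
qed simp

lemma near_relpow_trans:
  "(x, y) \<in> near X \<eta> S ^^ k \<Longrightarrow> (y, z) \<in> near X \<eta> S ^^ l \<Longrightarrow> (x, z) \<in> near X \<eta> S ^^ (k + l)"
  by (auto simp: relpow_add)

lemma near_relpow_mem: "(x, y) \<in> near X \<eta> S ^^ l \<Longrightarrow> x \<in> S \<Longrightarrow> y \<in> S"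
proof (cases l)
  case (Suc k)
  moreover assume "(x, y) \<in> near X \<eta> S ^^ l"
  ultimately obtain z where "(z, y) \<in> near X \<eta> S" by auto
  then show ?thesis by (simp add: near_def)
qed simp

text \<open>Repeating the last point lengthens a chain, so that a bound on the lengths of several chains can
  be replaced by one common length.\<close>

lemma near_relpow_pad:
  assumes "(x, y) \<in> near X \<eta> S ^^ k" "k \<le> l" "0 < \<eta>" "x \<in> S" "S \<subseteq> mspace X"
  shows "(x, y) \<in> near X \<eta> S ^^ l"
proof -
  have "y \<in> S" using near_relpow_mem assms by metis
  then have "(y, y) \<in> near X \<eta> S"
    using assms(3,5) by (auto simp: near_def)
  then have "(y, y) \<in> near X \<eta> S ^^ j" for j
    by (induction j) auto
  from near_relpow_trans[OF assms(1) this[of "l - k"]] show ?thesis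
    using assms(2) by simp
qed

text \<open>A chain in \<open>S\<close> with steps below \<open>\<eta>\<close> cannot leave a part \<open>W\<close> of \<open>S\<close> from which no such step leads
  out.\<close>

lemma near_relpow_confine:
  assumes "(x, y) \<in> near X \<eta> S ^^ l" "x \<in> W" "x \<in> S"
    and "\<And>a b. a \<in> W \<Longrightarrow> a \<in> S \<Longrightarrow> b \<in> S \<Longrightarrow> mdist X a b < \<eta> \<Longrightarrow> b \<in> W"
  shows "(x, y) \<in> near X \<eta> W ^^ l \<and> y \<in> W"
  using assms(1)
proof (induction l arbitrary: y)
  case (Suc l)
  then obtain z where z: "(x, z) \<in> near X \<eta> S ^^ l" "(z, y) \<in> near X \<eta> S" by auto
  with Suc.IH have *: "(x, z) \<in> near X \<eta> W ^^ l" "z \<in> W" by auto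
  moreover have "(z, y) \<in> near X \<eta> W" "y \<in> W"
    using z(2) *(2) assms(4)[of z y] by (simp_all add: near_def)
  ultimately show ?case by auto
qed (use assms in auto)

lemma near_relpow_imp_chain:
  assumes "(x, y) \<in> near X \<eta> S ^^ l" "x \<in> S" "S \<subseteq> mspace X"
  obtains c where "chain_linking X \<eta> l x y c" "c ` {..l} \<subseteq> S"
proof -
  obtain c where c: "c 0 = x" "c l = y" "\<And>i. i < l \<Longrightarrow> (c i, c (Suc i)) \<in> near X \<eta> S"
    using assms(1) unfolding relpow_fun_conv by auto
  have mem: "c i \<in> S" if "i \<le> l" for i
    using that c(3)[of "i - 1"] c(1) assms(2) by (cases i) (auto simp: near_def)
  have "mdist X (c i) (c (i - 1)) < \<eta>" if "i \<in> {1..l}" for i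
    using that c(3)[of "i - 1"] by (auto simp: near_def mdist_commute)
  then have "chain_linking X \<eta> l x y c"
    unfolding chain_linking_def using c mem assms(3) by auto
  then show thesis using that mem by blast
qed

text \<open>A chain that stays in a ball of radius \<open>\<epsilon> / 2\<close> has diameter below \<open>\<epsilon>\<close>.\<close>

lemma uniformly_locally_chain_equi_connectedI:
  assumes "\<And>\<epsilon>. 0 < \<epsilon> \<Longrightarrow> \<exists>\<delta>>0. \<forall>\<eta>>0. \<exists>l. \<forall>x\<in>mspace X. \<forall>y\<in>mspace X. mdist X x y < \<delta> \<longrightarrow>
      (x, y) \<in> near X \<eta> (mball_of X x \<epsilon>) ^^ l"
  shows "uniformly_locally_chain_equi_connected X"
  unfolding uniformly_locally_chain_equi_connected_def
proof (intro allI impI)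
  fix \<epsilon> :: real assume \<epsilon>: "0 < \<epsilon>"
  then obtain \<delta> where \<delta>: "0 < \<delta>" "\<forall>\<eta>>0. \<exists>l. \<forall>x\<in>mspace X. \<forall>y\<in>mspace X. mdist X x y < \<delta> \<longrightarrow>
      (x, y) \<in> near X \<eta> (mball_of X x (\<epsilon> / 2)) ^^ l"
    using assms[of "\<epsilon> / 2"] by auto
  have "\<exists>l. \<forall>x\<in>mspace X. \<forall>y\<in>mspace X. mdist X x y < \<delta> \<longrightarrow>
      (\<exists>k\<le>l. \<exists>c. chain_linking X \<eta> k x y c \<and> chain_diam X k c < \<epsilon>)" if \<eta>: "0 < \<eta>" for \<eta>
  proof -
    obtain l where l: "\<forall>x\<in>mspace X. \<forall>y\<in>mspace X. mdist X x y < \<delta> \<longrightarrow>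
      (x, y) \<in> near X \<eta> (mball_of X x (\<epsilon> / 2)) ^^ l" using \<delta> \<eta> by blast
    have "\<exists>c. chain_linking X \<eta> l x y c \<and> chain_diam X l c < \<epsilon>"
      if xy: "x \<in> mspace X" "y \<in> mspace X" "mdist X x y < \<delta>" for x y
    proof -
      obtain c where c: "chain_linking X \<eta> l x y c" "c ` {..l} \<subseteq> mball_of X x (\<epsilon> / 2)"
    proof (rule near_relpow_imp_chain)
        show "(x, y) \<in> near X \<eta> (mball_of X x (\<epsilon> / 2)) ^^ l" using l xy by blast
        show "x \<in> mball_of X x (\<epsilon> / 2)" using xy \<epsilon> by simp
      qed auto
      have "mdist X (c i) (c j) < \<epsilon>" if "i \<le> l" "j \<le> l" for i j
      proof -
        have "c i \<in> mball_of X x (\<epsilon> / 2)" "c j \<in> mball_of X x (\<epsilon> / 2)" using c that by auto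
        then show ?thesis
          using mdist_triangle[of "c i" X x "c j"] by (auto simp: mdist_commute)
      qed
      then have "chain_diam X l c < \<epsilon>"
        unfolding chain_diam_def by (subst Max_less_iff) auto
      then show ?thesis using c by blast
    qed
    then show ?thesis by blast
  qed
  then show "\<exists>\<delta>>0. \<forall>\<eta>>0. \<exists>l. \<forall>x\<in>mspace X. \<forall>y\<in>mspace X. mdist X x y < \<delta> \<longrightarrow>
      (\<exists>k\<le>l. \<exists>c. chain_linking X \<eta> k x y c \<and> chain_diam X k c < \<epsilon>)"
    using \<delta>(1) by blast
qed

text \<open>A locally finite set has no accumulation points, so it is closed and discrete.\<close>

lemma locally_finite_in_discrete_closed_sets:
  assumes D: "D \<subseteq> mspace X" "D \<noteq> {}"
    and fin: "\<And>x. x \<in> mspace X \<Longrightarrow> \<exists>r>0. finite (D \<inter> mball_of X x r)"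
  shows "D \<in> discrete_closed_sets X"
proof -
  interpret Metric_space "mspace X" "mdist X" by simp
  have "mtopology_of X derived_set_of D = {}"
  proof (rule ccontr)
    assume "\<not> ?thesis"
    then obtain x where x: "x \<in> mspace X" "\<And>r. r > 0 \<Longrightarrow> \<exists>y\<in>D - {x}. y \<in> mball x r"
      unfolding mtopology_of_def metric_derived_set_of by blast
    obtain r where r: "0 < r" "finite (D \<inter> mball_of X x r)" using fin[OF x(1)] by auto
    define F where "F = D \<inter> mball_of X x r - {x}"
    define r' where "r' = Min (insert r (mdist X x ` F))"
    have "finite F" using r by (simp add: F_def)
    have "0 < mdist X x y" if "y \<in> F" for y
      using that x(1) D by (intro mdist_gt_0) (auto simp: F_def)
    then have "0 < r'" "r' \<le> r" "\<And>y. y \<in> F \<Longrightarrow> r' \<le> mdist X x y"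
      using \<open>finite F\<close> r(1) unfolding r'_def
      by (auto intro: Min_le simp del: Min_insert simp: Min_gr_iff)
    moreover obtain y where "y \<in> D - {x}" "y \<in> mball x r'" using x(2) \<open>0 < r'\<close> by auto
    ultimately show False using x(1) D unfolding F_def by force
  qed
  then show ?thesis
    using D by (auto simp: discrete_closed_sets_def closed_sets_def closedin_contains_derived_set
        subtopology_eq_discrete_topology_eq)
qed

definition separated :: "'a metric \<Rightarrow> 'a set \<Rightarrow> bool" where
  "separated X D \<longleftrightarrow> (\<exists>s>0. \<forall>x\<in>D. \<forall>y\<in>D. x \<noteq> y \<longrightarrow> s \<le> mdist X x y)"

lemma separated_imp_card_ball:
  assumes s: "\<And>x y. x \<in> D \<Longrightarrow> y \<in> D \<Longrightarrow> x \<noteq> y \<Longrightarrow> s \<le> mdist X x y" and x: "x \<in> mspace X"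
  shows "finite (D \<inter> mball_of X x (s / 2)) \<and> card (D \<inter> mball_of X x (s / 2)) \<le> 1"
proof -
  have "y = z" if "y \<in> D \<inter> mball_of X x (s / 2)" "z \<in> D \<inter> mball_of X x (s / 2)" for y z
    using that mdist_triangle[of y X x z] s[of y z] by (auto simp: mdist_commute)
  then have "\<exists>a. D \<inter> mball_of X x (s / 2) \<subseteq> {a}" by blast
  then obtain a where "D \<inter> mball_of X x (s / 2) \<subseteq> {a}" by blast
  then show ?thesis
    using card_mono[of "{a}" "D \<inter> mball_of X x (s / 2)"]
    by (simp add: finite_subset[of _ "{a}"])
qed

lemma separated_in_small_discrete_closed_sets:
  assumes "D \<subseteq> mspace X" "D \<noteq> {}" "countable D" "separated X D"
  shows "D \<in> small_discrete_closed_sets X"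
proof -
  obtain s where s: "0 < s" "\<And>x y. x \<in> D \<Longrightarrow> y \<in> D \<Longrightarrow> x \<noteq> y \<Longrightarrow> s \<le> mdist X x y"
    using assms(4) unfolding separated_def by blast
  note card = separated_imp_card_ball[of D s X, OF s(2)]
  have "D \<in> discrete_closed_sets X"
    using card s(1) assms by (intro locally_finite_in_discrete_closed_sets) (auto intro!: exI[of _ "s / 2"])
  moreover have "uniformly_discrete X D"
    unfolding uniformly_discrete_def using card s(1) by (intro exI[of _ "s / 2"]) auto
  ultimately show ?thesis
    using assms by (simp add: small_discrete_closed_sets_def)
qed

text \<open>Only finitely many points of a separated set are close to a given point.\<close>

lemma separated_insert:
  assumes "separated X D" "D \<subseteq> mspace X" "x \<in> mspace X"
  shows "separated X (insert x D)"
proof -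
  obtain s where s: "0 < s" "\<And>x y. x \<in> D \<Longrightarrow> y \<in> D \<Longrightarrow> x \<noteq> y \<Longrightarrow> s \<le> mdist X x y"
    using assms(1) unfolding separated_def by blast
  define F where "F = D \<inter> mball_of X x (s / 2) - {x}"
  have "finite F"
    using separated_imp_card_ball[of D s X x, OF s(2)] assms unfolding F_def by auto
  define r where "r = Min (insert (s / 2) (mdist X x ` F))"
  have "0 < mdist X x y" if "y \<in> F" for y
    using that assms unfolding F_def by (intro mdist_gt_0) auto
  then have "0 < r"
    using \<open>finite F\<close> s(1) unfolding r_def by (subst Min_gr_iff) auto
  moreover have "r \<le> s / 2"
    unfolding r_def using \<open>finite F\<close> by (intro Min_le) auto
  moreover have "\<And>y. y \<in> F \<Longrightarrow> r \<le> mdist X x y"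
    using \<open>finite F\<close> unfolding r_def by (auto intro: Min_le simp del: Min_insert)
  ultimately have r: "0 < r" "r \<le> s / 2" "\<And>y. y \<in> F \<Longrightarrow> r \<le> mdist X x y"
    by blast+
  have xr: "r \<le> mdist X x y" if "y \<in> D" "y \<noteq> x" for y
    using that r assms by (cases "y \<in> F") (force simp: F_def)+
  then have "r \<le> mdist X y z" if yz: "y \<in> insert x D" "z \<in> insert x D" "y \<noteq> z" for y z
  proof -
    consider "y = x" "z \<in> D" "z \<noteq> x" | "z = x" "y \<in> D" "y \<noteq> x" | "y \<in> D" "z \<in> D"
      using yz by blast
    then show ?thesis
    proof cases
      case 1 then show ?thesis using xr[of z] by simp
    next
      case 2 then show ?thesis using xr[of y] mdist_commute[of X y x] by simp
    next
      case 3 then show ?thesis using s(2)[of y z] yz(3) r(2) s(1) by simp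
    qed
  qed
  then show ?thesis
    unfolding separated_def using r(1) by blast
qed

lemma separated_Un_finite:
  assumes "finite F" "separated X D" "D \<subseteq> mspace X" "F \<subseteq> mspace X"
  shows "separated X (F \<union> D)"
  using assms
proof (induction F rule: finite_induct)
  case (insert x F)
  then have "separated X (insert x (F \<union> D))" by (intro separated_insert) auto
  then show ?case by simp
qed simp

lemma finite_in_small_discrete_closed_sets:
  assumes "finite F" "F \<subseteq> mspace X" "F \<noteq> {}"
  shows "F \<in> small_discrete_closed_sets X"
proof -
  have "separated X {}" unfolding separated_def by (auto intro!: exI[of _ 1])
  then have "separated X F" using separated_Un_finite[of F X "{}"] assms by simp
  then show ?thesis
    using assms by (intro separated_in_small_discrete_closed_sets) (auto simp: countable_finite)
qed

text \<open>A Cauchy sequence without limit has no accumulation point at all, and its range is totally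
  bounded.\<close>

lemma cauchy_range_in_small_discrete_closed_sets:
  fixes u :: "nat \<Rightarrow> 'a"
  assumes u: "\<And>i. u i \<in> mspace X"
    and cauchy: "\<And>e. 0 < e \<Longrightarrow> \<exists>N. \<forall>i\<ge>N. \<forall>j\<ge>N. mdist X (u i) (u j) < e"
    and nonconv: "\<And>q. q \<in> mspace X \<Longrightarrow> \<exists>e>0. \<forall>N. \<exists>i\<ge>N. e \<le> mdist X (u i) q"
  shows "range u \<in> small_discrete_closed_sets X"
proof -
  interpret Metric_space "mspace X" "mdist X" by simp
  have "\<exists>r>0. finite (range u \<inter> mball_of X q r)" if q: "q \<in> mspace X" for q
  proof -
    obtain e where e: "0 < e" "\<And>N. \<exists>i\<ge>N. e \<le> mdist X (u i) q" using nonconv[OF q] by auto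
    obtain N where N: "\<And>i j. i \<ge> N \<Longrightarrow> j \<ge> N \<Longrightarrow> mdist X (u i) (u j) < e / 2"
      using cauchy[of "e / 2"] e(1) by auto
    obtain i where i: "i \<ge> N" "e \<le> mdist X (u i) q" using e(2) by blast
    have "e / 2 \<le> mdist X (u j) q" if "j \<ge> N" for j
      using mdist_triangle[of "u i" X "u j" q] N[OF i(1) that] i u q by auto
    then have "i < N" if "u i \<in> mball_of X q (e / 2)" for i
      using that by (metis in_mball_of linorder_not_less mdist_commute)
    then have "range u \<inter> mball_of X q (e / 2) \<subseteq> u ` {..<N}"
      by blast
    then show ?thesis
      using e(1) finite_subset by (intro exI[of _ "e / 2"]) auto
  qed
  then have "range u \<in> discrete_closed_sets X"
    using u by (intro locally_finite_in_discrete_closed_sets) auto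
  moreover have "mtotally_bounded (range u)"
    unfolding mtotally_bounded_def
  proof (intro allI impI)
    fix e :: real assume "0 < e"
    then obtain N where N: "\<And>i j. i \<ge> N \<Longrightarrow> j \<ge> N \<Longrightarrow> mdist X (u i) (u j) < e"
      using cauchy by blast
    have "u i \<in> (\<Union>x\<in>u ` {..N}. mball x e)" for i
    proof (cases "i \<le> N")
      case True
      then show ?thesis using u \<open>0 < e\<close> by (intro UN_I[of "u i"]) auto
    next
      case False
      then show ?thesis using N[of N i] u by (intro UN_I[of "u N"]) (auto simp: in_mball)
    qed
    then show "\<exists>K. finite K \<and> K \<subseteq> range u \<and> range u \<subseteq> (\<Union>x\<in>K. mball x e)"
      by (intro exI[of _ "u ` {..N}"]) auto
  qed
  ultimately show ?thesis
    by (simp add: small_discrete_closed_sets_def)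
qed

text \<open>Either, for some \<open>s\<close>, one can always continue at distance \<open>s\<close> from any finite set of terms, and
  a greedy choice gives a separated subsequence; or the range is totally bounded. The two
  alternatives match the two kinds of sets in
  \<^const>\<open>small_discrete_closed_sets\<close>, to which the local chain connectedness of
  the hyperspace can be applied.\<close>

lemma separated_or_cauchy_subsequence:
  fixes x :: "nat \<Rightarrow> 'a"
  assumes x: "\<And>i. x i \<in> mspace X"
  obtains (separated) s r where "0 < s" "\<And>k. k \<le> r k"
      "\<And>i j. i \<noteq> j \<Longrightarrow> s \<le> mdist X (x (r i)) (x (r j))"
  | (cauchy) r :: "nat \<Rightarrow> nat" where "\<And>k. k \<le> r k"
      "\<And>e. 0 < e \<Longrightarrow> \<exists>N. \<forall>i\<ge>N. \<forall>j\<ge>N. mdist X (x (r i)) (x (r j)) < e"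
proof (cases "\<exists>s>0. \<forall>K F. finite F \<longrightarrow> (\<exists>k\<ge>K. \<forall>j\<in>F. s \<le> mdist X (x j) (x k))")
  case True
  then obtain s where s: "0 < s"
    "\<And>K F. finite F \<Longrightarrow> \<exists>k\<ge>K. \<forall>j\<in>F. s \<le> mdist X (x j) (x k)" by blast
  obtain r where r: "\<And>k::nat. k \<le> r k" "\<And>j k. j < k \<Longrightarrow> s \<le> mdist X (x (r j)) (x (r k))"
  proof (rule greedy_sequence[of "\<lambda>k i. k \<le> i" "\<lambda>i j. s \<le> mdist X (x i) (x j)"])
    show "\<exists>u\<ge>k. \<forall>v\<in>F. s \<le> mdist X (x v) (x u)" if "finite F" for k F
      using s(2)[OF that] by blast
  qed blast
  have "s \<le> mdist X (x (r i)) (x (r j))" if "i \<noteq> j" for i j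
    using r(2)[of i j] r(2)[of j i] that by (cases "i < j") (auto simp: mdist_commute)
  then show thesis using separated s(1) r(1) by blast
next
  case False
  interpret Metric_space "mspace X" "mdist X" by simp
  have "mtotally_bounded (range x)"
    unfolding mtotally_bounded_def
  proof (intro allI impI)
    fix e :: real assume "0 < e"
    then obtain K F where KF: "finite F" "\<And>k. k \<ge> K \<Longrightarrow> \<exists>j\<in>F. mdist X (x j) (x k) < e"
      using False by (meson not_le)
    have "x k \<in> (\<Union>z\<in>x ` (F \<union> {..K}). mball z e)" for k
    proof (cases "k \<le> K")
      case True
      then show ?thesis using x \<open>0 < e\<close> by (intro UN_I[of "x k"]) auto
    next
      case False
      then show ?thesis using KF(2)[of k] x by (auto simp: in_mball)
    qed
    then have "range x \<subseteq> (\<Union>z\<in>x ` (F \<union> {..K}). mball z e)" by blast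
    then show "\<exists>K. finite K \<and> K \<subseteq> range x \<and> range x \<subseteq> (\<Union>z\<in>K. mball z e)"
      using KF(1) by (intro exI[of _ "x ` (F \<union> {..K})"]) (simp add: image_mono)
  qed
  then obtain r where r: "strict_mono r" "MCauchy (x \<circ> r)"
    unfolding mtotally_bounded_sequentially by blast
  then show thesis
    using cauchy[of r] seq_suble[OF r(1)] unfolding MCauchy_def by simp
qed

section \<open>From chains in the hyperspace to chains in the space\<close>

definition fattening :: "'a metric \<Rightarrow> real \<Rightarrow> 'a set \<Rightarrow> 'a set" where
  "fattening X r A = {y \<in> mspace X. \<exists>a\<in>A. mdist X a y < r}"

lemma mdist_hyperspace_leI_less:
  assumes "0 \<le> r" "\<And>x. x \<in> A \<Longrightarrow> \<exists>y\<in>B. mdist X x y < r" "\<And>y. y \<in> B \<Longrightarrow> \<exists>x\<in>A. mdist X y x < r"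
  shows "mdist (hyperspace X) A B \<le> r"
proof (rule mdist_hyperspace_leI[OF assms(1)])
  show "\<exists>y\<in>B. mdist X x y < e" if "x \<in> A" "r < e" for x e
    using assms(2)[OF that(1)] that(2) by (meson less_trans)
  show "\<exists>x\<in>A. mdist X y x < e" if "y \<in> B" "r < e" for y e
    using assms(3)[OF that(1)] that(2) by (meson less_trans)
qed

text \<open>Consecutive sets of a chain in the hyperspace are Hausdorff close, so a point of one can step to
  a point of the next. The number of steps is that of the chain, the same for all starting
  points: this is how uniformity on \<open>X\<close> is extracted from the hyperspace.\<close>

lemma hyperspace_chain_follow:
  assumes "\<And>i. i \<le> l \<Longrightarrow> c i \<subseteq> S"
    and "\<And>i. i < l \<Longrightarrow> mdist (hyperspace X) (c i) (c (Suc i)) < \<eta>" "\<eta> \<le> 1" "x \<in> c 0"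
  shows "\<exists>z\<in>c l. (x, z) \<in> near X \<eta> S ^^ l"
  using assms
proof (induction l)
  case (Suc l)
  then obtain z where z: "z \<in> c l" "(x, z) \<in> near X \<eta> S ^^ l" by (metis le_SucI less_SucI)
  obtain y where y: "y \<in> c (Suc l)" "mdist X z y < \<eta>"
    using mdist_hyperspace_lessD[OF Suc.prems(2)[of l] Suc.prems(3) z(1)] by auto
  have "(z, y) \<in> near X \<eta> S"
    using y z(1) Suc.prems(1)[of l] Suc.prems(1)[of "Suc l"] by (auto simp: near_def)
  then show ?case
    using z(2) y(1) by (intro bexI[of _ y]) auto
qed auto

text \<open>Local chain connectedness of the hyperspace at \<open>D\<close>, expressed through points. The length \<open>l\<close>
  depends on \<open>\<eta>\<close> and \<open>D'\<close> but not on the point that is followed.\<close>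

lemma locally_chain_connected_hyperspaceE:
  assumes lc: "locally_chain_connected_at (hyperspace X) (small_discrete_closed_sets X)"
    and D: "D \<in> small_discrete_closed_sets X" and \<epsilon>: "0 < \<epsilon>"
  obtains \<delta> where "0 < \<delta>"
    "\<And>\<eta> D'. 0 < \<eta> \<Longrightarrow> D' \<in> small_discrete_closed_sets X \<Longrightarrow>
      (\<And>x. x \<in> D \<Longrightarrow> \<exists>y\<in>D'. mdist X x y < \<delta>) \<Longrightarrow> (\<And>y. y \<in> D' \<Longrightarrow> \<exists>x\<in>D. mdist X y x < \<delta>) \<Longrightarrow>
      \<exists>l. (\<forall>x\<in>D. \<exists>y\<in>D'. (x, y) \<in> near X \<eta> (fattening X \<epsilon> D) ^^ l) \<and>
          (\<forall>y\<in>D'. \<exists>x\<in>D. (y, x) \<in> near X \<eta> (fattening X \<epsilon> D) ^^ l)"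
proof -
  let ?H = "hyperspace X"
  have "0 < min \<epsilon> 1" using \<epsilon> by simp
  then obtain \<delta>0 where \<delta>0: "0 < \<delta>0"
    "\<And>\<eta> D'. 0 < \<eta> \<Longrightarrow> D' \<in> small_discrete_closed_sets X \<Longrightarrow> mdist ?H D' D < \<delta>0 \<Longrightarrow>
      \<exists>l c. chain_linking ?H \<eta> l D D' c \<and> chain_diam ?H l c < min \<epsilon> 1"
    using lc[unfolded locally_chain_connected_at_def, rule_format, OF D \<open>0 < min \<epsilon> 1\<close>] by blast
  show thesis
  proof (rule that[of "\<delta>0 / 2"])
    fix \<eta> :: real and D'
    assume \<eta>: "0 < \<eta>" and D': "D' \<in> small_discrete_closed_sets X"
      and DD': "\<And>x. x \<in> D \<Longrightarrow> \<exists>y\<in>D'. mdist X x y < \<delta>0 / 2"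
      and D'D: "\<And>y. y \<in> D' \<Longrightarrow> \<exists>x\<in>D. mdist X y x < \<delta>0 / 2"
    have "mdist ?H D' D \<le> \<delta>0 / 2"
      using \<delta>0(1) DD' D'D by (intro mdist_hyperspace_leI_less) simp_all
    then have "mdist ?H D' D < \<delta>0" using \<delta>0(1) by simp
    moreover have "0 < min \<eta> 1" using \<eta> by simp
    ultimately obtain l c where c: "chain_linking ?H (min \<eta> 1) l D D' c" "chain_diam ?H l c < min \<epsilon> 1"
      using \<delta>0(2) D' by blast
    have ends: "c 0 = D" "c l = D'" and cl: "\<And>i. i \<le> l \<Longrightarrow> c i \<in> closed_sets X"
      using c(1) by (auto simp: chain_linking_def)
    have step: "mdist ?H (c (Suc i)) (c i) < min \<eta> 1" if "i < l" for i
    proof -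
      have "\<forall>j\<in>{1..l}. mdist ?H (c j) (c (j - 1)) < min \<eta> 1"
        using c(1) unfolding chain_linking_def by blast
      moreover have "Suc i \<in> {1..l}" using that by simp
      ultimately have "mdist ?H (c (Suc i)) (c (Suc i - 1)) < min \<eta> 1" by (rule bspec)
      then show ?thesis by simp
    qed
    have sub: "c i \<subseteq> fattening X \<epsilon> D" if "i \<le> l" for i
    proof
      fix x assume x: "x \<in> c i"
      have "mdist ?H (c i) (c 0) \<le> chain_diam ?H l c"
        unfolding chain_diam_def using that by (intro Max_ge) auto
      then have "mdist ?H (c i) (c 0) < min \<epsilon> 1" using c(2) by simp
      then obtain a where "a \<in> D" "mdist X x a < min \<epsilon> 1"
        using mdist_hyperspace_lessD[of X "c i" "c 0" "min \<epsilon> 1" x] x ends by auto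
      then show "x \<in> fattening X \<epsilon> D"
        using x closed_sets_subset[OF cl[OF that]] by (auto simp: fattening_def mdist_commute)
    qed
    have mono: "(a, b) \<in> near X (min \<eta> 1) S ^^ l \<Longrightarrow> (a, b) \<in> near X \<eta> S ^^ l" for a b S
      by (rule near_relpow_mono) auto
    have "\<exists>y\<in>D'. (x, y) \<in> near X \<eta> (fattening X \<epsilon> D) ^^ l" if "x \<in> D" for x
    proof -
      have "\<exists>z\<in>c l. (x, z) \<in> near X (min \<eta> 1) (fattening X \<epsilon> D) ^^ l"
      proof (rule hyperspace_chain_follow)
        show "mdist ?H (c i) (c (Suc i)) < min \<eta> 1" if "i < l" for i
          using step[OF that] by (simp add: mdist_commute)
      qed (use sub that ends in auto)
      then show ?thesis using mono ends by blast
    qed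
    moreover have "\<exists>x\<in>D. (y, x) \<in> near X \<eta> (fattening X \<epsilon> D) ^^ l" if "y \<in> D'" for y
    proof -
      have "\<exists>z\<in>c (l - l). (y, z) \<in> near X (min \<eta> 1) (fattening X \<epsilon> D) ^^ l"
      proof (rule hyperspace_chain_follow[of l "\<lambda>i. c (l - i)"])
        show "mdist ?H (c (l - i)) (c (l - Suc i)) < min \<eta> 1" if "i < l" for i
          using step[of "l - Suc i"] that by (simp add: Suc_diff_Suc)
      qed (use sub that ends in auto)
      then show ?thesis using mono ends by auto
    qed
    ultimately show "\<exists>l. (\<forall>x\<in>D. \<exists>y\<in>D'. (x, y) \<in> near X \<eta> (fattening X \<epsilon> D) ^^ l) \<and>
          (\<forall>y\<in>D'. \<exists>x\<in>D. (y, x) \<in> near X \<eta> (fattening X \<epsilon> D) ^^ l)" by blast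
  qed (use \<delta>0 in simp)
qed

context
  fixes X :: "'a metric"
  assumes lc: "locally_chain_connected_at (hyperspace X) (small_discrete_closed_sets X)"
begin

text \<open>Local chain connectedness is applied at \<open>D = range u\<close> and to \<open>D' = (\<Union>k. Z k)\<close>. Since \<open>u\<close> is
  separated, a chain with small steps near \<open>D\<close> stays near one \<open>u k\<close>, so it ends in that \<open>u k\<close>.
  All pieces \<open>Z k\<close> belong to one set \<open>D'\<close>, whence the common length \<open>L\<close>.\<close>

lemma separated_sequence_linking:
  fixes u :: "nat \<Rightarrow> 'a"
  assumes u: "\<And>i. u i \<in> mspace X" and s: "0 < s" "\<And>i j. i \<noteq> j \<Longrightarrow> s \<le> mdist X (u i) (u j)"
    and \<epsilon>: "0 < \<epsilon>"
  obtains \<delta> where "0 < \<delta>"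
    "\<And>\<eta> Z t. 0 < \<eta> \<Longrightarrow> 0 < t \<Longrightarrow> (\<And>k. Z k \<noteq> {}) \<Longrightarrow> (\<And>k. countable (Z k)) \<Longrightarrow> (\<And>k. Z k \<subseteq> mspace X) \<Longrightarrow>
      (\<And>k z. z \<in> Z k \<Longrightarrow> mdist X (u k) z < \<delta>) \<Longrightarrow>
      (\<And>k z z'. z \<in> Z k \<Longrightarrow> z' \<in> Z k \<Longrightarrow> z \<noteq> z' \<Longrightarrow> t \<le> mdist X z z') \<Longrightarrow>
      \<exists>L. \<forall>k. \<forall>z\<in>Z k. (z, u k) \<in> near X \<eta> (mball_of X (u k) \<epsilon>) ^^ L"
proof -
  \<comment> \<open>balls of radius \<open>s / 4\<close> about different \<open>u k\<close> are too far apart for a step below \<open>s / 4\<close>\<close>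
  define \<epsilon>' where "\<epsilon>' = min \<epsilon> (s / 4)"
  have \<epsilon>': "0 < \<epsilon>'" "\<epsilon>' \<le> \<epsilon>" "\<epsilon>' \<le> s / 4" using s \<epsilon> by (auto simp: \<epsilon>'_def)
  have "separated X (range u)"
    unfolding separated_def
  proof (intro exI[of _ s] conjI ballI impI)
    fix x y assume "x \<in> range u" "y \<in> range u" "x \<noteq> y"
    then obtain i j where "x = u i" "y = u j" "i \<noteq> j" by auto
    then show "s \<le> mdist X x y" using s(2) by simp
  qed (use s in auto)
  then have "range u \<in> small_discrete_closed_sets X"
    using u by (intro separated_in_small_discrete_closed_sets) auto
  from locally_chain_connected_hyperspaceE[OF lc this \<epsilon>'(1)] obtain \<delta>0 where \<delta>0: "0 < \<delta>0"
    "\<And>\<eta> D'. 0 < \<eta> \<Longrightarrow> D' \<in> small_discrete_closed_sets X \<Longrightarrow>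
      (\<And>x. x \<in> range u \<Longrightarrow> \<exists>y\<in>D'. mdist X x y < \<delta>0) \<Longrightarrow>
      (\<And>y. y \<in> D' \<Longrightarrow> \<exists>x\<in>range u. mdist X y x < \<delta>0) \<Longrightarrow>
      \<exists>l. (\<forall>x\<in>range u. \<exists>y\<in>D'. (x, y) \<in> near X \<eta> (fattening X \<epsilon>' (range u)) ^^ l) \<and>
          (\<forall>y\<in>D'. \<exists>x\<in>range u. (y, x) \<in> near X \<eta> (fattening X \<epsilon>' (range u)) ^^ l)" by blast
  show thesis
  proof (rule that[of "min \<delta>0 \<epsilon>'"])
    fix \<eta> t :: real and Z :: "nat \<Rightarrow> 'a set"
    assume \<eta>: "0 < \<eta>" and t: "0 < t" and Z: "\<And>k. Z k \<noteq> {}" "\<And>k. countable (Z k)" "\<And>k. Z k \<subseteq> mspace X"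
      and Zu: "\<And>k z. z \<in> Z k \<Longrightarrow> mdist X (u k) z < min \<delta>0 \<epsilon>'"
      and Zt: "\<And>k z z'. z \<in> Z k \<Longrightarrow> z' \<in> Z k \<Longrightarrow> z \<noteq> z' \<Longrightarrow> t \<le> mdist X z z'"
    define D' where "D' = (\<Union>k. Z k)"
    have "min t (s / 2) \<le> mdist X z z'" if zz: "z \<in> D'" "z' \<in> D'" "z \<noteq> z'" for z z'
    proof -
      obtain k k' where k: "z \<in> Z k" "z' \<in> Z k'" using zz by (auto simp: D'_def)
      then have mem: "z \<in> mspace X" "z' \<in> mspace X" using Z(3) by auto
      show ?thesis
      proof (cases "k = k'")
        case True
        then have "t \<le> mdist X z z'" using Zt k zz(3) by blast
        then show ?thesis by simp
      next
        case False
        have "s \<le> mdist X (u k) z + mdist X z z' + mdist X (u k') z'"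
          using s(2)[OF False] mdist_triangle[of "u k" X z "u k'"] mdist_triangle[of z X z' "u k'"]
            mem u[of k] u[of k'] by (simp add: mdist_commute)
        moreover have "mdist X (u k) z < \<epsilon>'" "mdist X (u k') z' < \<epsilon>'"
          using Zu[OF k(1)] Zu[OF k(2)] by auto
        ultimately have "s / 2 \<le> mdist X z z'" using \<epsilon>'(3) by linarith
        then show ?thesis by simp
      qed
    qed
    then have "separated X D'"
      unfolding separated_def using t s(1) by (intro exI[of _ "min t (s / 2)"]) auto
    then have D': "D' \<in> small_discrete_closed_sets X"
      using Z by (intro separated_in_small_discrete_closed_sets) (auto simp: D'_def)
    define \<eta>' where "\<eta>' = min \<eta> (s / 4)"
    have \<eta>': "0 < \<eta>'" "\<eta>' \<le> \<eta>" "\<eta>' \<le> s / 4" using \<eta> s by (auto simp: \<eta>'_def)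
    have a1: "\<exists>y\<in>D'. mdist X x y < \<delta>0" if x: "x \<in> range u" for x
    proof -
      obtain k where "x = u k" using x by blast
      moreover obtain z where "z \<in> Z k" using Z(1) by blast
      ultimately show ?thesis using Zu[of z k] by (intro bexI[of _ z]) (auto simp: D'_def)
    qed
    have a2: "\<exists>x\<in>range u. mdist X y x < \<delta>0" if y: "y \<in> D'" for y
    proof -
      obtain k where "y \<in> Z k" using y unfolding D'_def by blast
      then show ?thesis using Zu[of y k] by (intro bexI[of _ "u k"]) (auto simp: mdist_commute)
    qed
    obtain L where L: "\<forall>y\<in>D'. \<exists>x\<in>range u. (y, x) \<in> near X \<eta>' (fattening X \<epsilon>' (range u)) ^^ L"
      using \<delta>0(2)[OF \<eta>'(1) D' a1 a2] by blast
    have "(z, u k) \<in> near X \<eta> (mball_of X (u k) \<epsilon>) ^^ L" if z: "z \<in> Z k" for k z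
    proof -
      let ?W = "mball_of X (u k) \<epsilon>'"
      have zW: "z \<in> ?W" using z Z(3) Zu[OF z] u by auto
      obtain i where i: "(z, u i) \<in> near X \<eta>' (fattening X \<epsilon>' (range u)) ^^ L"
        using L z unfolding D'_def by blast
      have zi: "(z, u i) \<in> near X \<eta>' ?W ^^ L \<and> u i \<in> ?W"
      proof (rule near_relpow_confine[OF i zW])
        show "z \<in> fattening X \<epsilon>' (range u)" using zW by (auto simp: fattening_def)
        fix a b assume ab: "a \<in> ?W" "b \<in> fattening X \<epsilon>' (range u)" "mdist X a b < \<eta>'"
        obtain j where j: "mdist X (u j) b < \<epsilon>'" "b \<in> mspace X" using ab(2) by (auto simp: fattening_def)
        have "mdist X (u k) (u j) \<le> mdist X (u k) a + mdist X a b + mdist X (u j) b"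
          using mdist_triangle[of "u k" X a "u j"] mdist_triangle[of a X b "u j"] ab(1) j u[of j]
          by (simp add: mdist_commute)
        then have "mdist X (u k) (u j) < s" using ab(1,3) j \<epsilon>'(3) \<eta>'(3) s(1) by simp
        then have "k = j" using s(2)[of k j] by (cases "k = j") auto
        then show "b \<in> ?W" using j u by simp
      qed
      then have "i = k"
        using s(2)[of k i] \<epsilon>'(3) s(1) by (cases "i = k") auto
      then have "(z, u k) \<in> near X \<eta>' ?W ^^ L" using zi by simp
      then show ?thesis
        by (rule near_relpow_mono[OF _ \<eta>'(2)]) (use \<epsilon>'(2) in auto)
    qed
    then show "\<exists>L. \<forall>k. \<forall>z\<in>Z k. (z, u k) \<in> near X \<eta> (mball_of X (u k) \<epsilon>) ^^ L" by blast
  qed (use \<delta>0 \<epsilon>' in auto)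
qed

end

lemma mball_of_subset_triangle:
  assumes "p \<in> mspace X" "mdist X p q + r \<le> r'"
  shows "mball_of X q r \<subseteq> mball_of X p r'"
proof
  fix x assume "x \<in> mball_of X q r"
  then show "x \<in> mball_of X p r'"
    using mdist_triangle[of p X q x] assms by simp
qed

lemma fattening_subset_mball:
  assumes "p \<in> mspace X" "A \<subseteq> mspace X" "\<And>a. a \<in> A \<Longrightarrow> mdist X p a + r \<le> r'"
  shows "fattening X r A \<subseteq> mball_of X p r'"
proof
  fix x assume "x \<in> fattening X r A"
  then obtain a where "x \<in> mspace X" "a \<in> A" "mdist X a x < r" by (auto simp: fattening_def)
  then show "x \<in> mball_of X p r'"
    using mdist_triangle[of p X a x] assms(1,2) assms(3)[of a] by auto
qed

context
  fixes X :: "'a metric"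
  assumes lc: "locally_chain_connected_at (hyperspace X) (small_discrete_closed_sets X)"
begin

text \<open>If \<open>u\<close> converges to \<open>q\<close>, local chain connectedness is applied at \<open>{q}\<close>. Otherwise it is applied
  at the tail \<open>D\<close> of \<open>u\<close>, which is then closed and discrete: the finite piece \<open>u N,
  \<dots>, u J\<close> is close to \<open>D\<close> in the Hausdorff metric, with or without additional
  points \<open>Z\<close> near the tail.\<close>

lemma cauchy_sequence_linking:
  fixes u :: "nat \<Rightarrow> 'a"
  assumes u: "\<And>i. u i \<in> mspace X"
    and cauchy: "\<And>e. 0 < e \<Longrightarrow> \<exists>N. \<forall>i\<ge>N. \<forall>j\<ge>N. mdist X (u i) (u j) < e"
    and \<epsilon>: "0 < \<epsilon>"
  obtains N J \<delta> where "N0 \<le> N" "N \<le> J" "0 < \<delta>"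
    "\<And>i j. N \<le> i \<Longrightarrow> N \<le> j \<Longrightarrow> mdist X (u i) (u j) < \<epsilon>"
    "\<And>i j. J \<le> i \<Longrightarrow> J \<le> j \<Longrightarrow> mdist X (u i) (u j) < \<delta>"
    "\<And>\<eta> Z. 0 < \<eta> \<Longrightarrow> Z \<noteq> {} \<Longrightarrow> countable Z \<Longrightarrow> separated X Z \<Longrightarrow> Z \<subseteq> mspace X \<Longrightarrow>
      (\<And>z. z \<in> Z \<Longrightarrow> \<exists>i\<ge>J. mdist X z (u i) < \<delta>) \<Longrightarrow>
      \<exists>L. \<forall>z\<in>Z. \<exists>i\<ge>N. (z, u i) \<in> near X \<eta> (mball_of X (u N) \<epsilon>) ^^ L"
    "\<And>\<eta> i. 0 < \<eta> \<Longrightarrow> N \<le> i \<Longrightarrow>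
      \<exists>L. \<exists>j\<in>{N..J}. (u i, u j) \<in> near X \<eta> (mball_of X (u N) \<epsilon>) ^^ L"
proof (cases "\<exists>q\<in>mspace X. \<forall>e>0. \<exists>N. \<forall>i\<ge>N. mdist X (u i) q < e")
  case True
  then obtain q where q: "q \<in> mspace X" "\<And>e. 0 < e \<Longrightarrow> \<exists>N. \<forall>i\<ge>N. mdist X (u i) q < e" by blast
  have "{q} \<in> small_discrete_closed_sets X"
    using q by (intro finite_in_small_discrete_closed_sets) auto
  moreover have "0 < \<epsilon> / 4" using \<epsilon> by simp
  ultimately obtain \<delta>0 where \<delta>0: "0 < \<delta>0"
    "\<And>\<eta> D'. 0 < \<eta> \<Longrightarrow> D' \<in> small_discrete_closed_sets X \<Longrightarrow>
      (\<And>x. x \<in> {q} \<Longrightarrow> \<exists>y\<in>D'. mdist X x y < \<delta>0) \<Longrightarrow> (\<And>y. y \<in> D' \<Longrightarrow> \<exists>x\<in>{q}. mdist X y x < \<delta>0) \<Longrightarrow>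
      \<exists>l. (\<forall>x\<in>{q}. \<exists>y\<in>D'. (x, y) \<in> near X \<eta> (fattening X (\<epsilon> / 4) {q}) ^^ l) \<and>
          (\<forall>y\<in>D'. \<exists>x\<in>{q}. (y, x) \<in> near X \<eta> (fattening X (\<epsilon> / 4) {q}) ^^ l)"
    by (rule locally_chain_connected_hyperspaceE[OF lc]) blast
  define r where "r = min (\<delta>0 / 4) (\<epsilon> / 4)"
  have r: "0 < r" "r \<le> \<delta>0 / 4" "r \<le> \<epsilon> / 4" using \<delta>0(1) \<epsilon> by (auto simp: r_def)
  obtain N1 where N1: "\<And>i. N1 \<le> i \<Longrightarrow> mdist X (u i) q < r" using q(2)[OF r(1)] by blast
  define N where "N = max N0 N1"
  have N: "mdist X (u i) q < r" if "N \<le> i" for i using N1 that by (simp add: N_def)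
  have pair: "mdist X (u i) (u j) < 2 * r" if "N \<le> i" "N \<le> j" for i j
    using mdist_triangle[of "u i" X q "u j"] N[OF that(1)] N[OF that(2)] u q(1) by (simp add: mdist_commute)
  have sub: "fattening X (\<epsilon> / 4) {q} \<subseteq> mball_of X (u N) \<epsilon>"
    using N[of N] r \<epsilon> u q(1) by (intro fattening_subset_mball) auto
  have up: "(a, b) \<in> near X \<eta> (mball_of X (u N) \<epsilon>) ^^ l"
    if "(a, b) \<in> near X \<eta> (fattening X (\<epsilon> / 4) {q}) ^^ l" for a b \<eta> l
    using near_relpow_mono[OF that order_refl sub] .
  have link: "\<exists>L. \<forall>z\<in>Z. (z, q) \<in> near X \<eta> (mball_of X (u N) \<epsilon>) ^^ L"
    if "0 < \<eta>" "Z \<in> small_discrete_closed_sets X" "Z \<noteq> {}" "\<And>z. z \<in> Z \<Longrightarrow> mdist X z q < \<delta>0" for \<eta> Z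
  proof -
    have "\<exists>l. (\<forall>x\<in>{q}. \<exists>y\<in>Z. (x, y) \<in> near X \<eta> (fattening X (\<epsilon> / 4) {q}) ^^ l) \<and>
          (\<forall>y\<in>Z. \<exists>x\<in>{q}. (y, x) \<in> near X \<eta> (fattening X (\<epsilon> / 4) {q}) ^^ l)"
      using that by (intro \<delta>0(2)) (auto simp: mdist_commute)
    then show ?thesis using up by blast
  qed
  have link1: "\<exists>L. (u i, q) \<in> near X \<eta> (mball_of X (u N) \<epsilon>) ^^ L" if "0 < \<eta>" "N \<le> i" for \<eta> i
  proof -
    have "\<exists>L. \<forall>z\<in>{u i}. (z, q) \<in> near X \<eta> (mball_of X (u N) \<epsilon>) ^^ L"
      using that N[OF that(2)] u r \<delta>0(1) by (intro link finite_in_small_discrete_closed_sets) auto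
    then show ?thesis by simp
  qed
  show thesis
  proof (rule that[of N N "2 * r"])
    show "N0 \<le> N" by (simp add: N_def)
    show "mdist X (u i) (u j) < \<epsilon>" if "N \<le> i" "N \<le> j" for i j
      using pair[OF that] r \<epsilon> by simp
    show "\<exists>L. \<forall>z\<in>Z. \<exists>i\<ge>N. (z, u i) \<in> near X \<eta> (mball_of X (u N) \<epsilon>) ^^ L"
      if \<eta>: "0 < \<eta>" and Z: "Z \<noteq> {}" "countable Z" "separated X Z" "Z \<subseteq> mspace X"
        and Zu: "\<And>z. z \<in> Z \<Longrightarrow> \<exists>i\<ge>N. mdist X z (u i) < 2 * r" for \<eta> Z
    proof -
      have "mdist X z q < \<delta>0" if z: "z \<in> Z" for z
      proof -
        obtain i where "i \<ge> N" "mdist X z (u i) < 2 * r" using Zu[OF z] by blast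
        then show ?thesis
          using mdist_triangle[of z X "u i" q] N[of i] z Z(4) u[of i] q(1) r by auto
      qed
      then obtain L where L: "\<forall>z\<in>Z. (z, q) \<in> near X \<eta> (mball_of X (u N) \<epsilon>) ^^ L"
        using link[OF \<eta> separated_in_small_discrete_closed_sets] Z by blast
      obtain L' where "(u N, q) \<in> near X \<eta> (mball_of X (u N) \<epsilon>) ^^ L'" using link1[OF \<eta>] by blast
      then have "(q, u N) \<in> near X \<eta> (mball_of X (u N) \<epsilon>) ^^ L'" by (rule near_relpow_sym)
      then have "(z, u N) \<in> near X \<eta> (mball_of X (u N) \<epsilon>) ^^ (L + L')" if "z \<in> Z" for z
        using near_relpow_trans[OF L[rule_format, OF that]] by simp
      then show ?thesis by auto
    qed
    show "\<exists>L. \<exists>j\<in>{N..N}. (u i, u j) \<in> near X \<eta> (mball_of X (u N) \<epsilon>) ^^ L"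
      if \<eta>i: "0 < \<eta>" "N \<le> i" for \<eta> i
    proof -
      obtain L where "(u i, q) \<in> near X \<eta> (mball_of X (u N) \<epsilon>) ^^ L" using link1[OF \<eta>i] by blast
      moreover obtain L' where "(u N, q) \<in> near X \<eta> (mball_of X (u N) \<epsilon>) ^^ L'"
        using link1[OF \<eta>i(1)] by blast
      ultimately have "(u i, u N) \<in> near X \<eta> (mball_of X (u N) \<epsilon>) ^^ (L + L')"
        by (rule near_relpow_trans[OF _ near_relpow_sym])
      then show ?thesis by auto
    qed
  qed (use r pair in auto)
next
  case False
  obtain N1 where N1: "\<And>i j. N1 \<le> i \<Longrightarrow> N1 \<le> j \<Longrightarrow> mdist X (u i) (u j) < \<epsilon> / 2"
    using cauchy[of "\<epsilon> / 2"] \<epsilon> by auto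
  define N where "N = max N0 N1"
  have N: "mdist X (u i) (u j) < \<epsilon> / 2" if "N \<le> i" "N \<le> j" for i j using N1 that by (simp add: N_def)
  define D where "D = range (\<lambda>i. u (i + N))"
  have D: "D \<in> small_discrete_closed_sets X"
    unfolding D_def
  proof (rule cauchy_range_in_small_discrete_closed_sets)
    show "\<exists>M. \<forall>i\<ge>M. \<forall>j\<ge>M. mdist X (u (i + N)) (u (j + N)) < e" if "0 < e" for e
      using cauchy[OF that] by (meson trans_le_add1)
    show "\<exists>e>0. \<forall>M. \<exists>i\<ge>M. e \<le> mdist X (u (i + N)) q" if q: "q \<in> mspace X" for q
    proof -
      obtain e where e: "0 < e" "\<And>M. \<exists>i\<ge>M. \<not> mdist X (u i) q < e" using False q by blast
      have "\<exists>i\<ge>M. e \<le> mdist X (u (i + N)) q" for M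
      proof -
        obtain i where "i \<ge> M + N" "\<not> mdist X (u i) q < e" using e(2) by blast
        then show ?thesis by (intro exI[of _ "i - N"]) auto
      qed
      then show ?thesis using e(1) by blast
    qed
  qed (use u in auto)
  have Dmem: "u i \<in> D" if "N \<le> i" for i
    using that unfolding D_def by (metis le_add_diff_inverse2 rangeI)
  have DE: "\<exists>i\<ge>N. x = u i" if DE': "x \<in> D" for x
  proof -
    obtain i where "x = u (i + N)" using DE' unfolding D_def by blast
    then show ?thesis by (intro exI[of _ "i + N"]) simp
  qed
  have "0 < \<epsilon> / 2" using \<epsilon> by simp
  from locally_chain_connected_hyperspaceE[OF lc D this] obtain \<delta>0 where \<delta>0: "0 < \<delta>0"
    "\<And>\<eta> D'. 0 < \<eta> \<Longrightarrow> D' \<in> small_discrete_closed_sets X \<Longrightarrow>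
      (\<And>x. x \<in> D \<Longrightarrow> \<exists>y\<in>D'. mdist X x y < \<delta>0) \<Longrightarrow> (\<And>y. y \<in> D' \<Longrightarrow> \<exists>x\<in>D. mdist X y x < \<delta>0) \<Longrightarrow>
      \<exists>l. (\<forall>x\<in>D. \<exists>y\<in>D'. (x, y) \<in> near X \<eta> (fattening X (\<epsilon> / 2) D) ^^ l) \<and>
          (\<forall>y\<in>D'. \<exists>x\<in>D. (y, x) \<in> near X \<eta> (fattening X (\<epsilon> / 2) D) ^^ l)" by blast
  have sub: "fattening X (\<epsilon> / 2) D \<subseteq> mball_of X (u N) \<epsilon>"
  proof (rule fattening_subset_mball)
    fix a assume "a \<in> D"
    then show "mdist X (u N) a + \<epsilon> / 2 \<le> \<epsilon>" using DE[of a] N[of N] by force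
  qed (use u in \<open>auto simp: D_def\<close>)
  have up: "(a, b) \<in> near X \<eta> (mball_of X (u N) \<epsilon>) ^^ l"
    if "(a, b) \<in> near X \<eta> (fattening X (\<epsilon> / 2) D) ^^ l" for a b \<eta> l
    using near_relpow_mono[OF that order_refl sub] .
  obtain J1 where J1: "\<And>i j. J1 \<le> i \<Longrightarrow> J1 \<le> j \<Longrightarrow> mdist X (u i) (u j) < \<delta>0 / 2"
    using cauchy[of "\<delta>0 / 2"] \<delta>0(1) by auto
  define J where "J = max N J1"
  have J: "mdist X (u i) (u j) < \<delta>0 / 2" if "J \<le> i" "J \<le> j" for i j using J1 that by (simp add: J_def)
  have NJ: "N \<le> J" by (simp add: J_def)
  have near_finite: "\<exists>y\<in>u ` {N..J}. mdist X x y < \<delta>0" if x: "x \<in> D" for x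
  proof -
    obtain i where i: "N \<le> i" "x = u i" using DE[OF x] by blast
    show ?thesis
    proof (cases "i \<le> J")
      case True
      then show ?thesis using i u \<delta>0(1) by (intro bexI[of _ "u i"]) auto
    next
      case False
      then show ?thesis using J[of i J] i \<delta>0(1) NJ by (intro bexI[of _ "u J"]) auto
    qed
  qed
  show thesis
  proof (rule that[of N J "\<delta>0 / 2"])
    show "N0 \<le> N" by (simp add: N_def)
    show "mdist X (u i) (u j) < \<epsilon>" if "N \<le> i" "N \<le> j" for i j
      using N[OF that] \<epsilon> by simp
    show "\<exists>L. \<forall>z\<in>Z. \<exists>i\<ge>N. (z, u i) \<in> near X \<eta> (mball_of X (u N) \<epsilon>) ^^ L"
      if \<eta>: "0 < \<eta>" and Z: "Z \<noteq> {}" "countable Z" "separated X Z" "Z \<subseteq> mspace X"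
        and Zu: "\<And>z. z \<in> Z \<Longrightarrow> \<exists>i\<ge>J. mdist X z (u i) < \<delta>0 / 2" for \<eta> Z
    proof -
      have "u ` {N..J} \<union> Z \<in> small_discrete_closed_sets X"
        using Z u by (intro separated_in_small_discrete_closed_sets separated_Un_finite) auto
      then have "\<exists>l. (\<forall>x\<in>D. \<exists>y\<in>u ` {N..J} \<union> Z. (x, y) \<in> near X \<eta> (fattening X (\<epsilon> / 2) D) ^^ l) \<and>
          (\<forall>y\<in>u ` {N..J} \<union> Z. \<exists>x\<in>D. (y, x) \<in> near X \<eta> (fattening X (\<epsilon> / 2) D) ^^ l)"
      proof (rule \<delta>0(2)[OF \<eta>])
        show "\<exists>y\<in>u ` {N..J} \<union> Z. mdist X x y < \<delta>0" if "x \<in> D" for x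
          using near_finite[OF that] by blast
        show "\<exists>x\<in>D. mdist X y x < \<delta>0" if y: "y \<in> u ` {N..J} \<union> Z" for y
        proof (cases "y \<in> Z")
          case True
          then obtain i where "i \<ge> J" "mdist X y (u i) < \<delta>0 / 2" using Zu by blast
          then show ?thesis using Dmem[of i] NJ \<delta>0(1) by (intro bexI[of _ "u i"]) auto
        next
          case False
          then have "y \<in> D" "y \<in> mspace X" using y Dmem u by auto
          then show ?thesis using \<delta>0(1) by (intro bexI[of _ y]) auto
        qed
      qed
      then obtain l where "\<forall>y\<in>u ` {N..J} \<union> Z. \<exists>x\<in>D. (y, x) \<in> near X \<eta> (fattening X (\<epsilon> / 2) D) ^^ l"
        by blast
      then have "\<exists>i\<ge>N. (z, u i) \<in> near X \<eta> (mball_of X (u N) \<epsilon>) ^^ l" if "z \<in> Z" for z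
        using that DE up by (metis UnI2)
      then show ?thesis by blast
    qed
    show "\<exists>L. \<exists>j\<in>{N..J}. (u i, u j) \<in> near X \<eta> (mball_of X (u N) \<epsilon>) ^^ L"
      if \<eta>: "0 < \<eta>" and i: "N \<le> i" for \<eta> i
    proof -
      have "u ` {N..J} \<in> small_discrete_closed_sets X"
        using u NJ by (intro finite_in_small_discrete_closed_sets) auto
      then have "\<exists>l. (\<forall>x\<in>D. \<exists>y\<in>u ` {N..J}. (x, y) \<in> near X \<eta> (fattening X (\<epsilon> / 2) D) ^^ l) \<and>
          (\<forall>y\<in>u ` {N..J}. \<exists>x\<in>D. (y, x) \<in> near X \<eta> (fattening X (\<epsilon> / 2) D) ^^ l)"
      proof (rule \<delta>0(2)[OF \<eta> _ near_finite])
        show "\<exists>x\<in>D. mdist X y x < \<delta>0" if "y \<in> u ` {N..J}" for y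
          using that Dmem u \<delta>0(1) by (intro bexI[of _ y]) auto
      qed
      then obtain l where "\<forall>x\<in>D. \<exists>y\<in>u ` {N..J}. (x, y) \<in> near X \<eta> (fattening X (\<epsilon> / 2) D) ^^ l"
        by blast
      then obtain j where "j \<in> {N..J}" "(u i, u j) \<in> near X \<eta> (fattening X (\<epsilon> / 2) D) ^^ l"
        using Dmem[OF i] by blast
      then show ?thesis using up by blast
    qed
  qed (use \<delta>0 NJ J in auto)
qed

end

context
  fixes X :: "'a metric"
  assumes lc: "locally_chain_connected_at (hyperspace X) (small_discrete_closed_sets X)"
begin

text \<open>The required condition without the uniform bound on lengths. If it fails, there are pairs \<open>x n\<close>,
  \<open>y n\<close> at distance below \<open>1 / (n + 1)\<close> that are not linked inside \<open>mball_of X (x n) \<epsilon>\<close>. In the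
  separated case a single \<open>x n\<close> is replaced by \<open>y n\<close>. In the Cauchy case \<open>y n\<close> is linked to some
  later term of the sequence of the \<open>x n\<close>, and this term has to be linked back to \<open>x n\<close>; so one
  first passes to a subsequence whose terms are linked with each other.\<close>

lemma uniformly_linked:
  assumes \<epsilon>: "0 < \<epsilon>"
  obtains \<delta> where "0 < \<delta>"
    "\<And>x y \<eta>. x \<in> mspace X \<Longrightarrow> y \<in> mspace X \<Longrightarrow> mdist X x y < \<delta> \<Longrightarrow> 0 < \<eta> \<Longrightarrow>
      \<exists>l. (x, y) \<in> near X \<eta> (mball_of X x \<epsilon>) ^^ l"
proof (rule ccontr)
  assume neg: "\<not> thesis"
  have "\<exists>x y \<eta>. x \<in> mspace X \<and> y \<in> mspace X \<and> mdist X x y < 1 / Suc n \<and> 0 < \<eta> \<and>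
      (\<forall>l. (x, y) \<notin> near X \<eta> (mball_of X x \<epsilon>) ^^ l)" for n
  proof (rule ccontr)
    assume no: "\<not> ?thesis"
    have thesis
    proof (rule that[of "1 / Suc n"])
      show "\<exists>l. (x, y) \<in> near X \<eta> (mball_of X x \<epsilon>) ^^ l"
        if "x \<in> mspace X" "y \<in> mspace X" "mdist X x y < 1 / Suc n" "0 < \<eta>" for x y \<eta>
        using no that by blast
    qed simp
    then show False using neg by blast
  qed
  then obtain x y \<eta> where mem: "\<And>n. x n \<in> mspace X" "\<And>n. y n \<in> mspace X"
    and xy: "\<And>n. mdist X (x n) (y n) < 1 / Suc n" and \<eta>: "\<And>n. 0 < \<eta> n"
    and fail: "\<And>n l. (x n, y n) \<notin> near X (\<eta> n) (mball_of X (x n) \<epsilon>) ^^ l"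
    by metis
  have small: "\<exists>M. \<forall>n\<ge>M. mdist X (x n) (y n) < e" if e: "0 < e" for e
  proof -
    obtain M where M: "1 / Suc M < e" using e nat_approx_posE by blast
    have "mdist X (x n) (y n) < e" if "n \<ge> M" for n
    proof -
      have "1 / real (Suc n) \<le> 1 / real (Suc M)" using that by (intro divide_left_mono) auto
      then show ?thesis using xy[of n] M by linarith
    qed
    then show ?thesis by blast
  qed
  show False
  proof (rule separated_or_cauchy_subsequence[of x X])
    fix s r assume s: "0 < s" and r: "\<And>k::nat. k \<le> r k"
      and sep: "\<And>i j. i \<noteq> j \<Longrightarrow> s \<le> mdist X (x (r i)) (x (r j))"
    obtain \<delta> where \<delta>: "0 < \<delta>"
      "\<And>\<eta> Z t. 0 < \<eta> \<Longrightarrow> 0 < t \<Longrightarrow> (\<And>k. Z k \<noteq> {}) \<Longrightarrow> (\<And>k. countable (Z k)) \<Longrightarrow> (\<And>k. Z k \<subseteq> mspace X) \<Longrightarrow>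
      (\<And>k z. z \<in> Z k \<Longrightarrow> mdist X (x (r k)) z < \<delta>) \<Longrightarrow>
      (\<And>k z z'. z \<in> Z k \<Longrightarrow> z' \<in> Z k \<Longrightarrow> z \<noteq> z' \<Longrightarrow> t \<le> mdist X z z') \<Longrightarrow>
      \<exists>L. \<forall>k. \<forall>z\<in>Z k. (z, x (r k)) \<in> near X \<eta> (mball_of X (x (r k)) \<epsilon>) ^^ L"
      by (rule separated_sequence_linking[OF lc, of "\<lambda>i. x (r i)" s \<epsilon>, OF _ s sep \<epsilon>]) (use mem in blast)+
    obtain M where M: "\<And>n. M \<le> n \<Longrightarrow> mdist X (x n) (y n) < \<delta>" using small[OF \<delta>(1)] by blast
    define Z where "Z k = (if k = M then {y (r k)} else {x (r k)})" for k
    have "\<exists>L. \<forall>k. \<forall>z\<in>Z k. (z, x (r k)) \<in> near X (\<eta> (r M)) (mball_of X (x (r k)) \<epsilon>) ^^ L"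
      using \<eta> mem M[OF r] \<delta>(1) by (intro \<delta>(2)[of _ 1]) (auto simp: Z_def split: if_splits)
    then obtain L where "\<forall>k. \<forall>z\<in>Z k. (z, x (r k)) \<in> near X (\<eta> (r M)) (mball_of X (x (r k)) \<epsilon>) ^^ L" ..
    then have "(y (r M), x (r M)) \<in> near X (\<eta> (r M)) (mball_of X (x (r M)) \<epsilon>) ^^ L" by (simp add: Z_def)
    from near_relpow_sym[OF this] show False using fail by blast
  next
    fix r :: "nat \<Rightarrow> nat" assume r: "\<And>k. k \<le> r k"
      and cauchy: "\<And>e. 0 < e \<Longrightarrow> \<exists>N. \<forall>i\<ge>N. \<forall>j\<ge>N. mdist X (x (r i)) (x (r j)) < e"
    define u where "u i = x (r i)" for i
    have u: "u i \<in> mspace X" for i using mem by (simp add: u_def)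
    have ucauchy: "\<exists>N. \<forall>i\<ge>N. \<forall>j\<ge>N. mdist X (u i) (u j) < e" if "0 < e" for e
      using cauchy[OF that] by (simp add: u_def)
    have \<epsilon>8: "0 < \<epsilon> / 8" using \<epsilon> by simp
    obtain N J where NJ: "N \<le> J" and uN: "\<And>i j. N \<le> i \<Longrightarrow> N \<le> j \<Longrightarrow> mdist X (u i) (u j) < \<epsilon> / 8"
      and fin: "\<And>\<eta> i. 0 < \<eta> \<Longrightarrow> N \<le> i \<Longrightarrow>
        \<exists>L. \<exists>j\<in>{N..J}. (u i, u j) \<in> near X \<eta> (mball_of X (u N) (\<epsilon> / 8)) ^^ L"
      by (rule cauchy_sequence_linking[OF lc u ucauchy \<epsilon>8, of 0]) metis+
    let ?S = "mball_of X (u N) (\<epsilon> / 8)"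
    \<comment> \<open>the index \<open>j\<close> can be chosen independently of \<open>\<eta>\<close>, because there are only finitely many
      candidates and a chain for a smaller \<open>\<eta>\<close> serves for a larger one\<close>
    have "\<exists>j\<in>{N..J}. \<forall>\<eta>>0. \<exists>L. (u i, u j) \<in> near X \<eta> ?S ^^ L" if i: "N \<le> i" for i
    proof (rule ccontr)
      assume "\<not> ?thesis"
      then obtain h where h: "\<And>j. j \<in> {N..J} \<Longrightarrow> 0 < h j"
        "\<And>j L. j \<in> {N..J} \<Longrightarrow> (u i, u j) \<notin> near X (h j) ?S ^^ L" by metis
      define h0 where "h0 = Min (h ` {N..J})"
      have h0: "0 < h0" "\<And>j. j \<in> {N..J} \<Longrightarrow> h0 \<le> h j"
        using h(1) NJ by (auto simp: h0_def)
      obtain L j where L: "j \<in> {N..J}" "(u i, u j) \<in> near X h0 ?S ^^ L" using fin[OF h0(1) i] by blast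
      show False using h(2)[OF L(1)] near_relpow_mono[OF L(2) h0(2)[OF L(1)] order_refl] by blast
    qed
    then obtain f where f: "\<And>i. N \<le> i \<Longrightarrow> f i \<in> {N..J}"
      "\<And>i \<eta>. N \<le> i \<Longrightarrow> 0 < \<eta> \<Longrightarrow> \<exists>L. (u i, u (f i)) \<in> near X \<eta> ?S ^^ L" by metis
    have "\<exists>i0\<in>{N..}. infinite {a \<in> {N..}. f a = f i0}"
    proof (rule pigeonhole_infinite)
      have "f ` {N..} \<subseteq> {N..J}" using f(1) by blast
      then show "finite (f ` {N..})" by (rule finite_subset) simp
    qed (simp add: infinite_Ici)
    then obtain i0 where i0: "i0 \<ge> N" "infinite {a \<in> {N..}. f a = f i0}" by auto
    define K where "K = {a \<in> {N..}. f a = f i0}"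
    have K: "infinite K" "\<And>a. a \<in> K \<Longrightarrow> N \<le> a \<and> f a = f i0" using i0 by (auto simp: K_def)
    define v where "v k = u (enumerate K k)" for k
    have enK: "enumerate K k \<in> K" "k \<le> enumerate K k" for k
      using K(1) enumerate_in_set le_enumerate by auto
    have v: "v k \<in> mspace X" for k using u by (simp add: v_def)
    have vcauchy: "\<exists>N. \<forall>i\<ge>N. \<forall>j\<ge>N. mdist X (v i) (v j) < e" if e: "0 < e" for e
    proof -
      obtain N where "\<forall>i\<ge>N. \<forall>j\<ge>N. mdist X (u i) (u j) < e" using ucauchy[OF e] by blast
      then show ?thesis unfolding v_def using enK(2) by (meson order_trans)
    qed
    have vlink: "\<exists>L. (v i, v j) \<in> near X h ?S ^^ L" if h: "0 < h" for i j h
    proof -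
      obtain L where L: "(v i, u (f i0)) \<in> near X h ?S ^^ L"
        using f(2)[of "enumerate K i" h] K(2)[OF enK(1)] h unfolding v_def by auto
      obtain L' where L': "(v j, u (f i0)) \<in> near X h ?S ^^ L'"
        using f(2)[of "enumerate K j" h] K(2)[OF enK(1)] h unfolding v_def by auto
      show ?thesis using near_relpow_trans[OF L near_relpow_sym[OF L']] by blast
    qed
    obtain N' J' \<delta> where N'J': "N' \<le> J'" and \<delta>: "0 < \<delta>"
      and vN: "\<And>i j. N' \<le> i \<Longrightarrow> N' \<le> j \<Longrightarrow> mdist X (v i) (v j) < \<epsilon> / 8"
      and Zlink: "\<And>\<eta> Z. 0 < \<eta> \<Longrightarrow> Z \<noteq> {} \<Longrightarrow> countable Z \<Longrightarrow> separated X Z \<Longrightarrow> Z \<subseteq> mspace X \<Longrightarrow>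
        (\<And>z. z \<in> Z \<Longrightarrow> \<exists>i\<ge>J'. mdist X z (v i) < \<delta>) \<Longrightarrow>
        \<exists>L. \<forall>z\<in>Z. \<exists>i\<ge>N'. (z, v i) \<in> near X \<eta> (mball_of X (v N') (\<epsilon> / 8)) ^^ L"
      by (rule cauchy_sequence_linking[OF lc v vcauchy \<epsilon>8, of 0]) blast+
    obtain M where M: "\<And>n. M \<le> n \<Longrightarrow> mdist X (x n) (y n) < \<delta>" using small[OF \<delta>] by blast
    define k where "k = max J' M"
    define n where "n = r (enumerate K k)"
    have n: "M \<le> n" unfolding n_def k_def using r enK(2) by (meson max.cobounded2 order_trans)
    have vk: "v k = x n" by (simp add: v_def u_def n_def)
    have "\<exists>L. \<forall>z\<in>{y n}. \<exists>i\<ge>N'. (z, v i) \<in> near X (\<eta> n) (mball_of X (v N') (\<epsilon> / 8)) ^^ L"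
    proof (rule Zlink)
      show "\<exists>i\<ge>J'. mdist X z (v i) < \<delta>" if "z \<in> {y n}" for z
        using that M[OF n] vk by (intro exI[of _ k]) (auto simp: mdist_commute k_def)
    qed (use \<eta> mem in \<open>auto simp: separated_def intro: exI[of _ 1]\<close>)
    then obtain L i where i: "(y n, v i) \<in> near X (\<eta> n) (mball_of X (v N') (\<epsilon> / 8)) ^^ L" by blast
    obtain L' where L': "(v i, v k) \<in> near X (\<eta> n) ?S ^^ L'" using vlink[OF \<eta>] by blast
    have "N' \<le> k" using N'J' by (simp add: k_def)
    have s1: "mball_of X (v N') (\<epsilon> / 8) \<subseteq> mball_of X (x n) \<epsilon>"
      using vN[OF \<open>N' \<le> k\<close> order_refl] vk \<epsilon> mem by (intro mball_of_subset_triangle) auto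
    have "mdist X (x n) (u N) < \<epsilon> / 8"
      using uN[of "enumerate K k" N] K(2)[OF enK(1)] vk by (simp add: v_def)
    then have s2: "?S \<subseteq> mball_of X (x n) \<epsilon>"
      using \<epsilon> mem by (intro mball_of_subset_triangle) auto
    have "(y n, x n) \<in> near X (\<eta> n) (mball_of X (x n) \<epsilon>) ^^ (L + L')"
      using near_relpow_trans[OF near_relpow_mono[OF i order_refl s1] near_relpow_mono[OF L' order_refl s2]]
      by (simp add: vk)
    from near_relpow_sym[OF this] show False using fail by blast
  qed (use mem in auto)
qed

end

text \<open>Far out, all terms are within \<open>\<eta>\<close> of one fixed term, so only finitely many chain lengths matter.\<close>

lemma cauchy_tail_linking:
  fixes u :: "nat \<Rightarrow> 'a"
  assumes u: "\<And>i. u i \<in> mspace X"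
    and cauchy: "\<And>e. 0 < e \<Longrightarrow> \<exists>N. \<forall>i\<ge>N. \<forall>j\<ge>N. mdist X (u i) (u j) < e"
    and \<delta>: "\<And>x y \<eta>. x \<in> mspace X \<Longrightarrow> y \<in> mspace X \<Longrightarrow> mdist X x y < \<delta> \<Longrightarrow> 0 < \<eta> \<Longrightarrow>
      \<exists>l. (x, y) \<in> near X \<eta> (mball_of X x \<epsilon>) ^^ l" and \<epsilon>: "0 < \<epsilon>"
    and N: "\<And>i j. N \<le> i \<Longrightarrow> N \<le> j \<Longrightarrow> mdist X (u i) (u j) < min \<delta> \<epsilon>" and j: "N \<le> j" and \<eta>: "0 < \<eta>"
  shows "\<exists>L. \<forall>i\<ge>N. (u i, u j) \<in> near X \<eta> (mball_of X (u N) (2 * \<epsilon>)) ^^ L"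
proof -
  let ?B = "mball_of X (u N) (2 * \<epsilon>)"
  obtain I0 where I0: "\<And>i j. I0 \<le> i \<Longrightarrow> I0 \<le> j \<Longrightarrow> mdist X (u i) (u j) < \<eta>" using cauchy[OF \<eta>] by blast
  define I where "I = max N I0"
  have mem: "u i \<in> ?B" if "N \<le> i" for i
    using N[of N i] that u \<epsilon> by auto
  have "\<exists>l. (u i, u j) \<in> near X \<eta> ?B ^^ l" if i: "N \<le> i" for i
  proof -
    obtain l where l: "(u i, u j) \<in> near X \<eta> (mball_of X (u i) \<epsilon>) ^^ l"
      using \<delta>[OF u u _ \<eta>] N[OF i j] by force
    have "mball_of X (u i) \<epsilon> \<subseteq> ?B"
      using N[of N i] i u by (intro mball_of_subset_triangle) auto
    then show ?thesis using near_relpow_mono[OF l order_refl] by blast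
  qed
  then obtain l where l: "\<And>i. N \<le> i \<Longrightarrow> (u i, u j) \<in> near X \<eta> ?B ^^ l i" by metis
  define L where "L = Max (l ` {N..I})"
  have pad: "(u i, u j) \<in> near X \<eta> ?B ^^ Suc L" if "N \<le> i" for i
  proof (cases "i \<le> I")
    case True
    then have "l i \<le> L" unfolding L_def using that by (intro Max_ge) auto
    then show ?thesis by (intro near_relpow_pad[OF l[OF that]]) (use mem[OF that] \<eta> in auto)
  next
    case False
    have "l I \<le> L" unfolding L_def by (intro Max_ge) (auto simp: I_def)
    then have "(u I, u j) \<in> near X \<eta> ?B ^^ L"
      by (intro near_relpow_pad[OF l]) (use mem[of I] \<eta> in \<open>auto simp: I_def\<close>)
    moreover have "(u i, u I) \<in> near X \<eta> ?B"
      using mem[OF that] mem[of I] I0[of i I] False unfolding near_def I_def by auto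
    ultimately show ?thesis by (rule relpow_Suc_I2[rotated])
  qed
  then show ?thesis by blast
qed

text \<open>Suppose that no length suffices for the scales \<open>\<eta> n\<close>: for each \<open>l\<close> there is a pair in \<open>B n l\<close>,
  at distance below \<open>1 / (n + 1)\<close> and not linked in \<open>l\<close> steps. If, for some \<open>s\<close> and infinitely
  many \<open>n\<close>, the first points of these pairs cannot be covered by finitely many balls of radius
  \<open>s\<close>, then a greedy choice yields an \<open>s\<close>-separated sequence \<open>u\<close> which contains first points for
  all \<open>n\<close> in question and all \<open>l\<close>; linking the second points to \<open>u\<close> in a common number of steps
  is a contradiction.

  Otherwise, with radii \<open>1 / (k + 1)\<close>, the first points accumulate near points \<open>p k\<close> in the
  sense of \<open>close\<close>. Let \<open>W k l\<close> be the set of points near \<open>p k\<close> that are not linked to \<open>p k\<close> in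
  \<open>l\<close> steps. It is not empty, and it is not covered by finitely many balls of radius \<open>h k\<close>,
  since a point within one step of a finite set is linked to \<open>p k\<close> in a bounded number of steps.
  So one can choose separated points \<open>\<zeta> k l\<close> in \<open>W k l\<close>. A subsequence of \<open>p\<close> is separated or
  Cauchy, and in both cases the points \<open>\<zeta> k l\<close>, for one suitable \<open>k\<close> and all \<open>l\<close>, are linked to
  \<open>p k\<close> in a common number of steps: a contradiction.\<close>

theorem locally_chain_connected_imp_uniformly_locally_chain_equi_connected:
  fixes X :: "'a metric"
  assumes lc: "locally_chain_connected_at (hyperspace X) (small_discrete_closed_sets X)"
  shows "uniformly_locally_chain_equi_connected X"
proof (rule uniformly_locally_chain_equi_connectedI, rule ccontr)
  fix \<epsilon> :: real assume \<epsilon>: "0 < \<epsilon>"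
  assume neg: "\<not> (\<exists>\<delta>>0. \<forall>\<eta>>0. \<exists>l. \<forall>x\<in>mspace X. \<forall>y\<in>mspace X. mdist X x y < \<delta> \<longrightarrow>
    (x, y) \<in> near X \<eta> (mball_of X x \<epsilon>) ^^ l)"
  have "\<exists>\<eta>. 0 < \<eta> \<and> \<eta> \<le> \<epsilon> / 16 \<and> (\<forall>l. \<exists>x\<in>mspace X. \<exists>y\<in>mspace X. mdist X x y < 1 / Suc n \<and>
      (x, y) \<notin> near X \<eta> (mball_of X x \<epsilon>) ^^ l)" for n
  proof -
    have "\<not> (\<forall>\<eta>>0. \<exists>l. \<forall>x\<in>mspace X. \<forall>y\<in>mspace X. mdist X x y < 1 / Suc n \<longrightarrow>
      (x, y) \<in> near X \<eta> (mball_of X x \<epsilon>) ^^ l)"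
    proof
      assume A: "\<forall>\<eta>>0. \<exists>l. \<forall>x\<in>mspace X. \<forall>y\<in>mspace X. mdist X x y < 1 / Suc n \<longrightarrow>
        (x, y) \<in> near X \<eta> (mball_of X x \<epsilon>) ^^ l"
      show False
        by (rule notE[OF neg], rule exI[of _ "1 / Suc n"], rule conjI) (simp, rule A)
    qed
    then obtain \<eta> where \<eta>: "0 < \<eta>" "\<And>l. \<exists>x\<in>mspace X. \<exists>y\<in>mspace X. mdist X x y < 1 / Suc n \<and>
      (x, y) \<notin> near X \<eta> (mball_of X x \<epsilon>) ^^ l"
      by meson
    have mono: "(x, y) \<notin> near X (min \<eta> (\<epsilon> / 16)) S ^^ l" if "(x, y) \<notin> near X \<eta> S ^^ l" for x y S l
      using that near_relpow_mono[of x y l X "min \<eta> (\<epsilon> / 16)" S \<eta> S] by auto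
    show ?thesis
    proof (intro exI[of _ "min \<eta> (\<epsilon> / 16)"] conjI allI)
      fix l
      obtain x y where "x \<in> mspace X" "y \<in> mspace X" "mdist X x y < 1 / Suc n"
        "(x, y) \<notin> near X \<eta> (mball_of X x \<epsilon>) ^^ l" using \<eta>(2) by blast
      then show "\<exists>x\<in>mspace X. \<exists>y\<in>mspace X. mdist X x y < 1 / Suc n \<and>
          (x, y) \<notin> near X (min \<eta> (\<epsilon> / 16)) (mball_of X x \<epsilon>) ^^ l"
        using mono by (intro bexI[of _ x] bexI[of _ y]) auto
    qed (use \<eta>(1) \<epsilon> in auto)
  qed
  then obtain \<eta> where \<eta>: "\<And>n. 0 < \<eta> n" "\<And>n. \<eta> n \<le> \<epsilon> / 16"
    and bad: "\<And>n l. \<exists>x\<in>mspace X. \<exists>y\<in>mspace X. mdist X x y < 1 / Suc n \<and>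
      (x, y) \<notin> near X (\<eta> n) (mball_of X x \<epsilon>) ^^ l"
    by metis
  define B where "B n l = {(x, y). x \<in> mspace X \<and> y \<in> mspace X \<and> mdist X x y < 1 / Suc n \<and>
      (x, y) \<notin> near X (\<eta> n) (mball_of X x \<epsilon>) ^^ l}" for n l
  have Bne: "B n l \<noteq> {}" for n l
    using bad[of n l] by (auto simp: B_def)
  have Banti: "B n l' \<subseteq> B n l" if "l \<le> l'" for n l l'
  proof -
    have "(x, y) \<in> near X (\<eta> n) (mball_of X x \<epsilon>) ^^ l'"
      if "(x, y) \<in> near X (\<eta> n) (mball_of X x \<epsilon>) ^^ l" "x \<in> mspace X" for x y
      by (rule near_relpow_pad[OF that(1) \<open>l \<le> l'\<close> \<eta>(1)]) (use that(2) \<epsilon> in auto)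
    then show ?thesis unfolding B_def by blast
  qed
  have small: "\<exists>M. \<forall>n\<ge>M. c / Suc n < e" if ec: "0 < e" "0 < c" for c e :: real
  proof -
    have "0 < e / c" using ec by simp
    then obtain M where M: "1 / Suc M < e / c" by (rule nat_approx_posE)
    have "c / Suc n < e" if "n \<ge> M" for n
    proof -
      have "1 / real (Suc n) \<le> 1 / real (Suc M)" using that by (intro divide_left_mono) auto
      then have "1 / real (Suc n) < e / c" using M by linarith
      then show ?thesis using \<open>0 < c\<close> by (simp add: field_simps)
    qed
    then show ?thesis by blast
  qed
  define spread where "spread s n \<longleftrightarrow> (\<forall>l F. finite F \<longrightarrow> F \<subseteq> mspace X \<longrightarrow>
      (\<exists>(x, y)\<in>B n l. \<forall>z\<in>F. s \<le> mdist X z x))" for s n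
  show False
  proof (cases "\<exists>s>0. \<forall>n0. \<exists>n\<ge>n0. spread s n")
    case True
    then obtain s where s: "0 < s"
      and "\<And>n0. \<exists>n\<ge>n0. spread s n" by blast
    then obtain \<nu> where \<nu>1: "\<And>m. m \<le> \<nu> m" and \<nu>2: "\<And>m. spread s (\<nu> m)" by metis
    note \<nu> = \<nu>1 \<nu>2[unfolded spread_def, rule_format]
    \<comment> \<open>the index \<open>k\<close> encodes a pair: the scale and the length that has to be refuted\<close>
    define P where "P k p \<longleftrightarrow> p \<in> B (\<nu> (fst (prod_decode k))) (snd (prod_decode k))" for k p
    obtain p where p: "\<And>k. P k (p k)" "\<And>j k. j < k \<Longrightarrow> s \<le> mdist X (fst (p j)) (fst (p k))"
    proof (rule greedy_sequence[of P "\<lambda>a b. s \<le> mdist X (fst a) (fst b)"])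
      show "\<exists>u. P k u \<and> (\<forall>v\<in>F. s \<le> mdist X (fst v) (fst u))" if F: "finite F" "\<And>v. v \<in> F \<Longrightarrow> \<exists>j. P j v" for k F
      proof -
        have "finite (fst ` F)" "fst ` F \<subseteq> mspace X" using F by (auto simp: P_def B_def)
        then obtain x y where "(x, y) \<in> B (\<nu> (fst (prod_decode k))) (snd (prod_decode k))"
          "\<forall>z\<in>fst ` F. s \<le> mdist X z x" using \<nu>(2)[of "fst ` F"] by blast
        then show ?thesis by (intro exI[of _ "(x, y)"]) (auto simp: P_def)
      qed
    qed blast
    define u v where "u k = fst (p k)" and "v k = snd (p k)" for k
    have uvB: "(u k, v k) \<in> B (\<nu> (fst (prod_decode k))) (snd (prod_decode k))" for k
      using p(1)[of k] by (simp add: P_def u_def v_def)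
    have mem: "u k \<in> mspace X" "v k \<in> mspace X" for k using uvB[of k] by (auto simp: B_def)
    have sep: "s \<le> mdist X (u i) (u j)" if "i \<noteq> j" for i j
      using p(2)[of i j] p(2)[of j i] that unfolding u_def by (cases "i < j") (auto simp: mdist_commute)
    obtain \<delta> where \<delta>: "0 < \<delta>"
      "\<And>\<eta> Z t. 0 < \<eta> \<Longrightarrow> 0 < t \<Longrightarrow> (\<And>k. Z k \<noteq> {}) \<Longrightarrow> (\<And>k. countable (Z k)) \<Longrightarrow> (\<And>k. Z k \<subseteq> mspace X) \<Longrightarrow>
      (\<And>k z. z \<in> Z k \<Longrightarrow> mdist X (u k) z < \<delta>) \<Longrightarrow>
      (\<And>k z z'. z \<in> Z k \<Longrightarrow> z' \<in> Z k \<Longrightarrow> z \<noteq> z' \<Longrightarrow> t \<le> mdist X z z') \<Longrightarrow>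
      \<exists>L. \<forall>k. \<forall>z\<in>Z k. (z, u k) \<in> near X \<eta> (mball_of X (u k) \<epsilon>) ^^ L"
      by (rule separated_sequence_linking[OF lc, of u s \<epsilon>, OF mem(1) s sep \<epsilon>]) blast+
    obtain m where m: "\<And>n. m \<le> n \<Longrightarrow> 1 / Suc n < \<delta>" using small[OF \<delta>(1), of 1] by auto
    define Z where "Z k = (if fst (prod_decode k) = m then {v k} else {u k})" for k
    have "\<exists>L. \<forall>k. \<forall>z\<in>Z k. (z, u k) \<in> near X (\<eta> (\<nu> m)) (mball_of X (u k) \<epsilon>) ^^ L"
    proof (rule \<delta>(2)[of _ 1])
      fix k z assume z: "z \<in> Z k"
      show "mdist X (u k) z < \<delta>"
      proof (cases "fst (prod_decode k) = m")
        case True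
        then show ?thesis using z uvB[of k] m[OF \<nu>(1)] by (auto simp: Z_def B_def)
      next
        case False
        then show ?thesis using z mem \<delta>(1) by (auto simp: Z_def)
      qed
    qed (use \<eta> mem in \<open>auto simp: Z_def split: if_splits\<close>)
    then obtain L where L: "\<And>k z. z \<in> Z k \<Longrightarrow> (z, u k) \<in> near X (\<eta> (\<nu> m)) (mball_of X (u k) \<epsilon>) ^^ L"
      by blast
    define k where "k = prod_encode (m, L)"
    have "(v k, u k) \<in> near X (\<eta> (\<nu> m)) (mball_of X (u k) \<epsilon>) ^^ L"
      by (rule L) (simp add: Z_def k_def)
    from near_relpow_sym[OF this] show False
      using uvB[of k] by (simp add: k_def B_def)
  next
    case False
    obtain \<delta>U where \<delta>U: "0 < \<delta>U"
      "\<And>x y \<eta>. x \<in> mspace X \<Longrightarrow> y \<in> mspace X \<Longrightarrow> mdist X x y < \<delta>U \<Longrightarrow> 0 < \<eta> \<Longrightarrow>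
        \<exists>l. (x, y) \<in> near X \<eta> (mball_of X x (\<epsilon> / 16)) ^^ l"
      by (rule uniformly_linked[OF lc, of "\<epsilon> / 16"]) (use \<epsilon> in auto)
    define close where "close k n p \<longleftrightarrow> (\<forall>l. \<exists>(x, y)\<in>B n l. mdist X p x < 1 / Suc k)" for k n p
    have "\<exists>n p. k \<le> n \<and> p \<in> mspace X \<and> close k n p" for k
    proof -
      have "0 < 1 / real (Suc k)" by simp
      then have "\<not> (\<forall>n0. \<exists>n\<ge>n0. spread (1 / real (Suc k)) n)" using False by metis
      then obtain n0 where no: "\<And>n. n \<ge> n0 \<Longrightarrow> \<not> spread (1 / real (Suc k)) n" by metis
      have n0: "\<exists>l F. finite F \<and> F \<subseteq> mspace X \<and>
          \<not> (\<exists>(x, y)\<in>B n l. \<forall>z\<in>F. 1 / Suc k \<le> mdist X z x)" if "n \<ge> n0" for n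
        using no[OF that] by (simp only: spread_def not_all not_imp)
      define n where "n = max k n0"
      obtain l0 F where F: "finite F" "F \<subseteq> mspace X"
        "\<not> (\<exists>(x, y)\<in>B n l0. \<forall>z\<in>F. 1 / Suc k \<le> mdist X z x)"
        using n0[of n] by (auto simp: n_def)
      obtain f where f: "f \<in> F" "\<And>l. \<exists>b\<in>B n l. mdist X f (fst b) < 1 / Suc k"
      proof (rule antitone_pigeonhole[of "B n" F l0 "\<lambda>f b. mdist X f (fst b) < 1 / Suc k"])
        fix b assume b: "b \<in> B n l0"
        obtain x y where xy: "b = (x, y)" by (cases b)
        then have "\<not> (\<forall>z\<in>F. 1 / Suc k \<le> mdist X z x)" using F(3) b by blast
        then show "\<exists>f\<in>F. mdist X f (fst b) < 1 / Suc k" by (auto simp: xy not_le)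
      qed (use Banti Bne F in blast)+
      have "\<exists>(x, y)\<in>B n l. mdist X f x < 1 / Suc k" for l
        using f(2)[of l] by auto
      then show ?thesis using f(1) F(2) by (intro exI[of _ n] exI[of _ f]) (auto simp: n_def close_def)
    qed
    then obtain \<nu> p where \<nu>: "\<And>k. k \<le> \<nu> k" and p: "\<And>k. p k \<in> mspace X"
      and "\<And>k. close k (\<nu> k) (p k)" by metis
    then have pB: "\<exists>(x, y)\<in>B (\<nu> k) l. mdist X (p k) x < 1 / Suc k" for k l
      unfolding close_def by blast
    define h where "h k = \<eta> (\<nu> k)" for k
    have h: "0 < h k" "h k \<le> \<epsilon> / 16" for k using \<eta> by (auto simp: h_def)
    obtain K0 where K0: "\<And>k. K0 \<le> k \<Longrightarrow> 2 / Suc k < min \<delta>U (\<epsilon> / 16)"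
      using small[of "min \<delta>U (\<epsilon> / 16)" 2] \<delta>U(1) \<epsilon> by auto
    have tiny: "mdist X (p k) z < \<epsilon> / 16" "mdist X (p k) z < \<delta>U"
      if "K0 \<le> k" "mdist X (p k) z < 2 / Suc k" for k z
      using K0[OF that(1)] that(2) by linarith+
    define W where "W k l = {z \<in> mspace X. mdist X (p k) z < 2 / Suc k \<and>
        (z, p k) \<notin> near X (h k) (mball_of X (p k) (\<epsilon> / 4)) ^^ l}" for k l
    have Wanti: "W k l' \<subseteq> W k l" if k: "K0 \<le> k" and l: "l \<le> l'" for k l l'
    proof
      fix z assume z: "z \<in> W k l'"
      then have "z \<in> mball_of X (p k) (\<epsilon> / 4)" using p tiny(1)[OF k, of z] \<epsilon> by (simp add: W_def)
      then have "(z, p k) \<in> near X (h k) (mball_of X (p k) (\<epsilon> / 4)) ^^ l'"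
        if "(z, p k) \<in> near X (h k) (mball_of X (p k) (\<epsilon> / 4)) ^^ l"
        by (intro near_relpow_pad[OF that l h(1)]) auto
      then have "(z, p k) \<notin> near X (h k) (mball_of X (p k) (\<epsilon> / 4)) ^^ l"
        using z unfolding W_def by blast
      then show "z \<in> W k l" using z by (simp add: W_def)
    qed
    have Wne: "W k l \<noteq> {}" if k: "K0 \<le> k" for k l
    proof
      assume empty: "W k l = {}"
      obtain x y where xy: "(x, y) \<in> B (\<nu> k) (l + l)" "mdist X (p k) x < 1 / Suc k" using pB by blast
      then have mem: "x \<in> mspace X" "y \<in> mspace X" and "mdist X x y < 1 / Suc (\<nu> k)"
        and no: "(x, y) \<notin> near X (h k) (mball_of X x \<epsilon>) ^^ (l + l)"
        by (auto simp: B_def h_def)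
      moreover have "1 / real (Suc (\<nu> k)) \<le> 1 / real (Suc k)" using \<nu>[of k] by (intro divide_left_mono) auto
      ultimately have "mdist X x y < 1 / Suc k" by linarith
      moreover have "2 / real (Suc k) = 1 / Suc k + 1 / Suc k" "0 < 1 / real (Suc k)" by simp_all
      ultimately have y: "mdist X (p k) y < 2 / Suc k" "mdist X (p k) x < 2 / Suc k"
        using mdist_triangle[OF p mem(1) mem(2), of k] xy(2) by linarith+
      then have "(x, p k) \<in> near X (h k) (mball_of X (p k) (\<epsilon> / 4)) ^^ l"
        and "(y, p k) \<in> near X (h k) (mball_of X (p k) (\<epsilon> / 4)) ^^ l"
        using empty mem by (auto simp: W_def)
      from near_relpow_trans[OF this(1) near_relpow_sym[OF this(2)]]
      have xyl: "(x, y) \<in> near X (h k) (mball_of X (p k) (\<epsilon> / 4)) ^^ (l + l)" .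
      have sub: "mball_of X (p k) (\<epsilon> / 4) \<subseteq> mball_of X x \<epsilon>"
        using tiny(1)[OF k y(2)] mem \<epsilon> by (intro mball_of_subset_triangle) (auto simp: mdist_commute)
      show False using no near_relpow_mono[OF xyl order_refl sub] by blast
    qed
    have Wsep: "\<exists>z\<in>W k l. \<forall>f\<in>F. h k \<le> mdist X f z"
      if k: "K0 \<le> k" and F: "finite F" "F \<subseteq> mspace X" for k l F
    proof (rule ccontr)
      assume no: "\<not> ?thesis"
      obtain f where f: "f \<in> F" "\<And>l. \<exists>b\<in>W k l. mdist X f b < h k"
      proof (rule antitone_pigeonhole[of "W k" F l "\<lambda>f b. mdist X f b < h k"])
        show "\<exists>f\<in>F. mdist X f b < h k" if "b \<in> W k l" for b using no that by (auto simp: not_le)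
      qed (use Wanti[OF k] Wne[OF k] F in blast)+
      have fm: "f \<in> mspace X" using f(1) F by blast
      let ?B = "mball_of X (p k) (\<epsilon> / 4)"
      obtain z0 where z0: "z0 \<in> W k 0" "mdist X f z0 < h k" using f(2) by blast
      have z0': "z0 \<in> mspace X" "mdist X (p k) z0 < 2 / Suc k" using z0 by (auto simp: W_def)
      have "mdist X z0 (p k) < \<delta>U" using tiny(2)[OF k z0'(2)] by (simp add: mdist_commute)
      then obtain L where L: "(z0, p k) \<in> near X (h k) (mball_of X z0 (\<epsilon> / 16)) ^^ L"
        using \<delta>U(2)[OF z0'(1) p _ h(1)] by blast
      have sub: "mball_of X z0 (\<epsilon> / 16) \<subseteq> ?B"
        using tiny(1)[OF k z0'(2)] p \<epsilon> by (intro mball_of_subset_triangle) auto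
      have "mdist X (p k) f < \<epsilon> / 8"
        using mdist_triangle[of "p k" X z0 f] tiny(1)[OF k z0'(2)] z0'(1) z0(2) h(2)[of k] p[of k] fm
        by (simp add: mdist_commute)
      then have fB: "f \<in> ?B" using p fm \<epsilon> by auto
      have z0B: "z0 \<in> ?B" using z0'(1) tiny(1)[OF k z0'(2)] p \<epsilon> by simp
      \<comment> \<open>\<open>z\<close> reaches \<open>p k\<close> by two extra steps, from \<open>z\<close> to \<open>f\<close> and from \<open>f\<close> to \<open>z0\<close>\<close>
      obtain z where z: "z \<in> W k (Suc (Suc L))" "mdist X f z < h k" using f(2) by blast
      then have zB: "z \<in> ?B" using tiny(1)[OF k, of z] p \<epsilon> by (simp add: W_def)
      have "(f, p k) \<in> near X (h k) ?B ^^ Suc L"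
        using relpow_Suc_I2[OF _ near_relpow_mono[OF L order_refl sub], of f] fB z0B z0(2)
        by (auto simp: near_def)
      then have "(z, p k) \<in> near X (h k) ?B ^^ Suc (Suc L)"
        by (rule relpow_Suc_I2[rotated]) (use fB zB z(2) in \<open>auto simp: near_def mdist_commute\<close>)
      then show False using z by (simp add: W_def)
    qed
    have "\<exists>\<zeta>. (\<forall>l. \<zeta> l \<in> W k l) \<and> (\<forall>i j. i \<noteq> j \<longrightarrow> h k \<le> mdist X (\<zeta> i) (\<zeta> j))"
      (is "\<exists>\<zeta>. ?seq k \<zeta>") if k: "K0 \<le> k" for k
    proof -
      obtain \<zeta> where \<zeta>: "\<And>l. \<zeta> l \<in> W k l" "\<And>i j. i < j \<Longrightarrow> h k \<le> mdist X (\<zeta> i) (\<zeta> j)"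
      proof (rule greedy_sequence[of "\<lambda>l z. z \<in> W k l" "\<lambda>a b. h k \<le> mdist X a b"])
        show "\<exists>u. u \<in> W k l \<and> (\<forall>v\<in>F. h k \<le> mdist X v u)"
          if F: "finite F" "\<And>v. v \<in> F \<Longrightarrow> \<exists>j. v \<in> W k j" for l F
        proof -
          have "F \<subseteq> mspace X" using F(2) by (auto simp: W_def)
          then show ?thesis using Wsep[OF k F(1)] by blast
        qed
      qed blast
      have "h k \<le> mdist X (\<zeta> i) (\<zeta> j)" if "i \<noteq> j" for i j
        using \<zeta>(2)[of i j] \<zeta>(2)[of j i] that by (cases "i < j") (auto simp: mdist_commute)
      then show ?thesis using \<zeta>(1) by blast
    qed
    then have "\<forall>k. \<exists>\<zeta>. K0 \<le> k \<longrightarrow> ?seq k \<zeta>" by blast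
    from choice[OF this] obtain \<zeta> where "\<forall>k. K0 \<le> k \<longrightarrow> ?seq k (\<zeta> k)" ..
    then have \<zeta>: "\<And>k l. K0 \<le> k \<Longrightarrow> \<zeta> k l \<in> W k l"
      "\<And>k i j. K0 \<le> k \<Longrightarrow> i \<noteq> j \<Longrightarrow> h k \<le> mdist X (\<zeta> k i) (\<zeta> k j)" by blast+
    have \<zeta>m: "\<zeta> k l \<in> mspace X" "mdist X (p k) (\<zeta> k l) < 2 / Suc k" if "K0 \<le> k" for k l
      using \<zeta>(1)[OF that, of l] by (auto simp: W_def)
    have \<zeta>sep: "separated X (range (\<zeta> k))" if k: "K0 \<le> k" for k
      unfolding separated_def
    proof (intro exI[of _ "h k"] conjI ballI impI)
      fix x y assume "x \<in> range (\<zeta> k)" "y \<in> range (\<zeta> k)" "x \<noteq> y"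
      then obtain i j where "x = \<zeta> k i" "y = \<zeta> k j" "i \<noteq> j" by auto
      then show "h k \<le> mdist X x y" using \<zeta>(2)[OF k] by simp
    qed (rule h)
    define q where "q i = p (i + K0)" for i
    show False
    proof (rule separated_or_cauchy_subsequence[of q X])
      fix s r assume s: "0 < s" and r: "\<And>k::nat. k \<le> r k"
        and sep: "\<And>i j. i \<noteq> j \<Longrightarrow> s \<le> mdist X (q (r i)) (q (r j))"
      define u where "u i = q (r i)" for i
      have u: "u i \<in> mspace X" for i using p by (simp add: u_def q_def)
      have usep: "s \<le> mdist X (u i) (u j)" if "i \<noteq> j" for i j using sep[OF that] by (simp add: u_def)
      have \<epsilon>4: "0 < \<epsilon> / 4" using \<epsilon> by simp
      obtain \<delta> where \<delta>: "0 < \<delta>"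
        "\<And>\<eta> Z t. 0 < \<eta> \<Longrightarrow> 0 < t \<Longrightarrow> (\<And>k. Z k \<noteq> {}) \<Longrightarrow> (\<And>k. countable (Z k)) \<Longrightarrow> (\<And>k. Z k \<subseteq> mspace X) \<Longrightarrow>
        (\<And>k z. z \<in> Z k \<Longrightarrow> mdist X (u k) z < \<delta>) \<Longrightarrow>
        (\<And>k z z'. z \<in> Z k \<Longrightarrow> z' \<in> Z k \<Longrightarrow> z \<noteq> z' \<Longrightarrow> t \<le> mdist X z z') \<Longrightarrow>
        \<exists>L. \<forall>k. \<forall>z\<in>Z k. (z, u k) \<in> near X \<eta> (mball_of X (u k) (\<epsilon> / 4)) ^^ L"
        by (rule separated_sequence_linking[OF lc, of u s "\<epsilon> / 4", OF u s usep \<epsilon>4]) blast+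
      obtain m where m: "\<And>n. m \<le> n \<Longrightarrow> 2 / Suc n < \<delta>" using small[OF \<delta>(1), of 2] by auto
      define k where "k = r m + K0"
      have k: "K0 \<le> k" "m \<le> k" "u m = p k" using r[of m] by (auto simp: k_def u_def q_def)
      define Z where "Z i = (if i = m then range (\<zeta> k) else {u i})" for i
      have "\<exists>L. \<forall>i. \<forall>z\<in>Z i. (z, u i) \<in> near X (h k) (mball_of X (u i) (\<epsilon> / 4)) ^^ L"
      proof (rule \<delta>(2)[of _ "h k"])
        show "mdist X (u i) z < \<delta>" if "z \<in> Z i" for i z
          using that less_trans[OF \<zeta>m(2)[OF k(1)] m[OF k(2)]] u \<delta>(1) k(3)
          by (auto simp: Z_def split: if_splits)
        show "h k \<le> mdist X z z'" if zz: "z \<in> Z i" "z' \<in> Z i" "z \<noteq> z'" for i z z'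
        proof (cases "i = m")
          case True
          then obtain a b where "z = \<zeta> k a" "z' = \<zeta> k b" "a \<noteq> b" using zz by (auto simp: Z_def)
          then show ?thesis using \<zeta>(2)[OF k(1)] by simp
        qed (use zz in \<open>auto simp: Z_def\<close>)
        show "Z i \<subseteq> mspace X" for i using \<zeta>m(1)[OF k(1)] u by (auto simp: Z_def)
      qed (use h in \<open>auto simp: Z_def\<close>)
      then obtain L where L: "\<And>i z. z \<in> Z i \<Longrightarrow> (z, u i) \<in> near X (h k) (mball_of X (u i) (\<epsilon> / 4)) ^^ L"
        by blast
      have "(\<zeta> k L, u m) \<in> near X (h k) (mball_of X (u m) (\<epsilon> / 4)) ^^ L"
        by (rule L) (simp add: Z_def)
      then show False using \<zeta>(1)[OF k(1), of L] unfolding k(3) W_def by blast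
    next
      fix r :: "nat \<Rightarrow> nat" assume r: "\<And>k. k \<le> r k"
        and cauchy: "\<And>e. 0 < e \<Longrightarrow> \<exists>N. \<forall>i\<ge>N. \<forall>j\<ge>N. mdist X (q (r i)) (q (r j)) < e"
      define u where "u i = q (r i)" for i
      have u: "u i \<in> mspace X" for i using p by (simp add: u_def q_def)
      have ucauchy: "\<exists>N. \<forall>i\<ge>N. \<forall>j\<ge>N. mdist X (u i) (u j) < e" if "0 < e" for e
        using cauchy[OF that] by (simp add: u_def)
      define \<epsilon>' where "\<epsilon>' = min \<delta>U (\<epsilon> / 16)"
      have \<epsilon>': "0 < \<epsilon>'" "\<epsilon>' \<le> \<epsilon> / 16" using \<delta>U(1) \<epsilon> by (auto simp: \<epsilon>'_def)
      obtain N J \<delta> where NJ: "N \<le> J" and \<delta>: "0 < \<delta>"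
        and uN: "\<And>i j. N \<le> i \<Longrightarrow> N \<le> j \<Longrightarrow> mdist X (u i) (u j) < \<epsilon>'"
        and link: "\<And>\<eta> Z. 0 < \<eta> \<Longrightarrow> Z \<noteq> {} \<Longrightarrow> countable Z \<Longrightarrow> separated X Z \<Longrightarrow> Z \<subseteq> mspace X \<Longrightarrow>
          (\<And>z. z \<in> Z \<Longrightarrow> \<exists>i\<ge>J. mdist X z (u i) < \<delta>) \<Longrightarrow>
          \<exists>L. \<forall>z\<in>Z. \<exists>i\<ge>N. (z, u i) \<in> near X \<eta> (mball_of X (u N) \<epsilon>') ^^ L"
        by (rule cauchy_sequence_linking[OF lc, where u=u, OF u ucauchy \<epsilon>'(1), of 0]) blast+
      obtain m where m: "\<And>n. m \<le> n \<Longrightarrow> 2 / Suc n < \<delta>" using small[OF \<delta>, of 2] by auto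
      define j where "j = max J m"
      define k where "k = r j + K0"
      have k: "K0 \<le> k" "m \<le> k" "u j = p k" "J \<le> j" "N \<le> j"
        using r[of j] NJ by (auto simp: k_def u_def q_def j_def)
      have "\<exists>L. \<forall>z\<in>range (\<zeta> k). \<exists>i\<ge>N. (z, u i) \<in> near X (h k) (mball_of X (u N) \<epsilon>') ^^ L"
      proof (rule link[OF h(1) _ _ \<zeta>sep[OF k(1)]])
        show "\<exists>i\<ge>J. mdist X z (u i) < \<delta>" if "z \<in> range (\<zeta> k)" for z
          using that less_trans[OF \<zeta>m(2)[OF k(1)] m[OF k(2)]] k(3,4)
          by (intro exI[of _ j]) (auto simp: mdist_commute)
      qed (use \<zeta>m[OF k(1)] in auto)
      then obtain L where L: "\<And>l. \<exists>i\<ge>N. (\<zeta> k l, u i) \<in> near X (h k) (mball_of X (u N) \<epsilon>') ^^ L" by blast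
      have "\<exists>L. \<forall>i\<ge>N. (u i, u j) \<in> near X (h k) (mball_of X (u N) (2 * (\<epsilon> / 16))) ^^ L"
        by (rule cauchy_tail_linking[where u=u, OF u ucauchy \<delta>U(2) _ _ k(5) h(1)]) (use \<epsilon> uN in \<open>auto simp: \<epsilon>'_def\<close>)
      then obtain L' where L': "\<And>i. N \<le> i \<Longrightarrow> (u i, u j) \<in> near X (h k) (mball_of X (u N) (2 * (\<epsilon> / 16))) ^^ L'"
        by blast
      obtain i where i: "N \<le> i" "(\<zeta> k (L + L'), u i) \<in> near X (h k) (mball_of X (u N) \<epsilon>') ^^ L" using L by blast
      have "mdist X (p k) (u N) < \<epsilon> / 16" using uN[OF k(5) order_refl] \<epsilon>' k(3) by simp
      then have s1: "mball_of X (u N) \<epsilon>' \<subseteq> mball_of X (p k) (\<epsilon> / 4)"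
        using \<epsilon>' \<epsilon> by (intro mball_of_subset_triangle[OF p]) linarith
      have s2: "mball_of X (u N) (2 * (\<epsilon> / 16)) \<subseteq> mball_of X (p k) (\<epsilon> / 4)"
        using \<open>mdist X (p k) (u N) < \<epsilon> / 16\<close> \<epsilon> by (intro mball_of_subset_triangle[OF p]) linarith
      have "(\<zeta> k (L + L'), p k) \<in> near X (h k) (mball_of X (p k) (\<epsilon> / 4)) ^^ (L + L')"
        using near_relpow_trans[OF near_relpow_mono[OF i(2) order_refl s1]
            near_relpow_mono[OF L'[OF i(1)] order_refl s2]] k(3) by simp
      then show False using \<zeta>(1)[OF k(1), of "L + L'"] unfolding W_def by blast
    qed (use p in \<open>auto simp: q_def\<close>)
  qed
qed

section \<open>Traces from repeated subdivision of chains\<close>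

text \<open>Beyond its end the chain is continued constantly; it becomes a sequence defined at all indices.\<close>

lemma chain_padded:
  assumes "chain_linking X \<eta> k x y c" "chain_diam X k c < \<epsilon>" "k \<le> l" "0 < \<eta>"
  shows "\<exists>c. c 0 = x \<and> c l = y \<and> (\<forall>i. c i \<in> mspace X) \<and> (\<forall>i. mdist X (c i) (c (Suc i)) < \<eta>) \<and>
    (\<forall>i j. mdist X (c i) (c j) < \<epsilon>)"
proof (intro exI[of _ "\<lambda>i. c (min i k)"] conjI allI)
  have c: "c 0 = x" "c k = y" "\<And>i. i \<le> k \<Longrightarrow> c i \<in> mspace X"
    "\<And>i. i \<in> {1..k} \<Longrightarrow> mdist X (c i) (c (i - 1)) < \<eta>"
    using assms(1) by (auto simp: chain_linking_def)
  show "c (min 0 k) = x" "c (min l k) = y" "c (min i k) \<in> mspace X" for i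
    using c assms(3) by auto
  show "mdist X (c (min i k)) (c (min (Suc i) k)) < \<eta>" for i
  proof (cases "Suc i \<le> k")
    case True
    then show ?thesis using c(4)[of "Suc i"] by (simp add: mdist_commute min_def)
  next
    case False
    then have "min i k = k" "min (Suc i) k = k" by auto
    then show ?thesis using c(3)[of k] assms(4) by simp
  qed
  show "mdist X (c (min i k)) (c (min j k)) < \<epsilon>" for i j
  proof -
    have "mdist X (c (min i k)) (c (min j k)) \<le> chain_diam X k c"
      unfolding chain_diam_def by (intro Max_ge) auto
    then show ?thesis using assms(2) by simp
  qed
qed

text \<open>The steps of each chain \<open>S n x y\<close> are so short that they can be subdivided at stage \<open>n + 1\<close>. All
  chains of one stage have the same number of steps, so that the points of a repeated
  subdivision belong to times that do not depend on the end points.\<close>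

locale subdivision =
  fixes X :: "'a metric" and \<delta> :: "nat \<Rightarrow> real" and l :: "nat \<Rightarrow> nat"
    and S :: "nat \<Rightarrow> 'a \<Rightarrow> 'a \<Rightarrow> nat \<Rightarrow> 'a"
  assumes l2: "\<And>n. 2 \<le> l n"
    and S: "\<And>n x y. x \<in> mspace X \<Longrightarrow> y \<in> mspace X \<Longrightarrow> mdist X x y < \<delta> n \<Longrightarrow>
      S n x y 0 = x \<and> S n x y (l n) = y \<and> (\<forall>i. S n x y i \<in> mspace X) \<and>
      (\<forall>i. mdist X (S n x y i) (S n x y (Suc i)) < \<delta> (Suc n)) \<and>
      (\<forall>i j. mdist X (S n x y i) (S n x y j) < 1 / 2 ^ n)"
begin

text \<open>After \<open>j\<close> subdivisions, starting at stage \<open>n\<close>, \<open>grid n x y j N\<close> is the point with number \<open>N\<close>;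
  the last digit of \<open>N\<close> in the mixed radix system of the \<open>l (n + i)\<close> is the position inside the
  subdivided step. The points from the end on are all \<open>y\<close>, so that no upper bound on \<open>N\<close> has to
  be carried along.\<close>

primrec grid :: "nat \<Rightarrow> 'a \<Rightarrow> 'a \<Rightarrow> nat \<Rightarrow> nat \<Rightarrow> 'a" where
  "grid n x y 0 N = (if N = 0 then x else y)"
| "grid n x y (Suc j) N =
    S (n + j) (grid n x y j (N div l (n + j))) (grid n x y j (Suc (N div l (n + j)))) (N mod l (n + j))"

definition mesh :: "nat \<Rightarrow> nat \<Rightarrow> nat" where
  "mesh n j = (\<Prod>i<j. l (n + i))"

lemma l_pos [simp]: "0 < l n"
  using l2[of n] by simp

lemma mesh_pos [simp]: "0 < mesh n j"
  by (auto simp: mesh_def intro!: prod_pos)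

lemma mesh_neq_0 [simp]: "mesh n j \<noteq> 0"
  using mesh_pos[of n j] by linarith

lemma mesh_0 [simp]: "mesh n 0 = 1" and mesh_Suc: "mesh n (Suc j) = mesh n j * l (n + j)"
  by (simp_all add: mesh_def)

lemma mesh_add: "mesh n (j + m) = mesh n j * mesh (n + j) m"
  by (induction m) (simp_all add: mesh_Suc add.assoc)

lemma mesh_ge: "2 ^ j \<le> mesh n j"
proof (induction j)
  case (Suc j)
  then have "2 ^ j * 2 \<le> mesh n j * l (n + j)" using l2 by (intro mult_mono) auto
  then show ?case by (simp add: mesh_Suc)
qed simp

context
  fixes n x y assumes xy: "x \<in> mspace X" "y \<in> mspace X" "mdist X x y < \<delta> n" "0 < \<delta> n"
begin

abbreviation "G \<equiv> grid n x y"

lemma grid_mem_dist: "G j N \<in> mspace X \<and> mdist X (G j N) (G j (Suc N)) < \<delta> (n + j)"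
proof (induction j arbitrary: N)
  case 0
  then show ?case using xy by auto
next
  case (Suc j)
  let ?l = "l (n + j)" and ?q = "N div l (n + j)"
  let ?c = "S (n + j) (G j ?q) (G j (Suc ?q))"
  have c: "?c 0 = G j ?q \<and> ?c ?l = G j (Suc ?q) \<and> (\<forall>i. ?c i \<in> mspace X) \<and>
      (\<forall>i. mdist X (?c i) (?c (Suc i)) < \<delta> (Suc (n + j)))"
    using S[of "G j ?q" "G j (Suc ?q)" "n + j"] Suc.IH by blast
  have "G (Suc j) (Suc N) = ?c (Suc (N mod ?l))"
  proof (cases "Suc (N mod ?l) = ?l")
    case True
    then have "Suc N mod ?l = 0" "Suc N div ?l = Suc ?q"
      by (simp_all add: mod_Suc div_Suc)
    then have "G (Suc j) (Suc N) = G j (Suc ?q)"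
      using S[of "G j (Suc ?q)" "G j (Suc (Suc ?q))" "n + j"] Suc.IH by simp
    then show ?thesis using c True by simp
  next
    case False
    then have "Suc N mod ?l = Suc (N mod ?l)" "Suc N div ?l = ?q"
      by (simp_all add: mod_Suc div_Suc)
    then show ?thesis by simp
  qed
  then show ?case using c by simp
qed

lemma grid_refine:
  "G (Suc j) (N * l (n + j)) = G j N"
  "mdist X (G (Suc j) N) (G j (N div l (n + j))) < 1 / 2 ^ (n + j)"
proof -
  show "G (Suc j) (N * l (n + j)) = G j N"
    using S[of "G j N" "G j (Suc N)" "n + j"] grid_mem_dist by simp
  let ?q = "N div l (n + j)"
  let ?c = "S (n + j) (G j ?q) (G j (Suc ?q))"
  have "?c 0 = G j ?q" "mdist X (?c (N mod l (n + j))) (?c 0) < 1 / 2 ^ (n + j)"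
    using S[of "G j ?q" "G j (Suc ?q)" "n + j"] grid_mem_dist by blast+
  then show "mdist X (G (Suc j) N) (G j (N div l (n + j))) < 1 / 2 ^ (n + j)" by simp
qed

text \<open>Grids are consistent under refinement, and a point is close to the coarser grid point before it:
  the distance is a partial sum of the geometric series of the diameters.\<close>

lemma grid_refine_iterated:
  "G (j + m) (N * mesh (n + j) m) = G j N"
  "mdist X (G (j + m) N) (G j (N div mesh (n + j) m)) \<le> 2 / 2 ^ (n + j) - 2 / 2 ^ (n + j + m)"
proof -
  show "G (j + m) (N * mesh (n + j) m) = G j N"
  proof (induction m)
    case (Suc m)
    have "N * mesh (n + j) (Suc m) = (N * mesh (n + j) m) * l (n + (j + m))"
      by (simp add: mesh_Suc add.assoc)
    then have "G (j + Suc m) (N * mesh (n + j) (Suc m)) = G (j + m) (N * mesh (n + j) m)"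
      using grid_refine(1)[of "j + m" "N * mesh (n + j) m"] by (simp only: add_Suc_right)
    then show ?case using Suc by (simp only:)
  qed simp
  show "mdist X (G (j + m) N) (G j (N div mesh (n + j) m)) \<le> 2 / 2 ^ (n + j) - 2 / 2 ^ (n + j + m)"
  proof (induction m arbitrary: N)
    case 0
    then show ?case using grid_mem_dist[of j N] by simp
  next
    case (Suc m)
    let ?M = "N div l (n + (j + m))"
    have e: "N div mesh (n + j) (Suc m) = ?M div mesh (n + j) m"
      by (metis mesh_Suc div_mult2_eq mult.commute add.assoc)
    have "mdist X (G (j + Suc m) N) (G j (?M div mesh (n + j) m)) \<le>
        mdist X (G (Suc (j + m)) N) (G (j + m) ?M) + mdist X (G (j + m) ?M) (G j (?M div mesh (n + j) m))"
      using mdist_triangle grid_mem_dist by (metis add_Suc_right)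
    also have "\<dots> \<le> 1 / 2 ^ (n + (j + m)) + (2 / 2 ^ (n + j) - 2 / 2 ^ (n + j + m))"
      using grid_refine(2)[of "j + m" N] Suc[of ?M] by (intro add_mono) auto
    also have "\<dots> = 2 / 2 ^ (n + j) - 2 / 2 ^ (n + j + Suc m)"
      by (simp add: add.assoc field_simps)
    finally show ?case by (simp only: e)
  qed
qed

definition gridfun :: "real \<Rightarrow> 'a" where
  "gridfun u = (SOME p. \<exists>j N. u = real N / mesh n j \<and> p = G j N)"

lemma grid_consistent:
  assumes "real N / mesh n j = real N' / mesh n j'" "j \<le> j'"
  shows "G j N = G j' N'"
proof -
  define m where "m = j' - j"
  have j': "j' = j + m" using assms by (simp add: m_def)
  have "real N' = real N * mesh (n + j) m"
    using assms(1) mesh_neq_0[of n j] mesh_neq_0[of "n + j" m] unfolding j' mesh_add of_nat_mult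
    by (simp add: field_simps)
  then have "N' = N * mesh (n + j) m" by (metis of_nat_eq_iff of_nat_mult)
  then show ?thesis using grid_refine_iterated(1)[of j m N] by (simp add: j')
qed

lemma gridfun: "gridfun (real N / mesh n j) = G j N"
proof -
  have "\<exists>j' N'. real N / mesh n j = real N' / mesh n j' \<and> gridfun (real N / mesh n j) = G j' N'"
    unfolding gridfun_def by (rule someI_ex) blast
  then obtain j' N' where "real N / mesh n j = real N' / mesh n j'" "gridfun (real N / mesh n j) = G j' N'"
    by blast
  then show ?thesis
    using grid_consistent[of N j N' j'] grid_consistent[of N' j' N j] by (cases "j \<le> j'") auto
qed

text \<open>Times that differ by at most one mesh width of stage \<open>k\<close> have equal or adjacent grid points
  before them at that stage. These are \<open>1 / 2 ^ (n + k)\<close> apart, and each of the two refinements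
  contributes \<open>2 / 2 ^ (n + k)\<close>.\<close>

lemma gridfun_modulus:
  assumes u: "u = real N / mesh n j" and v: "v = real N' / mesh n j'"
    and k: "\<bar>u - v\<bar> \<le> 1 / mesh n k"
  shows "mdist X (gridfun u) (gridfun v) \<le> 5 / 2 ^ (n + k)"
proof -
  define m where "m = max j j'"
  have rep: "\<exists>M. u' = real M / mesh n (k + m)" if "u' = real N / mesh n j" "j \<le> m" for u' N j
  proof -
    have "k + m = j + (k + m - j)" using that by simp
    then have "mesh n (k + m) = mesh n j * mesh (n + j) (k + m - j)" by (metis mesh_add)
    then have "u' = real (N * mesh (n + j) (k + m - j)) / mesh n (k + m)"
      using that(1) by simp
    then show ?thesis by blast
  qed
  obtain M where M: "u = real M / mesh n (k + m)" using rep[OF u] by (auto simp: m_def)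
  obtain M' where M': "v = real M' / mesh n (k + m)" using rep[OF v] by (auto simp: m_def)
  let ?p = "mesh (n + k) m"
  let ?a = "M div ?p" and ?b = "M' div ?p"
  have p: "0 < ?p" by simp
  have "\<bar>real M - real M'\<bar> \<le> ?p"
  proof -
    have "\<bar>real M - real M'\<bar> / mesh n (k + m) \<le> 1 / mesh n k"
      using k unfolding M M' by (simp add: diff_divide_distrib[symmetric])
    then have "\<bar>real M - real M'\<bar> \<le> mesh n (k + m) / mesh n k"
      by (simp add: field_simps)
    then show ?thesis by (simp add: mesh_add)
  qed
  then have le: "M \<le> M' + ?p" "M' \<le> M + ?p" by linarith+
  have "?a \<le> Suc ?b" using div_le_mono[OF le(1), of ?p] p by simp
  moreover have "?b \<le> Suc ?a" using div_le_mono[OF le(2), of ?p] p by simp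
  ultimately have "?a = ?b \<or> ?a = Suc ?b \<or> ?b = Suc ?a" by linarith
  moreover have step: "mdist X (G k i) (G k (Suc i)) < 1 / 2 ^ (n + k)" for i
  proof -
    let ?c = "S (n + k) (G k i) (G k (Suc i))"
    have "?c 0 = G k i" "?c (l (n + k)) = G k (Suc i)" "mdist X (?c 0) (?c (l (n + k))) < 1 / 2 ^ (n + k)"
      using S[of "G k i" "G k (Suc i)" "n + k"] grid_mem_dist by blast+
    then show ?thesis by simp
  qed
  ultimately have ab: "mdist X (G k ?a) (G k ?b) \<le> 1 / 2 ^ (n + k)"
  proof (elim disjE)
    assume "?a = ?b"
    then show ?thesis using grid_mem_dist[of k ?b] by (simp only: mdist_self) (simp)?
  next
    assume "?a = Suc ?b"
    then show ?thesis using step[of ?b] by (simp only: mdist_commute[of X _ "G k ?b"]) (simp)?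
  next
    assume "?b = Suc ?a"
    then show ?thesis using step[of ?a] by (simp only:) (simp)?
  qed
  have bound: "mdist X (G (k + m) M) (G k (M div ?p)) \<le> 2 / 2 ^ (n + k)" for M
    using grid_refine_iterated(2)[of k m M] by (rule order_trans) simp
  have "mdist X (G (k + m) M) (G (k + m) M') \<le>
      mdist X (G (k + m) M) (G k ?a) + mdist X (G k ?a) (G k ?b) + mdist X (G k ?b) (G (k + m) M')"
    using mdist_triangle[of "G (k + m) M" X "G k ?a" "G (k + m) M'"]
      mdist_triangle[of "G k ?a" X "G k ?b" "G (k + m) M'"] grid_mem_dist by force
  also have "\<dots> \<le> 2 / 2 ^ (n + k) + 1 / 2 ^ (n + k) + 2 / 2 ^ (n + k)"
    using ab bound[of M] bound[of M'] by (simp add: mdist_commute)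
  finally show ?thesis unfolding M M' gridfun by simp
qed

lemma gridfun_ends: "gridfun 0 = x" "gridfun 1 = y"
  using gridfun[of 0 0] gridfun[of 1 0] by simp_all

lemma gridfun_trace:
  assumes T: "0 < T"
    and w: "\<And>s r. 0 \<le> s \<Longrightarrow> s \<le> T \<Longrightarrow> (\<And>k. s \<le> T / mesh n k \<Longrightarrow> r \<le> 5 / 2 ^ (n + k)) \<Longrightarrow> r \<le> w s"
  obtains D where "is_trace X w T D (\<lambda>t. gridfun (t / T))"
proof -
  define D where "D = {T * (real N / mesh n j) | N j. N \<le> mesh n j}"
  have Dsub: "D \<subseteq> {0..T}"
  proof
    fix t assume "t \<in> D"
    then obtain N j where N: "t = T * (real N / mesh n j)" "N \<le> mesh n j" by (auto simp: D_def)
    have "0 \<le> real N / mesh n j" "real N / mesh n j \<le> 1" using N(2) by (auto simp: divide_le_eq)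
    then show "t \<in> {0..T}" unfolding N(1) using mult_left_le[of "real N / mesh n j" T] T by simp
  qed
  have dense: "t \<in> closure D" if t: "t \<in> {0..T}" for t
    unfolding closure_approachable
  proof (intro allI impI)
    fix e :: real assume e: "0 < e"
    obtain j where j: "T / e < 2 ^ j" using real_arch_pow[of 2 "T / e"] by auto
    define s where "s = t / T * mesh n j"
    define N where "N = nat \<lfloor>s\<rfloor>"
    have m: "0 < real (mesh n j)" by simp
    have "0 \<le> s" "s \<le> mesh n j" using t T by (auto simp: s_def field_simps)
    then have N: "real N \<le> s" "s < real N + 1" "N \<le> mesh n j"
      unfolding N_def by (linarith, linarith, simp add: nat_le_iff floor_le_iff le_of_int_ceiling)

    have "\<bar>s - real N\<bar> \<le> 1" using N by linarith
    have ts: "t = T * (s / mesh n j)" using T m by (simp add: s_def)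
    have "dist (T * (real N / mesh n j)) t = \<bar>T * ((real N - s) / mesh n j)\<bar>"
      unfolding ts dist_real_def by (simp only: right_diff_distrib[symmetric] diff_divide_distrib[symmetric])
    also have "\<dots> = T * (\<bar>s - real N\<bar> / mesh n j)"
      using T by (simp add: abs_mult abs_minus_commute)
    also have "\<dots> \<le> T * (1 / mesh n j)"
      using T \<open>\<bar>s - real N\<bar> \<le> 1\<close> by (intro mult_left_mono divide_right_mono) auto
    also have "\<dots> \<le> T * (1 / 2 ^ j)"
    proof -
      have "(2::real) ^ j \<le> mesh n j" using mesh_ge[of j n] by (metis of_nat_le_iff of_nat_numeral of_nat_power)
      then show ?thesis using T by (intro mult_left_mono divide_left_mono) auto
    qed
    also have "\<dots> < e" using j e by (simp add: field_simps)
    finally show "\<exists>y\<in>D. dist y t < e" using N(3) unfolding D_def by blast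
  qed
  have "mdist X (gridfun (t / T)) (gridfun (t' / T)) \<le> w \<bar>t - t'\<bar>" if t: "t \<in> D" "t' \<in> D" for t t'
  proof -
    obtain N j N' j' where N: "t = T * (real N / mesh n j)" "t' = T * (real N' / mesh n j')"
      "N \<le> mesh n j" "N' \<le> mesh n j'" using t by (auto simp: D_def)
    then have u: "t / T = real N / mesh n j" "t' / T = real N' / mesh n j'" using T by auto
    have r: "0 \<le> t" "t \<le> T" "0 \<le> t'" "t' \<le> T"
      using Dsub t by auto
    show ?thesis
    proof (rule w)
      fix k assume "\<bar>t - t'\<bar> \<le> T / mesh n k"
      moreover have "\<bar>t / T - t' / T\<bar> = \<bar>t - t'\<bar> / T"
        using T by (simp add: diff_divide_distrib[symmetric])
      ultimately have "\<bar>t / T - t' / T\<bar> \<le> 1 / mesh n k"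
        using T by (simp add: field_simps)
      then show "mdist X (gridfun (t / T)) (gridfun (t' / T)) \<le> 5 / 2 ^ (n + k)"
        by (rule gridfun_modulus[OF u])
    qed (use r in auto)
  qed
  moreover have "gridfun (t / T) \<in> mspace X" if tD: "t \<in> D" for t
  proof -
    obtain N j where "t = T * (real N / mesh n j)" using tD by (auto simp: D_def)
    then have "t / T = real N / mesh n j" using T by simp
    then show ?thesis using gridfun grid_mem_dist by metis
  qed
  moreover have "0 \<in> D" unfolding D_def by (intro CollectI exI[of _ 0]) simp
  moreover have "T \<in> D" unfolding D_def by (intro CollectI exI[of _ 1] exI[of _ 0]) simp
  moreover have "{0..T} \<subseteq> closure D" using dense by blast
  ultimately show thesis
    using that[of D] T Dsub unfolding is_trace_def by (auto simp: image_subset_iff)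
qed

end

end

text \<open>Repeated subdivision turns \<open>x\<close>, \<open>y\<close> into a trace. Points at distance \<open>T\<close> with \<open>\<delta> (n + 1) \<le> T < \<delta>
  n\<close> are subdivided from stage \<open>n\<close> on, so that the total duration \<open>T\<close> is not too short for the
  first steps; this makes the moduli of all these traces comparable, and they have one concave
  majorant.\<close>

theorem uniformly_locally_chain_equi_connected_imp_trace_connected:
  assumes "uniformly_locally_chain_equi_connected X"
  obtains w e where "trace_connected X w e"
proof -
  define P where "P n d \<longleftrightarrow> (\<forall>\<eta>>0. \<exists>l. \<forall>x\<in>mspace X. \<forall>y\<in>mspace X. mdist X x y < d \<longrightarrow>
      (\<exists>k\<le>l. \<exists>c. chain_linking X \<eta> k x y c \<and> chain_diam X k c < 1 / 2 ^ n))" for n :: nat and d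
  have "\<exists>d>0. P n d" for n
    using assms unfolding uniformly_locally_chain_equi_connected_def P_def by simp
  then obtain d where d: "\<And>n. 0 < d n" "\<And>n. P n (d n)" by metis
  have Panti: "P n b" if "P n a" "b \<le> a" for n a b
    using that unfolding P_def by (meson order.strict_trans2)
  define \<delta> where "\<delta> n = Min (insert (1 / Suc n) (d ` {..n}))" for n
  have \<delta>pos: "0 < \<delta> n" for n
    unfolding \<delta>_def using d(1) by (subst Min_gr_iff) auto
  have \<delta>P: "P n (\<delta> n)" for n
    by (rule Panti[OF d(2)[of n]]) (auto simp: \<delta>_def simp del: Min_insert intro!: Min_le)
  have \<delta>small: "\<delta> n \<le> 1 / Suc n" for n
    unfolding \<delta>_def by (intro Min_le) auto
  have \<delta>dec: "\<delta> n \<le> \<delta> m" if "m \<le> n" for m n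
  proof -
    have "\<delta> n \<le> a" if "a \<in> insert (1 / Suc m) (d ` {..m})" for a
    proof (cases "a = 1 / Suc m")
      case True
      have "1 / real (Suc n) \<le> 1 / real (Suc m)" using \<open>m \<le> n\<close> by (intro divide_left_mono) auto
      then show ?thesis using \<delta>small[of n] True by simp
    next
      case False
      then show ?thesis using that \<open>m \<le> n\<close> unfolding \<delta>_def by (intro Min_le) auto
    qed
    then show ?thesis unfolding \<delta>_def[of m] by (subst Min_ge_iff) auto
  qed
  \<comment> \<open>a number of steps that is at least 2 makes the mesh widths tend to 0\<close>
  have "\<exists>l\<ge>2. \<forall>x\<in>mspace X. \<forall>y\<in>mspace X. mdist X x y < \<delta> n \<longrightarrow>
      (\<exists>c. c 0 = x \<and> c l = y \<and> (\<forall>i. c i \<in> mspace X) \<and> (\<forall>i. mdist X (c i) (c (Suc i)) < \<delta> (Suc n)) \<and>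
        (\<forall>i j. mdist X (c i) (c j) < 1 / 2 ^ n))" for n
  proof -
    obtain l where l: "\<forall>x\<in>mspace X. \<forall>y\<in>mspace X. mdist X x y < \<delta> n \<longrightarrow>
        (\<exists>k\<le>l. \<exists>c. chain_linking X (\<delta> (Suc n)) k x y c \<and> chain_diam X k c < 1 / 2 ^ n)"
      using \<delta>P[of n] \<delta>pos unfolding P_def by blast
    have "\<exists>c. c 0 = x \<and> c (l + 2) = y \<and> (\<forall>i. c i \<in> mspace X) \<and> (\<forall>i. mdist X (c i) (c (Suc i)) < \<delta> (Suc n)) \<and>
        (\<forall>i j. mdist X (c i) (c j) < 1 / 2 ^ n)"
      if xy: "x \<in> mspace X" "y \<in> mspace X" "mdist X x y < \<delta> n" for x y
    proof -
      obtain k c where "k \<le> l" "chain_linking X (\<delta> (Suc n)) k x y c" "chain_diam X k c < 1 / 2 ^ n"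
        using l xy by blast
      then show ?thesis by (intro chain_padded[of X _ k x y c]) (auto simp: \<delta>pos)
    qed
    then show ?thesis by (intro exI[of _ "l + 2"]) auto
  qed
  then obtain l where l: "\<And>n. l n \<ge> 2" and
    "\<And>n. \<forall>x\<in>mspace X. \<forall>y\<in>mspace X. mdist X x y < \<delta> n \<longrightarrow>
      (\<exists>c. c 0 = x \<and> c (l n) = y \<and> (\<forall>i. c i \<in> mspace X) \<and> (\<forall>i. mdist X (c i) (c (Suc i)) < \<delta> (Suc n)) \<and>
        (\<forall>i j. mdist X (c i) (c j) < 1 / 2 ^ n))" by metis
  then have ex: "\<exists>c. x \<in> mspace X \<and> y \<in> mspace X \<and> mdist X x y < \<delta> n \<longrightarrow>
      (c 0 = x \<and> c (l n) = y \<and> (\<forall>i. c i \<in> mspace X) \<and> (\<forall>i. mdist X (c i) (c (Suc i)) < \<delta> (Suc n)) \<and>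
        (\<forall>i j. mdist X (c i) (c j) < 1 / 2 ^ n))" for n x y by blast
  define S where "S n x y = (SOME c. x \<in> mspace X \<and> y \<in> mspace X \<and> mdist X x y < \<delta> n \<longrightarrow>
      (c 0 = x \<and> c (l n) = y \<and> (\<forall>i. c i \<in> mspace X) \<and> (\<forall>i. mdist X (c i) (c (Suc i)) < \<delta> (Suc n)) \<and>
        (\<forall>i j. mdist X (c i) (c j) < 1 / 2 ^ n)))" for n x y
  interpret subdivision X \<delta> l S
  proof
    show "2 \<le> l n" for n by (rule l)
    show "S n x y 0 = x \<and> S n x y (l n) = y \<and> (\<forall>i. S n x y i \<in> mspace X) \<and>
      (\<forall>i. mdist X (S n x y i) (S n x y (Suc i)) < \<delta> (Suc n)) \<and>
      (\<forall>i j. mdist X (S n x y i) (S n x y j) < 1 / 2 ^ n)"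
      if "x \<in> mspace X" "y \<in> mspace X" "mdist X x y < \<delta> n" for n x y
      using someI_ex[OF ex[of x y n]] that unfolding S_def by blast
  qed
  \<comment> \<open>for every admissible \<open>n\<close> and \<open>k > n\<close>, a time interval of length \<open>q k\<close> is at most one mesh width
    of stage \<open>k - n\<close>, since \<open>\<delta> k \<le> \<delta> (n + 1) \<le> T\<close>\<close>
  define q where "q k = \<delta> k / mesh 0 k" for k
  have lim: "(\<lambda>k. 5 / 2 ^ k :: real) \<longlonglongrightarrow> 0"
    using tendsto_mult_right_zero[OF LIMSEQ_power_zero[of "1 / 2 :: real"], of 5]
    by (simp add: power_divide)
  obtain w where w: "gauge_fun w"
    "\<And>s r. 0 \<le> s \<Longrightarrow> r \<le> 5 \<Longrightarrow> (\<And>k. s \<le> q k \<Longrightarrow> r \<le> 5 / 2 ^ k) \<Longrightarrow> r \<le> w s"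
    by (rule concave_majorant[of q "\<lambda>k. 5 / 2 ^ k" 5, OF _ _ lim]) (auto simp: q_def \<delta>pos)
  have "\<exists>D f. is_trace X w (mdist X x y) D f \<and> f 0 = x \<and> f (mdist X x y) = y"
    if xy: "x \<in> mspace X" "y \<in> mspace X" "mdist X x y < \<delta> 0" for x y
  proof (cases "x = y")
    case True
    then have "is_trace X w (mdist X x y) {0} (\<lambda>_. x)" using xy w(1) by (simp add: is_trace_def)
    then show ?thesis using True xy by auto
  next
    case False
    define T where "T = mdist X x y"
    have T: "0 < T" using False xy by (simp add: T_def mdist_gt_0)
    obtain m where m: "1 / Suc m < T" using T nat_approx_posE by blast
    define n' where "n' = (LEAST m. \<delta> m \<le> T)"
    have n': "\<delta> n' \<le> T" "\<And>m. m < n' \<Longrightarrow> T < \<delta> m"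
    proof -
      have "\<delta> m \<le> T" using \<delta>small[of m] m by linarith
      then show "\<delta> n' \<le> T" unfolding n'_def by (rule LeastI)
      show "T < \<delta> m" if "m < n'" for m using not_less_Least[of m "\<lambda>m. \<delta> m \<le> T"] that unfolding n'_def by simp
    qed
    have "n' \<noteq> 0"
    proof
      assume "n' = 0"
      then show False using n'(1) xy(3) by (simp add: T_def)
    qed
    then obtain n where n: "n' = Suc n" using not0_implies_Suc by blast
    have Tn: "\<delta> (Suc n) \<le> T" "T < \<delta> n" using n' n by auto
    have mesh_le: "mesh n k \<le> mesh 0 (n + k)" for k
      using mesh_add[of 0 n k] mesh_pos[of 0 n] by (simp add: Suc_leI)
    obtain D where D: "is_trace X w T D (\<lambda>t. gridfun n x y (t / T))"
    proof (rule gridfun_trace[OF xy(1,2) _ \<delta>pos T, of n w])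
      show "mdist X x y < \<delta> n" using Tn by (simp add: T_def)
      fix s r :: real assume s: "0 \<le> s" "s \<le> T" and r: "\<And>k. s \<le> T / mesh n k \<Longrightarrow> r \<le> 5 / 2 ^ (n + k)"
      have rn: "r \<le> 5 / 2 ^ n" using r[of 0] s by simp
      show "r \<le> w s"
      proof (rule w(2)[OF s(1)])
        show "r \<le> 5" using rn by (rule order_trans) (simp add: field_simps)
        fix k assume k: "s \<le> q k"
        show "r \<le> 5 / 2 ^ k"
        proof (cases "k \<le> n")
          case True
          then have "5 / 2 ^ n \<le> (5::real) / 2 ^ k" by (intro divide_left_mono power_increasing) auto
          then show ?thesis using rn by linarith
        next
          case False
          then have kn: "k = n + (k - n)" "\<delta> k \<le> T" using \<delta>dec[of "Suc n" k] Tn by auto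
          have "q k \<le> T / mesh n (k - n)"
            unfolding q_def
          proof (rule frac_le)
            show "real (mesh n (k - n)) \<le> real (mesh 0 k)" using mesh_le[of "k - n"] kn(1) by simp
          qed (use kn T in auto)
          then show ?thesis using r[of "k - n"] k kn(1) by simp
        qed
      qed
    qed blast
    then show ?thesis
      using gridfun_ends[OF xy(1,2) _ \<delta>pos, of n] Tn T
      by (intro exI[of _ D] exI[of _ "\<lambda>t. gridfun n x y (t / T)"]) (auto simp: T_def)
  qed
  then have "trace_connected X w (\<delta> 0)"
    using w(1) \<delta>pos by (simp add: trace_connected_def)
  then show thesis by (rule that)
qed

section \<open>Traces with prescribed domains and paths\<close>

text \<open>One step of the construction of an increasing map \<open>f\<close> from \<open>Q\<close> to \<open>D\<close> with slopes below 2: only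
  the neighbours \<open>q a < p < q b\<close> of the new argument matter. The constraints are strict, so the
  admissible values form an open interval, which meets the dense set \<open>D\<close>.\<close>

lemma monotone_pick:
  fixes f q :: "nat \<Rightarrow> real"
  assumes pair: "\<And>i j. i < k \<Longrightarrow> j < k \<Longrightarrow> q i < q j \<Longrightarrow> f i < f j \<and> f j - f i < 2 * (q j - q i)"
    and eq: "\<And>i j. i < k \<Longrightarrow> j < k \<Longrightarrow> q i = q j \<Longrightarrow> f i = f j"
    and D: "{0..T} \<subseteq> closure D" "\<And>i. i < k \<Longrightarrow> f i \<in> {0..T}"
    and lo: "l0 < k" "q l0 < p" and up: "u0 < k" "p < q u0" and new: "\<And>i. i < k \<Longrightarrow> q i \<noteq> p"
  obtains z where "z \<in> D"
    "\<And>j. j < k \<Longrightarrow> q j < p \<Longrightarrow> f j < z \<and> z - f j < 2 * (p - q j)"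
    "\<And>j. j < k \<Longrightarrow> p < q j \<Longrightarrow> z < f j \<and> f j - z < 2 * (q j - p)"
proof -
  define A B where "A = {j. j < k \<and> q j < p}" and "B = {j. j < k \<and> p < q j}"
  have fin: "finite (q ` A)" "finite (q ` B)" "q ` A \<noteq> {}" "q ` B \<noteq> {}"
    using lo up by (auto simp: A_def B_def)
  obtain a where a: "a \<in> A" "q a = Max (q ` A)" using Max_in[OF fin(1,3)] by auto
  obtain b where b: "b \<in> B" "q b = Min (q ` B)" using Min_in[OF fin(2,4)] by auto
  have amax: "q j \<le> q a" if "j \<in> A" for j using a(2) fin(1) that by simp
  have bmin: "q b \<le> q j" if "j \<in> B" for j using b(2) fin(2) that by simp
  have ab: "a < k" "b < k" "q a < p" "p < q b" using a b by (auto simp: A_def B_def)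
  then have fab: "f a < f b" "f b - f a < 2 * (q b - q a)" using pair[of a b] by auto
  obtain z where z: "z \<in> D" "max (f a) (f b - 2 * (q b - p)) < z" "z < min (f b) (f a + 2 * (p - q a))"
  proof (rule dense_pick[OF D(1)])
    show "0 \<le> max (f a) (f b - 2 * (q b - p))" using D(2)[OF ab(1)] by auto
    show "max (f a) (f b - 2 * (q b - p)) < min (f b) (f a + 2 * (p - q a))" using fab ab by auto
    show "min (f b) (f a + 2 * (p - q a)) \<le> T" using D(2)[OF ab(2)] by auto
  qed
  show thesis
  proof (rule that[OF z(1)])
    fix j assume j: "j < k" "q j < p"
    then have "j \<in> A" by (simp add: A_def)
    show "f j < z \<and> z - f j < 2 * (p - q j)"
    proof (cases "q j = q a")
      case True
      have "f j = f a" using eq[OF j(1) ab(1) True] .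
      then show ?thesis using z True by auto
    next
      case False
      then have "q j < q a" using amax[OF \<open>j \<in> A\<close>] by simp
      then have "f j < f a \<and> f a - f j < 2 * (q a - q j)" using pair j ab by blast
      then show ?thesis using z(2,3) by auto
    qed
  next
    fix j assume j: "j < k" "p < q j"
    then have "j \<in> B" by (simp add: B_def)
    show "z < f j \<and> f j - z < 2 * (q j - p)"
    proof (cases "q j = q b")
      case True
      have "f j = f b" using eq[OF j(1) ab(2) True] .
      then show ?thesis using z True by auto
    next
      case False
      then have "q b < q j" using bmin[OF \<open>j \<in> B\<close>] by simp
      then have "f b < f j \<and> f j - f b < 2 * (q j - q b)" using pair j ab by blast
      then show ?thesis using z(2,3) by auto
    qed
  qed
qed

lemma modulus_of_le:
  assumes "\<And>u v. u \<in> Q \<Longrightarrow> v \<in> Q \<Longrightarrow> \<bar>u - v\<bar> \<le> t \<Longrightarrow> mdist X (f u) (f v) \<le> r"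
  shows "modulus_of (submetric euclidean_metric Q) X f t \<le> ennreal r"
  unfolding modulus_of_def using assms
  by (intro SUP_least) (auto simp: dist_real_def intro!: ennreal_leI)

lemma modulus_ofD:
  assumes "modulus_of (submetric euclidean_metric Q) X f t \<le> ennreal r" "0 \<le> r"
    "u \<in> Q" "v \<in> Q" "\<bar>u - v\<bar> \<le> t"
  shows "mdist X (f u) (f v) \<le> r"
proof -
  have "ennreal (mdist X (f u) (f v)) \<le> modulus_of (submetric euclidean_metric Q) X f t"
    unfolding modulus_of_def using assms by (intro SUP_upper2[of "(u, v)"]) (auto simp: dist_real_def)
  then show ?thesis using assms(1,2) by (metis ennreal_le_iff order_trans)
qed

lemma gauge_fun_imp_continuity_modulus:
  assumes "gauge_fun w" "0 < c"
  shows "continuity_modulus (\<lambda>t. w (c * t))"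
proof -
  have "((\<lambda>t. w (c * t)) \<longlongrightarrow> 0) (at_right 0)"
  proof (rule order_tendstoI)
    fix a :: real assume "a < 0"
    then show "\<forall>\<^sub>F t in at_right 0. a < w (c * t)"
      using gauge_fun_pos[OF assms(1)] assms(2)
      by (auto simp: eventually_at_right_field intro!: exI[of _ 1] intro: less_trans)
  next
    fix a :: real assume "0 < a"
    obtain d where d: "0 < d" "\<And>t. 0 \<le> t \<Longrightarrow> t \<le> d \<Longrightarrow> w t < a" using gauge_fun_small[OF assms(1) \<open>0 < a\<close>] by blast
    have "w (c * t) < a" if "0 < t" "t < d / c" for t
      using that d assms(2) by (intro d(2)) (auto simp: field_simps)
    then show "\<forall>\<^sub>F t in at_right 0. w (c * t) < a"
      unfolding eventually_at_right_field using d(1) assms(2) by (intro exI[of _ "d / c"]) auto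
  qed
  moreover have "mono_on {0<..} (\<lambda>t. w (c * t))"
  proof (rule mono_onI)
    fix r s :: real assume "r \<in> {0<..}" "r \<le> s"
    then show "w (c * r) \<le> w (c * s)"
      using assms(2) by (intro gauge_fun_mono[OF assms(1)]) (simp_all add: mult_left_mono)
  qed
  ultimately show ?thesis
    using gauge_fun_pos[OF assms(1)] assms(2) by (simp add: continuity_modulus_def)
qed

lemma gauge_fun_imp_uniformly_continuous_map:
  assumes "gauge_fun w" "f ` Q \<subseteq> mspace X"
    "\<And>u v. u \<in> Q \<Longrightarrow> v \<in> Q \<Longrightarrow> mdist X (f u) (f v) \<le> w \<bar>u - v\<bar>"
  shows "uniformly_continuous_map (submetric euclidean_metric Q) X f"
  unfolding uniformly_continuous_map_def
proof (intro conjI allI impI)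
  fix e :: real assume "0 < e"
  then obtain d where d: "0 < d" "\<And>t. 0 \<le> t \<Longrightarrow> t \<le> d \<Longrightarrow> w t < e" using gauge_fun_small[OF assms(1)] by blast
  have "mdist X (f y) (f x) < e" if "x \<in> Q" "y \<in> Q" "dist y x < d" for x y
    using assms(3)[OF that(2,1)] d(2)[of "\<bar>y - x\<bar>"] that(3) by (simp add: dist_real_def)
  then show "\<exists>\<delta>>0. \<forall>x\<in>mspace (submetric euclidean_metric Q). \<forall>y\<in>mspace (submetric euclidean_metric Q).
      mdist (submetric euclidean_metric Q) y x < \<delta> \<longrightarrow> mdist X (f y) (f x) < e"
    using d(1) by auto
qed (use assms(2) in auto)

lemma rational_points_dense:
  fixes T :: real
  assumes "0 \<le> T"
  shows "{0..T} \<subseteq> closure ({0, T} \<union> ({0..T} \<inter> \<rat>))"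
proof
  fix x assume x: "x \<in> {0..T}"
  show "x \<in> closure ({0, T} \<union> ({0..T} \<inter> \<rat>))"
  proof (cases "x = 0")
    case True
    then have "x \<in> {0, T} \<union> ({0..T} \<inter> \<rat>)" by simp
    then show ?thesis by (rule subsetD[OF closure_subset])
  next
    case False
    show ?thesis
      unfolding closure_approachable
    proof (intro allI impI)
      fix e :: real assume "0 < e"
      then have "max 0 (x - e) < x" using x False by auto
      then obtain r where "r \<in> \<rat>" "max 0 (x - e) < r" "r < x" using Rats_dense_in_real by blast
      then show "\<exists>y\<in>{0, T} \<union> ({0..T} \<inter> \<rat>). dist y x < e"
        using x by (intro bexI[of _ r]) (auto simp: dist_real_def)
    qed
  qed
qed

text \<open>An arbitrary modulus has a concave majorant on bounded arguments, by \<open>concave_majorant\<close> applied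
  to scales at which the modulus is small.\<close>

lemma continuity_modulus_imp_trace_connected:
  assumes \<omega>: "continuity_modulus \<omega>" and \<epsilon>: "0 < \<epsilon>"
    and conn: "\<And>x y. x \<in> mspace X \<Longrightarrow> y \<in> mspace X \<Longrightarrow> mdist X x y < \<epsilon> \<Longrightarrow>
      \<exists>D f. D \<subseteq> {0..mdist X x y} \<and> {0..mdist X x y} \<subseteq> closure D \<and> 0 \<in> D \<and> mdist X x y \<in> D \<and>
        f ` D \<subseteq> mspace X \<and> f 0 = x \<and> f (mdist X x y) = y \<and>
        (\<forall>t>0. modulus_of (submetric euclidean_metric D) X f t \<le> ennreal (\<omega> t))"
  obtains w where "trace_connected X w \<epsilon>"
proof -
  have \<omega>pos: "0 < \<omega> t" if "0 < t" for t using \<omega> that by (simp add: continuity_modulus_def)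
  have \<omega>mono: "\<omega> s \<le> \<omega> t" if "0 < s" "s \<le> t" for s t
    using \<omega> that by (auto simp: continuity_modulus_def mono_on_def)
  have "\<exists>q>0. \<omega> q < 1 / Suc k" for k
  proof -
    have "\<forall>\<^sub>F t in at_right 0. \<omega> t < 1 / Suc k"
      using \<omega> order_tendstoD(2)[of \<omega> 0 "at_right 0" "1 / Suc k"] by (simp add: continuity_modulus_def)
    then obtain b where "0 < b" "\<And>t. 0 < t \<Longrightarrow> t < b \<Longrightarrow> \<omega> t < 1 / Suc k"
      unfolding eventually_at_right_field by auto
    then show ?thesis by (intro exI[of _ "b / 2"]) auto
  qed
  then obtain q where q: "\<And>k. 0 < q k" "\<And>k. \<omega> (q k) < 1 / Suc k" by metis
  have lim: "(\<lambda>k. \<omega> (q k)) \<longlonglongrightarrow> 0"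
  proof (rule tendsto_sandwich[of "\<lambda>_. 0"])
    show "(\<lambda>k. 1 / real (Suc k)) \<longlonglongrightarrow> 0" using LIMSEQ_inverse_real_of_nat by (simp add: inverse_eq_divide)
    show "\<forall>\<^sub>F k in sequentially. 0 \<le> \<omega> (q k)" using \<omega>pos[OF q(1)] by (simp add: less_imp_le)
    show "\<forall>\<^sub>F k in sequentially. \<omega> (q k) \<le> 1 / real (Suc k)" using q(2) by (simp add: less_imp_le)
  qed simp
  obtain w where w: "gauge_fun w"
    "\<And>s r. 0 \<le> s \<Longrightarrow> r \<le> \<omega> \<epsilon> \<Longrightarrow> (\<And>k. s \<le> q k \<Longrightarrow> r \<le> \<omega> (q k)) \<Longrightarrow> r \<le> w s"
    by (rule concave_majorant[of q "\<lambda>k. \<omega> (q k)" "\<omega> \<epsilon>", OF q(1) _ lim])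
      (use \<omega>pos[OF q(1)] \<omega>pos[OF \<epsilon>] in \<open>auto simp: less_imp_le\<close>)
  have "\<exists>D f. is_trace X w (mdist X x y) D f \<and> f 0 = x \<and> f (mdist X x y) = y"
    if xy: "x \<in> mspace X" "y \<in> mspace X" "mdist X x y < \<epsilon>" for x y
  proof -
    obtain D f where D: "D \<subseteq> {0..mdist X x y}" "{0..mdist X x y} \<subseteq> closure D" "0 \<in> D" "mdist X x y \<in> D"
      "f ` D \<subseteq> mspace X" and f: "f 0 = x" "f (mdist X x y) = y"
      "\<And>t. 0 < t \<Longrightarrow> modulus_of (submetric euclidean_metric D) X f t \<le> ennreal (\<omega> t)"
      using conn[OF xy] by blast
    have "mdist X (f u) (f v) \<le> w \<bar>u - v\<bar>" if uv: "u \<in> D" "v \<in> D" for u v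
    proof (cases "u = v")
      case True
      then show ?thesis using uv D(5) w(1) by (simp add: image_subset_iff)
    next
      case False
      then have pos: "0 < \<bar>u - v\<bar>" by simp
      have le: "mdist X (f u) (f v) \<le> \<omega> \<bar>u - v\<bar>"
        using modulus_ofD[OF f(3)[OF pos] _ uv] \<omega>pos[OF pos] by simp
      show ?thesis
      proof (rule w(2))
        have "u \<in> {0..mdist X x y}" "v \<in> {0..mdist X x y}" using uv D(1) by blast+
        then have "\<bar>u - v\<bar> \<le> \<epsilon>" using xy(3) by auto
        then show "mdist X (f u) (f v) \<le> \<omega> \<epsilon>" using le \<omega>mono[OF pos] by (meson order_trans)
        show "mdist X (f u) (f v) \<le> \<omega> (q k)" if "\<bar>u - v\<bar> \<le> q k" for k
          using le \<omega>mono[OF pos that] by (rule order_trans)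
      qed simp
    qed
    then show ?thesis using D f by (intro exI[of _ D] exI[of _ f]) (auto simp: is_trace_def)
  qed
  then show thesis using that[of w] w(1) \<epsilon> by (simp add: trace_connected_def)
qed

lemma uniformly_locally_trace_equi_connected_imp_trace_connected:
  assumes "uniformly_locally_trace_equi_connected X"
  obtains w e where "trace_connected X w e"
proof -
  obtain \<epsilon> \<omega> where \<epsilon>: "0 < \<epsilon>" "continuity_modulus \<omega>" and
    f: "\<And>x y Q. x \<in> mspace X \<Longrightarrow> y \<in> mspace X \<Longrightarrow> mdist X x y < \<epsilon> \<Longrightarrow>
        countable Q \<and> Q \<subseteq> {0..mdist X x y} \<and> {0..mdist X x y} \<subseteq> closure Q \<and> {0, mdist X x y} \<subseteq> Q \<Longrightarrow>
          (\<exists>f. uniformly_continuous_map (submetric euclidean_metric Q) X f \<and>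
               f 0 = x \<and> f (mdist X x y) = y \<and>
               (\<forall>t>0. modulus_of (submetric euclidean_metric Q) X f t \<le> ennreal (\<omega> t)))"
    using assms unfolding uniformly_locally_trace_equi_connected_def by metis
  obtain w where "trace_connected X w \<epsilon>"
  proof (rule continuity_modulus_imp_trace_connected[OF \<epsilon>(2,1)])
    fix x y assume xy: "x \<in> mspace X" "y \<in> mspace X" "mdist X x y < \<epsilon>"
    let ?T = "mdist X x y"
    let ?Q = "{0, ?T} \<union> ({0..?T} \<inter> \<rat>)"
    have Q: "countable ?Q \<and> ?Q \<subseteq> {0..?T} \<and> {0..?T} \<subseteq> closure ?Q \<and> {0, ?T} \<subseteq> ?Q"
      using rational_points_dense[of ?T] by (auto simp: countable_rat)
    from f[OF xy Q] obtain g where g: "uniformly_continuous_map (submetric euclidean_metric ?Q) X g"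
      "g 0 = x" "g ?T = y" "\<forall>t>0. modulus_of (submetric euclidean_metric ?Q) X g t \<le> ennreal (\<omega> t)" by blast
    have "g ` ?Q \<subseteq> mspace X" using uniformly_continuous_map_funspace[OF g(1)] by auto
    then show "\<exists>D f. D \<subseteq> {0..?T} \<and> {0..?T} \<subseteq> closure D \<and> 0 \<in> D \<and> ?T \<in> D \<and>
        f ` D \<subseteq> mspace X \<and> f 0 = x \<and> f ?T = y \<and>
        (\<forall>t>0. modulus_of (submetric euclidean_metric D) X f t \<le> ennreal (\<omega> t))"
      using Q g by (intro exI[of _ ?Q] exI[of _ g]) auto
  qed
  then show thesis by (rule that)
qed

lemma uniformly_locally_path_equi_connected_imp_trace_connected:
  assumes "uniformly_locally_path_equi_connected X"
  obtains w e where "trace_connected X w e"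
proof -
  obtain \<epsilon> \<omega> where \<epsilon>: "0 < \<epsilon>" "continuity_modulus \<omega>" and
    f: "\<And>x y. x \<in> mspace X \<Longrightarrow> y \<in> mspace X \<Longrightarrow> mdist X x y < \<epsilon> \<Longrightarrow>
        (\<exists>f. continuous_map (subtopology euclideanreal {0..mdist X x y}) (mtopology_of X) f \<and>
             f 0 = x \<and> f (mdist X x y) = y \<and>
             (\<forall>t>0. modulus_of (submetric euclidean_metric {0..mdist X x y}) X f t \<le> ennreal (\<omega> t)))"
    using assms unfolding uniformly_locally_path_equi_connected_def by blast
  obtain w where "trace_connected X w \<epsilon>"
  proof (rule continuity_modulus_imp_trace_connected[OF \<epsilon>(2,1)])
    fix x y assume xy: "x \<in> mspace X" "y \<in> mspace X" "mdist X x y < \<epsilon>"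
    let ?T = "mdist X x y"
    from f[OF xy] obtain g where g: "continuous_map (subtopology euclideanreal {0..?T}) (mtopology_of X) g"
      "g 0 = x" "g ?T = y" "\<forall>t>0. modulus_of (submetric euclidean_metric {0..?T}) X g t \<le> ennreal (\<omega> t)" by blast
    have "g ` {0..?T} \<subseteq> mspace X" using continuous_map_image_subset_topspace[OF g(1)] by simp
    then show "\<exists>D f. D \<subseteq> {0..?T} \<and> {0..?T} \<subseteq> closure D \<and> 0 \<in> D \<and> ?T \<in> D \<and>
        f ` D \<subseteq> mspace X \<and> f 0 = x \<and> f ?T = y \<and>
        (\<forall>t>0. modulus_of (submetric euclidean_metric D) X f t \<le> ennreal (\<omega> t))"
      using g by (intro exI[of _ "{0..?T}"] exI[of _ g]) auto
  qed
  then show thesis by (rule that)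
qed

text \<open>Arbitrary countable and dense sets of times can be exchanged for one another at the cost of a
  factor 2: the points of \<open>Q\<close> are enumerated, the two ends first, and mapped into \<open>D\<close> one after
  the other.\<close>

lemma Lipschitz_selection_into_dense:
  fixes Q D :: "real set"
  assumes Q: "countable Q" "Q \<subseteq> {0..T}" "0 \<in> Q" "T \<in> Q" and T: "0 < T"
    and D: "{0..T} \<subseteq> closure D" "D \<subseteq> {0..T}" "0 \<in> D" "T \<in> D"
  obtains \<theta> where "\<theta> 0 = 0" "\<theta> T = T" "\<And>p. p \<in> Q \<Longrightarrow> \<theta> p \<in> D"
    "\<And>p p'. p \<in> Q \<Longrightarrow> p' \<in> Q \<Longrightarrow> \<bar>\<theta> p - \<theta> p'\<bar> \<le> 2 * \<bar>p - p'\<bar>"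
proof -
  define q where "q n = (if n = 0 then 0 else if n = 1 then T else from_nat_into Q (n - 2))" for n
  have q0: "q 0 = 0" "q 1 = T" by (auto simp: q_def)
  have qQ: "q n \<in> Q" for n
    using Q(3,4) from_nat_into[of Q "n - 2"] by (auto simp: q_def)
  have qsurj: "\<exists>n. q n = p" if "p \<in> Q" for p
  proof -
    obtain n where "from_nat_into Q n = p" using from_nat_into_surj[OF Q(1) \<open>p \<in> Q\<close>] by blast
    then show ?thesis by (intro exI[of _ "n + 2"]) (simp add: q_def)
  qed
  define ok where "ok f k r \<longleftrightarrow> (k = 0 \<longrightarrow> r = 0) \<and> (k = 1 \<longrightarrow> r = T) \<and> r \<in> D \<and> (\<forall>j<k.
      (q j < q k \<longrightarrow> f j < r \<and> r - f j < 2 * (q k - q j)) \<and>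
      (q k < q j \<longrightarrow> r < f j \<and> f j - r < 2 * (q j - q k)) \<and> (q j = q k \<longrightarrow> r = f j))" for f k r
  have "\<exists>f. \<forall>k. ok f k (f k)"
  proof (rule dependent_wellorder_choice)
    fix k :: nat and f :: "nat \<Rightarrow> real"
    assume IH: "\<And>y. y < k \<Longrightarrow> ok f y (f y)"
    have pair: "f i < f j \<and> f j - f i < 2 * (q j - q i)" if "i < k" "j < k" "q i < q j" for i j
    proof (cases i j rule: linorder_cases)
      case less
      then show ?thesis using IH[OF that(2)] that(3) unfolding ok_def by blast
    next
      case equal
      then show ?thesis using that by simp
    next
      case greater
      then show ?thesis using IH[OF that(1)] that(3) unfolding ok_def by blast
    qed
    have eq: "f i = f j" if "i < k" "j < k" "q i = q j" for i j
    proof (cases i j rule: linorder_cases)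
      case less
      then have "f j = f i" using IH[OF that(2)] that(3) unfolding ok_def by blast
      then show ?thesis by simp
    next
      case equal
      then show ?thesis by simp
    next
      case greater
      then show ?thesis using IH[OF that(1)] that(3) unfolding ok_def by auto
    qed
    have fD: "f i \<in> D" if "i < k" for i using IH[OF that] by (simp add: ok_def)
    show "\<exists>r. ok f k r"
    proof (cases "k \<le> 1")
      case True
      show ?thesis
      proof (cases "k = 0")
        case True
        then show ?thesis using D(3) by (intro exI[of _ 0]) (simp add: ok_def)
      next
        case False
        then have k: "k = 1" using \<open>k \<le> 1\<close> by simp
        have "f 0 = 0" using IH[of 0] k by (simp add: ok_def)
        then show ?thesis using k D(4) T q0 by (intro exI[of _ T]) (simp add: ok_def)
      qed
    next
      case k: False
      show ?thesis
      proof (cases "\<exists>i<k. q i = q k")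
        case True
        then obtain i where i: "i < k" "q i = q k" by blast
        have "ok f k (f i)"
          unfolding ok_def using k fD[OF i(1)] pair[OF i(1)] pair[OF _ i(1)] eq[OF i(1)] i(2) by auto
        then show ?thesis by blast
      next
        case False
        have p: "0 < q k" "q k < T"
        proof -
          have "q k \<noteq> 0" "q k \<noteq> T" using False k q0 by (metis not_le_imp_less zero_less_one order.strict_trans)+
          moreover have "q k \<in> {0..T}" using qQ Q(2) by blast
          ultimately show "0 < q k" "q k < T" by auto
        qed
        obtain z where z: "z \<in> D"
          "\<And>j. j < k \<Longrightarrow> q j < q k \<Longrightarrow> f j < z \<and> z - f j < 2 * (q k - q j)"
          "\<And>j. j < k \<Longrightarrow> q k < q j \<Longrightarrow> z < f j \<and> f j - z < 2 * (q j - q k)"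
        proof (rule monotone_pick[of k q f T D 0 "q k" 1])
          show "f i < f j \<and> f j - f i < 2 * (q j - q i)" if "i < k" "j < k" "q i < q j" for i j
            using pair[OF that] .
          show "f i = f j" if "i < k" "j < k" "q i = q j" for i j using eq[OF that] .
          show "{0..T} \<subseteq> closure D" by (rule D(1))
          show "f i \<in> {0..T}" if "i < k" for i using fD[OF that] D(2) by blast
          show "0 < k" "1 < k" using k by simp_all
          show "q 0 < q k" "q k < q 1" using p q0 by simp_all
          show "q i \<noteq> q k" if "i < k" for i using False that by blast
        qed (rule that; assumption)
        have "ok f k z" unfolding ok_def using z k False by auto
        then show ?thesis by blast
      qed
    qed
  next
    fix r :: real and f g :: "nat \<Rightarrow> real" and x :: nat
    assume "\<And>y. y < x \<Longrightarrow> f y = g y"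
    then show "ok f x r = ok g x r" unfolding ok_def by simp
  qed
  then obtain f where f: "\<And>k. ok f k (f k)" by blast
  have close: "\<bar>f i - f j\<bar> \<le> 2 * \<bar>q i - q j\<bar>" for i j
  proof (cases i j rule: linorder_cases)
    case less
    then show ?thesis using f[of j] unfolding ok_def by (cases "q i" "q j" rule: linorder_cases) auto
  next
    case greater
    then show ?thesis using f[of i] unfolding ok_def by (cases "q i" "q j" rule: linorder_cases) auto
  qed simp
  define n where "n p = (SOME n. q n = p)" for p
  have n: "q (n p) = p" if "p \<in> Q" for p
    unfolding n_def using qsurj[OF that] by (rule someI_ex)
  \<comment> \<open>the enumeration may repeat points; \<open>f\<close> depends only on the value \<open>q i\<close>\<close>
  have fn: "f i = f (n (q i))" for i
    using close[of i "n (q i)"] n[OF qQ] by simp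
  show thesis
  proof (rule that[of "\<lambda>p. f (n p)"])
    show "f (n 0) = 0" "f (n T) = T"
      using fn[of 0] fn[of 1] f[of 0] f[of 1] q0 by (auto simp: ok_def)
    show "f (n p) \<in> D" for p using f[of "n p"] by (simp add: ok_def)
    show "\<bar>f (n p) - f (n p')\<bar> \<le> 2 * \<bar>p - p'\<bar>" if "p \<in> Q" "p' \<in> Q" for p p'
      using close[of "n p" "n p'"] n that by simp
  qed
qed

theorem trace_connected_imp_uniformly_locally_trace_equi_connected:
  assumes tc: "trace_connected X w e"
  shows "uniformly_locally_trace_equi_connected X"
proof -
  have w: "gauge_fun w" and e: "0 < e" using tc by (auto simp: trace_connected_def)
  have w2: "gauge_fun (\<lambda>t. 2 * w t)" using gauge_fun_cmult[OF w, of 2] by simp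
  have "\<exists>f. uniformly_continuous_map (submetric euclidean_metric Q) X f \<and>
               f 0 = x \<and> f (mdist X x y) = y \<and>
               (\<forall>t>0. modulus_of (submetric euclidean_metric Q) X f t \<le> ennreal (w (2 * t)))"
    if xy: "x \<in> mspace X" "y \<in> mspace X" "mdist X x y < e"
      and Q: "countable Q \<and> Q \<subseteq> {0..mdist X x y} \<and> {0..mdist X x y} \<subseteq> closure Q \<and> {0, mdist X x y} \<subseteq> Q"
    for x y Q
  proof -
    let ?T = "mdist X x y"
    obtain D g where g: "is_trace X w ?T D g" "g 0 = x" "g ?T = y"
      using tc xy unfolding trace_connected_def by blast
    have "\<exists>\<theta>. \<theta> 0 = 0 \<and> \<theta> ?T = ?T \<and> (\<forall>p\<in>Q. \<theta> p \<in> D) \<and> (\<forall>p\<in>Q. \<forall>p'\<in>Q. \<bar>\<theta> p - \<theta> p'\<bar> \<le> 2 * \<bar>p - p'\<bar>)"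
    proof (cases "?T = 0")
      case True
      then have "Q \<subseteq> {0}" using Q by auto
      then show ?thesis using True g(1) by (intro exI[of _ "\<lambda>_. 0"]) (auto simp: is_trace_def)
    next
      case False
      then have T: "0 < ?T" using mdist_nonneg[of X x y] by linarith
      show ?thesis
        by (rule Lipschitz_selection_into_dense[of Q ?T D])
          (use Q T g(1) in \<open>auto simp: is_trace_def\<close>)
    qed
    then obtain \<theta> where \<theta>: "\<theta> 0 = 0" "\<theta> ?T = ?T" "\<And>p. p \<in> Q \<Longrightarrow> \<theta> p \<in> D"
      "\<And>p p'. p \<in> Q \<Longrightarrow> p' \<in> Q \<Longrightarrow> \<bar>\<theta> p - \<theta> p'\<bar> \<le> 2 * \<bar>p - p'\<bar>" by blast
    have mod: "mdist X (g (\<theta> u)) (g (\<theta> v)) \<le> w (2 * \<bar>u - v\<bar>)" if "u \<in> Q" "v \<in> Q" for u v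
    proof -
      have "mdist X (g (\<theta> u)) (g (\<theta> v)) \<le> w \<bar>\<theta> u - \<theta> v\<bar>"
        using g(1) \<theta>(3) that by (simp add: is_trace_def)
      also have "\<dots> \<le> w (2 * \<bar>u - v\<bar>)"
        using \<theta>(4)[OF that] by (intro gauge_fun_mono[OF w]) auto
      finally show ?thesis .
    qed
    have "uniformly_continuous_map (submetric euclidean_metric Q) X (\<lambda>u. g (\<theta> u))"
    proof (rule gauge_fun_imp_uniformly_continuous_map[OF w2])
      show "(\<lambda>u. g (\<theta> u)) ` Q \<subseteq> mspace X" using g(1) \<theta>(3) by (auto simp: is_trace_def)
      show "mdist X (g (\<theta> u)) (g (\<theta> v)) \<le> 2 * w \<bar>u - v\<bar>" if "u \<in> Q" "v \<in> Q" for u v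
        using mod[OF that] gauge_fun_subadditive[OF w, of "\<bar>u - v\<bar>" "\<bar>u - v\<bar>"] by simp
    qed
    moreover have "modulus_of (submetric euclidean_metric Q) X (\<lambda>u. g (\<theta> u)) t \<le> ennreal (w (2 * t))" for t
    proof (rule modulus_of_le)
      fix u v assume "u \<in> Q" "v \<in> Q" "\<bar>u - v\<bar> \<le> t"
      then show "mdist X (g (\<theta> u)) (g (\<theta> v)) \<le> w (2 * t)"
        using mod[of u v] gauge_fun_mono[OF w, of "2 * \<bar>u - v\<bar>" "2 * t"] by simp
    qed
    ultimately show ?thesis using \<theta>(1,2) g(2,3) by (intro exI[of _ "\<lambda>u. g (\<theta> u)"]) simp
  qed
  then show ?thesis
    unfolding uniformly_locally_trace_equi_connected_def
    using e gauge_fun_imp_continuity_modulus[OF w, of 2]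
    by (intro exI[of _ e] conjI exI[of _ "\<lambda>t. w (2 * t)"]) auto
qed

text \<open>A uniformly continuous map into a complete space extends to the closure of its domain, and the
  modulus is inherited because \<open>w\<close> is continuous.\<close>

lemma trace_connected_complete_path:
  assumes tc: "trace_connected X w e" and X: "mcomplete_of X"
    and xy: "x \<in> mspace X" "y \<in> mspace X" "mdist X x y < e"
  obtains g where "is_trace X w (mdist X x y) {0..mdist X x y} g" "g 0 = x" "g (mdist X x y) = y"
proof -
  have w: "gauge_fun w" and e: "0 < e" using tc by (auto simp: trace_connected_def)
  let ?T = "mdist X x y"
  obtain D f where f: "is_trace X w ?T D f" "f 0 = x" "f ?T = y"
    using tc xy unfolding trace_connected_def by blast
  have D: "D \<subseteq> {0..?T}" "{0..?T} \<subseteq> closure D" "0 \<in> D" "?T \<in> D" "f ` D \<subseteq> mspace X"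
    and fw: "\<And>u v. u \<in> D \<Longrightarrow> v \<in> D \<Longrightarrow> mdist X (f u) (f v) \<le> w \<bar>u - v\<bar>"
    using f(1) by (auto simp: is_trace_def)
  have cl: "mtopology_of euclidean_metric closure_of D = {0..?T}"
  proof -
    have "closure D \<subseteq> {0..?T}" using D(1) by (rule closure_minimal) simp
    then show ?thesis using D(2) by simp
  qed
  have "uniformly_continuous_map (submetric euclidean_metric D) X f"
    by (rule gauge_fun_imp_uniformly_continuous_map[OF w D(5) fw])
  then obtain g where "uniformly_continuous_map (submetric euclidean_metric
      (mtopology_of euclidean_metric closure_of D)) X g" and gf: "\<And>u. u \<in> D \<Longrightarrow> g u = f u"
    using uniformly_continuous_map_extends_to_closure_of[OF X] by metis
  then have g: "uniformly_continuous_map (submetric euclidean_metric {0..?T}) X g" by (simp only: cl)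
  have gX: "g u \<in> mspace X" if "u \<in> {0..?T}" for u
    using uniformly_continuous_map_funspace[OF g] that by auto
  have gw: "mdist X (g u) (g v) \<le> w \<bar>u - v\<bar>" if u: "u \<in> {0..?T}" and v: "v \<in> {0..?T}" for u v
  proof (rule field_le_epsilon)
    fix r :: real assume r: "0 < r"
    obtain d1 where d1: "0 < d1" "\<And>t. 0 \<le> t \<Longrightarrow> t \<le> d1 \<Longrightarrow> w t < r / 3"
      using gauge_fun_small[OF w, of "r / 3"] r by auto
    obtain d2 where d2: "0 < d2" "\<And>u v. u \<in> {0..?T} \<Longrightarrow> v \<in> {0..?T} \<Longrightarrow> dist v u < d2 \<Longrightarrow> mdist X (g v) (g u) < r / 3"
      using g r unfolding uniformly_continuous_map_def by (auto dest!: spec[of _ "r / 3"])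
    define d where "d = min (d1 / 2) d2"
    have d: "0 < d" "d \<le> d1 / 2" "d \<le> d2" using d1 d2 by (auto simp: d_def)
    obtain u' where u': "u' \<in> D" "dist u' u < d" using u D(2) d(1) closure_approachable by blast
    obtain v' where v': "v' \<in> D" "dist v' v < d" using v D(2) d(1) closure_approachable by blast
    have mem: "u' \<in> {0..?T}" "v' \<in> {0..?T}" using u' v' D(1) by auto
    have "mdist X (g u') (g v') \<le> w \<bar>u' - v'\<bar>" using fw gf u' v' by simp
    also have "\<dots> \<le> w (\<bar>u - v\<bar> + d1)"
      using u'(2) v'(2) d by (intro gauge_fun_mono[OF w]) (auto simp: dist_real_def)
    also have "\<dots> \<le> w \<bar>u - v\<bar> + w d1"
      using d1(1) by (intro gauge_fun_subadditive[OF w]) auto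
    also have "w d1 < r / 3" using d1 by simp
    finally have "mdist X (g u') (g v') < w \<bar>u - v\<bar> + r / 3" by simp
    moreover have "mdist X (g u') (g u) < r / 3" using d2(2)[OF u mem(1)] u'(2) d(3) by simp
    moreover have "mdist X (g v') (g v) < r / 3" using d2(2)[OF v mem(2)] v'(2) d(3) by simp
    moreover have "mdist X (g u) (g v) \<le> mdist X (g u') (g u) + mdist X (g u') (g v') + mdist X (g v') (g v)"
      using mdist_triangle[of "g u" X "g u'" "g v"] mdist_triangle[of "g u'" X "g v'" "g v"]
        gX[OF u] gX[OF v] gX[OF mem(1)] gX[OF mem(2)] by (simp add: mdist_commute)
    ultimately show "mdist X (g u) (g v) \<le> w \<bar>u - v\<bar> + r" by linarith
  qed
  have "is_trace X w ?T {0..?T} g"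
    unfolding is_trace_def using gX gw closure_subset[of "{0..?T}"] by (auto simp: image_subset_iff)
  then show thesis using that[of g] gf D(3,4) f(2,3) by simp
qed

theorem trace_connected_complete_imp_uniformly_locally_path_equi_connected:
  assumes tc: "trace_connected X w e" and X: "mcomplete_of X"
  shows "uniformly_locally_path_equi_connected X"
proof -
  have w: "gauge_fun w" and e: "0 < e" using tc by (auto simp: trace_connected_def)
  have "\<exists>f. continuous_map (subtopology euclideanreal {0..mdist X x y}) (mtopology_of X) f \<and>
             f 0 = x \<and> f (mdist X x y) = y \<and>
             (\<forall>t>0. modulus_of (submetric euclidean_metric {0..mdist X x y}) X f t \<le> ennreal (w (1 * t)))"
    if xy: "x \<in> mspace X" "y \<in> mspace X" "mdist X x y < e" for x y
  proof -
    let ?T = "mdist X x y"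
    obtain g where g: "is_trace X w ?T {0..?T} g" "g 0 = x" "g ?T = y"
      by (rule trace_connected_complete_path[OF tc X xy])
    have gX: "g ` {0..?T} \<subseteq> mspace X" and gw: "\<And>u v. u \<in> {0..?T} \<Longrightarrow> v \<in> {0..?T} \<Longrightarrow> mdist X (g u) (g v) \<le> w \<bar>u - v\<bar>"
      using g(1) unfolding is_trace_def by blast+
    have "uniformly_continuous_map (submetric euclidean_metric {0..?T}) X g"
      by (rule gauge_fun_imp_uniformly_continuous_map[OF w gX gw])
    from uniformly_continuous_imp_continuous_map[OF this]
    have "continuous_map (subtopology euclideanreal {0..?T}) (mtopology_of X) g"
      by (simp add: mtopology_of_submetric)
    moreover have "modulus_of (submetric euclidean_metric {0..?T}) X g t \<le> ennreal (w (1 * t))" for t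
    proof (rule modulus_of_le)
      fix u v assume "u \<in> {0..?T}" "v \<in> {0..?T}" "\<bar>u - v\<bar> \<le> t"
      then show "mdist X (g u) (g v) \<le> w (1 * t)"
        using gw[of u v] gauge_fun_mono[OF w, of "\<bar>u - v\<bar>" t] by simp
    qed
    ultimately show ?thesis using g(2,3) by (intro exI[of _ g]) simp
  qed
  then show ?thesis
    unfolding uniformly_locally_path_equi_connected_def
    using e gauge_fun_imp_continuity_modulus[OF w, of 1]
    by (intro exI[of _ e] conjI exI[of _ "\<lambda>t. w (1 * t)"]) auto
qed

section \<open>Convex metrics\<close>

text \<open>A chain of traces has spent the cost \<open>A\<close> when it enters a trace of duration \<open>\<tau>\<close>, after which the
  cost \<open>B\<close> remains. The trace is cut just before the time \<open>v\<close> at which the cost spent reaches \<open>W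
  s\<close>. By concavity the remaining cost \<open>B + W (\<tau> - v)\<close> is below \<open>W t\<close>, and by continuity of \<open>W\<close>
  this persists in an interval before \<open>v\<close>; such an interval contains times at which the trace is
  defined.\<close>

lemma gauge_fun_split:
  assumes W: "gauge_fun W" and st: "0 < s" "0 < t" and AB: "0 \<le> A" "0 \<le> B" and \<tau>: "0 \<le> \<tau>"
    and lo: "A < W s" and hi: "W s \<le> A + W \<tau>" and total: "A + W \<tau> + B < W (s + t)"
  obtains a b where "0 \<le> a" "a < b" "b \<le> \<tau>"
    "\<And>u. a < u \<Longrightarrow> u < b \<Longrightarrow> A + W u < W s \<and> B + W (\<tau> - u) < W t"
proof -
  define S where "S = {u \<in> {0..\<tau>}. W s - A \<le> W u}"
  have cont: "continuous_on {0..} W"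
    unfolding continuous_on_iff
  proof (intro ballI allI impI)
    fix x e :: real assume x: "x \<in> {0..}" and "0 < e"
    obtain d where d: "0 < d" "\<And>t. 0 \<le> t \<Longrightarrow> t \<le> d \<Longrightarrow> W t < e" using gauge_fun_small[OF W \<open>0 < e\<close>] by blast
    have "dist (W x') (W x) < e" if "x' \<in> {0..}" "dist x' x < d" for x'
      using gauge_fun_dist[OF W, of x' x] d(2)[of "\<bar>x' - x\<bar>"] that x by (simp add: dist_real_def)
    then show "\<exists>d>0. \<forall>x'\<in>{0..}. dist x' x < d \<longrightarrow> dist (W x') (W x) < e" using d(1) by blast
  qed
  have "compact S"
  proof -
    have "continuous_on {0..\<tau>} W" using cont by (rule continuous_on_subset) auto
    then have "closed ({0..\<tau>} \<inter> W -` {W s - A..})" by (intro continuous_closed_preimage) auto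
    moreover have "S = {0..\<tau>} \<inter> W -` {W s - A..}" by (auto simp: S_def)
    ultimately have "closed S" by simp
    moreover have "bounded S" by (rule bounded_subset[of "{0..\<tau>}"]) (auto simp: S_def)
    ultimately show ?thesis by (simp add: compact_eq_bounded_closed)
  qed
  moreover have "S \<noteq> {}" using hi \<tau> by (auto simp: S_def intro!: exI[of _ \<tau>])
  \<comment> \<open>the first time at which the cost reaches \<open>W s\<close>\<close>
  ultimately obtain v where v: "v \<in> S" "\<And>u. u \<in> S \<Longrightarrow> v \<le> u"
    using compact_attains_inf[of S] by blast
  have v1: "0 \<le> v" "v \<le> \<tau>" "W s - A \<le> W v" using v(1) by (auto simp: S_def)
  have below: "W u < W s - A" if "0 \<le> u" "u < v" for u
  proof (rule ccontr)
    assume "\<not> W u < W s - A"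
    then have "u \<in> S" using that v1 by (simp add: S_def)
    then show False using v(2) that(2) by fastforce
  qed
  have "v \<noteq> 0" using v1(3) lo W by auto
  then have "0 < v" using v1 by simp
  have "W v \<le> W s - A"
  proof (rule field_le_epsilon)
    fix e :: real assume "0 < e"
    obtain d where d: "0 < d" "\<And>t. 0 \<le> t \<Longrightarrow> t \<le> d \<Longrightarrow> W t < e" using gauge_fun_small[OF W \<open>0 < e\<close>] by blast
    define u where "u = max 0 (v - d)"
    have u: "0 \<le> u" "u < v" "v - u \<le> d" using d(1) \<open>0 < v\<close> by (auto simp: u_def)
    then have "W v \<le> W u + W (v - u)" using gauge_fun_subadditive[OF W, of u "v - u"] by simp
    then show "W v \<le> W s - A + e" using below[OF u(1,2)] d(2)[of "v - u"] u by simp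
  qed
  with v1 have Wv: "A = W s - W v" by simp
  have vs: "v \<le> s"
  proof (cases "s \<le> \<tau>")
    case True
    then show ?thesis using v(2)[of s] st AB by (simp add: S_def)
  qed (use v1 in simp)
  have "\<tau> - v \<le> t"
  proof (rule ccontr)
    assume "\<not> \<tau> - v \<le> t"
    then have "W (v + t) \<le> W \<tau>" using v1 st by (intro gauge_fun_mono[OF W]) auto
    moreover have "W (s + t) - W s \<le> W (v + t) - W v"
      using v1 vs st by (intro gauge_fun_increment[OF W]) auto
    ultimately show False using total AB Wv by simp
  qed
  have "W (s + (\<tau> - v)) - W s \<le> W (v + (\<tau> - v)) - W v"
    using v1 vs by (intro gauge_fun_increment[OF W]) auto
  moreover have "W (t + s) - W t \<le> W ((\<tau> - v) + s) - W (\<tau> - v)"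
    using v1 st \<open>\<tau> - v \<le> t\<close> by (intro gauge_fun_increment[OF W]) auto
  ultimately have strict: "B + W (\<tau> - v) < W t"
    using total Wv by (simp add: add.commute)
  obtain d where d: "0 < d" "\<And>r. 0 \<le> r \<Longrightarrow> r \<le> d \<Longrightarrow> W r < W t - B - W (\<tau> - v)"
    using gauge_fun_small[OF W, of "W t - B - W (\<tau> - v)"] strict by auto
  show thesis
  proof (rule that[of "max 0 (v - d)" v])
    fix u assume u: "max 0 (v - d) < u" "u < v"
    have "W ((\<tau> - v) + (v - u)) \<le> W (\<tau> - v) + W (v - u)"
      using u v1 by (intro gauge_fun_subadditive[OF W]) auto
    then show "A + W u < W s \<and> B + W (\<tau> - u) < W t"
      using below[of u] d(2)[of "v - u"] u by (simp add: less_diff_eq)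
  qed (use v1 \<open>0 < v\<close> d(1) in auto)
qed

lemma trace_restrict:
  assumes tr: "is_trace X w T D f" and u: "u \<in> D"
  shows "is_trace X w u (D \<inter> {0..u}) f"
proof -
  have T: "D \<subseteq> {0..T}" "{0..T} \<subseteq> closure D" "u \<le> T" "0 \<le> u" using tr u by (auto simp: is_trace_def)
  have "x \<in> closure (D \<inter> {0..u})" if x: "x \<in> {0..u}" for x
    unfolding closure_approachable
  proof (intro allI impI)
    fix e :: real assume e: "0 < e"
    show "\<exists>y\<in>D \<inter> {0..u}. dist y x < e"
    proof (cases "x = u")
      case True
      then show ?thesis using u T e by (intro bexI[of _ u]) auto
    next
      case False
      then have "0 \<le> x" "x < min u (x + e)" "min u (x + e) \<le> T" using x e T(3) by auto
      from dense_pick[OF T(2) this] obtain y where "y \<in> D" "x < y" "y < min u (x + e)" by blast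
      then show ?thesis using x by (intro bexI[of _ y]) (auto simp: dist_real_def)
    qed
  qed
  then show ?thesis using tr u T by (auto simp: is_trace_def)
qed

lemma trace_restrict_tail:
  assumes tr: "is_trace X w T D f" and u: "u \<in> D"
  obtains D' where "is_trace X w (T - u) D' (\<lambda>v. f (u + v))"
proof -
  have "T - u \<in> (\<lambda>v. T - v) ` D" using u by simp
  from trace_reverse[OF trace_restrict[OF trace_reverse[OF tr] this]]
  show thesis by (intro that) (simp add: algebra_simps)
qed

definition trace_joined :: "'a metric \<Rightarrow> (real \<Rightarrow> real) \<Rightarrow> real \<Rightarrow> 'a \<Rightarrow> 'a \<Rightarrow> bool" where
  "trace_joined X w t x y \<longleftrightarrow> (\<exists>D f. is_trace X w t D f \<and> f 0 = x \<and> f t = y)"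

lemma trace_joined_mem: "trace_joined X w t x y \<Longrightarrow> 0 \<le> t \<and> x \<in> mspace X \<and> y \<in> mspace X \<and> mdist X x y \<le> w t"
  by (force simp: trace_joined_def is_trace_def)

lemma trace_joined_sym: "trace_joined X w t x y \<Longrightarrow> trace_joined X w t y x"
  unfolding trace_joined_def using trace_reverse by fastforce

lemma trace_joined_split:
  assumes "trace_joined X w t x y" "0 \<le> a" "a < b" "b \<le> t"
  obtains u z where "a < u" "u < b" "trace_joined X w u x z" "trace_joined X w (t - u) z y"
proof -
  obtain D f where f: "is_trace X w t D f" "f 0 = x" "f t = y" using assms(1) by (auto simp: trace_joined_def)
  then have "{0..t} \<subseteq> closure D" by (simp add: is_trace_def)
  from dense_pick[OF this assms(2-4)] obtain u where u: "u \<in> D" "a < u" "u < b" by blast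
  obtain D' where D': "is_trace X w (t - u) D' (\<lambda>v. f (u + v))" using trace_restrict_tail[OF f(1) u(1)] by blast
  show thesis
  proof (rule that[OF u(2,3), of "f u"])
    show "trace_joined X w u x (f u)" unfolding trace_joined_def using trace_restrict[OF f(1) u(1)] f(2) by blast
    show "trace_joined X w (t - u) (f u) y"
      unfolding trace_joined_def using D' f(3) by (intro exI[of _ D'] exI[of _ "\<lambda>v. f (u + v)"]) simp
  qed
qed

lemma chain_linking_iff_rtrancl:
  "(\<exists>l c. chain_linking X \<eta> l x y c) \<longleftrightarrow> x \<in> mspace X \<and> (x, y) \<in> (near X \<eta> (mspace X))\<^sup>*"
proof
  assume "\<exists>l c. chain_linking X \<eta> l x y c"
  then obtain l c where c: "chain_linking X \<eta> l x y c" by blast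
  have "(c 0, c i) \<in> (near X \<eta> (mspace X))\<^sup>*" if "i \<le> l" for i
    using that
  proof (induction i)
    case (Suc i)
    then have "Suc i \<in> {1..l}" by simp
    then have "mdist X (c (Suc i)) (c (Suc i - 1)) < \<eta>" using c unfolding chain_linking_def by blast
    then have "(c i, c (Suc i)) \<in> near X \<eta> (mspace X)"
      using c Suc.prems by (simp add: chain_linking_def near_def mdist_commute)
    then show ?case using Suc by (meson Suc_leD rtrancl.rtrancl_into_rtrancl)
  qed simp
  then show "x \<in> mspace X \<and> (x, y) \<in> (near X \<eta> (mspace X))\<^sup>*"
    using c unfolding chain_linking_def by auto
next
  assume *: "x \<in> mspace X \<and> (x, y) \<in> (near X \<eta> (mspace X))\<^sup>*"
  then obtain l where l: "(x, y) \<in> near X \<eta> (mspace X) ^^ l" by (meson rtrancl_imp_relpow)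
  show "\<exists>l c. chain_linking X \<eta> l x y c"
    by (rule near_relpow_imp_chain[OF l]) (use * in blast)+
qed

lemma trace_joined_imp_chain:
  assumes w: "gauge_fun w" and xy: "trace_joined X w t x y" and \<eta>: "0 < \<eta>"
  shows "(x, y) \<in> (near X \<eta> (mspace X))\<^sup>*"
proof -
  obtain D f where f: "is_trace X w t D f" "f 0 = x" "f t = y" using xy by (auto simp: trace_joined_def)
  have D: "D \<subseteq> {0..t}" "{0..t} \<subseteq> closure D" "0 \<in> D" "t \<in> D" "0 \<le> t" "\<And>u. u \<in> D \<Longrightarrow> f u \<in> mspace X"
    "\<And>u v. u \<in> D \<Longrightarrow> v \<in> D \<Longrightarrow> mdist X (f u) (f v) \<le> w \<bar>u - v\<bar>"
    using f(1) by (auto simp: is_trace_def)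
  obtain d where d: "0 < d" "\<And>t. 0 \<le> t \<Longrightarrow> t \<le> d \<Longrightarrow> w t < \<eta>" using gauge_fun_small[OF w \<eta>] by blast
  have close: "(f u, f v) \<in> near X \<eta> (mspace X)" if "u \<in> D" "v \<in> D" "\<bar>u - v\<bar> \<le> d" for u v
  proof -
    have "mdist X (f u) (f v) < \<eta>" using D(7)[OF that(1,2)] d(2)[of "\<bar>u - v\<bar>"] that(3) by simp
    then show ?thesis using D(6) that by (simp add: near_def)
  qed
  have "(f u, f t) \<in> (near X \<eta> (mspace X))\<^sup>*" if "u \<in> D" "t - u \<le> real n * (d / 2)" for n u
    using that
  proof (induction n arbitrary: u)
    case 0
    then have "u = t" using D(1) by auto
    then show ?case by simp
  next
    case (Suc n)
    have ut: "0 \<le> u" "u \<le> t" using D(1) Suc.prems by auto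
    show ?case
    proof (cases "t - u \<le> d")
      case True
      then show ?thesis using close[of u t] ut D(4) Suc.prems(1) by auto
    next
      case False
      then obtain v where v: "v \<in> D" "u + d / 2 < v" "v < u + d"
        using dense_pick[OF D(2), of "u + d / 2" "u + d"] ut d(1) by auto
      have "(f v, f t) \<in> (near X \<eta> (mspace X))\<^sup>*"
        using Suc.prems v by (intro Suc.IH) (auto simp: algebra_simps)
      moreover have "(f u, f v) \<in> near X \<eta> (mspace X)"
        using close[OF Suc.prems(1) v(1)] v(2,3) d(1) by simp
      ultimately show ?thesis by (rule converse_rtrancl_into_rtrancl[rotated])
    qed
  qed
  moreover obtain n :: nat where "t < real n * (d / 2)" using reals_Archimedean3[of "d / 2"] d(1) by auto
  ultimately show ?thesis using D(3) f(2,3) by (metis diff_zero less_imp_le)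
qed

lemma trace_connectedD:
  assumes "trace_connected X w e" "x \<in> mspace X" "y \<in> mspace X" "mdist X x y < e"
  shows "trace_joined X w (mdist X x y) x y"
  using assms unfolding trace_connected_def trace_joined_def by blast

text \<open>Traces are concatenated, each at the cost \<open>W t\<close> for its duration \<open>t\<close>. If \<open>W\<close> dominates \<open>w\<close>, this
  cost bounds the distance of the ends, which the total duration does not.\<close>

inductive reach :: "'a metric \<Rightarrow> (real \<Rightarrow> real) \<Rightarrow> (real \<Rightarrow> real) \<Rightarrow> 'a \<Rightarrow> 'a \<Rightarrow> real \<Rightarrow> bool"
  for X w W x where
  start: "x \<in> mspace X \<Longrightarrow> reach X w W x x 0"
| step: "reach X w W x y c \<Longrightarrow> trace_joined X w t y z \<Longrightarrow> reach X w W x z (c + W t)"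

lemma reach_mem:
  assumes "reach X w W x y c" "gauge_fun W" "\<And>t. 0 \<le> t \<Longrightarrow> w t \<le> W t"
  shows "x \<in> mspace X \<and> y \<in> mspace X \<and> 0 \<le> c \<and> mdist X x y \<le> c"
  using assms(1)
proof induction
  case (step y c t z)
  have "w t \<le> W t" "0 \<le> W t" using trace_joined_mem[OF step(2)] assms gauge_fun_nonneg by blast+
  then show ?case using trace_joined_mem[OF step(2)] step.IH mdist_triangle[of x X y z] by simp
qed simp

lemma reach_trans: "reach X w W y z c' \<Longrightarrow> reach X w W x y c \<Longrightarrow> reach X w W x z (c + c')"
proof (induction rule: reach.induct)
  case (step z c' t z')
  then have "reach X w W x z' (c + c' + W t)" by (intro reach.step) auto
  then show ?case by (simp add: add.assoc)
qed simp

lemma reach_sym: "reach X w W x y c \<Longrightarrow> reach X w W y x c"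
proof (induction rule: reach.induct)
  case (step y c t z)
  have "z \<in> mspace X" using trace_joined_mem[OF step(2)] by simp
  from reach.step[OF reach.start[OF this] trace_joined_sym[OF step(2)]]
  have "reach X w W z y (W t)" by simp
  from reach_trans[OF step.IH this] show ?case by (simp add: add.commute)
qed (rule reach.start)

text \<open>The induction runs over the traces from the last to the first; \<open>B\<close> is the cost of the traces
  that have already been split off at the end.\<close>

lemma reach_split:
  assumes "reach X w W x y c" and W: "gauge_fun W" and wW: "\<And>t. 0 \<le> t \<Longrightarrow> w t \<le> W t"
    and st: "0 < s" "0 < t" and B: "0 \<le> B" "c + B < W (s + t)"
  shows "c < W s \<or> (\<exists>z c1 c2. reach X w W x z c1 \<and> c1 < W s \<and> reach X w W z y c2 \<and> c2 + B < W t)"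
  using assms(1) B
proof (induction arbitrary: B)
  case start
  then show ?case using gauge_fun_pos[OF W st(1)] by simp
next
  case (step y c \<tau> y')
  have \<tau>: "0 \<le> \<tau>" using trace_joined_mem[OF step(2)] by simp
  have c: "0 \<le> c" using reach_mem[OF step(1) W wW] by simp
  show ?case
  proof (cases "c < W s")
    case cs: True
    show ?thesis
    proof (cases "c + W \<tau> < W s")
      case False
      then obtain a b where ab: "0 \<le> a" "a < b" "b \<le> \<tau>"
        "\<And>u. a < u \<Longrightarrow> u < b \<Longrightarrow> c + W u < W s \<and> B + W (\<tau> - u) < W t"
        using gauge_fun_split[OF W st c step.prems(1) \<tau> cs] step.prems(2) by (auto simp: not_less)
      obtain u z where u: "a < u" "u < b" "trace_joined X w u y z" "trace_joined X w (\<tau> - u) z y'"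
        using trace_joined_split[OF step(2) ab(1-3)] by blast
      have "reach X w W x z (c + W u)" using step(1) u(3) by (rule reach.step)
      moreover have "reach X w W z y' (W (\<tau> - u))"
        using reach.step[OF reach.start u(4)] trace_joined_mem[OF u(4)] by simp
      moreover have "c + W u < W s" "W (\<tau> - u) + B < W t" using ab(4)[OF u(1,2)] by auto
      ultimately show ?thesis by blast
    qed simp
  next
    case False
    have "0 \<le> B + W \<tau>" "c + (B + W \<tau>) < W (s + t)" using step.prems gauge_fun_nonneg[OF W \<tau>] by auto
    from step.IH[OF this] False obtain z c1 c2 where z: "reach X w W x z c1" "c1 < W s"
      "reach X w W z y c2" "c2 + (B + W \<tau>) < W t" by blast
    have "reach X w W z y' (c2 + W \<tau>)" using z(3) step(2) by (rule reach.step)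
    then show ?thesis using z by (intro disjI2 exI[of _ z] exI[of _ c1] exI[of _ "c2 + W \<tau>"]) (simp add: algebra_simps)
  qed
qed

lemma muniformity_le:
  assumes "mspace Y = mspace Z"
    and "\<And>e. 0 < e \<Longrightarrow> \<exists>d>0. \<forall>x\<in>mspace Y. \<forall>y\<in>mspace Y. mdist Y x y < d \<longrightarrow> mdist Z x y < e"
  shows "muniformity Y \<le> muniformity Z"
  unfolding muniformity_def
proof (rule INF_greatest)
  fix e :: real assume "e \<in> {0<..}"
  then obtain d where d: "0 < d" "\<forall>x\<in>mspace Y. \<forall>y\<in>mspace Y. mdist Y x y < d \<longrightarrow> mdist Z x y < e"
    using assms(2)[of e] by auto
  have "(INF e\<in>{0<..}. principal {(x, y). x \<in> mspace Y \<and> y \<in> mspace Y \<and> mdist Y x y < e})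
      \<le> principal {(x, y). x \<in> mspace Y \<and> y \<in> mspace Y \<and> mdist Y x y < d}"
    using d(1) by (intro INF_lower) simp
  also have "\<dots> \<le> principal {(x, y). x \<in> mspace Z \<and> y \<in> mspace Z \<and> mdist Z x y < e}"
    using d(2) assms(1) by auto
  finally show "(INF e\<in>{0<..}. principal {(x, y). x \<in> mspace Y \<and> y \<in> mspace Y \<and> mdist Y x y < e})
      \<le> principal {(x, y). x \<in> mspace Z \<and> y \<in> mspace Z \<and> mdist Z x y < e}" .
qed

lemma muniformity_leD:
  assumes "muniformity Y \<le> muniformity Z" "0 < e"
  obtains d where "0 < d" "\<And>x y. x \<in> mspace Y \<Longrightarrow> y \<in> mspace Y \<Longrightarrow> mdist Y x y < d \<Longrightarrow> mdist Z x y < e"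
proof -
  have "eventually (\<lambda>(x, y). mdist Z x y < e) (muniformity Z)"
    unfolding muniformity_def using assms(2)
    by (intro eventually_INF1[of e]) (auto simp: eventually_principal)
  then have "eventually (\<lambda>(x, y). mdist Z x y < e) (muniformity Y)"
    using assms(1) by (rule filter_leD[rotated])
  then have "\<exists>d\<in>{0<..}. eventually (\<lambda>(x, y). mdist Z x y < e)
      (principal {(x, y). x \<in> mspace Y \<and> y \<in> mspace Y \<and> mdist Y x y < d})"
    unfolding muniformity_def
  proof (subst (asm) eventually_INF_base)
    fix a b :: real assume "a \<in> {0<..}" "b \<in> {0<..}"
    then show "\<exists>x\<in>{0<..}. principal {(xa, y). xa \<in> mspace Y \<and> y \<in> mspace Y \<and> mdist Y xa y < x}
        \<le> inf (principal {(x, y). x \<in> mspace Y \<and> y \<in> mspace Y \<and> mdist Y x y < a})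
            (principal {(x, y). x \<in> mspace Y \<and> y \<in> mspace Y \<and> mdist Y x y < b})"
      by (intro bexI[of _ "min a b"]) auto
  qed auto
  then show thesis using that by (auto simp: eventually_principal)
qed

lemma trace_connected_imp_chain_connected_im_kleinen:
  assumes "trace_connected X w e"
  shows "chain_connected_im_kleinen X"
  unfolding chain_connected_im_kleinen_def
proof (intro exI[of _ e] conjI ballI impI allI)
  show "0 < e" using assms by (simp add: trace_connected_def)
  fix x y and \<eta> :: real
  assume "x \<in> mspace X" "y \<in> mspace X" "mdist X x y < e" "0 < \<eta>"
  then show "\<exists>l c. chain_linking X \<eta> l x y c"
    using trace_joined_imp_chain[OF _ trace_connectedD[OF assms]] assms
    unfolding chain_linking_iff_rtrancl by (simp add: trace_connected_def)
qed

text \<open>Traces can be resolved into arbitrarily fine chains, and steps below \<open>e\<close> can be replaced by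
  traces.\<close>

lemma chain_component_iff_reach:
  assumes tc: "trace_connected X w e" and x0: "x0 \<in> mspace X"
  shows "x \<in> chain_component X x0 \<longleftrightarrow> (\<exists>c. reach X w W x x0 c)"
proof
  have w: "gauge_fun w" and e: "0 < e" using tc by (auto simp: trace_connected_def)
  assume "x \<in> chain_component X x0"
  then have x: "x \<in> mspace X" and "\<exists>l c. chain_linking X e l x x0 c"
    using e by (auto simp: chain_component_def)
  then have "(x, x0) \<in> (near X e (mspace X))\<^sup>*" by (simp only: chain_linking_iff_rtrancl)
  then show "\<exists>c. reach X w W x x0 c"
  proof induction
    case base
    show ?case using reach.start[OF x] by blast
  next
    case (step y z)
    have "trace_joined X w (mdist X y z) y z" using step(2) trace_connectedD[OF tc] by (simp add: near_def)
    moreover obtain c where "reach X w W x y c" using step.IH by blast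
    ultimately show ?case using reach.step[of X w W x y c] by blast
  qed
next
  have w: "gauge_fun w" using tc by (simp add: trace_connected_def)
  assume "\<exists>c. reach X w W x x0 c"
  then obtain c where "reach X w W x x0 c" by blast
  then have "x \<in> mspace X \<and> (\<forall>\<eta>>0. (x, x0) \<in> (near X \<eta> (mspace X))\<^sup>*)"
  proof induction
    case (step y c t z)
    then show ?case using trace_joined_imp_chain[OF w step(2)] by (meson rtrancl_trans)
  qed simp
  then show "x \<in> chain_component X x0"
    unfolding chain_component_def chain_linking_iff_rtrancl by simp
qed

locale trace_metric =
  fixes X :: "'a metric" and w e W
  assumes tc: "trace_connected X w e" and W: "gauge_fun W" and wW: "\<And>t. 0 \<le> t \<Longrightarrow> w t \<le> W t"
begin

definition linked :: "'a \<Rightarrow> 'a \<Rightarrow> bool" where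
  "linked x y \<longleftrightarrow> (\<exists>c. reach X w W x y c)"

definition cost :: "'a \<Rightarrow> 'a \<Rightarrow> real" where
  "cost x y = Inf {c. reach X w W x y c}"

text \<open>The base point of the component of \<open>x\<close>: the choice depends only on the predicate \<open>linked x\<close>.\<close>

definition base :: "'a \<Rightarrow> 'a" where
  "base x = (SOME y. linked x y)"

text \<open>Infinite costs are avoided by routing points of different components through the base points, at
  the extra cost 1. Only small distances and distances inside a component matter.\<close>

definition trace_dist :: "'a \<Rightarrow> 'a \<Rightarrow> real" where
  "trace_dist x y = (if linked x y then cost x y else cost x (base x) + 1 + cost (base y) y)"

lemma reachD:
  assumes "reach X w W x y c"
  shows "x \<in> mspace X" "y \<in> mspace X" "0 \<le> c" "mdist X x y \<le> c"
  using reach_mem[OF assms W] wW by blast+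

lemma linked_refl: "x \<in> mspace X \<Longrightarrow> linked x x"
  unfolding linked_def using reach.start by metis

lemma linked_sym: "linked x y \<Longrightarrow> linked y x"
  unfolding linked_def using reach_sym by metis

lemma linked_trans: "linked x y \<Longrightarrow> linked y z \<Longrightarrow> linked x z"
  unfolding linked_def using reach_trans by metis

lemma bdd: "bdd_below {c. reach X w W x y c}"
  using reachD(3) by (intro bdd_belowI[of _ 0]) auto

lemma cost_le: "reach X w W x y c \<Longrightarrow> cost x y \<le> c"
  unfolding cost_def using bdd by (intro cInf_lower) auto

lemma cost_approx:
  assumes "linked x y" "0 < r"
  obtains c where "reach X w W x y c" "c < cost x y + r"
proof -
  have "{c. reach X w W x y c} \<noteq> {}" using assms(1) by (auto simp: linked_def)
  then obtain c where "c \<in> {c. reach X w W x y c}" "c < cost x y + r"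
    using cInf_lessD[of "{c. reach X w W x y c}" "cost x y + r"] assms(2) unfolding cost_def by auto
  then show thesis using that by blast
qed

lemma cost_ge: "linked x y \<Longrightarrow> mdist X x y \<le> cost x y"
  unfolding cost_def linked_def using reachD(4) by (intro cInf_greatest) auto

lemma cost_refl: "x \<in> mspace X \<Longrightarrow> cost x x = 0"
  using cost_le[OF reach.start] cost_ge[OF linked_refl] by fastforce

lemma cost_sym: "cost x y = cost y x"
proof -
  have "{c. reach X w W x y c} = {c. reach X w W y x c}" by (auto intro: reach_sym)
  then show ?thesis by (simp add: cost_def)
qed

lemma cost_triangle:
  assumes "linked x y" "linked y z"
  shows "cost x z \<le> cost x y + cost y z"
proof (rule field_le_epsilon)
  fix r :: real assume "0 < r"
  then have "0 < r / 2" by simp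
  obtain c where c: "reach X w W x y c" "c < cost x y + r / 2" by (rule cost_approx[OF assms(1) \<open>0 < r / 2\<close>])
  obtain c' where c': "reach X w W y z c'" "c' < cost y z + r / 2" by (rule cost_approx[OF assms(2) \<open>0 < r / 2\<close>])
  show "cost x z \<le> cost x y + cost y z + r"
    using cost_le[OF reach_trans[OF c'(1) c(1)]] c(2) c'(2) by simp
qed

lemma linked_base: "x \<in> mspace X \<Longrightarrow> linked x (base x)"
  unfolding base_def using linked_refl by (metis someI)

lemma base_eq: "linked x y \<Longrightarrow> base x = base y"
proof -
  assume "linked x y"
  then have "linked x = linked y" using linked_trans linked_sym by blast
  then show ?thesis by (simp add: base_def)
qed

lemma cost_nonneg: "linked x y \<Longrightarrow> 0 \<le> cost x y"
  using cost_ge[of x y] mdist_nonneg[of X x y] by linarith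

lemma cost_base_nonneg: "x \<in> mspace X \<Longrightarrow> 0 \<le> cost x (base x)" "x \<in> mspace X \<Longrightarrow> 0 \<le> cost (base x) x"
  using cost_nonneg linked_base linked_sym by blast+

lemma Metric_space_trace_dist: "Metric_space (mspace X) trace_dist'"
  if "trace_dist' = (\<lambda>x y. if x \<in> mspace X \<and> y \<in> mspace X then trace_dist x y else 0)"
proof
  fix x y
  show "0 \<le> trace_dist' x y"
    using cost_base_nonneg[of x] cost_base_nonneg[of y] cost_nonneg[of x y]
    unfolding that trace_dist_def by auto
  show "trace_dist' x y = trace_dist' y x"
    unfolding that trace_dist_def using cost_sym linked_sym[of x y] linked_sym[of y x] by auto
next
  fix x y assume xy: "x \<in> mspace X" "y \<in> mspace X"
  show "trace_dist' x y = 0 \<longleftrightarrow> x = y"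
  proof (cases "linked x y")
    case True
    have "cost x y = 0 \<longleftrightarrow> x = y"
    proof
      assume "cost x y = 0"
      then have "mdist X x y = 0" using cost_ge[OF True] mdist_nonneg[of X x y] by linarith
      then show "x = y" using xy by simp
    qed (use cost_refl xy in auto)
    then show ?thesis using True xy by (simp add: that trace_dist_def)
  next
    case False
    then have "x \<noteq> y" using linked_refl xy by blast
    then show ?thesis using False xy cost_base_nonneg(1)[OF xy(1)] cost_base_nonneg(2)[OF xy(2)]
      by (simp add: that trace_dist_def)
  qed
next
  fix x y z assume m: "x \<in> mspace X" "y \<in> mspace X" "z \<in> mspace X"
  note nn = cost_base_nonneg[OF m(1)] cost_base_nonneg[OF m(2)] cost_base_nonneg[OF m(3)]
  have bs: "cost (base y) y = cost y (base y)" "cost (base x) x = cost x (base x)" "cost (base z) z = cost z (base z)"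
    by (rule cost_sym)+
  have up: "cost a (base a) \<le> cost a b + cost b (base b)" if "linked a b" "b \<in> mspace X" for a b
    using cost_triangle[OF that(1) linked_base[OF that(2)]] base_eq[OF that(1)] by simp
  have "trace_dist x z \<le> trace_dist x y + trace_dist y z"
  proof (cases "linked x y")
    case xy: True
    show ?thesis
    proof (cases "linked y z")
      case True
      then show ?thesis using xy linked_trans cost_triangle by (simp add: trace_dist_def)
    next
      case False
      then have "\<not> linked x z" using xy linked_trans linked_sym by blast
      then show ?thesis using xy False up[OF xy m(2)] by (simp add: trace_dist_def)
    qed
  next
    case xy: False
    show ?thesis
    proof (cases "linked y z")
      case True
      then have "\<not> linked x z" using xy linked_trans linked_sym by blast
      then show ?thesis using xy True up[OF linked_sym[OF True] m(2)] bs cost_sym[of y z] by (simp add: trace_dist_def)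
    next
      case yz: False
      show ?thesis
      proof (cases "linked x z")
        case True
        have "cost x z \<le> cost x (base x) + cost (base x) z"
          using True linked_base[OF m(1)] linked_sym linked_trans by (intro cost_triangle) blast+
        then show ?thesis using True xy yz nn base_eq[OF True] by (simp add: trace_dist_def)
      next
        case False
        then show ?thesis using xy yz nn by (simp add: trace_dist_def)
      qed
    qed
  qed
  then show "trace_dist' x z \<le> trace_dist' x y + trace_dist' y z" using m by (simp add: that)
qed

text \<open>The least cost of joining two points by traces is a metric. Inside the components it dominates
  \<open>mdist X\<close>, and for close points it is at most \<open>W\<close> of it, so the uniformity does not change.
  Cutting an almost optimal sequence of traces at a prescribed cost gives the intermediate
  points that convexity asks for.\<close>

theorem convex_metric:
  "\<exists>Z. mspace Z = mspace X \<and> muniformity Z = muniformity X \<and>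
    (\<forall>x0\<in>mspace X. omega_convex W (submetric Z (chain_component X x0)))"
proof -
  define dz where "dz = (\<lambda>x y. if x \<in> mspace X \<and> y \<in> mspace X then trace_dist x y else 0)"
  note M = Metric_space_trace_dist[OF dz_def]
  define Z where "Z = metric (mspace X, dz)"
  have Z: "mspace Z = mspace X" "mdist Z = dz"
    using M by (simp_all add: Z_def Metric_space.mspace_metric Metric_space.mdist_metric)
  have e: "0 < e" using tc by (simp add: trace_connected_def)
  have "muniformity Z \<le> muniformity X"
  proof (rule muniformity_le[OF Z(1)])
    fix r :: real assume "0 < r"
    have "mdist X x y < r" if "x \<in> mspace X" "y \<in> mspace X" "dz x y < min r 1" for x y
    proof (cases "linked x y")
      case True
      then show ?thesis using cost_ge[OF True] that by (simp add: dz_def trace_dist_def)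
    next
      case False
      then show ?thesis using that cost_base_nonneg(1)[OF that(1)] cost_base_nonneg(2)[OF that(2)]
        by (simp add: dz_def trace_dist_def)
    qed
    then show "\<exists>d>0. \<forall>x\<in>mspace Z. \<forall>y\<in>mspace Z. mdist Z x y < d \<longrightarrow> mdist X x y < r"
      using \<open>0 < r\<close> unfolding Z by (intro exI[of _ "min r 1"]) auto
  qed
  moreover have "muniformity X \<le> muniformity Z"
  proof (rule muniformity_le[OF Z(1)[symmetric]])
    fix r :: real assume "0 < r"
    obtain d where d: "0 < d" "\<And>t. 0 \<le> t \<Longrightarrow> t \<le> d \<Longrightarrow> W t < r" using gauge_fun_small[OF W \<open>0 < r\<close>] by blast
    have "dz x y < r" if xy: "x \<in> mspace X" "y \<in> mspace X" "mdist X x y < min d e" for x y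
    proof -
      have "reach X w W x y (0 + W (mdist X x y))"
        using xy by (intro reach.step[OF reach.start trace_connectedD[OF tc]]) auto
      then have "linked x y" "cost x y \<le> W (mdist X x y)" using cost_le unfolding linked_def by auto
      then show ?thesis using d(2)[of "mdist X x y"] xy by (simp add: dz_def trace_dist_def)
    qed
    then show "\<exists>d>0. \<forall>x\<in>mspace X. \<forall>y\<in>mspace X. mdist X x y < d \<longrightarrow> mdist Z x y < r"
      using d(1) e unfolding Z by (intro exI[of _ "min d e"]) auto
  qed
  ultimately have "muniformity Z = muniformity X" by (rule antisym)
  moreover have "omega_convex W (submetric Z (chain_component X x0))" if x0: "x0 \<in> mspace X" for x0
  proof -
    have comp: "x \<in> chain_component X x0 \<longleftrightarrow> linked x x0" for x
      unfolding linked_def by (rule chain_component_iff_reach[OF tc x0])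
    have mem: "x \<in> mspace X" if "linked x x0" for x
      using that reachD(1) unfolding linked_def by blast
    have dzc: "dz x y = cost x y" if "linked x x0" "linked y x0" for x y
    proof -
      have "linked x y" using that linked_trans linked_sym by blast
      moreover have "x \<in> mspace X" "y \<in> mspace X" using that reachD(1) unfolding linked_def by auto
      ultimately show ?thesis by (simp add: dz_def trace_dist_def)
    qed
    have "\<exists>z. linked z x0 \<and> cost x z < W s \<and> cost z y < W t"
      if xy: "linked x x0" "linked y x0" and st: "0 < s" "0 < t" and less: "cost x y < W (s + t)" for x y s t
    proof -
      have L: "linked x y" using xy linked_trans linked_sym by blast
      obtain c where c: "reach X w W x y c" "c < cost x y + (W (s + t) - cost x y)"
        by (rule cost_approx[OF L, of "W (s + t) - cost x y"]) (use less in auto)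
      have "c < W s \<or> (\<exists>z c1 c2. reach X w W x z c1 \<and> c1 < W s \<and> reach X w W z y c2 \<and> c2 + 0 < W t)"
        using c(2) by (intro reach_split[OF c(1) W wW st]) auto
      then show ?thesis
      proof
        assume "c < W s"
        have "y \<in> mspace X" by (rule reachD(2)[OF c(1)])
        then show ?thesis using cost_le[OF c(1)] \<open>c < W s\<close> cost_refl gauge_fun_pos[OF W st(2)] xy(2)
          by (intro exI[of _ y]) auto
      next
        assume "\<exists>z c1 c2. reach X w W x z c1 \<and> c1 < W s \<and> reach X w W z y c2 \<and> c2 + 0 < W t"
        then obtain z c1 c2 where z: "reach X w W x z c1" "c1 < W s" "reach X w W z y c2" "c2 < W t" by auto
        have "linked z y" using z(3) by (auto simp: linked_def)
        then have "linked z x0" using xy(2) linked_trans by blast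
        then show ?thesis using cost_le[OF z(1)] cost_le[OF z(3)] z(2,4) by (intro exI[of _ z]) auto
      qed
    qed
    then show ?thesis
      unfolding omega_convex_def mspace_submetric mdist_submetric Z
      using dzc comp mem by (auto simp: Bex_def) metis
  qed
  ultimately show ?thesis using Z(1) by blast
qed

end

theorem trace_connected_imp_weakly_convexifiable:
  assumes tc: "trace_connected X w e"
  shows "weakly_convexifiable X"
proof -
  have w: "gauge_fun w" using tc by (simp add: trace_connected_def)
  have w0: "(\<lambda>t. if t = 0 then 0 else w t) = w" using w by auto
  have "\<exists>Z. mspace Z = mspace X \<and> muniformity Z = muniformity X \<and>
      (\<forall>x0\<in>mspace X. omega_convex \<omega> (submetric Z (chain_component X x0)))"
    if "concave_modulus \<omega>" "\<forall>t>0. w t \<le> \<omega> t" for \<omega>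
  proof -
    define W where "W = (\<lambda>t. if t = 0 then 0 else \<omega> t)"
    interpret trace_metric X w e W
      using tc that w by unfold_locales (auto simp: concave_modulus_iff_gauge_fun W_def)
    have "omega_convex W Y \<longleftrightarrow> omega_convex \<omega> Y" for Y :: "'a metric"
      unfolding omega_convex_def W_def by force
    then show ?thesis using convex_metric by simp
  qed
  then show ?thesis
    unfolding weakly_convexifiable_def
    using trace_connected_imp_chain_connected_im_kleinen[OF tc] w
    by (intro conjI exI[of _ w]) (auto simp: concave_modulus_iff_gauge_fun w0)
qed

text \<open>Convexity is used to cut off pieces of size \<open>W h\<close> from a pair at distance below \<open>W T\<close>, where \<open>T
  = n * h\<close>. The number \<open>n\<close> of pieces depends only on how small \<open>W h\<close> has to be, and all
  intermediate points remain within \<open>W T\<close> of the first point.\<close>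

theorem weakly_convexifiable_imp_uniformly_locally_chain_equi_connected:
  assumes "weakly_convexifiable X"
  shows "uniformly_locally_chain_equi_connected X"
proof (rule uniformly_locally_chain_equi_connectedI)
  fix \<epsilon> :: real assume \<epsilon>: "0 < \<epsilon>"
  obtain \<epsilon>0 where \<epsilon>0: "0 < \<epsilon>0" "\<And>x y \<eta>. x \<in> mspace X \<Longrightarrow> y \<in> mspace X \<Longrightarrow> mdist X x y < \<epsilon>0 \<Longrightarrow> 0 < \<eta> \<Longrightarrow>
      \<exists>l c. chain_linking X \<eta> l x y c"
    using assms unfolding weakly_convexifiable_def chain_connected_im_kleinen_def by blast
  obtain \<alpha> where \<alpha>: "concave_modulus \<alpha>" and
    all: "\<And>\<omega>. concave_modulus \<omega> \<and> (\<forall>t>0. \<alpha> t \<le> \<omega> t) \<Longrightarrow>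
      \<exists>Z. mspace Z = mspace X \<and> muniformity Z = muniformity X \<and>
        (\<forall>x0\<in>mspace X. omega_convex \<omega> (submetric Z (chain_component X x0)))"
    using assms unfolding weakly_convexifiable_def by blast
  have "\<exists>Z. mspace Z = mspace X \<and> muniformity Z = muniformity X \<and>
      (\<forall>x0\<in>mspace X. omega_convex \<alpha> (submetric Z (chain_component X x0)))"
    by (rule all) (simp add: \<alpha>)
  then obtain Z where Z: "mspace Z = mspace X" "muniformity Z = muniformity X"
    and conv: "\<And>x0. x0 \<in> mspace X \<Longrightarrow> omega_convex \<alpha> (submetric Z (chain_component X x0))" by blast
  define W where "W = (\<lambda>t. if t = 0 then 0 else \<alpha> t)"
  have W: "gauge_fun W" using \<alpha> by (simp add: concave_modulus_iff_gauge_fun W_def)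
  obtain r where r: "0 < r" "\<And>x y. x \<in> mspace X \<Longrightarrow> y \<in> mspace X \<Longrightarrow> mdist Z x y < r \<Longrightarrow> mdist X x y < \<epsilon>"
    by (rule muniformity_leD[of Z X \<epsilon>]) (use Z \<epsilon> in auto)
  obtain T where T: "0 < T" "\<And>t. 0 \<le> t \<Longrightarrow> t \<le> T \<Longrightarrow> W t < r" using gauge_fun_small[OF W r(1)] by blast
  have WT: "0 < W T" using gauge_fun_pos[OF W T(1)] .
  obtain \<delta>1 where \<delta>1: "0 < \<delta>1" "\<And>x y. x \<in> mspace X \<Longrightarrow> y \<in> mspace X \<Longrightarrow> mdist X x y < \<delta>1 \<Longrightarrow> mdist Z x y < W T"
    by (rule muniformity_leD[of X Z "W T"]) (use Z WT in auto)
  define \<delta> where "\<delta> = min \<delta>1 \<epsilon>0"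
  have "\<exists>l. \<forall>x\<in>mspace X. \<forall>y\<in>mspace X. mdist X x y < \<delta> \<longrightarrow> (x, y) \<in> near X \<eta> (mball_of X x \<epsilon>) ^^ l"
    if \<eta>: "0 < \<eta>" for \<eta>
  proof -
    obtain \<eta>' where \<eta>': "0 < \<eta>'" "\<And>x y. x \<in> mspace X \<Longrightarrow> y \<in> mspace X \<Longrightarrow> mdist Z x y < \<eta>' \<Longrightarrow> mdist X x y < \<eta>"
      by (rule muniformity_leD[of Z X \<eta>]) (use Z \<eta> in auto)
    obtain \<tau> where \<tau>: "0 < \<tau>" "\<And>t. 0 \<le> t \<Longrightarrow> t \<le> \<tau> \<Longrightarrow> W t < \<eta>'" using gauge_fun_small[OF W \<eta>'(1)] by blast
    obtain m :: nat where m: "T < real m * \<tau>" using reals_Archimedean3[OF \<tau>(1)] by blast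
    define n where "n = Suc m"
    define h where "h = T / n"
    have h: "0 < h" "h \<le> \<tau>" "real n * h = T"
      using T(1) m \<tau>(1) by (auto simp: h_def n_def field_simps)
    have "(x, y) \<in> near X \<eta> (mball_of X x \<epsilon>) ^^ n" if xy: "x \<in> mspace X" "y \<in> mspace X" "mdist X x y < \<delta>" for x y
    proof -
      let ?C = "chain_component X x" and ?R = "near X \<eta> (mball_of X x \<epsilon>)"
      have x: "x \<in> ?C"
        using xy(1) unfolding chain_component_def chain_linking_iff_rtrancl by simp
      have y: "y \<in> ?C"
        using xy \<epsilon>0(2)[OF xy(2,1)] by (auto simp: chain_component_def \<delta>_def mdist_commute)
      have CX: "z \<in> mspace X" if "z \<in> ?C" for z using that by (simp add: chain_component_def)
      have "(x, z) \<in> ?R ^^ Suc k" if "z \<in> ?C" "mdist Z x z < W (real (Suc k) * h)" "Suc k \<le> n" for k z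
        using that
      proof (induction k arbitrary: z)
        case 0
        have "W h < r" "W h < \<eta>'"
          using T(2)[of h] \<tau>(2)[of h] h 0(3) by (auto simp: h_def field_simps n_def)
        then have "mdist X x z < \<epsilon>" "mdist X x z < \<eta>"
          using r(2)[OF xy(1) CX[OF 0(1)]] \<eta>'(2)[OF xy(1) CX[OF 0(1)]] 0(2) by auto
        then show ?case using xy(1) CX[OF 0(1)] \<epsilon> by (simp add: near_def)
      next
        case (Suc k)
        have kh: "0 < real (Suc k) * h" "real (Suc (Suc k)) * h = real (Suc k) * h + h"
          using h(1) mult_pos_pos[of "real (Suc k)" h] by (simp_all add: algebra_simps)
        have "mdist Z x z < \<alpha> (real (Suc k) * h + h)"
          using Suc.prems(2) kh h(1) unfolding W_def by (simp split: if_splits)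
        then have "\<exists>z'\<in>mspace (submetric Z ?C). mdist Z x z' < \<alpha> (real (Suc k) * h) \<and> mdist Z z' z < \<alpha> h"
          using conv[OF xy(1)] x Suc.prems(1) CX kh(1) h(1) Z(1) unfolding omega_convex_def by auto
        then obtain z' where z': "z' \<in> ?C" "mdist Z x z' < W (real (Suc k) * h)" "mdist Z z' z < W h"
          using kh(1) h(1) by (auto simp: W_def)
        have 1: "(x, z') \<in> ?R ^^ Suc k" using Suc.IH[OF z'(1,2)] Suc.prems(3) by simp
        then have "z' \<in> mball_of X x \<epsilon>" by (rule near_relpow_mem) (use xy \<epsilon> in simp)
        moreover have "mdist X z' z < \<eta>"
          using \<eta>'(2)[OF CX CX, OF z'(1) Suc.prems(1)] z'(3) \<tau>(2)[of h] h by simp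
        moreover have "mdist X x z < \<epsilon>"
        proof -
          have "real (Suc (Suc k)) * h \<le> T" using Suc.prems(3) h by (metis mult_right_mono of_nat_le_iff less_imp_le)
          then have "W (real (Suc (Suc k)) * h) < r" using h(1) by (intro T(2)) auto
          then show ?thesis using r(2)[OF xy(1) CX[OF Suc.prems(1)]] Suc.prems(2) by simp
        qed
        ultimately have "(z', z) \<in> ?R" using xy(1) CX[OF Suc.prems(1)] by (simp add: near_def)
        with 1 show ?case by auto
      qed
      from this[OF y, of m] show ?thesis
        using \<delta>1(2)[OF xy(1,2)] xy(3) h(3) by (simp add: n_def \<delta>_def)
    qed
    then show ?thesis by blast
  qed
  then show "\<exists>\<delta>>0. \<forall>\<eta>>0. \<exists>l. \<forall>x\<in>mspace X. \<forall>y\<in>mspace X. mdist X x y < \<delta> \<longrightarrow>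
      (x, y) \<in> near X \<eta> (mball_of X x \<epsilon>) ^^ l"
    using \<delta>1(1) \<epsilon>0(1) by (intro exI[of _ \<delta>]) (simp add: \<delta>_def)
qed

section \<open>Retractions onto the hyperspace\<close>

lemma continuous_map_mtopology_of_iff:
  "continuous_map (mtopology_of A) (mtopology_of B) f \<longleftrightarrow> f ` mspace A \<subseteq> mspace B \<and>
    (\<forall>a\<in>mspace A. \<forall>\<epsilon>>0. \<exists>\<delta>>0. \<forall>x. x \<in> mspace A \<and> mdist A a x < \<delta> \<longrightarrow> mdist B (f a) (f x) < \<epsilon>)"
  unfolding mtopology_of_def
  by (rule Metric_space.metric_continuous_map) auto

text \<open>A continuous map from the complement of the embedded copy of \<open>Y\<close> that is close to the identity
  near that copy extends continuously by the identity; the required closeness is the uniform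
  continuity at the copy. Closedness of the copy separates the two cases.\<close>

lemma near_retraction:
  fixes M :: "'m metric" and Y :: "'y metric"
  assumes emb: "closed_isometric_embedding Y M e" and U: "U \<subseteq> mspace M" "e ` mspace Y \<subseteq> U"
    and G: "\<And>m. m \<in> U - e ` mspace Y \<Longrightarrow> G m \<in> mspace Y"
    and near: "\<And>\<epsilon>. 0 < \<epsilon> \<Longrightarrow> \<exists>\<eta>>0. \<forall>a\<in>mspace Y. \<forall>m\<in>U - e ` mspace Y. mdist M m (e a) < \<eta> \<longrightarrow> mdist Y (G m) a < \<epsilon>"
    and cont: "\<And>m \<epsilon>. m \<in> U - e ` mspace Y \<Longrightarrow> 0 < \<epsilon> \<Longrightarrow>
      \<exists>\<eta>>0. \<forall>m'\<in>U - e ` mspace Y. mdist M m m' < \<eta> \<longrightarrow> mdist Y (G m) (G m') < \<epsilon>"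
  shows "\<exists>r. retraction_onto M U (e ` mspace Y) r \<and> uniformly_continuous_at_set M U (e ` mspace Y) r"
proof -
  let ?S = "e ` mspace Y"
  define r where "r m = (if m \<in> ?S then m else e (G m))" for m
  have emem: "e a \<in> mspace M" if "a \<in> mspace Y" for a
    using emb that by (auto simp: closed_isometric_embedding_def)
  have iso: "mdist M (e a) (e b) = mdist Y a b" if "a \<in> mspace Y" "b \<in> mspace Y" for a b
    using emb that by (simp add: closed_isometric_embedding_def)
  have at: "\<exists>\<delta>>0. \<forall>x\<in>?S. \<forall>y\<in>U. mdist M x y < \<delta> \<longrightarrow> mdist M (r y) x < \<epsilon>" if \<epsilon>: "0 < \<epsilon>" for \<epsilon>
  proof -
    obtain \<eta> where \<eta>: "0 < \<eta>" "\<And>a m. a \<in> mspace Y \<Longrightarrow> m \<in> U - ?S \<Longrightarrow> mdist M m (e a) < \<eta> \<Longrightarrow> mdist Y (G m) a < \<epsilon>"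
      using near[OF \<epsilon>] by blast
    have "mdist M (r y) x < \<epsilon>" if xy: "x \<in> ?S" "y \<in> U" "mdist M x y < min \<eta> \<epsilon>" for x y
    proof (cases "y \<in> ?S")
      case True
      then show ?thesis using xy by (simp add: r_def mdist_commute)
    next
      case False
      obtain a where a: "a \<in> mspace Y" "x = e a" using xy(1) by blast
      have "mdist Y (G y) a < \<epsilon>" using \<eta>(2)[OF a(1), of y] False xy a(2) by (simp add: mdist_commute)
      then show ?thesis using False iso[OF G[of y] a(1)] xy(2) a(2) by (simp add: r_def)
    qed
    then show ?thesis using \<eta>(1) \<epsilon> by (intro exI[of _ "min \<eta> \<epsilon>"]) auto
  qed
  have "\<exists>\<delta>>0. \<forall>x. x \<in> U \<and> mdist M a x < \<delta> \<longrightarrow> mdist M (r a) (r x) < \<epsilon>"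
    if a: "a \<in> U" and \<epsilon>: "0 < \<epsilon>" for a \<epsilon>
  proof (cases "a \<in> ?S")
    case True
    obtain \<delta> where \<delta>: "0 < \<delta>" "\<And>y. y \<in> U \<Longrightarrow> mdist M a y < \<delta> \<Longrightarrow> mdist M (r y) a < \<epsilon>"
      using at[OF \<epsilon>] True by blast
    have "mdist M (r a) (r x) < \<epsilon>" if "x \<in> U" "mdist M a x < \<delta>" for x
      using \<delta>(2)[OF that] True by (simp add: r_def mdist_commute[of M a])
    then show ?thesis using \<delta>(1) by blast
  next
    case False
    obtain \<eta> where \<eta>: "0 < \<eta>" "\<And>m'. m' \<in> U - ?S \<Longrightarrow> mdist M a m' < \<eta> \<Longrightarrow> mdist Y (G a) (G m') < \<epsilon>"
      using cont[of a, OF _ \<epsilon>] False a by blast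
    have "closedin (mtopology_of M) ?S" using emb by (simp add: closed_isometric_embedding_def)
    then obtain \<rho> where \<rho>: "0 < \<rho>" "disjnt ?S (mball_of M a \<rho>)"
      using False a U(1) unfolding mtopology_of_def mball_of_def
      by (metis Metric_space.closedin_metric Metric_space_mspace_mdist DiffI subsetD)
    have "mdist M (r a) (r x) < \<epsilon>" if x: "x \<in> U" "mdist M a x < min \<eta> \<rho>" for x
    proof -
      have "x \<in> mball_of M a \<rho>" using x a U(1) by auto
      then have "x \<notin> ?S" using \<rho>(2) by (auto simp: disjnt_iff)
      then show ?thesis using \<eta>(2)[of x] x False a iso[OF G G, of a x] by (simp add: r_def)
    qed
    then show ?thesis using \<eta>(1) \<rho>(1) by (intro exI[of _ "min \<eta> \<rho>"]) auto
  qed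
  moreover have "r ` U \<subseteq> ?S" using G by (auto simp: r_def)
  ultimately have "continuous_map (mtopology_of (submetric M U)) (mtopology_of (submetric M ?S)) r"
    unfolding continuous_map_mtopology_of_iff using U emem by (auto simp: Int_absorb2 image_subset_iff)
  then have "retraction_onto M U ?S r"
    unfolding retraction_onto_def using U by (simp add: mtopology_of_submetric r_def)
  then show ?thesis using at unfolding uniformly_continuous_at_set_def by blast
qed

definition dist_to :: "'m metric \<Rightarrow> 'm set \<Rightarrow> 'm \<Rightarrow> real" where
  "dist_to M S m = (INF s\<in>S. mdist M m s)"

lemma dist_to_le: "s \<in> S \<Longrightarrow> dist_to M S m \<le> mdist M m s"
  unfolding dist_to_def by (intro cINF_lower bdd_belowI[of _ 0]) auto

lemma dist_to_nonneg: "S \<noteq> {} \<Longrightarrow> 0 \<le> dist_to M S m"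
  unfolding dist_to_def by (intro cINF_greatest) auto

lemma dist_to_less: "S \<noteq> {} \<Longrightarrow> dist_to M S m < r \<Longrightarrow> \<exists>s\<in>S. mdist M m s < r"
  unfolding dist_to_def by (subst (asm) cINF_less_iff) (auto intro!: bdd_belowI[of _ 0])

lemma dist_to_Lipschitz:
  assumes "S \<noteq> {}" "S \<subseteq> mspace M" "m \<in> mspace M" "m' \<in> mspace M"
  shows "dist_to M S m \<le> dist_to M S m' + mdist M m m'"
proof -
  have "dist_to M S m - mdist M m m' \<le> mdist M m' s" if "s \<in> S" for s
    using dist_to_le[OF that, of M m] mdist_triangle[of m M m' s] assms that by auto
  then have "dist_to M S m - mdist M m m' \<le> dist_to M S m'"
    unfolding dist_to_def[of M S m'] using assms(1) by (intro cINF_greatest) auto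
  then show ?thesis by simp
qed

lemma dist_to_pos:
  assumes "closedin (mtopology_of M) S" "S \<noteq> {}" "m \<in> mspace M" "m \<notin> S"
  shows "0 < dist_to M S m"
proof -
  obtain \<rho> where \<rho>: "0 < \<rho>" "disjnt S (mball_of M m \<rho>)"
    using assms unfolding mtopology_of_def mball_of_def
    by (metis Metric_space.closedin_metric Metric_space_mspace_mdist DiffI)
  have "S \<subseteq> mspace M" using closedin_subset[OF assms(1)] by simp
  then have "\<rho> \<le> mdist M m s" if "s \<in> S" for s
    using \<rho>(2) that assms(3) by (force simp: disjnt_iff)
  then have "\<rho> \<le> dist_to M S m" unfolding dist_to_def using assms(2) by (intro cINF_greatest) auto
  then show ?thesis using \<rho>(1) by simp
qed

text \<open>\<open>V A t\<close> is a set that has grown from \<open>A\<close> for a time \<open>t\<close>. A point \<open>m\<close> at distance \<open>\<delta> m\<close> from the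
  copy of the hyperspace is sent to the union of the sets \<open>V A (c * v m A)\<close> over all \<open>A\<close> with \<open>v
  m A > 0\<close>, where \<open>v m A = 2 * \<delta> m - mdist M m (e A)\<close>.

  Near the copy, all these \<open>A\<close> are close to each other and the times are short, so the image is
  close to \<open>m\<close>. For continuity, a change of \<open>m\<close> by \<open>h\<close> changes the times by at most \<open>3 * c * h\<close>.
  The only difficulty is a set \<open>A\<close> whose time drops to 0, since its whole contribution
  disappears. But a set \<open>A'\<close> that is almost nearest to \<open>m\<close> is active for a time of at least \<open>c *
  (3 / 4) * \<delta> m\<close>, and then it has absorbed \<open>A\<close>, by assumption \<open>absorb\<close>.\<close>

lemma hyperspace_flow_retraction:
  fixes M :: "'m metric" and V :: "'a set \<Rightarrow> real \<Rightarrow> 'a set"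
  assumes emb: "closed_isometric_embedding (hyperspace X) M e" and X: "mspace X \<noteq> {}"
    and w: "gauge_fun w" and c: "0 < c"
    and V0: "\<And>A. A \<in> closed_sets X \<Longrightarrow> V A 0 = A"
    and VX: "\<And>A t. A \<in> closed_sets X \<Longrightarrow> V A t \<subseteq> mspace X"
    and mono: "\<And>A t t'. A \<in> closed_sets X \<Longrightarrow> 0 \<le> t \<Longrightarrow> t \<le> t' \<Longrightarrow> V A t \<subseteq> V A t'"
    and grow: "\<And>A t t' y. A \<in> closed_sets X \<Longrightarrow> 0 \<le> t \<Longrightarrow> t \<le> t' \<Longrightarrow> y \<in> V A t' \<Longrightarrow>
      \<exists>x\<in>V A t. mdist X y x \<le> w (2 * (t' - t))"
    and U: "U \<subseteq> mspace M" "e ` closed_sets X \<subseteq> U"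
    and absorb: "\<And>m A A'. m \<in> U - e ` closed_sets X \<Longrightarrow> A \<in> closed_sets X \<Longrightarrow> A' \<in> closed_sets X \<Longrightarrow>
      mdist (hyperspace X) A A' < 4 * dist_to M (e ` closed_sets X) m \<Longrightarrow>
      A \<subseteq> V A' (c * (3 / 4 * dist_to M (e ` closed_sets X) m))"
  shows "\<exists>r. retraction_onto M U (e ` closed_sets X) r \<and> uniformly_continuous_at_set M U (e ` closed_sets X) r"
proof -
  let ?Y = "hyperspace X" and ?S = "e ` closed_sets X"
  define \<delta> where "\<delta> = dist_to M ?S"
  obtain x0 where "x0 \<in> mspace X" using X by blast
  then have "{x0} \<in> closed_sets X" by (rule singleton_in_closed_sets)
  then have Sne: "?S \<noteq> {}" by auto
  have emem: "e A \<in> mspace M" if "A \<in> closed_sets X" for A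
    using emb that by (auto simp: closed_isometric_embedding_def)
  then have SM: "?S \<subseteq> mspace M" by blast
  have iso: "mdist M (e A) (e B) = mdist ?Y A B" if "A \<in> closed_sets X" "B \<in> closed_sets X" for A B
    using emb that by (simp add: closed_isometric_embedding_def)
  have closed: "closedin (mtopology_of M) ?S" using emb by (simp add: closed_isometric_embedding_def)
  have \<delta>pos: "0 < \<delta> m" if "m \<in> U - ?S" for m
    unfolding \<delta>_def using dist_to_pos[OF closed Sne] that U(1) by blast
  have tri: "mdist ?Y A B \<le> mdist M m (e A) + mdist M m (e B)"
    if "A \<in> closed_sets X" "B \<in> closed_sets X" "m \<in> mspace M" for A B m
    using mdist_triangle[of "e A" M m "e B"] that emem iso by (simp add: mdist_commute)
  \<comment> \<open>the radius \<open>2 * \<delta> m\<close> leaves room for sets \<open>A'\<close> with \<open>mdist M m (e A') < 5 / 4 * \<delta> m\<close>, whose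
    value \<open>v m A'\<close> is at least \<open>3 / 4 * \<delta> m\<close>\<close>
  define v where "v m A = 2 * \<delta> m - mdist M m (e A)" for m A
  define act where "act m = {A \<in> closed_sets X. 0 < v m A}" for m
  define G where "G m = (\<Union>A\<in>act m. V A (c * v m A))" for m
  have act_ne: "\<exists>A\<in>closed_sets X. mdist M m (e A) < 5 / 4 * \<delta> m" if "m \<in> U - ?S" for m
    using dist_to_less[OF Sne, of M m "5 / 4 * \<delta> m"] \<delta>pos[OF that] unfolding \<delta>_def by auto
  have actD: "A \<in> closed_sets X" "mdist M m (e A) < 2 * \<delta> m" "0 < v m A" "v m A \<le> 2 * \<delta> m" if "A \<in> act m" for A m
    using that by (auto simp: act_def v_def)
  have GX: "G m \<subseteq> mspace X" for m using VX by (auto simp: G_def act_def)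
  have subG: "A \<subseteq> G m" if A: "A \<in> act m" for A m
  proof -
    have "V A 0 \<subseteq> V A (c * v m A)" using actD[OF A] c by (intro mono) auto
    then show ?thesis using V0 actD(1)[OF A] A by (auto simp: G_def)
  qed
  have Gne: "\<exists>A. A \<in> act m" if "m \<in> U - ?S" for m
    using act_ne[OF that] \<delta>pos[OF that] by (force simp: act_def v_def)
  have GY: "mtopology_of X closure_of G m \<in> closed_sets X" if m: "m \<in> U - ?S" for m
  proof (rule mclosure_in_closed_sets[OF GX])
    obtain A where A: "A \<in> act m" using Gne[OF m] by blast
    then show "G m \<noteq> {}" using subG[OF A] closed_sets_nonempty[OF actD(1)[OF A]] by blast
  qed
  have "\<exists>r. retraction_onto M U (e ` mspace ?Y) r \<and> uniformly_continuous_at_set M U (e ` mspace ?Y) r"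
  proof (rule near_retraction[where G = "\<lambda>m. mtopology_of X closure_of G m", OF emb U(1)])
    show "e ` mspace ?Y \<subseteq> U" using U(2) by simp
    show "mtopology_of X closure_of G m \<in> mspace ?Y" if "m \<in> U - e ` mspace ?Y" for m
      using GY that by simp
  next
    fix \<epsilon> :: real assume \<epsilon>: "0 < \<epsilon>"
    obtain d where d: "0 < d" "\<And>t. 0 \<le> t \<Longrightarrow> t \<le> d \<Longrightarrow> w t < \<epsilon> / 2"
      using gauge_fun_small[OF w, of "\<epsilon> / 2"] \<epsilon> by auto
    define \<eta> where "\<eta> = min (1 / 3) (min (\<epsilon> / 6) (d / (4 * c)))"
    have \<eta>: "0 < \<eta>" "3 * \<eta> \<le> 1" "3 * \<eta> \<le> \<epsilon> / 2" "\<eta> \<le> d / (4 * c)" using \<epsilon> d(1) c by (auto simp: \<eta>_def)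
    have wd: "w (4 * c * \<eta>) < \<epsilon> / 2" using \<eta> c d(1) by (intro d(2)) (auto simp: field_simps)
    have "mdist ?Y (mtopology_of X closure_of G m) B < \<epsilon>"
      if B: "B \<in> closed_sets X" and m: "m \<in> U - ?S" and mB: "mdist M m (e B) < \<eta>" for B m
    proof -
      have \<delta>\<eta>: "\<delta> m < \<eta>" unfolding \<delta>_def using dist_to_le[of "e B" ?S M m] B mB by simp
      have AB: "mdist ?Y A B < 3 * \<eta>" if "A \<in> act m" for A
        using tri[OF actD(1)[OF that] B, of m] actD(2)[OF that] mB \<delta>\<eta> m U(1) by auto
      have "mdist ?Y (mtopology_of X closure_of G m) (mtopology_of X closure_of B) \<le> 3 * \<eta> + w (4 * c * \<eta>)"
      proof (rule mdist_hyperspace_closure_leI[OF _ GX closed_sets_subset[OF B]])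
        show "0 \<le> 3 * \<eta> + w (4 * c * \<eta>)" using \<eta> c gauge_fun_nonneg[OF w, of "4 * c * \<eta>"] by simp
        fix y r assume y: "y \<in> G m" and r: "3 * \<eta> + w (4 * c * \<eta>) < r"
        obtain A where A: "A \<in> act m" "y \<in> V A (c * v m A)" using y by (auto simp: G_def)
        note AD = actD[OF A(1)]
        obtain x where x: "x \<in> V A 0" "mdist X y x \<le> w (2 * (c * v m A - 0))"
          using grow[OF AD(1), of 0 "c * v m A" y] A(2) AD(3) c by auto
        have xA: "x \<in> A" using x(1) V0[OF AD(1)] by simp
        obtain b where b: "b \<in> B" "mdist X x b < 3 * \<eta>"
          using mdist_hyperspace_lessD[OF AB[OF A(1)] \<eta>(2) xA] by blast
        have "c * v m A \<le> c * (2 * \<eta>)" using AD(4) \<delta>\<eta> c by (intro mult_left_mono) auto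
        then have "w (2 * (c * v m A - 0)) \<le> w (4 * c * \<eta>)"
          using AD(3) c by (intro gauge_fun_mono[OF w]) auto
        then have "mdist X y b < r"
          using mdist_triangle[of y X x b] x(2) b r GX[of m] y xA b(1) closed_sets_subset[OF AD(1)] closed_sets_subset[OF B] by fastforce
        then show "\<exists>b\<in>B. mdist X y b < r" using b(1) by blast
      next
        fix b r assume b: "b \<in> B" and r: "3 * \<eta> + w (4 * c * \<eta>) < r"
        obtain A where A: "A \<in> act m" using Gne[OF m] by blast
        have "mdist ?Y B A < 3 * \<eta>" using AB[OF A] by (simp add: mdist_commute)
        then obtain a where a: "a \<in> A" "mdist X b a < 3 * \<eta>"
          using mdist_hyperspace_lessD[OF _ \<eta>(2) b] by blast
        have "mdist X b a < r" using a(2) r gauge_fun_nonneg[OF w, of "4 * c * \<eta>"] \<eta>(1) c by simp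
        then show "\<exists>a\<in>G m. mdist X b a < r" using a(1) subG[OF A] by blast
      qed
      then show ?thesis using closedin_mclosure_eq[OF B] wd \<eta>(3) by simp
    qed
    then show "\<exists>\<eta>>0. \<forall>a\<in>mspace ?Y. \<forall>m\<in>U - e ` mspace ?Y. mdist M m (e a) < \<eta> \<longrightarrow>
        mdist ?Y (mtopology_of X closure_of G m) a < \<epsilon>"
      using \<eta>(1) by auto
  next
    fix m and \<epsilon> :: real assume "m \<in> U - e ` mspace ?Y" and \<epsilon>: "0 < \<epsilon>"
    then have m: "m \<in> U - ?S" by simp
    obtain d where d: "0 < d" "\<And>t. 0 \<le> t \<Longrightarrow> t \<le> d \<Longrightarrow> w t < \<epsilon>" using gauge_fun_small[OF w \<epsilon>] by blast
    have one_way: "\<exists>y'\<in>G m'. mdist X y y' \<le> w (2 * (c * (3 * mdist M m m')))"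
      if m: "m \<in> U - ?S" and m': "m' \<in> U - ?S" and h: "mdist M m m' \<le> \<delta> m' / 12" and y: "y \<in> G m" for m m' y
    proof -
      let ?h = "mdist M m m'"
      obtain A where A: "A \<in> act m" "y \<in> V A (c * v m A)" using y by (auto simp: G_def)
      note AD = actD[OF A(1)]
      have mM: "m \<in> mspace M" "m' \<in> mspace M" using m m' U(1) by auto
      have \<delta>L: "\<delta> m \<le> \<delta> m' + ?h" unfolding \<delta>_def by (rule dist_to_Lipschitz[OF Sne SM mM])
      have vv: "v m A \<le> v m' A + 3 * ?h"
        using \<delta>L mdist_triangle[of m' M m "e A"] mM emem[OF AD(1)] by (simp add: v_def mdist_commute)
      show ?thesis
      proof (cases "0 < v m' A")
        case True
        then have A': "A \<in> act m'" using AD(1) by (simp add: act_def)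
        define u where "u = min (v m' A) (v m A)"
        have u: "0 \<le> u" "u \<le> v m' A" "u \<le> v m A" "v m A - u \<le> 3 * ?h" using True AD(3) vv mdist_nonneg[of M m m'] by (auto simp: u_def min_def)
        have "\<exists>x\<in>V A (c * u). mdist X y x \<le> w (2 * (c * v m A - c * u))"
          using A(2) u c by (intro grow[OF AD(1)]) (auto simp: mult_left_mono)
        then obtain x where x: "x \<in> V A (c * u)" "mdist X y x \<le> w (2 * (c * v m A - c * u))" by blast
        have "w (2 * (c * v m A - c * u)) \<le> w (2 * (c * (3 * ?h)))"
          unfolding right_diff_distrib[symmetric] using u c
          by (intro gauge_fun_mono[OF w] mult_left_mono mult_nonneg_nonneg) auto
        moreover have "x \<in> G m'"
          using x(1) mono[OF AD(1), of "c * u" "c * v m' A"] u c A' by (auto simp: G_def mult_left_mono)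
        ultimately show ?thesis using x(2) by (meson order_trans)
      next
        case False
        then have v3: "v m A \<le> 3 * ?h" using vv by simp
        obtain x where x: "x \<in> V A 0" "mdist X y x \<le> w (2 * (c * v m A - 0))"
          using grow[OF AD(1), of 0 "c * v m A" y] A(2) AD(3) c by auto
        have "c * v m A \<le> c * (3 * ?h)" using v3 c by (intro mult_left_mono) auto
        then have le: "w (2 * (c * v m A - 0)) \<le> w (2 * (c * (3 * ?h)))"
          using AD(3) c by (intro gauge_fun_mono[OF w]) auto
        obtain A' where A': "A' \<in> closed_sets X" "mdist M m' (e A') < 5 / 4 * \<delta> m'" using act_ne[OF m'] by blast
        have v': "3 / 4 * \<delta> m' \<le> v m' A'" using A'(2) by (simp add: v_def)
        then have act': "A' \<in> act m'" using A'(1) \<delta>pos[OF m'] by (simp add: act_def)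
        have "mdist ?Y A A' < 4 * \<delta> m'"
        proof -
          have "mdist ?Y A A' \<le> mdist M m (e A) + mdist M m (e A')" by (rule tri[OF AD(1) A'(1) mM(1)])
          moreover have "mdist M m (e A') \<le> ?h + mdist M m' (e A')"
            using mdist_triangle[of m M m' "e A'"] mM emem[OF A'(1)] by simp
          ultimately show ?thesis using AD(2) A'(2) \<delta>L h \<delta>pos[OF m'] by linarith
        qed
        then have "A \<subseteq> V A' (c * (3 / 4 * \<delta> m'))" unfolding \<delta>_def by (intro absorb[OF m' AD(1) A'(1)])
        also have "\<dots> \<subseteq> V A' (c * v m' A')"
          using v' c \<delta>pos[OF m'] by (intro mono[OF A'(1)]) (auto simp: mult_left_mono)
        also have "\<dots> \<subseteq> G m'" using act' by (auto simp: G_def)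
        finally have "x \<in> G m'" using x(1) V0[OF AD(1)] by blast
        then show ?thesis using x(2) le by (meson order_trans)
      qed
    qed
    define \<eta> where "\<eta> = min (\<delta> m / 24) (d / (6 * c))"
    have \<eta>: "0 < \<eta>" "\<eta> \<le> \<delta> m / 24" "\<eta> \<le> d / (6 * c)" using \<delta>pos[OF m] d(1) c by (auto simp: \<eta>_def)
    have "mdist ?Y (mtopology_of X closure_of G m) (mtopology_of X closure_of G m') < \<epsilon>"
      if m': "m' \<in> U - ?S" and h: "mdist M m m' < \<eta>" for m'
    proof -
      let ?r = "w (2 * (c * (3 * mdist M m m')))"
      have mM: "m \<in> mspace M" "m' \<in> mspace M" using m m' U(1) by auto
      have "\<delta> m \<le> \<delta> m' + mdist M m m'" unfolding \<delta>_def by (rule dist_to_Lipschitz[OF Sne SM mM])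
      then have h': "mdist M m m' \<le> \<delta> m' / 12" "mdist M m' m \<le> \<delta> m / 12"
        using h \<eta>(2) \<delta>pos[OF m] by (auto simp: mdist_commute)
      have "mdist ?Y (mtopology_of X closure_of G m) (mtopology_of X closure_of G m') \<le> ?r"
      proof (rule mdist_hyperspace_closure_leI[OF _ GX GX])
        show "0 \<le> ?r" using c by (intro gauge_fun_nonneg[OF w]) auto
        show "\<exists>y'\<in>G m'. mdist X y y' < r" if "y \<in> G m" "?r < r" for y r
          using one_way[OF m m' h'(1) that(1)] that(2) by (meson order_le_less_trans)
        show "\<exists>y'\<in>G m. mdist X y y' < r" if "y \<in> G m'" "?r < r" for y r
          using one_way[OF m' m h'(2) that(1)] that(2) by (metis mdist_commute order_le_less_trans)
      qed
      also have "?r < \<epsilon>"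
      proof (rule d(2))
        have "6 * c * mdist M m m' \<le> 6 * c * \<eta>" using h c by (intro mult_left_mono) auto
        also have "\<dots> \<le> d" using \<eta>(3) c by (simp add: field_simps)
        finally show "2 * (c * (3 * mdist M m m')) \<le> d" by (simp add: algebra_simps)
      qed (use c in auto)
      finally show ?thesis .
    qed
    then show "\<exists>\<eta>>0. \<forall>m'\<in>U - e ` mspace ?Y. mdist M m m' < \<eta> \<longrightarrow>
        mdist ?Y (mtopology_of X closure_of G m) (mtopology_of X closure_of G m') < \<epsilon>"
      using \<eta>(1) by auto
  qed
  then show ?thesis by simp
qed

definition trace_hull :: "(real \<times> real set \<times> (real \<Rightarrow> 'a)) set \<Rightarrow> real \<Rightarrow> 'a set" where
  "trace_hull F t = {f v | T D f v. (T, D, f) \<in> F \<and> v \<in> D \<and> v \<le> t}"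

lemma trace_hullI: "(T, D, f) \<in> F \<Longrightarrow> v \<in> D \<Longrightarrow> v \<le> t \<Longrightarrow> f v \<in> trace_hull F t"
  unfolding trace_hull_def by blast

lemma trace_hull_mono: "t \<le> t' \<Longrightarrow> trace_hull F t \<subseteq> trace_hull F t'"
  unfolding trace_hull_def by force

text \<open>A point visited by the time \<open>t'\<close> is traced back to a time at which its trace is defined and
  which does not exceed \<open>t\<close>. Since the domain is only dense, this time may have to precede \<open>t\<close>,
  by less than \<open>t' - t\<close>; this is the factor 2.\<close>

lemma trace_hull_grow:
  assumes F: "\<And>T D f. (T, D, f) \<in> F \<Longrightarrow> is_trace X w T D f" and w: "gauge_fun w"
    and t: "0 \<le> t" "t \<le> t'" and y: "y \<in> trace_hull F t'"
  shows "\<exists>x\<in>trace_hull F t. mdist X y x \<le> w (2 * (t' - t))"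
proof -
  obtain T D f v where v: "(T, D, f) \<in> F" "v \<in> D" "v \<le> t'" "y = f v"
    using y unfolding trace_hull_def by blast
  have D: "D \<subseteq> {0..T}" "{0..T} \<subseteq> closure D" "0 \<in> D" "f ` D \<subseteq> mspace X"
    and fw: "\<And>u v. u \<in> D \<Longrightarrow> v \<in> D \<Longrightarrow> mdist X (f u) (f v) \<le> w \<bar>u - v\<bar>"
    using F[OF v(1)] by (auto simp: is_trace_def)
  have "\<exists>u\<in>D. u \<le> t \<and> \<bar>v - u\<bar> \<le> 2 * (t' - t)"
  proof (cases "v \<le> t")
    case True
    then show ?thesis using v(2) t by (intro bexI[of _ v]) auto
  next
    case False
    have vT: "0 \<le> v" "v \<le> T" using v(2) D(1) by auto
    show ?thesis
    proof (cases "t = 0")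
      case True
      then show ?thesis using D(3) v(3) vT by (intro bexI[of _ 0]) auto
    next
      case t0: False
      have "0 \<le> max 0 (t - (t' - t))" "max 0 (t - (t' - t)) < t" "t \<le> T"
        using t t0 False v(3) vT by auto
      from dense_pick[OF D(2) this] obtain u where "u \<in> D" "max 0 (t - (t' - t)) < u" "u < t" by blast
      then show ?thesis using False v(3) by (intro bexI[of _ u]) auto
    qed
  qed
  then obtain u where u: "u \<in> D" "u \<le> t" "\<bar>v - u\<bar> \<le> 2 * (t' - t)" by blast
  have "w \<bar>v - u\<bar> \<le> w (2 * (t' - t))" by (rule gauge_fun_mono[OF w _ u(3)]) simp
  then have "mdist X y (f u) \<le> w (2 * (t' - t))"
    using fw[OF v(2) u(1)] v(4) by simp
  then show ?thesis using v(1) u(1,2) unfolding trace_hull_def by blast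
qed

definition flow :: "'a metric \<Rightarrow> (real \<Rightarrow> real) \<Rightarrow> 'a set \<Rightarrow> real \<Rightarrow> 'a set" where
  "flow X w A = trace_hull {(T, D, f). is_trace X w T D f \<and> f 0 \<in> A}"

lemma flow_joined:
  assumes "x \<in> A" "trace_joined X w s x y" "s \<le> t"
  shows "y \<in> flow X w A t"
proof -
  obtain D f where f: "is_trace X w s D f" "f 0 = x" "f s = y" using assms(2) by (auto simp: trace_joined_def)
  then have "(s, D, f) \<in> {(T, D, f). is_trace X w T D f \<and> f 0 \<in> A}" "s \<in> D"
    using assms(1) by (auto simp: is_trace_def)
  then show ?thesis unfolding flow_def trace_hull_def using f(3) assms(3) by blast
qed

lemma trace_joined_refl: "gauge_fun w \<Longrightarrow> x \<in> mspace X \<Longrightarrow> trace_joined X w 0 x x"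
  unfolding trace_joined_def
  by (intro exI[of _ "{0}"] exI[of _ "\<lambda>_. x"]) (simp add: is_trace_def)

lemma trace_joined_modulus_mono:
  "trace_joined X w t x y \<Longrightarrow> (\<And>s. 0 \<le> s \<Longrightarrow> w s \<le> w' s) \<Longrightarrow> trace_joined X w' t x y"
proof -
  assume "trace_joined X w t x y" and le: "\<And>s. 0 \<le> s \<Longrightarrow> w s \<le> w' s"
  then obtain D f where f: "is_trace X w t D f" "f 0 = x" "f t = y" by (auto simp: trace_joined_def)
  have "mdist X (f u) (f v) \<le> w' \<bar>u - v\<bar>" if "u \<in> D" "v \<in> D" for u v
  proof -
    have "mdist X (f u) (f v) \<le> w \<bar>u - v\<bar>" using f(1) that by (simp add: is_trace_def)
    also have "\<dots> \<le> w' \<bar>u - v\<bar>" by (rule le) simp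
    finally show ?thesis .
  qed
  then have "is_trace X w' t D f" using f(1) by (simp add: is_trace_def)
  then show "trace_joined X w' t x y" using f by (auto simp: trace_joined_def)
qed

lemma flow_0:
  assumes w: "gauge_fun w" and A: "A \<subseteq> mspace X"
  shows "flow X w A 0 = A"
proof
  show "flow X w A 0 \<subseteq> A"
    unfolding flow_def trace_hull_def is_trace_def by force
  show "A \<subseteq> flow X w A 0"
  proof
    fix x assume x: "x \<in> A"
    then have "x \<in> mspace X" using A by blast
    from flow_joined[OF x trace_joined_refl[OF w this] order_refl] show "x \<in> flow X w A 0" .
  qed
qed

lemma flow_retraction:
  assumes emb: "closed_isometric_embedding (hyperspace X) M e" and X: "mspace X \<noteq> {}"
    and w: "gauge_fun w" and c: "0 < c" and U: "U \<subseteq> mspace M" "e ` closed_sets X \<subseteq> U"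
    and absorb: "\<And>m A A'. m \<in> U - e ` closed_sets X \<Longrightarrow> A \<in> closed_sets X \<Longrightarrow> A' \<in> closed_sets X \<Longrightarrow>
      mdist (hyperspace X) A A' < 4 * dist_to M (e ` closed_sets X) m \<Longrightarrow>
      A \<subseteq> flow X w A' (c * (3 / 4 * dist_to M (e ` closed_sets X) m))"
  shows "\<exists>r. retraction_onto M U (e ` closed_sets X) r \<and> uniformly_continuous_at_set M U (e ` closed_sets X) r"
proof (rule hyperspace_flow_retraction[where V = "flow X w", OF emb X w c])
  show "flow X w A 0 = A" if "A \<in> closed_sets X" for A
    using flow_0[OF w closed_sets_subset[OF that]] .
  show "flow X w A t \<subseteq> mspace X" for A t
    unfolding flow_def trace_hull_def is_trace_def by force
  show "flow X w A t \<subseteq> flow X w A t'" if "t \<le> t'" for A t t'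
    unfolding flow_def by (rule trace_hull_mono[OF that])
  show "\<exists>x\<in>flow X w A t. mdist X y x \<le> w (2 * (t' - t))" if "0 \<le> t" "t \<le> t'" "y \<in> flow X w A t'" for A t t' y
    using that unfolding flow_def by (intro trace_hull_grow[OF _ w]) auto
qed (use U absorb in auto)

text \<open>Two closed sets at distance below \<open>4 * \<delta> m \<le> \<epsilon>\<close> absorb each other by traces of duration below \<open>4
  * \<delta> m\<close>, and \<open>6 * (3 / 4) > 4\<close>.\<close>

theorem trace_connected_imp_uniform_ANR_hyperspace:
  assumes tc: "trace_connected X w \<epsilon>" and X: "mspace X \<noteq> {}"
  shows "uniform_ANR TYPE('m) (hyperspace X)"
  unfolding uniform_ANR_def
proof (intro allI impI)
  fix M :: "'m metric" and e assume emb: "closed_isometric_embedding (hyperspace X) M e"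
  let ?S = "e ` closed_sets X"
  have w: "gauge_fun w" and \<epsilon>: "0 < \<epsilon>" using tc by (auto simp: trace_connected_def)
  define \<kappa> where "\<kappa> = min \<epsilon> 1 / 4"
  have \<kappa>: "0 < \<kappa>" "4 * \<kappa> \<le> \<epsilon>" "4 * \<kappa> \<le> 1" using \<epsilon> by (auto simp: \<kappa>_def)
  define U where "U = {m \<in> mspace M. \<exists>s\<in>?S. mdist M m s < \<kappa>}"
  have SM: "?S \<subseteq> mspace M" using emb by (auto simp: closed_isometric_embedding_def)
  have "s \<in> U" if "s \<in> ?S" for s
  proof -
    have "s \<in> mspace M" using that SM by blast
    then show ?thesis using that \<kappa>(1) unfolding U_def by (intro CollectI conjI bexI[of _ s]) auto
  qed
  then have SU: "?S \<subseteq> U" by blast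
  have "\<exists>r. retraction_onto M U ?S r \<and> uniformly_continuous_at_set M U ?S r"
  proof (rule flow_retraction[OF emb X w, of 6])
    fix m A A' assume m: "m \<in> U - ?S" and A: "A \<in> closed_sets X" "A' \<in> closed_sets X"
      and AA': "mdist (hyperspace X) A A' < 4 * dist_to M ?S m"
    have "dist_to M ?S m < \<kappa>" using m dist_to_le[of _ ?S M m] unfolding U_def by fastforce
    then have small: "4 * dist_to M ?S m \<le> 1" "4 * dist_to M ?S m \<le> \<epsilon>" using \<kappa> by auto
    show "A \<subseteq> flow X w A' (6 * (3 / 4 * dist_to M ?S m))"
    proof
      fix x assume x: "x \<in> A"
      obtain x' where x': "x' \<in> A'" "mdist X x x' < 4 * dist_to M ?S m"
        using mdist_hyperspace_lessD[OF AA' small(1) x] by blast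
      have "x \<in> mspace X" "x' \<in> mspace X" using x x'(1) A closed_sets_subset by blast+
      then have "trace_joined X w (mdist X x' x) x' x"
        using x'(2) small(2) by (intro trace_connectedD[OF tc]) (auto simp: mdist_commute)
      then show "x \<in> flow X w A' (6 * (3 / 4 * dist_to M ?S m))"
        by (rule flow_joined[OF x'(1)]) (use x'(2) mdist_nonneg[of X x' x] mdist_commute[of X x x'] in linarith)
    qed
  qed (use SU in \<open>auto simp: U_def\<close>)
  then obtain r where r: "retraction_onto M U ?S r" "uniformly_continuous_at_set M U ?S r" by blast
  have nb: "{x \<in> mspace M. set_dist M x ?S < ennreal \<kappa>} \<subseteq> U"
  proof
    fix x assume x: "x \<in> {x \<in> mspace M. set_dist M x ?S < ennreal \<kappa>}"
    then obtain s where "s \<in> ?S" "ennreal (mdist M x s) < ennreal \<kappa>"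
      unfolding set_dist_def INF_less_iff by blast
    then show "x \<in> U" using x \<kappa>(1) unfolding U_def by (auto simp: ennreal_less_iff)
  qed
  have UM: "U \<subseteq> mspace M" by (auto simp: U_def)
  show "\<exists>U r. uniform_neighborhood M (e ` mspace (hyperspace X)) U \<and>
      retraction_onto M U (e ` mspace (hyperspace X)) r \<and>
      uniformly_continuous_at_set M U (e ` mspace (hyperspace X)) r"
    unfolding uniform_neighborhood_def mspace_hyperspace using \<kappa>(1) UM r nb
    by (intro exI[of _ U] exI[of _ r] conjI exI[of _ \<kappa>]) simp_all
qed

text \<open>The sum of the moduli is a modulus for the concatenation since both are monotone.\<close>

lemma trace_concat:
  assumes f: "is_trace X w T D f" and g: "is_trace X w' T' D' g" and fg: "f T = g 0"
    and w: "gauge_fun w" "gauge_fun w'"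
  shows "is_trace X (\<lambda>t. w t + w' t) (T + T') (D \<union> (\<lambda>v. v + T) ` D') (\<lambda>v. if v \<le> T then f v else g (v - T))"
proof -
  have D: "0 \<le> T" "D \<subseteq> {0..T}" "{0..T} \<subseteq> closure D" "0 \<in> D" "T \<in> D" "\<And>u. u \<in> D \<Longrightarrow> f u \<in> mspace X"
    and fw: "\<And>u v. u \<in> D \<Longrightarrow> v \<in> D \<Longrightarrow> mdist X (f u) (f v) \<le> w \<bar>u - v\<bar>"
    using f by (auto simp: is_trace_def)
  have D': "0 \<le> T'" "D' \<subseteq> {0..T'}" "{0..T'} \<subseteq> closure D'" "0 \<in> D'" "T' \<in> D'" "\<And>u. u \<in> D' \<Longrightarrow> g u \<in> mspace X"
    and gw: "\<And>u v. u \<in> D' \<Longrightarrow> v \<in> D' \<Longrightarrow> mdist X (g u) (g v) \<le> w' \<bar>u - v\<bar>"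
    using g by (auto simp: is_trace_def)
  let ?h = "\<lambda>v. if v \<le> T then f v else g (v - T)"
  have hg: "?h (v + T) = g v" if "v \<in> D'" for v
    using that D'(2) fg by (cases "v = 0") auto
  have hf: "?h u = f u" if "u \<in> D" for u using that D(2) by auto
  have dense: "x \<in> closure (D \<union> (\<lambda>v. v + T) ` D')" if x: "x \<in> {0..T + T'}" for x
  proof (cases "x \<le> T")
    case True
    then have "x \<in> closure D" using D(3) x by auto
    then show ?thesis using closure_mono[of D "D \<union> (\<lambda>v. v + T) ` D'"] by blast
  next
    case False
    show ?thesis
      unfolding closure_approachable
    proof (intro allI impI)
      fix e :: real assume "0 < e"
      have "x - T \<in> closure D'" using D'(3) x False by auto
      then obtain y where "y \<in> D'" "dist y (x - T) < e" using \<open>0 < e\<close> closure_approachable by blast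
      then show "\<exists>y\<in>D \<union> (\<lambda>v. v + T) ` D'. dist y x < e"
        by (intro bexI[of _ "y + T"]) (auto simp: dist_real_def algebra_simps)
    qed
  qed
  have cross: "mdist X (f u) (g v) \<le> w \<bar>u - (v + T)\<bar> + w' \<bar>u - (v + T)\<bar>" if "u \<in> D" "v \<in> D'" for u v
  proof -
    have uv: "0 \<le> u" "u \<le> T" "0 \<le> v" using that D(2) D'(2) by auto
    have "mdist X (f u) (g v) \<le> mdist X (f u) (f T) + mdist X (g 0) (g v)"
      using mdist_triangle[of "f u" X "f T" "g v"] D D' that fg by simp
    also have "\<dots> \<le> w \<bar>u - T\<bar> + w' \<bar>0 - v\<bar>" using fw[OF that(1) D(5)] gw[OF D'(4) that(2)] by simp
    also have "\<dots> \<le> w \<bar>u - (v + T)\<bar> + w' \<bar>u - (v + T)\<bar>"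
      using uv by (intro add_mono gauge_fun_mono[OF w(1)] gauge_fun_mono[OF w(2)]) auto
    finally show ?thesis .
  qed
  have nn: "0 \<le> w \<bar>r\<bar>" "0 \<le> w' \<bar>r\<bar>" for r
    using gauge_fun_nonneg[OF w(1), of "\<bar>r\<bar>"] gauge_fun_nonneg[OF w(2), of "\<bar>r\<bar>"] by simp_all
  have mod: "mdist X (?h a) (?h b) \<le> w \<bar>a - b\<bar> + w' \<bar>a - b\<bar>"
    if ab: "a \<in> D \<union> (\<lambda>v. v + T) ` D'" "b \<in> D \<union> (\<lambda>v. v + T) ` D'" for a b
  proof (cases "a \<in> D")
    case aD: True
    show ?thesis
    proof (cases "b \<in> D")
      case True
      have "mdist X (f a) (f b) \<le> w \<bar>a - b\<bar> + w' \<bar>a - b\<bar>"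
        using fw[OF aD True] nn(2)[of "a - b"] by linarith
      then show ?thesis by (simp only: hf[OF aD] hf[OF True])
    next
      case False
      then obtain v where v: "v \<in> D'" "b = v + T" using ab by blast
      show ?thesis unfolding v(2) hg[OF v(1)] hf[OF aD] by (rule cross[OF aD v(1)])
    qed
  next
    case False
    then obtain u where u: "u \<in> D'" "a = u + T" using ab by blast
    show ?thesis
    proof (cases "b \<in> D")
      case True
      show ?thesis unfolding u(2) hg[OF u(1)] hf[OF True]
        using cross[OF True u(1)] by (simp only: mdist_commute[of X "g u"] abs_minus_commute[of "u + T"])
    next
      case False
      then obtain v where v: "v \<in> D'" "b = v + T" using ab by blast
      have "mdist X (g u) (g v) \<le> w \<bar>u - v\<bar> + w' \<bar>u - v\<bar>"
        using gw[OF u(1) v(1)] nn(1)[of "u - v"] by linarith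
      then show ?thesis unfolding u(2) v(2) hg[OF u(1)] hg[OF v(1)] by simp
    qed
  qed
  have mem: "?h a \<in> mspace X" if aD: "a \<in> D \<union> (\<lambda>v. v + T) ` D'" for a
  proof (cases "a \<in> D")
    case True
    show ?thesis unfolding hf[OF True] by (rule D(6)[OF True])
  next
    case False
    then obtain v where v: "v \<in> D'" "a = v + T" using aD by blast
    show ?thesis unfolding v(2) hg[OF v(1)] by (rule D'(6)[OF v(1)])
  qed
  have "D \<union> (\<lambda>v. v + T) ` D' \<subseteq> {0..T + T'}" using D(1,2) D'(1,2) by force
  moreover have "T + T' \<in> D \<union> (\<lambda>v. v + T) ` D'" using D'(5) by (auto simp: add.commute)
  moreover have "?h ` (D \<union> (\<lambda>v. v + T) ` D') \<subseteq> mspace X" using mem by blast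
  moreover have "{0..T + T'} \<subseteq> closure (D \<union> (\<lambda>v. v + T) ` D')" using dense by blast
  moreover have "0 \<in> D \<union> (\<lambda>v. v + T) ` D'" using D(4) by blast
  moreover have "0 \<le> T + T'" using D(1) D'(1) by simp
  ultimately show ?thesis
    unfolding is_trace_def using mod by blast
qed

lemma trace_joined_trans:
  assumes "trace_joined X w t x y" "trace_joined X w' s y z" "gauge_fun w" "gauge_fun w'"
  shows "trace_joined X (\<lambda>r. w r + w' r) (t + s) x z"
proof -
  obtain D f where f: "is_trace X w t D f" "f 0 = x" "f t = y" using assms(1) by (auto simp: trace_joined_def)
  obtain D' g where g: "is_trace X w' s D' g" "g 0 = y" "g s = z" using assms(2) by (auto simp: trace_joined_def)
  have ts: "0 \<le> t" "0 \<le> s" using f(1) g(1) by (auto simp: is_trace_def)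
  have "f t = g 0" using f g by simp
  from trace_concat[OF f(1) g(1) this assms(3,4)] show ?thesis
    unfolding trace_joined_def
  proof (intro exI conjI)
    show "(if 0 \<le> t then f 0 else g (0 - t)) = x" using ts f by simp
    show "(if t + s \<le> t then f (t + s) else g (t + s - t)) = z" using ts f g by (cases "s = 0") auto
  qed
qed

text \<open>Every step of the chain adds one copy of \<open>w\<close> to the modulus, so chains of bounded length give
  traces with a common modulus.\<close>

lemma chain_imp_trace_joined:
  assumes tc: "trace_connected X w \<epsilon>" and c: "chain_linking X \<epsilon> k x y c"
  shows "\<exists>t. t \<le> k * \<epsilon> \<and> trace_joined X (\<lambda>r. real (Suc k) * w r) t x y"
  using c
proof (induction k arbitrary: y)
  case 0
  have w: "gauge_fun w" using tc by (simp add: trace_connected_def)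
  show ?case using 0 trace_joined_refl[OF w, of x X] by (intro exI[of _ 0]) (auto simp: chain_linking_def)
next
  case (Suc k)
  have w: "gauge_fun w" using tc by (simp add: trace_connected_def)
  have "chain_linking X \<epsilon> k x (c k) c" using Suc.prems by (auto simp: chain_linking_def)
  from Suc.IH[OF this] obtain t where t: "t \<le> k * \<epsilon>" "trace_joined X (\<lambda>r. real (Suc k) * w r) t x (c k)" by blast
  have "Suc k \<in> {1..Suc k}" by simp
  then have "mdist X (c (Suc k)) (c (Suc k - 1)) < \<epsilon>" using Suc.prems unfolding chain_linking_def by blast
  then have d: "mdist X (c k) y < \<epsilon>" "c k \<in> mspace X" "y \<in> mspace X"
    using Suc.prems by (auto simp: chain_linking_def mdist_commute)
  have "trace_joined X (\<lambda>r. real (Suc k) * w r + w r) (t + mdist X (c k) y) x y"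
    by (rule trace_joined_trans[OF t(2) trace_connectedD[OF tc d(2,3,1)] gauge_fun_cmult[OF w] w]) simp
  moreover have "(\<lambda>r. real (Suc k) * w r + w r) = (\<lambda>r. real (Suc (Suc k)) * w r)"
    by (simp add: algebra_simps fun_eq_iff)
  ultimately show ?case
    using t(1) d(1) by (intro exI[of _ "t + mdist X (c k) y"]) (simp add: algebra_simps)
qed

text \<open>Far from the copy of the hyperspace, absorption is obtained from the speed \<open>c\<close> of the flow: any
  two points of \<open>X\<close> are joined by a trace of duration at most \<open>l * \<epsilon>\<close>, and \<open>c\<close> is so large that
  this time is available as soon as \<open>\<delta> m \<ge> \<kappa>\<close>.\<close>

theorem trace_connected_imp_uniform_AR_hyperspace:
  assumes tc: "trace_connected X w \<epsilon>" and X: "mspace X \<noteq> {}" and ce: "chain_equi_connected X"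
  shows "uniform_AR TYPE('m) (hyperspace X)"
  unfolding uniform_AR_def
proof (intro allI impI)
  fix M :: "'m metric" and e assume emb: "closed_isometric_embedding (hyperspace X) M e"
  let ?S = "e ` closed_sets X"
  have w: "gauge_fun w" and \<epsilon>: "0 < \<epsilon>" using tc by (auto simp: trace_connected_def)
  have "\<exists>l. \<forall>x\<in>mspace X. \<forall>y\<in>mspace X. \<exists>k\<le>l. \<exists>c. chain_linking X \<epsilon> k x y c"
    using ce[unfolded chain_equi_connected_def, rule_format, OF \<epsilon>] .
  then obtain l where "\<forall>x\<in>mspace X. \<forall>y\<in>mspace X. \<exists>k\<le>l. \<exists>c. chain_linking X \<epsilon> k x y c" ..
  then have l: "\<exists>k\<le>l. \<exists>c. chain_linking X \<epsilon> k x y c" if "x \<in> mspace X" "y \<in> mspace X" for x y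
    using that by metis
  define w' where "w' r = real (Suc l) * w r" for r
  have w': "gauge_fun w'" unfolding w'_def by (rule gauge_fun_cmult[OF w]) simp
  have ww': "real (Suc k) * w r \<le> w' r" if "k \<le> l" "0 \<le> r" for k r
    unfolding w'_def using that gauge_fun_nonneg[OF w] by (intro mult_right_mono) auto
  have small: "trace_joined X w' (mdist X x y) x y" if "x \<in> mspace X" "y \<in> mspace X" "mdist X x y < \<epsilon>" for x y
    by (rule trace_joined_modulus_mono[OF trace_connectedD[OF tc that]]) (use ww'[of 0] in simp)
  have large: "\<exists>t\<le>l * \<epsilon>. trace_joined X w' t x y" if xy: "x \<in> mspace X" "y \<in> mspace X" for x y
  proof -
    obtain k c where k: "k \<le> l" "chain_linking X \<epsilon> k x y c" using l[OF xy] by blast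
    obtain t where t: "t \<le> k * \<epsilon>" "trace_joined X (\<lambda>r. real (Suc k) * w r) t x y"
      using chain_imp_trace_joined[OF tc k(2)] by blast
    have "k * \<epsilon> \<le> l * \<epsilon>" using k(1) \<epsilon> by (intro mult_right_mono) auto
    then have "t \<le> l * \<epsilon>" using t(1) by linarith
    moreover have "trace_joined X w' t x y" by (rule trace_joined_modulus_mono[OF t(2) ww'[OF k(1)]])
    ultimately show ?thesis by blast
  qed
  define \<kappa> where "\<kappa> = min \<epsilon> 1 / 4"
  have \<kappa>: "0 < \<kappa>" "4 * \<kappa> \<le> \<epsilon>" "4 * \<kappa> \<le> 1" using \<epsilon> by (auto simp: \<kappa>_def)
  define c where "c = max 6 (l * \<epsilon> / (3 / 4 * \<kappa>))"
  have c: "6 \<le> c" "l * \<epsilon> \<le> c * (3 / 4 * \<kappa>)"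
    using \<kappa>(1) by (auto simp: c_def pos_divide_le_eq[symmetric])
  have SM: "?S \<subseteq> mspace M" using emb by (auto simp: closed_isometric_embedding_def)
  have "\<exists>r. retraction_onto M (mspace M) ?S r \<and> uniformly_continuous_at_set M (mspace M) ?S r"
  proof (rule flow_retraction[OF emb X w', of c])
    fix m A A' assume m: "m \<in> mspace M - ?S" and A: "A \<in> closed_sets X" "A' \<in> closed_sets X"
      and AA': "mdist (hyperspace X) A A' < 4 * dist_to M ?S m"
    let ?\<delta> = "dist_to M ?S m"
    have \<delta>: "0 \<le> ?\<delta>" using A by (intro dist_to_nonneg) auto
    show "A \<subseteq> flow X w' A' (c * (3 / 4 * ?\<delta>))"
    proof
      fix x assume x: "x \<in> A"
      then have xX: "x \<in> mspace X" using closed_sets_subset[OF A(1)] by blast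
      show "x \<in> flow X w' A' (c * (3 / 4 * ?\<delta>))"
      proof (cases "?\<delta> < \<kappa>")
        case True
        then have \<delta>1: "4 * ?\<delta> \<le> 1" "4 * ?\<delta> \<le> \<epsilon>" using \<kappa> by auto
        obtain x' where x': "x' \<in> A'" "mdist X x x' < 4 * ?\<delta>"
          using mdist_hyperspace_lessD[OF AA' \<delta>1(1) x] by blast
        have "x' \<in> mspace X" using x'(1) closed_sets_subset[OF A(2)] by blast
        then have "trace_joined X w' (mdist X x' x) x' x"
          using x'(2) \<delta>1(2) xX by (intro small) (auto simp: mdist_commute)
        moreover have "6 * (3 / 4 * ?\<delta>) \<le> c * (3 / 4 * ?\<delta>)" using c(1) \<delta> by (intro mult_right_mono) auto
        then have "mdist X x' x \<le> c * (3 / 4 * ?\<delta>)" using x'(2) \<delta> by (simp add: mdist_commute)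
        ultimately show ?thesis by (rule flow_joined[OF x'(1)])
      next
        case False
        obtain x' where x': "x' \<in> A'" using closed_sets_nonempty[OF A(2)] by blast
        then have "x' \<in> mspace X" using closed_sets_subset[OF A(2)] by blast
        then obtain t where t: "t \<le> l * \<epsilon>" "trace_joined X w' t x' x" using large xX by blast
        have "c * (3 / 4 * \<kappa>) \<le> c * (3 / 4 * ?\<delta>)" using False c(1) by (intro mult_left_mono) auto
        then have "t \<le> c * (3 / 4 * ?\<delta>)" using t(1) c(2) by linarith
        with t(2) show ?thesis by (rule flow_joined[OF x'])
      qed
    qed
  qed (use SM c in auto)
  then show "\<exists>r. retraction_onto M (mspace M) (e ` mspace (hyperspace X)) r \<and>
      uniformly_continuous_at_set M (mspace M) (e ` mspace (hyperspace X)) r" by simp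
qed

section \<open>Paths in the hyperspace\<close>

lemma gauge_fun_scale:
  assumes "gauge_fun w" "0 \<le> t"
  shows "w (real n * t) \<le> real n * w t"
proof (induction n)
  case (Suc n)
  have "w (real (Suc n) * t) = w (real n * t + t)" by (simp add: algebra_simps)
  also have "\<dots> \<le> w (real n * t) + w t" using assms by (intro gauge_fun_subadditive) auto
  finally show ?case using Suc by (simp add: algebra_simps)
qed (use assms in simp)

lemma trace_hull_subset:
  assumes "\<And>T D f. (T, D, f) \<in> F \<Longrightarrow> is_trace X w T D f"
  shows "trace_hull F t \<subseteq> mspace X"
  using assms unfolding trace_hull_def is_trace_def by force

text \<open>For growing times, the family of hulls is a path in the hyperspace.\<close>

lemma trace_hull_closure_dist:
  assumes F: "\<And>T D f. (T, D, f) \<in> F \<Longrightarrow> is_trace X w T D f" and w: "gauge_fun w"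
    and t: "0 \<le> t" "0 \<le> t'"
  shows "mdist (hyperspace X) (mtopology_of X closure_of trace_hull F t)
    (mtopology_of X closure_of trace_hull F t') \<le> w (2 * \<bar>t - t'\<bar>)"
proof -
  have *: "mdist (hyperspace X) (mtopology_of X closure_of trace_hull F t)
      (mtopology_of X closure_of trace_hull F t') \<le> w (2 * (t' - t))" if t: "0 \<le> t" "t \<le> t'" for t t'
  proof (rule mdist_hyperspace_closure_leI)
    show "0 \<le> w (2 * (t' - t))" using t by (intro gauge_fun_nonneg[OF w]) auto
    show "trace_hull F t \<subseteq> mspace X" "trace_hull F t' \<subseteq> mspace X" using trace_hull_subset[OF F] by auto
    show "\<exists>y\<in>trace_hull F t'. mdist X x y < e" if x: "x \<in> trace_hull F t" and e: "w (2 * (t' - t)) < e" for x e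
    proof (intro bexI[of _ x])
      have "x \<in> mspace X" using x trace_hull_subset[OF F] by blast
      then show "mdist X x x < e" using e t gauge_fun_nonneg[OF w, of "2 * (t' - t)"] by simp
      show "x \<in> trace_hull F t'" using x trace_hull_mono[OF t(2), of F] by blast
    qed
    show "\<exists>x\<in>trace_hull F t. mdist X y x < e" if y: "y \<in> trace_hull F t'" and e: "w (2 * (t' - t)) < e" for y e
      using trace_hull_grow[OF F w t y] e by (meson order_le_less_trans)
  qed
  show ?thesis
  proof (cases "t \<le> t'")
    case True
    then show ?thesis using *[OF t(1) True] by (simp add: abs_minus_commute)
  next
    case False
    then show ?thesis using *[of t' t] t(2) by (simp add: mdist_commute)
  qed
qed

text \<open>Let \<open>F\<close> consist of all short traces from \<open>A\<close> to \<open>B\<close>. The hulls of \<open>F\<close> grow from \<open>A\<close> to the union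
  of these traces, and the hulls of the reversed traces \<open>R\<close> shrink from there to \<open>B\<close>.\<close>

lemma hyperspace_path:
  assumes tc: "trace_connected X w e" and A: "A \<in> closed_sets X" and B: "B \<in> closed_sets X"
    and h: "mdist (hyperspace X) A B = h" "0 < h" "2 * h \<le> e" "h < 1"
  obtains P where "P 0 = A" "P h = B" "\<And>t. t \<in> {0..h} \<Longrightarrow> P t \<in> closed_sets X"
    "\<And>s t. s \<in> {0..h} \<Longrightarrow> t \<in> {0..h} \<Longrightarrow> mdist (hyperspace X) (P s) (P t) \<le> 2 * w (8 * \<bar>s - t\<bar>)"
proof -
  have w: "gauge_fun w" using tc by (simp add: trace_connected_def)
  let ?Y = "hyperspace X"
  \<comment> \<open>the bound \<open>2 * h\<close> exceeds the Hausdorff distance \<open>h\<close>, which need not be attained by points; so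
    every point of \<open>A\<close> and every point of \<open>B\<close> is an end of a trace in \<open>F\<close>\<close>
  define F where "F = {(T, D, f). is_trace X w T D f \<and> f 0 \<in> A \<and> f T \<in> B \<and> T \<le> 2 * h}"
  define R where "R = {(T, D, f). \<exists>D' f'. (T, D', f') \<in> F \<and> D = (\<lambda>u. T - u) ` D' \<and> f = (\<lambda>u. f' (T - u))}"
  have F: "is_trace X w T D f" if "(T, D, f) \<in> F" for T D f using that by (simp add: F_def)
  have R: "is_trace X w T D f" if "(T, D, f) \<in> R" for T D f
    using that trace_reverse[OF F] unfolding R_def by blast
  have AX: "A \<subseteq> mspace X" and BX: "B \<subseteq> mspace X" using A B closed_sets_subset by auto
  have r: "h < min (2 * h) 1" "min (2 * h) 1 \<le> 1" using h by auto
  have ex: "\<exists>T D f. (T, D, f) \<in> F \<and> f 0 = a \<and> f T = b"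
    if ab: "a \<in> A" "b \<in> B" "mdist X a b < min (2 * h) 1" for a b
  proof -
    have "trace_joined X w (mdist X a b) a b"
      using ab AX BX h by (intro trace_connectedD[OF tc]) auto
    then obtain D f where "is_trace X w (mdist X a b) D f" "f 0 = a" "f (mdist X a b) = b"
      by (auto simp: trace_joined_def)
    then have "(mdist X a b, D, f) \<in> F \<and> f 0 = a \<and> f (mdist X a b) = b" using ab by (simp add: F_def)
    then show ?thesis by blast
  qed
  have start: "trace_hull F 0 = A"
  proof
    show "trace_hull F 0 \<subseteq> A" unfolding trace_hull_def F_def is_trace_def by force
    show "A \<subseteq> trace_hull F 0"
    proof
      fix a assume a: "a \<in> A"
      have "mdist ?Y A B < min (2 * h) 1" using r h by simp
      from mdist_hyperspace_lessD[OF this r(2) a] obtain b where b: "b \<in> B" "mdist X a b < min (2 * h) 1" by blast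
      obtain T D f where f: "(T, D, f) \<in> F" "f 0 = a" using ex[OF a b] by blast
      then have "0 \<in> D" using F[OF f(1)] by (simp add: is_trace_def)
      then show "a \<in> trace_hull F 0" unfolding trace_hull_def using f by blast
    qed
  qed
  have finish: "trace_hull R 0 = B"
  proof
    show "trace_hull R 0 \<subseteq> B"
    proof
      fix y assume "y \<in> trace_hull R 0"
      then obtain T D f v where v: "(T, D, f) \<in> R" "v \<in> D" "v \<le> 0" "y = f v" unfolding trace_hull_def by blast
      obtain D' f' where D': "(T, D', f') \<in> F" "f = (\<lambda>u. f' (T - u))" using v(1) unfolding R_def by blast
      have "v = 0" using R[OF v(1)] v(2,3) by (force simp: is_trace_def)
      then show "y \<in> B" using v(4) D' by (simp add: F_def)
    qed
    show "B \<subseteq> trace_hull R 0"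
    proof
      fix b assume b: "b \<in> B"
      have "mdist ?Y B A < min (2 * h) 1" using r h by (simp add: mdist_commute)
      from mdist_hyperspace_lessD[OF this r(2) b] obtain a where a: "a \<in> A" "mdist X b a < min (2 * h) 1" by blast
      obtain T D f where f: "(T, D, f) \<in> F" "f T = b" using ex[OF a(1) b] a(2) by (auto simp: mdist_commute)
      have "(T, (\<lambda>u. T - u) ` D, \<lambda>u. f (T - u)) \<in> R" unfolding R_def using f(1) by blast
      moreover have "0 \<in> (\<lambda>u. T - u) ` D" using F[OF f(1)] by (auto simp: is_trace_def)
      ultimately have "f (T - 0) \<in> trace_hull R 0" by (rule trace_hullI) simp
      then show "b \<in> trace_hull R 0" using f(2) by simp
    qed
  qed
  have middle: "trace_hull F (2 * h) = trace_hull R (2 * h)"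
  proof
    show "trace_hull F (2 * h) \<subseteq> trace_hull R (2 * h)"
    proof
      fix y assume "y \<in> trace_hull F (2 * h)"
      then obtain T D f v where v: "(T, D, f) \<in> F" "v \<in> D" "y = f v" unfolding trace_hull_def by blast
      have "(T, (\<lambda>u. T - u) ` D, \<lambda>u. f (T - u)) \<in> R" unfolding R_def using v(1) by blast
      moreover have "T - v \<in> (\<lambda>u. T - u) ` D" using v(2) by blast
      moreover have "T - v \<le> 2 * h"
      proof -
        have "0 \<le> v" using F[OF v(1)] v(2) by (auto simp: is_trace_def)
        then show ?thesis using v(1) by (simp add: F_def)
      qed
      ultimately have "f (T - (T - v)) \<in> trace_hull R (2 * h)" by (rule trace_hullI)
      then show "y \<in> trace_hull R (2 * h)" using v(3) by simp
    qed
    show "trace_hull R (2 * h) \<subseteq> trace_hull F (2 * h)"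
    proof
      fix y assume "y \<in> trace_hull R (2 * h)"
      then obtain T D f v where v: "(T, D, f) \<in> R" "v \<in> D" "y = f v" unfolding trace_hull_def by blast
      obtain D' f' where D': "(T, D', f') \<in> F" "D = (\<lambda>u. T - u) ` D'" "f = (\<lambda>u. f' (T - u))"
        using v(1) unfolding R_def by blast
      obtain u where u: "u \<in> D'" "v = T - u" using v(2) D'(2) by blast
      have "u \<le> T" using F[OF D'(1)] u(1) by (auto simp: is_trace_def)
      then have "u \<le> 2 * h" "y = f' u" using D'(1,3) v(3) u(2) by (auto simp: F_def)
      then show "y \<in> trace_hull F (2 * h)" unfolding trace_hull_def using D'(1) u(1) by blast
    qed
  qed
  \<comment> \<open>the speed 4 makes the hulls reach the time \<open>2 * h\<close> at half of the duration \<open>h\<close>\<close>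
  define P where "P t = mtopology_of X closure_of
      (if t \<le> h / 2 then trace_hull F (4 * t) else trace_hull R (4 * (h - t)))" for t
  have P1: "P t = mtopology_of X closure_of trace_hull F (4 * t)" if "t \<le> h / 2" for t
    using that by (simp add: P_def)
  have P2: "P t = mtopology_of X closure_of trace_hull R (4 * (h - t))" if "h / 2 \<le> t" for t
    using that middle by (cases "t = h / 2") (auto simp: P_def)
  have c1: "mdist ?Y (P s) (P t) \<le> w (8 * \<bar>s - t\<bar>)" if "0 \<le> s" "0 \<le> t" "s \<le> h / 2" "t \<le> h / 2" for s t
  proof -
    have "mdist ?Y (P s) (P t) \<le> w (2 * \<bar>4 * s - 4 * t\<bar>)"
      unfolding P1[OF that(3)] P1[OF that(4)] using that by (intro trace_hull_closure_dist[OF F w]) auto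
    also have "2 * \<bar>4 * s - 4 * t\<bar> = 8 * \<bar>s - t\<bar>" by (simp add: abs_if)
    finally show ?thesis .
  qed
  have c2: "mdist ?Y (P s) (P t) \<le> w (8 * \<bar>s - t\<bar>)" if "s \<le> h" "t \<le> h" "h / 2 \<le> s" "h / 2 \<le> t" for s t
  proof -
    have "mdist ?Y (P s) (P t) \<le> w (2 * \<bar>4 * (h - s) - 4 * (h - t)\<bar>)"
      unfolding P2[OF that(3)] P2[OF that(4)] using that by (intro trace_hull_closure_dist[OF R w]) auto
    also have "2 * \<bar>4 * (h - s) - 4 * (h - t)\<bar> = 8 * \<bar>s - t\<bar>" by (simp add: abs_if)
    finally show ?thesis .
  qed
  have Pmem: "P t \<in> closed_sets X" if t: "t \<in> {0..h}" for t
    unfolding P_def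
  proof (rule mclosure_in_closed_sets)
    show "(if t \<le> h / 2 then trace_hull F (4 * t) else trace_hull R (4 * (h - t))) \<subseteq> mspace X"
      using trace_hull_subset[of F X w, OF F] trace_hull_subset[of R X w, OF R] by simp
    have "A \<subseteq> trace_hull F (4 * t)" using trace_hull_mono[of 0 "4 * t" F] start t by simp
    moreover have "B \<subseteq> trace_hull R (4 * (h - t))" using trace_hull_mono[of 0 "4 * (h - t)" R] finish t by simp
    ultimately show "(if t \<le> h / 2 then trace_hull F (4 * t) else trace_hull R (4 * (h - t))) \<noteq> {}"
      using closed_sets_nonempty[OF A] closed_sets_nonempty[OF B] by auto
  qed
  have cross: "mdist ?Y (P s) (P t) \<le> 2 * w (8 * \<bar>s - t\<bar>)"
    if st: "s \<in> {0..h}" "t \<in> {0..h}" "s \<le> h / 2" "h / 2 \<le> t" for s t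
  proof -
    have "h / 2 \<in> {0..h}" using h(2) by simp
    then have "mdist ?Y (P s) (P t) \<le> mdist ?Y (P s) (P (h / 2)) + mdist ?Y (P (h / 2)) (P t)"
      using Pmem st by (intro mdist_triangle) auto
    also have "\<dots> \<le> w (8 * \<bar>s - h / 2\<bar>) + w (8 * \<bar>h / 2 - t\<bar>)"
      using st h(2) by (intro add_mono c1 c2) auto
    also have "\<dots> \<le> w (8 * \<bar>s - t\<bar>) + w (8 * \<bar>s - t\<bar>)"
      using st by (intro add_mono gauge_fun_mono[OF w]) auto
    finally show ?thesis by simp
  qed
  show thesis
  proof (rule that[of P])
    show "P 0 = A" using P1[of 0] start h(2) closedin_mclosure_eq[OF A] by simp
    show "P h = B" using P2[of h] finish h(2) closedin_mclosure_eq[OF B] by simp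
    show "P t \<in> closed_sets X" if "t \<in> {0..h}" for t by (rule Pmem[OF that])
    show "mdist ?Y (P s) (P t) \<le> 2 * w (8 * \<bar>s - t\<bar>)" if st: "s \<in> {0..h}" "t \<in> {0..h}" for s t
    proof -
      have nn: "0 \<le> w (8 * \<bar>s - t\<bar>)" by (intro gauge_fun_nonneg[OF w]) auto
      consider "s \<le> h / 2" "t \<le> h / 2" | "h / 2 \<le> s" "h / 2 \<le> t" | "s \<le> h / 2" "h / 2 \<le> t" | "t \<le> h / 2" "h / 2 \<le> s"
        by linarith
      then show ?thesis
      proof cases
        case 1 then show ?thesis using c1[of s t] st nn by simp
      next
        case 2 then show ?thesis using c2[of s t] st nn by simp
      next
        case 3 then show ?thesis using cross[OF st] by simp
      next
        case 4 then show ?thesis using cross[OF st(2,1)] by (simp add: mdist_commute abs_minus_commute)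
      qed
    qed
  qed
qed

theorem trace_connected_imp_uniformly_locally_path_equi_connected_hyperspace:
  assumes tc: "trace_connected X w e"
  shows "uniformly_locally_path_equi_connected (hyperspace X)"
proof -
  let ?Y = "hyperspace X"
  have w: "gauge_fun w" and e: "0 < e" using tc by (auto simp: trace_connected_def)
  have w2: "gauge_fun (\<lambda>t. 2 * w t)" and w16: "gauge_fun (\<lambda>t. 16 * w t)"
    using gauge_fun_cmult[OF w] by simp_all
  define \<epsilon> where "\<epsilon> = min (e / 2) 1"
  have "\<exists>f. continuous_map (subtopology euclideanreal {0..mdist ?Y A B}) (mtopology_of ?Y) f \<and>
             f 0 = A \<and> f (mdist ?Y A B) = B \<and>
             (\<forall>t>0. modulus_of (submetric euclidean_metric {0..mdist ?Y A B}) ?Y f t \<le> ennreal (2 * w (8 * t)))"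
    if AB: "A \<in> mspace ?Y" "B \<in> mspace ?Y" "mdist ?Y A B < \<epsilon>" for A B
  proof (cases "A = B")
    case True
    have "modulus_of (submetric euclidean_metric {0..mdist ?Y A B}) ?Y (\<lambda>_. A) t \<le> ennreal (2 * w (8 * t))" if "0 < t" for t
    proof (rule modulus_of_le)
      have "0 \<le> w (8 * t)" using that by (intro gauge_fun_nonneg[OF w]) auto
      then show "mdist ?Y A A \<le> 2 * w (8 * t)" using AB(1) by simp
    qed
    then show ?thesis using True AB(1) by (intro exI[of _ "\<lambda>_. A"]) auto
  next
    case False
    let ?h = "mdist ?Y A B"
    have h: "0 < ?h" "2 * ?h \<le> e" "?h < 1" using False AB mdist_gt_0[of A ?Y B] by (auto simp: \<epsilon>_def)
    have AB': "A \<in> closed_sets X" "B \<in> closed_sets X" using AB by auto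
    obtain P where P: "P 0 = A" "P ?h = B" "\<And>t. t \<in> {0..?h} \<Longrightarrow> P t \<in> closed_sets X"
      "\<And>s t. s \<in> {0..?h} \<Longrightarrow> t \<in> {0..?h} \<Longrightarrow> mdist ?Y (P s) (P t) \<le> 2 * w (8 * \<bar>s - t\<bar>)"
      by (rule hyperspace_path[OF tc AB' refl h]) blast
    have "uniformly_continuous_map (submetric euclidean_metric {0..?h}) ?Y P"
    proof (rule gauge_fun_imp_uniformly_continuous_map[OF w16])
      show "P ` {0..?h} \<subseteq> mspace ?Y" using P(3) by (simp add: image_subset_iff)
      show "mdist ?Y (P s) (P t) \<le> 16 * w \<bar>s - t\<bar>" if "s \<in> {0..?h}" "t \<in> {0..?h}" for s t
        using P(4)[OF that] gauge_fun_scale[OF w, of "\<bar>s - t\<bar>" 8] by simp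
    qed
    then have "continuous_map (subtopology euclideanreal {0..?h}) (mtopology_of ?Y) P"
      using uniformly_continuous_imp_continuous_map by (fastforce simp: mtopology_of_submetric)
    moreover have "modulus_of (submetric euclidean_metric {0..?h}) ?Y P t \<le> ennreal (2 * w (8 * t))" for t
    proof (rule modulus_of_le)
      fix u v assume uv: "u \<in> {0..?h}" "v \<in> {0..?h}" "\<bar>u - v\<bar> \<le> t"
      have "w (8 * \<bar>u - v\<bar>) \<le> w (8 * t)" using uv(3) by (intro gauge_fun_mono[OF w]) auto
      then show "mdist ?Y (P u) (P v) \<le> 2 * w (8 * t)" using P(4)[OF uv(1,2)] by linarith
    qed
    ultimately show ?thesis using P(1,2) by blast
  qed
  then show ?thesis
    unfolding uniformly_locally_path_equi_connected_def
    using e gauge_fun_imp_continuity_modulus[OF w2, of 8]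
    by (intro exI[of _ \<epsilon>] conjI exI[of _ "\<lambda>t. 2 * w (8 * t)"]) (auto simp: \<epsilon>_def)
qed

section \<open>Retractions with discrete values\<close>

lemma maximal_separated_subset:
  assumes s: "0 < s"
  obtains Q where "Q \<subseteq> mspace X" "\<And>p q. p \<in> Q \<Longrightarrow> q \<in> Q \<Longrightarrow> p \<noteq> q \<Longrightarrow> s \<le> mdist X p q"
    "\<And>x. x \<in> mspace X \<Longrightarrow> \<exists>q\<in>Q. mdist X x q < s"
proof -
  define A where "A = {Q. Q \<subseteq> mspace X \<and> (\<forall>p\<in>Q. \<forall>q\<in>Q. p \<noteq> q \<longrightarrow> s \<le> mdist X p q)}"
  have "\<exists>M\<in>A. \<forall>B\<in>A. M \<subseteq> B \<longrightarrow> B = M"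
  proof (rule subset_Zorn')
    fix C assume C: "subset.chain A C"
    have "s \<le> mdist X p q" if pq: "p \<in> \<Union> C" "q \<in> \<Union> C" "p \<noteq> q" for p q
    proof -
      obtain B B' where B: "B \<in> C" "p \<in> B" "B' \<in> C" "q \<in> B'" using pq by blast
      then have "B \<subseteq> B' \<or> B' \<subseteq> B" using C unfolding subset.chain_def by blast
      moreover have "B \<in> A" "B' \<in> A" using B C unfolding subset.chain_def by blast+
      ultimately show ?thesis using B pq(3) unfolding A_def by blast
    qed
    moreover have "\<Union> C \<subseteq> mspace X" using C unfolding subset.chain_def A_def by blast
    ultimately show "\<Union> C \<in> A" by (simp add: A_def)
  qed
  then obtain Q where Q: "Q \<in> A" "\<And>B. B \<in> A \<Longrightarrow> Q \<subseteq> B \<Longrightarrow> B = Q" by blast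
  have "\<exists>q\<in>Q. mdist X x q < s" if x: "x \<in> mspace X" for x
  proof (rule ccontr)
    assume no: "\<not> ?thesis"
    then have far: "s \<le> mdist X x q" if "q \<in> Q" for q using that by (auto simp: not_less)
    have far': "s \<le> mdist X q x" if "q \<in> Q" for q using far[OF that] by (subst mdist_commute)
    have Q1: "Q \<subseteq> mspace X" "\<And>p q. p \<in> Q \<Longrightarrow> q \<in> Q \<Longrightarrow> p \<noteq> q \<Longrightarrow> s \<le> mdist X p q"
      using Q(1) unfolding A_def by blast+
    have "insert x Q \<in> A" using Q1(1) x Q1(2) far far' unfolding A_def by blast
    then have "x \<in> Q" using Q(2)[of "insert x Q"] by blast
    then show False using far[of x] x s by simp
  qed
  then show thesis using Q(1) that[of Q] unfolding A_def by blast
qed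

lemma separated_compact_finite:
  assumes K: "compactin (mtopology_of X) K" and s: "0 < s"
    and Q: "\<And>p q. p \<in> Q \<Longrightarrow> q \<in> Q \<Longrightarrow> p \<noteq> q \<Longrightarrow> s \<le> mdist X p q"
  shows "finite (Q \<inter> K)"
proof -
  interpret Metric_space "mspace X" "mdist X" by simp
  have tb: "mtotally_bounded K" using K compactin_imp_mtotally_bounded unfolding mtopology_of_def by blast
  have "0 < s / 2" using s by simp
  from tb[unfolded mtotally_bounded_def, rule_format, OF this]
  obtain F where F: "finite F" "F \<subseteq> K" "K \<subseteq> (\<Union>x\<in>F. mball x (s / 2))" by blast
  have KX: "K \<subseteq> mspace X" using compactin_subset_topspace[OF K] by simp
  have "Q \<inter> K \<subseteq> (\<Union>x\<in>F. Q \<inter> mball_of X x (s / 2))"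
    using F(3) by (auto simp: mball_of_def)
  moreover have "finite (Q \<inter> mball_of X x (s / 2))" if "x \<in> F" for x
    using separated_imp_card_ball[of Q s X x, OF Q] that F(2) KX by blast
  ultimately show ?thesis using F(1) by (meson finite_UN_I finite_subset)
qed

definition clamp01 :: "real \<Rightarrow> real" where
  "clamp01 r = max 0 (min 1 r)"

lemma clamp01: "0 \<le> clamp01 r" "clamp01 r \<le> 1" "0 < clamp01 r \<longleftrightarrow> 0 < r" "1 \<le> r \<Longrightarrow> clamp01 r = 1"
  "r \<le> 0 \<Longrightarrow> clamp01 r = 0" "clamp01 r \<le> clamp01 s + \<bar>r - s\<bar>"
  by (auto simp: clamp01_def)

text \<open>Retractions onto spaces \<open>H\<close> of closed sets that contain the discrete ones, but possibly not the
  unions of flows used before. The value of the retraction at \<open>m\<close> has to be a discrete set: it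
  consists of points of nets \<open>Q n\<close> with \<open>1 / 2 ^ n\<close> comparable to the distance of \<open>m\<close> from the
  copy of \<open>H\<close>, and it depends continuously on \<open>m\<close> because its points appear and disappear by
  moving along the paths \<open>\<Gamma> q q'\<close> between points of the nets. Compact balls make the nets
  locally finite.\<close>

locale discretization =
  fixes X :: "'a metric" and M :: "'m metric" and em :: "'a set \<Rightarrow> 'm" and H :: "'a set set"
    and w :: "real \<Rightarrow> real" and \<Gamma> :: "'a \<Rightarrow> 'a \<Rightarrow> real \<Rightarrow> 'a" and Q :: "nat \<Rightarrow> 'a set" and \<kappa> r0 :: real
  assumes emb: "closed_isometric_embedding (submetric (hyperspace X) H) M em"
    and HX: "H \<subseteq> closed_sets X" and DH: "discrete_closed_sets X \<subseteq> H" and Xne: "mspace X \<noteq> {}"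
    and w: "gauge_fun w"
    and Q: "\<And>n. Q n \<subseteq> mspace X" and net: "\<And>x n. x \<in> mspace X \<Longrightarrow> \<exists>q\<in>Q n. mdist X x q < 1 / 2 ^ n"
    and locfin: "\<And>n x. x \<in> mspace X \<Longrightarrow> finite (Q n \<inter> mcball_of X x r0)"
    \<comment> \<open>paths are only needed between net points at distance below \<open>64 * \<kappa>\<close>\<close>
    and \<kappa>: "0 < \<kappa>" "64 * \<kappa> \<le> 1" "w (64 * \<kappa>) \<le> r0 / 4" "64 * \<kappa> \<le> r0 / 4"
    and \<Gamma>: "\<And>x y s. x \<in> mspace X \<Longrightarrow> y \<in> mspace X \<Longrightarrow> mdist X x y < 64 * \<kappa> \<Longrightarrow> s \<in> {0..1} \<Longrightarrow>
        \<Gamma> x y s \<in> mspace X \<and> \<Gamma> x y 0 = x \<and> \<Gamma> x y 1 = y \<and> mdist X x (\<Gamma> x y s) \<le> w (mdist X x y)"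
    and \<Gamma>w: "\<And>x y s s'. x \<in> mspace X \<Longrightarrow> y \<in> mspace X \<Longrightarrow> mdist X x y < 64 * \<kappa> \<Longrightarrow> s \<in> {0..1} \<Longrightarrow> s' \<in> {0..1} \<Longrightarrow>
        mdist X (\<Gamma> x y s) (\<Gamma> x y s') \<le> w \<bar>s - s'\<bar>"
begin

abbreviation "S \<equiv> em ` H"

definition \<delta> :: "'m \<Rightarrow> real" where "\<delta> = dist_to M S"

definition U :: "'m set" where "U = {m \<in> mspace M. \<exists>s\<in>S. mdist M m s < \<kappa>}"

text \<open>How strongly the net point \<open>q\<close> of scale \<open>1 / 2 ^ n\<close> is demanded by the set \<open>A\<close> at \<open>m\<close>. The first
  two factors are 1 if \<open>1 \<le> 2 ^ n * \<delta> m \<le> 2\<close> and vanish outside \<open>1 / 2 < 2 ^ n * \<delta> m < 4\<close>; the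
  third is 1 if \<open>q\<close> is within \<open>1 / 2 ^ n\<close> of \<open>A\<close> and vanishes from \<open>2 / 2 ^ n\<close> on; the last
  restricts \<open>A\<close> to sets with \<open>mdist M m (em A) < 2 * \<delta> m\<close>.\<close>

definition bump :: "'m \<Rightarrow> nat \<Rightarrow> 'a \<Rightarrow> 'a set \<Rightarrow> real" where
  "bump m n q A = min (min (clamp01 (2 * (2 ^ n * \<delta> m) - 1)) (clamp01 (2 - 2 ^ n * \<delta> m / 2)))
    (min (clamp01 (2 - 2 ^ n * dist_to X A q)) (clamp01 (2 ^ n * (4 * \<delta> m - 2 * mdist M m (em A)))))"

definition weight :: "'m \<Rightarrow> nat \<Rightarrow> 'a \<Rightarrow> real" where
  "weight m n q = (SUP A\<in>H. bump m n q A)"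

text \<open>\<open>\<sigma>\<close> increases from 0 to 1 between the weights \<open>3 / 4\<close> and 1, and \<open>\<tau>\<close> between the weights 0 and
  \<open>3 / 4\<close>. So when the weight of \<open>q\<close> drops to \<open>3 / 4\<close> and the points resting at \<open>q\<close> are removed,
  they have all returned to \<open>q\<close>, and the points that move from net points of weight 1 towards
  \<open>q\<close> have arrived there.\<close>

definition \<sigma> :: "real \<Rightarrow> real" where "\<sigma> r = clamp01 (4 * r - 3)"
definition \<tau> :: "real \<Rightarrow> real" where "\<tau> r = clamp01 (4 / 3 * r)"

text \<open>The pair \<open>((n, q), (n', q'))\<close> contributes a point on the path from \<open>q\<close> to \<open>q'\<close>; the further both
  weights exceed their thresholds \<open>3 / 4\<close> and 0, the further it has moved.\<close>

definition pos :: "'m \<Rightarrow> (nat \<times> 'a) \<times> (nat \<times> 'a) \<Rightarrow> 'a" where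
  "pos m = (\<lambda>((n, q), (n', q')). \<Gamma> q q' (\<sigma> (weight m n q) * \<tau> (weight m n' q')))"

definition pairs :: "'m \<Rightarrow> ((nat \<times> 'a) \<times> (nat \<times> 'a)) set" where
  "pairs m = {((n, q), (n', q')). q \<in> Q n \<and> q' \<in> Q n' \<and> 3 / 4 < weight m n q \<and> 0 < weight m n' q' \<and>
    mdist X q q' < 32 / 2 ^ n}"

definition G :: "'m \<Rightarrow> 'a set" where "G m = pos m ` pairs m"

lemma iso: "A \<in> H \<Longrightarrow> B \<in> H \<Longrightarrow> mdist M (em A) (em B) = mdist (hyperspace X) A B"
  and emem: "A \<in> H \<Longrightarrow> em A \<in> mspace M"
  and closedS: "closedin (mtopology_of M) S"
  using emb HX by (auto simp: closed_isometric_embedding_def Int_absorb2)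

lemma Hne: "\<exists>A. A \<in> H"
proof -
  obtain x where "x \<in> mspace X" using Xne by blast
  then have "{x} \<in> discrete_closed_sets X"
    by (intro locally_finite_in_discrete_closed_sets) (auto intro: exI[of _ 1])
  then show ?thesis using DH by blast
qed

lemma Sne: "S \<noteq> {}" and SM: "S \<subseteq> mspace M"
  using Hne emem by auto

lemma \<delta>_pos: "m \<in> U - S \<Longrightarrow> 0 < \<delta> m"
  unfolding \<delta>_def U_def using dist_to_pos[OF closedS Sne] by simp

lemma \<delta>_less: "m \<in> U \<Longrightarrow> \<delta> m < \<kappa>"
  unfolding \<delta>_def U_def using dist_to_le[of _ S M m] by fastforce

lemma \<delta>_Lipschitz: "m \<in> mspace M \<Longrightarrow> m' \<in> mspace M \<Longrightarrow> \<bar>\<delta> m - \<delta> m'\<bar> \<le> mdist M m m'"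
  using dist_to_Lipschitz[OF Sne SM, of m m'] dist_to_Lipschitz[OF Sne SM, of m' m]
  by (simp add: \<delta>_def mdist_commute abs_le_iff)

lemma tri: "A \<in> H \<Longrightarrow> B \<in> H \<Longrightarrow> m \<in> mspace M \<Longrightarrow>
    mdist (hyperspace X) A B \<le> mdist M m (em A) + mdist M m (em B)"
  using mdist_triangle[of "em A" M m "em B"] emem iso by (simp add: mdist_commute)

lemma bump_bounds: "0 \<le> bump m n q A" "bump m n q A \<le> 1"
  unfolding bump_def using clamp01(1,2) by (auto simp: min_le_iff_disj)

lemma bump_le_weight: "A \<in> H \<Longrightarrow> bump m n q A \<le> weight m n q"
  unfolding weight_def using bump_bounds by (intro cSUP_upper bdd_aboveI[of _ 1]) auto

lemma weight_bounds: "0 \<le> weight m n q" "weight m n q \<le> 1"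
proof -
  obtain A where "A \<in> H" using Hne by blast
  then show "0 \<le> weight m n q" using bump_le_weight[of A m n q] bump_bounds(1)[of m n q A] by linarith
  show "weight m n q \<le> 1" unfolding weight_def using Hne bump_bounds by (intro cSUP_least) auto
qed

lemma weight_posD:
  assumes "0 < weight m n q"
  shows "1 / 2 < 2 ^ n * \<delta> m" "2 ^ n * \<delta> m < 4"
    "\<exists>A\<in>H. dist_to X A q < 2 / 2 ^ n \<and> mdist M m (em A) < 2 * \<delta> m"
proof -
  have "\<exists>A\<in>H. 0 < bump m n q A"
    using assms Hne unfolding weight_def by (subst (asm) less_cSUP_iff) (auto intro!: bdd_aboveI[of _ 1] bump_bounds)
  then obtain A where A: "A \<in> H" "0 < bump m n q A" by blast
  then have pos: "0 < 2 * (2 ^ n * \<delta> m) - 1" "0 < 2 - 2 ^ n * \<delta> m / 2" "0 < 2 - 2 ^ n * dist_to X A q"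
    "0 < 2 ^ n * (4 * \<delta> m - 2 * mdist M m (em A))"
    unfolding bump_def by (simp_all add: clamp01(3))
  show "1 / 2 < 2 ^ n * \<delta> m" "2 ^ n * \<delta> m < 4" using pos by simp_all
  have "dist_to X A q < 2 / 2 ^ n" using pos(3) by (simp add: field_simps)
  moreover have "mdist M m (em A) < 2 * \<delta> m" using pos(4) by (simp add: zero_less_mult_iff)
  ultimately show "\<exists>A\<in>H. dist_to X A q < 2 / 2 ^ n \<and> mdist M m (em A) < 2 * \<delta> m" using A(1) by blast
qed

lemma weight_pos_scale: assumes "0 < weight m n q" shows "1 / 2 ^ n < 2 * \<delta> m"
  using weight_posD(1)[OF assms] by (simp add: field_simps)

text \<open>On the relevant scales \<open>2 ^ n * \<delta> m < 8\<close>, and there every factor of \<open>bump\<close> is Lipschitz with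
  constant \<open>6 * 2 ^ n\<close>; on the other scales both weights vanish.\<close>

lemma weight_close:
  assumes m: "m \<in> U - S" "m' \<in> U - S" and h: "mdist M m m' \<le> \<delta> m / 2"
  shows "\<bar>weight m n q - weight m' n q\<bar> \<le> 48 * mdist M m m' / \<delta> m"
proof -
  let ?h = "mdist M m m'"
  have mM: "m \<in> mspace M" "m' \<in> mspace M" using m by (auto simp: U_def)
  have \<delta>p: "0 < \<delta> m" using \<delta>_pos m by blast
  have dL: "\<bar>\<delta> m - \<delta> m'\<bar> \<le> ?h" by (rule \<delta>_Lipschitz[OF mM])
  have rhs: "0 \<le> 48 * ?h / \<delta> m" using \<delta>p by simp
  show ?thesis
  proof (cases "2 ^ n * \<delta> m < 8")
    case False
    have "\<not> 0 < weight m n q" using weight_posD(2)[of m n q] False by linarith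
    moreover have "\<not> 0 < weight m' n q"
    proof
      assume "0 < weight m' n q"
      then have "2 ^ n * \<delta> m' < 4" by (rule weight_posD(2))
      moreover have "2 ^ n * (\<delta> m / 2) \<le> 2 ^ n * \<delta> m'" using dL h by (intro mult_left_mono) auto
      ultimately show False using False by simp
    qed
    ultimately have "weight m n q = 0" "weight m' n q = 0" using weight_bounds(1)[of m n q] weight_bounds(1)[of m' n q] by linarith+
    then show ?thesis using rhs by simp
  next
    case True
    define N :: real where "N = 2 ^ n"
    have N: "0 \<le> N" by (simp add: N_def)
    have one: "bump a n q A \<le> bump b n q A + 6 * N * ?h"
      if ab: "a \<in> mspace M" "b \<in> mspace M" "\<bar>\<delta> a - \<delta> b\<bar> \<le> ?h" "mdist M a b = ?h" and A: "A \<in> H" for a b A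
    proof -
      have "\<bar>mdist M a (em A) - mdist M b (em A)\<bar> \<le> ?h"
        using mdist_triangle[of a M b "em A"] mdist_triangle[of b M a "em A"] ab emem[OF A] by (simp add: mdist_commute abs_le_iff)
      then have "\<bar>(4 * \<delta> a - 2 * mdist M a (em A)) - (4 * \<delta> b - 2 * mdist M b (em A))\<bar> \<le> 6 * ?h"
        using ab(3) by linarith
      then have "N * \<bar>(4 * \<delta> a - 2 * mdist M a (em A)) - (4 * \<delta> b - 2 * mdist M b (em A))\<bar> \<le> N * (6 * ?h)"
        using N by (rule mult_left_mono)
      then have 3: "\<bar>N * (4 * \<delta> a - 2 * mdist M a (em A)) - N * (4 * \<delta> b - 2 * mdist M b (em A))\<bar> \<le> 6 * N * ?h"
        using N by (simp add: abs_mult right_diff_distrib[symmetric])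
      have "N * \<bar>\<delta> a - \<delta> b\<bar> \<le> N * ?h" using ab(3) N by (rule mult_left_mono)
      then have ND: "\<bar>N * \<delta> a - N * \<delta> b\<bar> \<le> N * ?h" using N by (simp add: abs_mult right_diff_distrib[symmetric])
      have Nh: "0 \<le> N * ?h" using N by simp
      have 1: "\<bar>(2 * (N * \<delta> a) - 1) - (2 * (N * \<delta> b) - 1)\<bar> \<le> 6 * N * ?h" using ND Nh by linarith
      have 2: "\<bar>(2 - N * \<delta> a / 2) - (2 - N * \<delta> b / 2)\<bar> \<le> 6 * N * ?h" using ND Nh by linarith
      have "clamp01 (2 * (N * \<delta> a) - 1) \<le> clamp01 (2 * (N * \<delta> b) - 1) + 6 * N * ?h"
        using clamp01(6)[of "2 * (N * \<delta> a) - 1" "2 * (N * \<delta> b) - 1"] 1 by linarith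
      moreover have "clamp01 (2 - N * \<delta> a / 2) \<le> clamp01 (2 - N * \<delta> b / 2) + 6 * N * ?h"
        using clamp01(6)[of "2 - N * \<delta> a / 2" "2 - N * \<delta> b / 2"] 2 by linarith
      moreover have "clamp01 (N * (4 * \<delta> a - 2 * mdist M a (em A))) \<le> clamp01 (N * (4 * \<delta> b - 2 * mdist M b (em A))) + 6 * N * ?h"
        using clamp01(6)[of "N * (4 * \<delta> a - 2 * mdist M a (em A))" "N * (4 * \<delta> b - 2 * mdist M b (em A))"] 3 by linarith
      ultimately show ?thesis unfolding bump_def N_def[symmetric] using Nh by linarith
    qed
    have two: "weight a n q \<le> weight b n q + 6 * N * ?h"
      if ab: "a \<in> mspace M" "b \<in> mspace M" "\<bar>\<delta> a - \<delta> b\<bar> \<le> ?h" "mdist M a b = ?h" for a b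
      unfolding weight_def[of a]
    proof (rule cSUP_least)
      show "bump a n q A \<le> weight b n q + 6 * N * ?h" if "A \<in> H" for A
        using one[OF ab that] bump_le_weight[OF that, of b n q] by linarith
    qed (use Hne in blast)
    have "\<bar>weight m n q - weight m' n q\<bar> \<le> 6 * N * ?h"
    proof (rule abs_leI)
      show "weight m n q - weight m' n q \<le> 6 * N * ?h" using two[OF mM dL refl] by simp
      have "\<bar>\<delta> m' - \<delta> m\<bar> \<le> ?h" using dL by (simp only: abs_minus_commute)
      from two[OF mM(2,1) this mdist_commute]
      show "- (weight m n q - weight m' n q) \<le> 6 * N * ?h" by simp
    qed
    also have "\<dots> \<le> 48 * ?h / \<delta> m"
    proof -
      have "N \<le> 8 / \<delta> m" using True \<delta>p by (simp add: N_def field_simps)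
      then have "6 * ?h * N \<le> 6 * ?h * (8 / \<delta> m)" by (intro mult_left_mono) auto
      then show ?thesis by (simp add: mult_ac)
    qed
    finally show ?thesis .
  qed
qed

text \<open>At every \<open>m\<close> the net has points of weight 1 near each point of the sets in question: the scale
  \<open>n\<close> is the first one with \<open>1 \<le> 2 ^ n * \<delta> m\<close>, and the set demanding \<open>q\<close> is an almost nearest
  one.\<close>

lemma dominating:
  assumes m: "m \<in> U - S" and A: "A \<in> H" "mdist M m (em A) < 2 * \<delta> m"
    and x: "x \<in> mspace X" "dist_to X A x < \<rho>"
  obtains n q where "q \<in> Q n" "weight m n q = 1" "mdist X x q < \<rho> + 4 * \<delta> m + 1 / 2 ^ n"
    "1 \<le> 2 ^ n * \<delta> m" "2 ^ n * \<delta> m \<le> 2"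
proof -
  have mM: "m \<in> mspace M" using m by (auto simp: U_def)
  have \<delta>m: "0 < \<delta> m" "64 * \<delta> m < 1" using \<delta>_pos[OF m] \<delta>_less[of m] m \<kappa> by auto
  obtain n0 where "1 / \<delta> m < 2 ^ n0" using real_arch_pow[of 2 "1 / \<delta> m"] by auto
  then have ex: "1 \<le> 2 ^ n0 * \<delta> m" using \<delta>m by (simp add: field_simps)
  define n where "n = (LEAST n. 1 \<le> 2 ^ n * \<delta> m)"
  have n1: "1 \<le> 2 ^ n * \<delta> m" unfolding n_def by (rule LeastI[of _ n0]) (rule ex)
  have n2: "2 ^ n * \<delta> m \<le> 2"
  proof (cases n)
    case 0
    then show ?thesis using n1 \<delta>m by simp
  next
    case (Suc k)
    then have "\<not> 1 \<le> 2 ^ k * \<delta> m" using not_less_Least[of k "\<lambda>n. 1 \<le> 2 ^ n * \<delta> m"] unfolding n_def by simp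
    then show ?thesis by (simp add: Suc)
  qed
  have AX: "A \<subseteq> mspace X" using A(1) HX closed_sets_subset by blast
  have "\<exists>s\<in>S. mdist M m s < 3 / 2 * \<delta> m"
    by (rule dist_to_less[OF Sne]) (use \<delta>m in \<open>simp add: \<delta>_def\<close>)
  then obtain A' where A': "A' \<in> H" "mdist M m (em A') < 3 / 2 * \<delta> m" by blast
  have A'X: "A' \<subseteq> mspace X" using A'(1) HX closed_sets_subset by blast
  have AA': "mdist (hyperspace X) A A' < 4 * \<delta> m" using tri[OF A(1) A'(1) mM] A(2) A'(2) \<delta>m by linarith
  have Ane: "A \<noteq> {}" using A(1) HX closed_sets_nonempty by blast
  obtain a where a: "a \<in> A" "mdist X x a < \<rho>" using dist_to_less[OF Ane x(2)] by blast
  obtain a' where a': "a' \<in> A'" "mdist X a a' < 4 * \<delta> m"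
    using mdist_hyperspace_lessD[OF AA' _ a(1)] \<delta>m by auto
  have mem: "a \<in> mspace X" "a' \<in> mspace X" using a a' AX A'X by auto
  obtain q where q: "q \<in> Q n" "mdist X a' q < 1 / 2 ^ n" using net[OF mem(2)] by blast
  have qX: "q \<in> mspace X" using q Q by blast
  have "dist_to X A' q \<le> mdist X q a'" using a'(1) by (rule dist_to_le)
  then have "dist_to X A' q \<le> 1 / 2 ^ n" using q(2) by (simp add: mdist_commute)
  then have "1 \<le> 2 - 2 ^ n * dist_to X A' q" by (simp add: field_simps)
  moreover have "2 ^ n * \<delta> m \<le> 2 ^ n * (4 * \<delta> m - 2 * mdist M m (em A'))"
    using A'(2) by (intro mult_left_mono) auto
  ultimately have "clamp01 (2 - 2 ^ n * dist_to X A' q) = 1"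
    "clamp01 (2 ^ n * (4 * \<delta> m - 2 * mdist M m (em A'))) = 1"
    using n1 by (auto intro!: clamp01(4) elim: order_trans)
  moreover have "clamp01 (2 * (2 ^ n * \<delta> m) - 1) = 1" "clamp01 (2 - 2 ^ n * \<delta> m / 2) = 1"
    using n1 n2 by (auto intro!: clamp01(4))
  ultimately have "bump m n q A' = 1" unfolding bump_def by (simp only: min.idem)
  then have "weight m n q = 1" using bump_le_weight[OF A'(1), of m n q] weight_bounds(2)[of m n q] by simp
  moreover have "mdist X x q < \<rho> + 4 * \<delta> m + 1 / 2 ^ n"
    using mdist_triangle[of x X a q] mdist_triangle[of a X a' q] x(1) mem qX a(2) a'(2) q(2) by linarith
  ultimately show thesis using that[OF q(1)] n1 n2 by blast
qed

text \<open>The number 32 in the definition of \<open>pairs\<close> is chosen for this estimate: whatever \<open>q\<close> has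
  positive weight, some point of weight 1 moves towards it.\<close>

lemma dominating_index:
  assumes m: "m \<in> U - S" and q: "q \<in> Q n" "0 < weight m n q"
  obtains k p where "p \<in> Q k" "weight m k p = 1" "mdist X p q < 32 / 2 ^ k"
proof -
  obtain A where A: "A \<in> H" "dist_to X A q < 2 / 2 ^ n" "mdist M m (em A) < 2 * \<delta> m"
    using weight_posD(3)[OF q(2)] by blast
  have "q \<in> mspace X" using q(1) Q by blast
  from dominating[OF m A(1,3) this A(2)] obtain k p where p: "p \<in> Q k" "weight m k p = 1"
    "mdist X q p < 2 / 2 ^ n + 4 * \<delta> m + 1 / 2 ^ k" "2 ^ k * \<delta> m \<le> 2" by metis
  have "\<delta> m \<le> 2 / 2 ^ k" using p(4) by (simp add: field_simps)
  moreover have "2 / 2 ^ n < 4 * \<delta> m" using weight_pos_scale[OF q(2)] by simp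
  moreover have "16 / 2 ^ k + 1 / 2 ^ k \<le> (32 :: real) / 2 ^ k" by (simp add: field_simps)
  ultimately have "mdist X q p < 32 / 2 ^ k" using p(3) by linarith
  then show thesis using that p(1,2) by (metis mdist_commute)
qed

lemma pairs_dist:
  assumes m: "m \<in> U - S" and p: "((n, q), (n', q')) \<in> pairs m"
  shows "q \<in> mspace X" "q' \<in> mspace X" "mdist X q q' < 64 * \<delta> m" "mdist X q q' < 64 * \<kappa>"
    "mdist X q (pos m ((n, q), (n', q'))) \<le> w (64 * \<delta> m)" "pos m ((n, q), (n', q')) \<in> mspace X"
proof -
  have p': "q \<in> Q n" "q' \<in> Q n'" "0 < weight m n q" "mdist X q q' < 32 / 2 ^ n" using p by (auto simp: pairs_def)
  show mem: "q \<in> mspace X" "q' \<in> mspace X" using p' Q by blast+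
  show d: "mdist X q q' < 64 * \<delta> m" using p'(4) weight_pos_scale[OF p'(3)] by simp
  then show d': "mdist X q q' < 64 * \<kappa>" using \<delta>_less[of m] m by simp
  have s: "\<sigma> (weight m n q) * \<tau> (weight m n' q') \<in> {0..1}"
    unfolding \<sigma>_def \<tau>_def using clamp01(1,2) by (simp add: mult_le_one)
  note g = \<Gamma>[OF mem d' s]
  show "pos m ((n, q), (n', q')) \<in> mspace X" using g by (simp add: pos_def)
  have "mdist X q (pos m ((n, q), (n', q'))) \<le> w (mdist X q q')" using g by (simp add: pos_def)
  also have "\<dots> \<le> w (64 * \<delta> m)" using d by (intro gauge_fun_mono[OF w]) auto
  finally show "mdist X q (pos m ((n, q), (n', q'))) \<le> w (64 * \<delta> m)" .
qed

lemma diagonal_in_G: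
  assumes m: "m \<in> U - S" and q: "q \<in> Q n" "3 / 4 < weight m n q"
  shows "q \<in> G m"
proof -
  have qX: "q \<in> mspace X" using q Q by blast
  have p: "((n, q), (n, q)) \<in> pairs m" using q qX by (simp add: pairs_def)
  let ?p = "pos m ((n, q), (n, q))"
  have s: "\<sigma> (weight m n q) * \<tau> (weight m n q) \<in> {0..1}"
    unfolding \<sigma>_def \<tau>_def using clamp01(1,2) by (simp add: mult_le_one)
  have "mdist X q ?p \<le> w (mdist X q q)" using \<Gamma>[OF qX qX _ s] qX \<kappa>(1) by (simp add: pos_def)
  then have "mdist X q ?p = 0" using qX w mdist_nonneg[of X q ?p] by simp
  then have "?p = q" using pairs_dist(6)[OF m p] qX by simp
  then show ?thesis unfolding G_def using p by (metis imageI)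
qed

lemma G_subset: "m \<in> U - S \<Longrightarrow> G m \<subseteq> mspace X"
  unfolding G_def using pairs_dist(6) by auto

text \<open>The scales of the net points of positive weight are bounded in terms of \<open>\<delta> m\<close>, and each net is
  locally finite.\<close>

lemma G_in_H:
  assumes m: "m \<in> U - S"
  shows "G m \<in> H"
proof -
  have \<delta>m: "0 < \<delta> m" "\<delta> m < \<kappa>" using \<delta>_pos[OF m] \<delta>_less[of m] m by auto
  have "\<exists>s\<in>S. mdist M m s < 2 * \<delta> m"
    by (rule dist_to_less[OF Sne]) (use \<delta>m in \<open>simp add: \<delta>_def\<close>)
  then obtain A where A: "A \<in> H" "mdist M m (em A) < 2 * \<delta> m" by blast
  then obtain a where a: "a \<in> A" using HX closed_sets_nonempty by blast
  have aX: "a \<in> mspace X" using a A(1) HX closed_sets_subset by blast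
  have "dist_to X A a < 1" using dist_to_le[OF a, of X a] aX by simp
  from dominating[OF m A aX this] obtain n q where "q \<in> Q n" "weight m n q = 1" by metis
  then have "q \<in> G m" by (intro diagonal_in_G[OF m]) auto
  then have ne: "G m \<noteq> {}" by blast
  have r0: "0 < r0" using \<kappa> by simp
  obtain n0 where n0: "4 / \<delta> m < 2 ^ n0" using real_arch_pow[of 2 "4 / \<delta> m"] by auto
  have lev: "n < n0" if "0 < weight m n q" for n q
  proof -
    have "2 ^ n < 4 / \<delta> m" using weight_posD(2)[OF that] \<delta>m by (simp add: field_simps)
    then have "(2::real) ^ n < 2 ^ n0" using n0 by linarith
    then show ?thesis by (simp add: power_less_imp_less_exp)
  qed
  have "finite (G m \<inter> mball_of X x (r0 / 4))" if x: "x \<in> mspace X" for x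
  proof -
    define I where "I = (SIGMA n:{..<n0}. Q n \<inter> mcball_of X x r0)"
    have "finite I" unfolding I_def using locfin[OF x] by auto
    have "G m \<inter> mball_of X x (r0 / 4) \<subseteq> pos m ` (I \<times> I)"
    proof
      fix y assume y: "y \<in> G m \<inter> mball_of X x (r0 / 4)"
      then obtain n q n' q' where p: "((n, q), (n', q')) \<in> pairs m" "y = pos m ((n, q), (n', q'))"
        unfolding G_def by (auto simp: image_iff)
      note pd = pairs_dist[OF m p(1)]
      have pp: "q \<in> Q n" "q' \<in> Q n'" "0 < weight m n q" "0 < weight m n' q'" using p(1) by (auto simp: pairs_def)
      have "w (64 * \<delta> m) \<le> w (64 * \<kappa>)" using \<delta>m by (intro gauge_fun_mono[OF w]) auto
      then have qy: "mdist X q y \<le> r0 / 4" using pd(5) p(2) \<kappa>(3) by simp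
      have "mdist X x q \<le> r0 / 2"
        using mdist_triangle[of x X y q] y qy x pd(1) by (auto simp: mdist_commute)
      moreover have "mdist X x q' \<le> mdist X x q + mdist X q q'" using x pd(1,2) by (intro mdist_triangle)
      ultimately have "q \<in> mcball_of X x r0" "q' \<in> mcball_of X x r0"
        using pd(1,2,4) \<kappa>(4) x r0 by auto
      then have "((n, q), (n', q')) \<in> I \<times> I" unfolding I_def using pp lev by blast
      then show "y \<in> pos m ` (I \<times> I)" using p(2) by blast
    qed
    then show ?thesis using \<open>finite I\<close> by (meson finite_SigmaI finite_imageI finite_subset)
  qed
  then have "G m \<in> discrete_closed_sets X"
    using ne G_subset[OF m] r0 by (intro locally_finite_in_discrete_closed_sets) (auto intro!: exI[of _ "r0 / 4"])
  then show ?thesis using DH by blast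
qed

text \<open>Every point of \<open>G m\<close> is close to a net point \<open>q\<close> of positive weight, thus to a set \<open>A\<close> with
  \<open>mdist M m (em A) < 2 * \<delta> m\<close>, thus to \<open>B\<close>; conversely a point of weight 1 near a point of \<open>B\<close>
  belongs to \<open>G m\<close>.\<close>

lemma G_near:
  assumes m: "m \<in> U - S" and B: "B \<in> H" "mdist M m (em B) < \<eta>" and \<eta>: "3 * \<eta> \<le> 1"
  shows "mdist (hyperspace X) (G m) B \<le> 9 * \<eta> + w (64 * \<eta>)"
proof -
  have mM: "m \<in> mspace M" using m by (auto simp: U_def)
  have "\<delta> m \<le> mdist M m (em B)" unfolding \<delta>_def using B(1) by (intro dist_to_le) auto
  then have \<delta>m: "0 < \<delta> m" "\<delta> m < \<eta>" using \<delta>_pos[OF m] B(2) by auto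
  have \<eta>0: "0 \<le> w (64 * \<eta>)" using \<delta>m by (intro gauge_fun_nonneg[OF w]) auto
  have BX: "B \<subseteq> mspace X" using B(1) HX closed_sets_subset by blast
  have AB: "mdist (hyperspace X) A B < 3 * \<eta>" if "A \<in> H" "mdist M m (em A) < 2 * \<delta> m" for A
    using tri[OF that(1) B(1) mM] that(2) B(2) \<delta>m by linarith
  show ?thesis
  proof (rule mdist_hyperspace_leI)
    show "0 \<le> 9 * \<eta> + w (64 * \<eta>)" using \<eta>0 \<delta>m by simp
    fix y r assume y: "y \<in> G m" and r: "9 * \<eta> + w (64 * \<eta>) < r"
    obtain n q n' q' where p: "((n, q), (n', q')) \<in> pairs m" "y = pos m ((n, q), (n', q'))"
      using y unfolding G_def by (auto simp: image_iff)
    note pd = pairs_dist[OF m p(1)]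
    have wq: "0 < weight m n q" using p(1) by (auto simp: pairs_def)
    obtain A where A: "A \<in> H" "dist_to X A q < 2 / 2 ^ n" "mdist M m (em A) < 2 * \<delta> m"
      using weight_posD(3)[OF wq] by blast
    have Ane: "A \<noteq> {}" "A \<subseteq> mspace X" using A(1) HX closed_sets_nonempty closed_sets_subset by blast+
    obtain a where a: "a \<in> A" "mdist X q a < 2 / 2 ^ n" using dist_to_less[OF Ane(1) A(2)] by blast
    have qa: "mdist X q a < 4 * \<eta>" using a(2) weight_pos_scale[OF wq] \<delta>m by simp
    obtain b where b: "b \<in> B" "mdist X a b < 3 * \<eta>"
      using mdist_hyperspace_lessD[OF AB[OF A(1,3)] \<eta> a(1)] by blast
    have mem: "a \<in> mspace X" "b \<in> mspace X" "y \<in> mspace X" using a b Ane(2) BX pd(6) p(2) by auto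
    have "w (64 * \<delta> m) \<le> w (64 * \<eta>)" using \<delta>m by (intro gauge_fun_mono[OF w]) auto
    then have "mdist X y q \<le> w (64 * \<eta>)" using pd(5) p(2) by (simp add: mdist_commute)
    then have "mdist X y b < r"
      using mdist_triangle[OF mem(3) pd(1) mem(2)] mdist_triangle[OF pd(1) mem(1,2)] qa b(2) r \<delta>m by linarith
    then show "\<exists>b\<in>B. mdist X y b < r" using b(1) by blast
  next
    fix b r assume b: "b \<in> B" and r: "9 * \<eta> + w (64 * \<eta>) < r"
    have "\<exists>s\<in>S. mdist M m s < 2 * \<delta> m"
      by (rule dist_to_less[OF Sne]) (use \<delta>m in \<open>simp add: \<delta>_def\<close>)
    then obtain A where A: "A \<in> H" "mdist M m (em A) < 2 * \<delta> m" by blast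
    have "mdist (hyperspace X) B A < 3 * \<eta>" using AB[OF A] by (simp add: mdist_commute)
    from mdist_hyperspace_lessD[OF this \<eta> b] obtain a where a: "a \<in> A" "mdist X b a < 3 * \<eta>" by blast
    have aX: "a \<in> mspace X" using a A(1) HX closed_sets_subset by blast
    have "dist_to X A a < \<delta> m" using dist_to_le[OF a(1), of X a] aX \<delta>m by simp
    from dominating[OF m A aX this] obtain n q where q: "q \<in> Q n" "weight m n q = 1"
      "mdist X a q < \<delta> m + 4 * \<delta> m + 1 / 2 ^ n" "1 \<le> 2 ^ n * \<delta> m" by metis
    have "q \<in> G m" using q by (intro diagonal_in_G[OF m]) auto
    moreover have "1 / 2 ^ n \<le> \<delta> m" using q(4) by (simp add: field_simps)
    then have "mdist X b q < r"
      using mdist_triangle[of b X a q] b BX aX q(1,3) Q a(2) \<delta>m r \<eta>0 by (smt (verit) subsetD)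
    ultimately show "\<exists>y\<in>G m. mdist X b y < r" by blast
  qed
qed

lemma cutoffs: "\<sigma> r \<in> {0..1}" "\<tau> r \<in> {0..1}" "\<sigma> r * \<tau> s \<in> {0..1}" "\<sigma> 1 = 1"
  "\<bar>r - s\<bar> \<le> \<theta> \<Longrightarrow> \<bar>\<sigma> r - \<sigma> s\<bar> \<le> 4 * \<theta>" "\<bar>r - s\<bar> \<le> \<theta> \<Longrightarrow> \<bar>\<tau> r - \<tau> s\<bar> \<le> 2 * \<theta>"
proof -
  show "\<sigma> r \<in> {0..1}" "\<tau> r \<in> {0..1}" "\<sigma> r * \<tau> s \<in> {0..1}" "\<sigma> 1 = 1"
    unfolding \<sigma>_def \<tau>_def by (auto simp: mult_le_one clamp01(1,2,4))
  show "\<bar>\<sigma> r - \<sigma> s\<bar> \<le> 4 * \<theta>" if "\<bar>r - s\<bar> \<le> \<theta>"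
    using that unfolding \<sigma>_def clamp01_def by (simp add: abs_le_iff max_def min_def)
  show "\<bar>\<tau> r - \<tau> s\<bar> \<le> 2 * \<theta>" if "\<bar>r - s\<bar> \<le> \<theta>"
    using that unfolding \<tau>_def clamp01_def by (simp add: abs_le_iff max_def min_def)
qed

text \<open>The point belonging to a pair at \<open>m\<close> is compared with that of the same pair at \<open>m'\<close>, if this is
  still admitted. If the weight of \<open>q'\<close> has dropped to 0, the point was close to \<open>q\<close>, which
  belongs to \<open>G m'\<close>. If the weight of \<open>q\<close> has dropped to \<open>3 / 4\<close>, the point was again close to
  \<open>q\<close>, and some point of weight 1 at \<open>m'\<close> has moved towards \<open>q\<close> all the way, up to a distance
  controlled by \<open>\<theta>\<close>.\<close>

lemma G_one_way:
  assumes m: "m \<in> U - S" "m' \<in> U - S" and \<theta>: "0 \<le> \<theta>" "\<theta> \<le> 1 / 4"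
    and close: "\<And>n q. \<bar>weight m n q - weight m' n q\<bar> \<le> \<theta>" and y: "y \<in> G m"
  shows "\<exists>y'\<in>G m'. mdist X y y' \<le> 2 * w (8 * \<theta>)"
proof -
  obtain n q n' q' where p: "((n, q), (n', q')) \<in> pairs m" "y = pos m ((n, q), (n', q'))"
    using y unfolding G_def by (auto simp: image_iff)
  note pd = pairs_dist[OF m(1) p(1)]
  have pp: "q \<in> Q n" "q' \<in> Q n'" "3 / 4 < weight m n q" "0 < weight m n' q'" "mdist X q q' < 32 / 2 ^ n"
    using p(1) by (auto simp: pairs_def)
  let ?a = "weight m n q" and ?b = "weight m n' q'" and ?a' = "weight m' n q" and ?b' = "weight m' n' q'"
  have cl: "\<bar>?a - ?a'\<bar> \<le> \<theta>" "\<bar>?b - ?b'\<bar> \<le> \<theta>" using close by auto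
  have yv: "y = \<Gamma> q q' (\<sigma> ?a * \<tau> ?b)" using p(2) by (simp add: pos_def)
  have q0: "\<Gamma> q q' 0 = q" using \<Gamma>[OF pd(1,2,4), of 0] by simp
  have w8: "w t \<le> w (8 * \<theta>)" if "0 \<le> t" "t \<le> 8 * \<theta>" for t using gauge_fun_mono[OF w that] .
  have nn: "0 \<le> w (8 * \<theta>)" using \<theta> by (intro gauge_fun_nonneg[OF w]) auto
  have st: "0 \<le> \<sigma> ?a" "\<sigma> ?a \<le> 1" "0 \<le> \<tau> ?b" "\<tau> ?b \<le> 1" using cutoffs(1)[of ?a] cutoffs(2)[of ?b] by auto
  have to_q: "mdist X y q \<le> w (8 * \<theta>)" if "\<sigma> ?a * \<tau> ?b \<le> 8 * \<theta>"
  proof -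
    have "mdist X y q \<le> w \<bar>\<sigma> ?a * \<tau> ?b - 0\<bar>"
      using \<Gamma>w[OF pd(1,2,4) cutoffs(3)[of ?a ?b], of 0] by (simp add: yv q0)
    also have "\<dots> \<le> w (8 * \<theta>)" using that st by (intro w8) auto
    finally show ?thesis .
  qed
  show ?thesis
  proof (cases "3 / 4 < ?a'")
    case a': True
    show ?thesis
    proof (cases "0 < ?b'")
      case True
      have p': "((n, q), (n', q')) \<in> pairs m'" using pp a' True by (simp add: pairs_def)
      have s': "0 \<le> \<sigma> ?a'" "\<sigma> ?a' \<le> 1" "0 \<le> \<tau> ?b'" "\<tau> ?b' \<le> 1" using cutoffs(1)[of ?a'] cutoffs(2)[of ?b'] by auto
      have e1: "\<bar>\<sigma> ?a - \<sigma> ?a'\<bar> \<le> 4 * \<theta>" by (rule cutoffs(5)[OF cl(1)])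
      have e2: "\<bar>\<tau> ?b - \<tau> ?b'\<bar> \<le> 2 * \<theta>" by (rule cutoffs(6)[OF cl(2)])
      have "\<sigma> ?a * \<tau> ?b - \<sigma> ?a' * \<tau> ?b' = \<sigma> ?a * (\<tau> ?b - \<tau> ?b') + (\<sigma> ?a - \<sigma> ?a') * \<tau> ?b'"
        by (simp add: algebra_simps)
      then have "\<bar>\<sigma> ?a * \<tau> ?b - \<sigma> ?a' * \<tau> ?b'\<bar> \<le> \<sigma> ?a * \<bar>\<tau> ?b - \<tau> ?b'\<bar> + \<bar>\<sigma> ?a - \<sigma> ?a'\<bar> * \<tau> ?b'"
        using st(1) s'(3) abs_triangle_ineq[of "\<sigma> ?a * (\<tau> ?b - \<tau> ?b')" "(\<sigma> ?a - \<sigma> ?a') * \<tau> ?b'"]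
        by (simp add: abs_mult)
      also have "\<dots> \<le> 1 * (2 * \<theta>) + (4 * \<theta>) * 1"
        using e1 e2 st s' \<theta> by (intro add_mono mult_mono) auto
      finally have d: "\<bar>\<sigma> ?a * \<tau> ?b - \<sigma> ?a' * \<tau> ?b'\<bar> \<le> 8 * \<theta>" using \<theta> by simp
      have "mdist X y (pos m' ((n, q), (n', q'))) \<le> w \<bar>\<sigma> ?a * \<tau> ?b - \<sigma> ?a' * \<tau> ?b'\<bar>"
        using \<Gamma>w[OF pd(1,2,4) cutoffs(3) cutoffs(3), of ?a ?b ?a' ?b'] by (simp add: yv pos_def)
      also have "\<dots> \<le> w (8 * \<theta>)" using d by (intro w8) auto
      finally show ?thesis using p' nn unfolding G_def by (intro bexI[of _ "pos m' ((n, q), (n', q'))"]) auto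
    next
      case False
      then have "?b' = 0" using weight_bounds(1)[of m' n' q'] by linarith
      then have "\<tau> ?b \<le> 2 * \<theta>" using cutoffs(6)[OF cl(2)] by (simp add: \<tau>_def clamp01(5))
      then have "\<sigma> ?a * \<tau> ?b \<le> 8 * \<theta>" using mult_left_le_one_le[OF st(3,1,2)] \<theta> by linarith
      then have "mdist X y q \<le> 2 * w (8 * \<theta>)" using to_q nn by linarith
      moreover have "q \<in> G m'" by (rule diagonal_in_G[OF m(2) pp(1) a'])
      ultimately show ?thesis by blast
    qed
  next
    case False
    then have "\<sigma> ?a' = 0" by (simp add: \<sigma>_def clamp01(5))
    then have "\<sigma> ?a \<le> 4 * \<theta>" using cutoffs(5)[OF cl(1)] by simp
    then have "\<sigma> ?a * \<tau> ?b \<le> 8 * \<theta>" using mult_right_le_one_le[OF st(1,3,4)] \<theta> by linarith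
    then have yq: "mdist X y q \<le> w (8 * \<theta>)" by (rule to_q)
    have a'pos: "0 < ?a'" "1 - ?a' * (4 / 3) \<le> 4 / 3 * \<theta>" using pp(3) cl(1) \<theta> by linarith+
    obtain k r where r: "r \<in> Q k" "weight m' k r = 1" "mdist X r q < 32 / 2 ^ k"
      by (rule dominating_index[OF m(2) pp(1) a'pos(1)])
    have p': "((k, r), (n, q)) \<in> pairs m'" using r pp(1) a'pos(1) by (simp add: pairs_def)
    note pd' = pairs_dist[OF m(2) p']
    let ?z = "pos m' ((k, r), (n, q))"
    have t: "\<bar>\<tau> ?a' - 1\<bar> \<le> 8 * \<theta>" using a'pos \<theta> unfolding \<tau>_def clamp01_def by (auto simp: min_def max_def)
    have z: "?z = \<Gamma> r q (\<tau> ?a')" by (simp add: pos_def r(2) cutoffs(4))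
    have "mdist X ?z q \<le> w \<bar>\<tau> ?a' - 1\<bar>"
      using \<Gamma>w[OF pd'(1,2,4) cutoffs(2)[of ?a'], of 1] \<Gamma>[OF pd'(1,2,4), of 1] by (simp add: z)
    also have "\<dots> \<le> w (8 * \<theta>)" using t by (intro w8) auto
    finally have "mdist X y ?z \<le> 2 * w (8 * \<theta>)"
      using yq mdist_triangle[of y X q ?z] pd(1,6) p(2) pd'(6) by (simp add: mdist_commute)
    then show ?thesis using p' unfolding G_def by blast
  qed
qed

lemma retraction:
  "\<exists>r. retraction_onto M U S r \<and> uniformly_continuous_at_set M U S r"
proof -
  let ?Y = "submetric (hyperspace X) H"
  have Y: "mspace ?Y = H" using HX by auto
  have SU: "S \<subseteq> U"
  proof
    fix s assume "s \<in> S"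
    then show "s \<in> U" using SM \<kappa>(1) unfolding U_def by (intro CollectI conjI bexI[of _ s]) auto
  qed
  have "\<exists>r. retraction_onto M U (em ` mspace ?Y) r \<and> uniformly_continuous_at_set M U (em ` mspace ?Y) r"
    unfolding Y
  proof (rule near_retraction[where G = G, OF emb, unfolded Y])
    show "U \<subseteq> mspace M" by (auto simp: U_def)
    show "S \<subseteq> U" by (rule SU)
    show "G m \<in> H" if "m \<in> U - S" for m by (rule G_in_H[OF that])
  next
    fix \<epsilon> :: real assume \<epsilon>: "0 < \<epsilon>"
    obtain d where d: "0 < d" "\<And>t. 0 \<le> t \<Longrightarrow> t \<le> d \<Longrightarrow> w t < \<epsilon> / 2" using gauge_fun_small[OF w, of "\<epsilon> / 2"] \<epsilon> by auto
    define \<eta> where "\<eta> = min (1 / 3) (min (\<epsilon> / 18) (d / 64))"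
    have \<eta>: "0 < \<eta>" "3 * \<eta> \<le> 1" "9 * \<eta> \<le> \<epsilon> / 2" "64 * \<eta> \<le> d" using \<epsilon> d(1) by (auto simp: \<eta>_def)
    have "mdist ?Y (G m) A < \<epsilon>" if "A \<in> H" "m \<in> U - S" "mdist M m (em A) < \<eta>" for A m
      using G_near[OF that(2,1,3) \<eta>(2)] d(2)[of "64 * \<eta>"] \<eta> by simp
    then show "\<exists>\<eta>>0. \<forall>a\<in>H. \<forall>m\<in>U - S. mdist M m (em a) < \<eta> \<longrightarrow> mdist ?Y (G m) a < \<epsilon>"
      using \<eta>(1) by blast
  next
    fix m and \<epsilon> :: real assume m: "m \<in> U - S" and \<epsilon>: "0 < \<epsilon>"
    obtain d where d: "0 < d" "\<And>t. 0 \<le> t \<Longrightarrow> t \<le> d \<Longrightarrow> w t < \<epsilon> / 3" using gauge_fun_small[OF w, of "\<epsilon> / 3"] \<epsilon> by auto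
    have \<delta>m: "0 < \<delta> m" by (rule \<delta>_pos[OF m])
    define \<theta> where "\<theta> = min (1 / 4) (d / 8)"
    have \<theta>: "0 < \<theta>" "\<theta> \<le> 1 / 4" "8 * \<theta> \<le> d" using d(1) by (auto simp: \<theta>_def)
    define \<eta> where "\<eta> = min (\<delta> m / 2) (\<theta> * \<delta> m / 48)"
    have \<eta>: "0 < \<eta>" "\<eta> \<le> \<delta> m / 2" "\<eta> \<le> \<theta> * \<delta> m / 48" using \<delta>m \<theta>(1) by (auto simp: \<eta>_def)
    have "mdist ?Y (G m) (G m') < \<epsilon>" if m': "m' \<in> U - S" and h: "mdist M m m' < \<eta>" for m'
    proof -
      have "48 * mdist M m m' / \<delta> m \<le> \<theta>" using h \<eta>(3) \<delta>m by (simp add: field_simps)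
      moreover have "mdist M m m' \<le> \<delta> m / 2" using h \<eta>(2) by simp
      ultimately have cl: "\<bar>weight m n q - weight m' n q\<bar> \<le> \<theta>" for n q
        using weight_close[OF m m', of n q] by linarith
      then have cl': "\<bar>weight m' n q - weight m n q\<bar> \<le> \<theta>" for n q by (simp add: abs_minus_commute)
      have "mdist (hyperspace X) (G m) (G m') \<le> 2 * w (8 * \<theta>)"
      proof (rule mdist_hyperspace_leI)
        show "0 \<le> 2 * w (8 * \<theta>)" using \<theta>(1) gauge_fun_nonneg[OF w, of "8 * \<theta>"] by simp
        show "\<exists>y'\<in>G m'. mdist X y y' < r" if "y \<in> G m" "2 * w (8 * \<theta>) < r" for y r
          using G_one_way[OF m m' less_imp_le[OF \<theta>(1)] \<theta>(2) cl that(1)] that(2) by (meson order_le_less_trans)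
        show "\<exists>y'\<in>G m. mdist X y y' < r" if "y \<in> G m'" "2 * w (8 * \<theta>) < r" for y r
          using G_one_way[OF m' m less_imp_le[OF \<theta>(1)] \<theta>(2) cl' that(1)] that(2) by (meson order_le_less_trans)
      qed
      then show ?thesis using d(2)[of "8 * \<theta>"] \<theta> \<epsilon> by simp
    qed
    then show "\<exists>\<eta>>0. \<forall>m'\<in>U - S. mdist M m m' < \<eta> \<longrightarrow> mdist ?Y (G m) (G m') < \<epsilon>"
      using \<eta>(1) by blast
  qed
  then show ?thesis by (simp only: Y)
qed

end

text \<open>A Cauchy sequence finally stays in one of the compact balls.\<close>

lemma uniformly_locally_compact_imp_mcomplete:
  assumes ulc: "uniformly_locally_compact X"
  shows "mcomplete_of X"
proof -
  interpret Metric_space "mspace X" "mdist X" by simp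
  obtain \<epsilon> where \<epsilon>: "0 < \<epsilon>" "\<And>x. x \<in> mspace X \<Longrightarrow> compactin mtopology (mcball x \<epsilon>)"
    using ulc unfolding uniformly_locally_compact_def mtopology_of_def mcball_of_def by blast
  have "\<exists>x. limitin mtopology \<sigma> x sequentially" if \<sigma>: "MCauchy \<sigma>" for \<sigma>
  proof -
    have \<sigma>X: "\<sigma> n \<in> mspace X" for n using \<sigma> unfolding MCauchy_def by blast
    obtain N where N: "\<And>n n'. N \<le> n \<Longrightarrow> N \<le> n' \<Longrightarrow> mdist X (\<sigma> n) (\<sigma> n') < \<epsilon>"
      using \<sigma> \<epsilon>(1) unfolding MCauchy_def by blast
    have "mdist X (\<sigma> N) (\<sigma> (n + N)) \<le> \<epsilon>" for n using N[of N "n + N"] by simp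
    then have "range (\<lambda>n. \<sigma> (n + N)) \<subseteq> mcball (\<sigma> N) \<epsilon>" using \<sigma>X by auto
    then obtain l r where l: "strict_mono r" "limitin mtopology ((\<lambda>n. \<sigma> (n + N)) \<circ> r) l sequentially"
      using \<epsilon>(2)[OF \<sigma>X[of N]] unfolding compactin_sequentially by blast
    have "strict_mono (\<lambda>n. r n + N)" using l(1) by (simp add: strict_mono_def)
    moreover have "limitin mtopology (\<sigma> \<circ> (\<lambda>n. r n + N)) l sequentially" using l(2) by (simp add: o_def)
    ultimately show ?thesis using MCauchy_convergent_subsequence[OF \<sigma>] by blast
  qed
  then show ?thesis unfolding mcomplete_of_def mcomplete_def by blast
qed

text \<open>The space is complete, so traces extend to paths; reparametrized over the unit interval they
  keep the modulus, because their durations are at most 1.\<close>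

theorem uniformly_locally_compact_imp_uniform_ANR_between:
  fixes X :: "'a metric"
  assumes tc: "trace_connected X w e" and ulc: "uniformly_locally_compact X" and Xne: "mspace X \<noteq> {}"
    and DH: "discrete_closed_sets X \<subseteq> H" and HX: "H \<subseteq> closed_sets X"
  shows "uniform_ANR TYPE('m) (submetric (hyperspace X) H)"
  unfolding uniform_ANR_def
proof (intro allI impI)
  fix M :: "'m metric" and em assume emb: "closed_isometric_embedding (submetric (hyperspace X) H) M em"
  have w: "gauge_fun w" and e: "0 < e" using tc by (auto simp: trace_connected_def)
  have comp: "mcomplete_of X" using ulc by (rule uniformly_locally_compact_imp_mcomplete)
  obtain r0 where r0: "0 < r0" "\<And>x. x \<in> mspace X \<Longrightarrow> compactin (mtopology_of X) (mcball_of X x r0)"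
    using ulc unfolding uniformly_locally_compact_def by blast
  have "0 < r0 / 4" using r0(1) by simp
  from gauge_fun_small[OF w this]
  obtain d where d: "0 < d" "\<And>t. 0 \<le> t \<Longrightarrow> t \<le> d \<Longrightarrow> w t < r0 / 4" by blast
  define \<kappa> where "\<kappa> = min (min d e) (min 1 (r0 / 4)) / 64"
  have \<kappa>: "0 < \<kappa>" "64 * \<kappa> \<le> d" "64 * \<kappa> \<le> e" "64 * \<kappa> \<le> 1" "64 * \<kappa> \<le> r0 / 4"
    using d(1) e r0(1) by (auto simp: \<kappa>_def)
  have w\<kappa>: "w (64 * \<kappa>) \<le> r0 / 4" using d(2)[of "64 * \<kappa>"] \<kappa>(1,2) by simp
  have "\<exists>q. q \<subseteq> mspace X \<and> (\<forall>a\<in>q. \<forall>b\<in>q. a \<noteq> b \<longrightarrow> 1 / 2 ^ n \<le> mdist X a b) \<and>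
      (\<forall>x\<in>mspace X. \<exists>a\<in>q. mdist X x a < 1 / 2 ^ n)" for n :: nat
  proof -
    have "(0::real) < 1 / 2 ^ n" by simp
    from maximal_separated_subset[OF this, of X] show ?thesis by metis
  qed
  then obtain Q where Q: "\<And>n :: nat. Q n \<subseteq> mspace X"
    and sep: "\<And>n a b. a \<in> Q n \<Longrightarrow> b \<in> Q n \<Longrightarrow> a \<noteq> b \<Longrightarrow> 1 / 2 ^ n \<le> mdist X a b"
    and net: "\<And>n x. x \<in> mspace X \<Longrightarrow> \<exists>a\<in>Q n. mdist X x a < 1 / 2 ^ n" by metis
  have locfin: "finite (Q n \<inter> mcball_of X x r0)" if "x \<in> mspace X" for n x
    by (rule separated_compact_finite[OF r0(2)[OF that], of "1 / 2 ^ n"]) (auto intro: sep)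
  define P where "P x y \<gamma> \<longleftrightarrow> (\<forall>s\<in>{0..1::real}. \<forall>s'\<in>{0..1}. \<gamma> s \<in> mspace X \<and> \<gamma> 0 = x \<and> \<gamma> 1 = y \<and>
      mdist X x (\<gamma> s) \<le> w (mdist X x y) \<and> mdist X (\<gamma> s) (\<gamma> s') \<le> w \<bar>s - s'\<bar>)" for x y \<gamma>
  have "\<exists>\<gamma>. \<forall>s\<in>{0..1}. \<forall>s'\<in>{0..1}. \<gamma> s \<in> mspace X \<and> \<gamma> 0 = x \<and> \<gamma> 1 = y \<and> mdist X x (\<gamma> s) \<le> w (mdist X x y) \<and>
      mdist X (\<gamma> s) (\<gamma> s') \<le> w \<bar>s - s'\<bar>"
    if xy: "x \<in> mspace X" "y \<in> mspace X" "mdist X x y < 64 * \<kappa>" for x y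
  proof -
    let ?T = "mdist X x y"
    have T: "?T < e" "0 \<le> ?T" "?T \<le> 1" using xy(3) \<kappa>(3,4) by auto
    obtain g where g: "is_trace X w ?T {0..?T} g" "g 0 = x" "g ?T = y"
      by (rule trace_connected_complete_path[OF tc comp xy(1,2) T(1)])
    have gX: "g u \<in> mspace X" if "u \<in> {0..?T}" for u using g(1) that unfolding is_trace_def by blast
    have gw: "mdist X (g u) (g v) \<le> w \<bar>u - v\<bar>" if "u \<in> {0..?T}" "v \<in> {0..?T}" for u v
      using g(1) that unfolding is_trace_def by blast
    have in_T: "s * ?T \<in> {0..?T}" if "s \<in> {0..1}" for s
      using that T mult_left_le_one_le[of ?T s] by auto
    have "mdist X (g (s * ?T)) (g (s' * ?T)) \<le> w \<bar>s - s'\<bar>" if s: "s \<in> {0..1}" "s' \<in> {0..1}" for s s'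
    proof -
      have "\<bar>s * ?T - s' * ?T\<bar> = \<bar>s - s'\<bar> * ?T" using T by (simp add: abs_mult left_diff_distrib[symmetric])
      also have "\<dots> \<le> \<bar>s - s'\<bar>" using T by (simp add: mult_left_le)
      finally show ?thesis
        using gw[OF in_T[OF s(1)] in_T[OF s(2)]] gauge_fun_mono[OF w abs_ge_zero] by (meson order_trans)
    qed
    moreover have "mdist X x (g (s * ?T)) \<le> w ?T" if s: "s \<in> {0..1}" for s
    proof -
      have "mdist X (g 0) (g (s * ?T)) \<le> w (s * ?T)" using gw[of 0 "s * ?T"] in_T[OF s] T by simp
      also have "\<dots> \<le> w ?T" using in_T[OF s] by (intro gauge_fun_mono[OF w]) auto
      finally show ?thesis by (simp only: g(2))
    qed
    ultimately show ?thesis using gX in_T g(2,3) by (intro exI[of _ "\<lambda>s. g (s * ?T)"]) simp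
  qed
  then have "\<exists>\<gamma>. x \<in> mspace X \<longrightarrow> y \<in> mspace X \<longrightarrow> mdist X x y < 64 * \<kappa> \<longrightarrow> P x y \<gamma>" for x y unfolding P_def by blast
  then have "\<forall>x. \<exists>f. \<forall>y. x \<in> mspace X \<longrightarrow> y \<in> mspace X \<longrightarrow> mdist X x y < 64 * \<kappa> \<longrightarrow> P x y (f y)"
    by (intro allI choice) simp
  from choice[OF this] obtain \<Gamma> where
    \<Gamma>P: "\<And>x y. x \<in> mspace X \<Longrightarrow> y \<in> mspace X \<Longrightarrow> mdist X x y < 64 * \<kappa> \<Longrightarrow> P x y (\<Gamma> x y)" by blast
  have \<Gamma>: "\<Gamma> x y s \<in> mspace X \<and> \<Gamma> x y 0 = x \<and> \<Gamma> x y 1 = y \<and>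
      mdist X x (\<Gamma> x y s) \<le> w (mdist X x y) \<and> mdist X (\<Gamma> x y s) (\<Gamma> x y s') \<le> w \<bar>s - s'\<bar>"
    if "x \<in> mspace X" "y \<in> mspace X" "mdist X x y < 64 * \<kappa>" "s \<in> {0..1}" "s' \<in> {0..1}" for x y s s'
    by (rule \<Gamma>P[OF that(1,2,3), unfolded P_def, rule_format, OF that(4,5)])
  interpret discretization X M em H w \<Gamma> Q \<kappa> r0
  proof
    fix x y and s s' :: real
    assume *: "x \<in> mspace X" "y \<in> mspace X" "mdist X x y < 64 * \<kappa>" "s \<in> {0..1}"
    show "\<Gamma> x y s \<in> mspace X \<and> \<Gamma> x y 0 = x \<and> \<Gamma> x y 1 = y \<and> mdist X x (\<Gamma> x y s) \<le> w (mdist X x y)"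
      using \<Gamma>[OF * *(4)] by blast
    show "mdist X (\<Gamma> x y s) (\<Gamma> x y s') \<le> w \<bar>s - s'\<bar>" if "s' \<in> {0..1}" using \<Gamma>[OF * that] by blast
  qed (use emb HX DH Xne w Q net locfin \<kappa> w\<kappa> in simp_all)
  have S: "S = em ` mspace (submetric (hyperspace X) H)" using HX by (simp add: Int_absorb2)
  obtain r where r: "retraction_onto M U S r" "uniformly_continuous_at_set M U S r" using retraction by blast
  have nb: "{x \<in> mspace M. set_dist M x S < ennreal \<kappa>} \<subseteq> U"
  proof
    fix x assume x: "x \<in> {x \<in> mspace M. set_dist M x S < ennreal \<kappa>}"
    then obtain s where "s \<in> S" "ennreal (mdist M x s) < ennreal \<kappa>"
      unfolding set_dist_def INF_less_iff by blast
    then show "x \<in> U" using x \<kappa>(1) unfolding U_def by (auto simp: ennreal_less_iff)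
  qed
  have UM: "U \<subseteq> mspace M" by (auto simp: U_def)
  show "\<exists>U r. uniform_neighborhood M (em ` mspace (submetric (hyperspace X) H)) U \<and>
      retraction_onto M U (em ` mspace (submetric (hyperspace X) H)) r \<and>
      uniformly_continuous_at_set M U (em ` mspace (submetric (hyperspace X) H)) r"
    unfolding uniform_neighborhood_def S[symmetric] using \<kappa>(1) UM r nb
    by (intro exI[of _ U] exI[of _ r] conjI exI[of _ \<kappa>]) simp_all
qed

section \<open>Consequences of local connectedness\<close>

text \<open>The set of points that can be reached by chains inside \<open>C\<close> is open and closed in \<open>C\<close>.\<close>

lemma connectedin_imp_chain:
  assumes C: "connectedin (mtopology_of X) C" and xy: "x \<in> C" "y \<in> C" and \<eta>: "0 < \<eta>"
  obtains l c where "chain_linking X \<eta> l x y c" "c ` {..l} \<subseteq> C"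
proof -
  have CX: "C \<subseteq> mspace X" using connectedin_subset_topspace[OF C] by simp
  interpret Z: Metric_space C "mdist X"
    using CX by (metis Metric_space.subspace Metric_space_mspace_mdist)
  have top: "subtopology (mtopology_of X) C = Z.mtopology"
    using mtopology_of_submetric[of X C] CX by (simp add: submetric_def Int_absorb2)
  have con: "connected_space Z.mtopology" using C top by (simp add: connectedin_def)
  let ?R = "near X \<eta> C"
  define T where "T = {z \<in> C. (x, z) \<in> ?R\<^sup>*}"
  have "openin Z.mtopology T"
    unfolding Z.openin_mtopology
  proof (intro conjI allI impI)
    show "T \<subseteq> C" by (auto simp: T_def)
    fix z assume z: "z \<in> T"
    have "v \<in> T" if v: "v \<in> Z.mball z \<eta>" for v
    proof -
      have "(z, v) \<in> ?R" using v by (simp add: near_def)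
      then show ?thesis using z v unfolding T_def by (auto intro: rtrancl_into_rtrancl)
    qed
    then show "\<exists>r>0. Z.mball z r \<subseteq> T" using \<eta> by blast
  qed
  moreover have "closedin Z.mtopology T"
    unfolding Z.closedin_metric
  proof (intro conjI allI impI)
    show "T \<subseteq> C" by (auto simp: T_def)
    fix z assume z: "z \<in> C - T"
    have "v \<notin> T" if v: "v \<in> Z.mball z \<eta>" for v
    proof
      assume "v \<in> T"
      moreover have "(v, z) \<in> ?R" using v by (simp add: near_def mdist_commute)
      ultimately have "z \<in> T" using z unfolding T_def by (auto intro: rtrancl_into_rtrancl)
      then show False using z by blast
    qed
    then show "\<exists>r>0. disjnt T (Z.mball z r)" using \<eta> by (auto simp: disjnt_iff)
  qed
  moreover have "x \<in> T" using xy by (simp add: T_def)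
  ultimately have "T = C" using con unfolding connected_space_clopen_in by auto
  then have "(x, y) \<in> ?R\<^sup>*" using xy(2) by (auto simp: T_def)
  then obtain l where "(x, y) \<in> ?R ^^ l" by (auto simp: rtrancl_is_UN_relpow)
  from near_relpow_imp_chain[OF this xy(1) CX] that show thesis .
qed

theorem locally_connected_imp_locally_chain_connected:
  assumes lc: "locally_connected_space (mtopology_of Y)"
  shows "locally_chain_connected Y"
  unfolding locally_chain_connected_def locally_chain_connected_at_def
proof (intro ballI allI impI)
  fix x0 and \<epsilon> :: real assume x0: "x0 \<in> mspace Y" and \<epsilon>: "0 < \<epsilon>"
  interpret Metric_space "mspace Y" "mdist Y" by simp
  have "openin (mtopology_of Y) (mball x0 (\<epsilon> / 2))" "x0 \<in> mball x0 (\<epsilon> / 2)"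
    using x0 \<epsilon> by (simp_all add: mtopology_of_def)
  then obtain C where C: "openin (mtopology_of Y) C" "connectedin (mtopology_of Y) C" "x0 \<in> C" "C \<subseteq> mball x0 (\<epsilon> / 2)"
    using lc[unfolded locally_connected_space, rule_format, OF conjI] by blast
  obtain \<delta> where \<delta>: "0 < \<delta>" "mball x0 \<delta> \<subseteq> C"
    using C(1,3) unfolding mtopology_of_def openin_mtopology by blast
  have "\<exists>l c. chain_linking Y \<eta> l x0 x c \<and> chain_diam Y l c < \<epsilon>"
    if \<eta>: "0 < \<eta>" and x: "x \<in> mspace Y" "mdist Y x x0 < \<delta>" for \<eta> x
  proof -
    have "x \<in> C" using \<delta>(2) x x0 by (auto simp: mdist_commute)
    from connectedin_imp_chain[OF C(2,3) this \<eta>]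
    obtain l c where c: "chain_linking Y \<eta> l x0 x c" "c ` {..l} \<subseteq> C" .
    have "mdist Y (c i) (c j) < \<epsilon>" if "i \<le> l" "j \<le> l" for i j
    proof -
      have "c i \<in> mball x0 (\<epsilon> / 2)" "c j \<in> mball x0 (\<epsilon> / 2)" using that c(2) C(4) by blast+
      then show ?thesis using mdist_triangle[of "c i" Y x0 "c j"] by (auto simp: mdist_commute)
    qed
    then have "chain_diam Y l c < \<epsilon>" unfolding chain_diam_def by (subst Max_less_iff) auto
    then show ?thesis using c(1) by blast
  qed
  then show "\<exists>\<delta>>0. \<forall>\<eta>>0. \<forall>x\<in>mspace Y. mdist Y x x0 < \<delta> \<longrightarrow>
      (\<exists>l c. chain_linking Y \<eta> l x0 x c \<and> chain_diam Y l c < \<epsilon>)"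
    using \<delta>(1) by blast
qed

lemma uniformly_locally_chain_equi_connected_imp_locally_chain_connected:
  assumes "uniformly_locally_chain_equi_connected Y"
  shows "locally_chain_connected Y"
  unfolding locally_chain_connected_def locally_chain_connected_at_def
proof (intro ballI allI impI)
  fix x0 and \<epsilon> :: real assume x0: "x0 \<in> mspace Y" and \<epsilon>: "0 < \<epsilon>"
  from assms[unfolded uniformly_locally_chain_equi_connected_def, rule_format, OF \<epsilon>]
  obtain \<delta> where \<delta>: "\<delta> > 0" "\<forall>\<eta>>0. \<exists>l. \<forall>x\<in>mspace Y. \<forall>y\<in>mspace Y. mdist Y x y < \<delta> \<longrightarrow>
      (\<exists>k\<le>l. \<exists>c. chain_linking Y \<eta> k x y c \<and> chain_diam Y k c < \<epsilon>)" by blast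
  have "\<exists>l c. chain_linking Y \<eta> l x0 x c \<and> chain_diam Y l c < \<epsilon>"
    if \<eta>: "0 < \<eta>" and x: "x \<in> mspace Y" "mdist Y x x0 < \<delta>" for \<eta> x
  proof -
    have "mdist Y x0 x < \<delta>" using x(2) by (simp only: mdist_commute)
    then show ?thesis using \<delta>(2)[rule_format, OF \<eta>] x0 x(1) by meson
  qed
  then show "\<exists>\<delta>>0. \<forall>\<eta>>0. \<forall>x\<in>mspace Y. mdist Y x x0 < \<delta> \<longrightarrow>
      (\<exists>l c. chain_linking Y \<eta> l x0 x c \<and> chain_diam Y l c < \<epsilon>)"
    using \<delta>(1) by blast
qed

lemma locally_chain_connected_at_subset:
  "locally_chain_connected Y \<Longrightarrow> Z \<subseteq> mspace Y \<Longrightarrow> locally_chain_connected_at Y Z"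
  unfolding locally_chain_connected_def locally_chain_connected_at_def by (meson subsetD)

section \<open>Absolute neighbourhood retracts are locally connected\<close>

text \<open>A uniform neighbourhood contains an open one.\<close>

theorem uniform_ANR_imp_metric_ANR:
  assumes "uniform_ANR TYPE('m) Y"
  shows "metric_ANR TYPE('m) Y"
  unfolding metric_ANR_def
proof (intro allI impI)
  fix M :: "'m metric" and e assume emb: "closed_isometric_embedding Y M e"
  let ?S = "e ` mspace Y"
  from assms[unfolded uniform_ANR_def, rule_format, OF emb]
  obtain U r where U: "uniform_neighborhood M ?S U" and r: "retraction_onto M U ?S r" by blast
  obtain \<epsilon> where \<epsilon>: "0 < \<epsilon>" "{x \<in> mspace M. set_dist M x ?S < ennreal \<epsilon>} \<subseteq> U"
    using U unfolding uniform_neighborhood_def by blast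
  have r1: "continuous_map (subtopology (mtopology_of M) U) (subtopology (mtopology_of M) ?S) r"
    and r2: "U \<subseteq> mspace M" "\<forall>x\<in>?S. r x = x"
    using r by (simp_all add: retraction_onto_def)
  define V where "V = (\<Union>s\<in>?S. mball_of M s \<epsilon>)"
  have SM: "?S \<subseteq> mspace M" using emb by (auto simp: closed_isometric_embedding_def)
  have VU: "V \<subseteq> U"
  proof
    fix x assume "x \<in> V"
    then obtain s where s: "s \<in> ?S" "x \<in> mspace M" "mdist M s x < \<epsilon>" unfolding V_def by auto
    then have "ennreal (mdist M x s) < ennreal \<epsilon>" using \<epsilon>(1) by (simp add: ennreal_less_iff mdist_commute)
    then have "set_dist M x ?S < ennreal \<epsilon>" using s(1) unfolding set_dist_def INF_less_iff by blast
    then show "x \<in> U" using \<epsilon>(2) s(2) by blast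
  qed
  have "?S \<subseteq> V"
  proof
    fix s assume "s \<in> ?S"
    moreover have "s \<in> mball_of M s \<epsilon>" using calculation SM \<epsilon>(1) by auto
    ultimately show "s \<in> V" unfolding V_def by blast
  qed
  moreover have openV: "openin (mtopology_of M) V"
  proof -
    have "openin (mtopology_of M) (mball_of M s \<epsilon>)" for s
      unfolding mball_of_def mtopology_of_def
      by (rule Metric_space.openin_mball[OF Metric_space_mspace_mdist])
    then show ?thesis unfolding V_def by (intro openin_Union) (elim imageE, simp only:)
  qed
  moreover have "continuous_map (subtopology (mtopology_of M) V) (subtopology (mtopology_of M) ?S) r"
    by (rule continuous_map_from_subtopology_mono[OF r1 VU])
  ultimately have "retraction_onto M V ?S r" using r2 VU by (auto simp only: retraction_onto_def intro: order_trans)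
  then show "\<exists>U r. openin (mtopology_of M) U \<and> retraction_onto M U ?S r" using openV by (intro exI conjI)
qed

lemma uniform_AR_imp_metric_AR: "uniform_AR TYPE('m) Y \<Longrightarrow> metric_AR TYPE('m) Y"
  unfolding uniform_AR_def metric_AR_def by blast

lemma metric_AR_imp_metric_ANR:
  assumes "metric_AR TYPE('m) Y"
  shows "metric_ANR TYPE('m) Y"
  unfolding metric_ANR_def
proof (intro allI impI)
  fix M :: "'m metric" and e assume emb: "closed_isometric_embedding Y M e"
  from assms[unfolded metric_AR_def, rule_format, OF emb]
  obtain r where "retraction_onto M (mspace M) (e ` mspace Y) r" ..
  moreover have "openin (mtopology_of M) (mspace M)"
    by (metis openin_topspace topspace_mtopology_of)
  ultimately show "\<exists>U r. openin (mtopology_of M) U \<and> retraction_onto M U (e ` mspace Y) r" by blast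
qed

lemma isometry_homeomorphic_space:
  assumes "f ` mspace A = mspace B" "\<And>x y. x \<in> mspace A \<Longrightarrow> y \<in> mspace A \<Longrightarrow> mdist B (f x) (f y) = mdist A x y"
  shows "mtopology_of A homeomorphic_space mtopology_of B"
proof -
  interpret Metric_space12 "mspace A" "mdist A" "mspace B" "mdist B" by (simp add: Metric_space12_mspace_mdist)
  have "homeomorphic_map M1.mtopology M2.mtopology f"
    using assms by (rule isometry_imp_homeomorphic_map)
  then show ?thesis unfolding mtopology_of_def by (rule homeomorphic_map_imp_homeomorphic_space)
qed

lemma metric_ANR_imp_locally_connected:
  fixes M :: "'m metric"
  assumes anr: "metric_ANR TYPE('m) Y" and emb: "closed_isometric_embedding Y M e"
    and lc: "locally_connected_space (mtopology_of M)"
  shows "locally_connected_space (mtopology_of Y)"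
proof -
  let ?S = "e ` mspace Y"
  from anr[unfolded metric_ANR_def, rule_format, OF emb]
  obtain U r where U: "openin (mtopology_of M) U" and r: "retraction_onto M U ?S r" by blast
  have SU: "?S \<subseteq> U" "U \<subseteq> mspace M" using r by (auto simp: retraction_onto_def)
  have "locally_connected_space (subtopology (mtopology_of M) U)"
    using lc U by (rule locally_connected_space_open_subset)
  moreover have "retraction_map (subtopology (mtopology_of M) U) (subtopology (mtopology_of M) ?S) r"
    unfolding retraction_map_def retraction_maps_def
  proof (intro exI[of _ id] conjI)
    show "continuous_map (subtopology (mtopology_of M) ?S) (subtopology (mtopology_of M) U) id"
      using SU(1) by (auto simp: continuous_map_in_subtopology)
  qed (use r SU in \<open>auto simp: retraction_onto_def\<close>)
  ultimately have "locally_connected_space (subtopology (mtopology_of M) ?S)"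
    by (metis locally_connected_space_retraction_map_image)
  moreover have "mtopology_of Y homeomorphic_space mtopology_of (submetric M ?S)"
    by (rule isometry_homeomorphic_space) (use emb SU in \<open>auto simp: closed_isometric_embedding_def\<close>)
  ultimately show ?thesis
    by (simp add: mtopology_of_submetric homeomorphic_locally_connected_space)
qed

definition kuratowski :: "'y metric \<Rightarrow> 'y \<Rightarrow> 'y \<Rightarrow> real" where
  "kuratowski Y y = restrict (mdist Y y) (mspace Y)"

text \<open>The bounded functions on \<open>Y\<close> that dominate a positive multiple of some distance function.
  Nonnegativity makes this set convex up to end points: moving from \<open>f\<close> towards another member
  keeps a fraction of the bound for \<open>f\<close>. So it is locally connected, and it is small enough for
  the distance functions to form a closed subset.\<close>

definition kuratowski_hull :: "'y metric \<Rightarrow> ('y \<Rightarrow> real) metric" where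
  "kuratowski_hull Y = submetric (funspace (mspace Y) euclidean_metric)
     {f. \<exists>y\<in>mspace Y. \<exists>l>0. \<forall>z\<in>mspace Y. l * mdist Y y z \<le> f z}"

lemma mspace_kuratowski_hull:
  "f \<in> mspace (kuratowski_hull Y) \<longleftrightarrow> f \<in> extensional (mspace Y) \<and> bounded (f ` mspace Y) \<and>
    (\<exists>y\<in>mspace Y. \<exists>l>0. \<forall>z\<in>mspace Y. l * mdist Y y z \<le> f z)"
  by (auto simp: kuratowski_hull_def Met_TC.fspace_def Met_TC.mbounded bounded_def)

lemma mdist_kuratowski_hull_le:
  assumes "f \<in> mspace (kuratowski_hull Y)" "g \<in> mspace (kuratowski_hull Y)"
  shows "mdist (kuratowski_hull Y) f g \<le> a \<longleftrightarrow> (\<forall>z\<in>mspace Y. \<bar>f z - g z\<bar> \<le> a)"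
proof -
  have "mspace Y \<noteq> {}" using assms(1) unfolding mspace_kuratowski_hull by blast
  then show ?thesis
    using assms funspace_mdist_le[of f "mspace Y" euclidean_metric g a]
    by (simp add: kuratowski_hull_def dist_real_def)
qed

lemma kuratowski_hull_coord:
  assumes "f \<in> mspace (kuratowski_hull Y)" "g \<in> mspace (kuratowski_hull Y)" "z \<in> mspace Y"
  shows "\<bar>f z - g z\<bar> \<le> mdist (kuratowski_hull Y) f g"
  using mdist_kuratowski_hull_le[OF assms(1,2), of "mdist (kuratowski_hull Y) f g"] assms(3) by simp

text \<open>Let \<open>f\<close> dominate \<open>l * mdist Y y\<close>. If \<open>f\<close> is within \<open>s\<close> of the distance function of \<open>z\<close>, then
  evaluation at \<open>z\<close> gives \<open>l * mdist Y y z < s\<close>, so that \<open>f\<close> is within \<open>s + s / l\<close> of the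
  distance function of \<open>y\<close>. Hence a limit of distance functions is a distance function.\<close>

lemma kuratowski_closed_isometric_embedding:
  assumes bd: "\<And>y z. y \<in> mspace Y \<Longrightarrow> z \<in> mspace Y \<Longrightarrow> mdist Y y z \<le> B"
  shows "closed_isometric_embedding Y (kuratowski_hull Y) (kuratowski Y)"
proof -
  let ?N = "kuratowski_hull Y" and ?k = "kuratowski Y"
  have k: "?k y \<in> mspace ?N" if y: "y \<in> mspace Y" for y
    unfolding mspace_kuratowski_hull
  proof (intro conjI bexI[of _ y] exI[of _ 1])
    show "?k y \<in> extensional (mspace Y)" by (simp add: kuratowski_def)
    show "bounded (?k y ` mspace Y)" using bd[OF y] by (auto intro!: boundedI[of _ B] simp: kuratowski_def)
  qed (use y in \<open>auto simp: kuratowski_def\<close>)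
  have le: "mdist ?N (?k x) (?k y) \<le> mdist Y x y" if xy: "x \<in> mspace Y" "y \<in> mspace Y" for x y
  proof -
    have "\<bar>mdist Y x z - mdist Y y z\<bar> \<le> mdist Y x y" if z: "z \<in> mspace Y" for z
      using mdist_triangle[OF xy z] mdist_triangle[OF xy(2,1) z] by (simp add: mdist_commute abs_le_iff)
    then show ?thesis by (subst mdist_kuratowski_hull_le[OF k k]) (use xy in \<open>auto simp: kuratowski_def\<close>)
  qed
  have ge: "f y \<le> mdist ?N f (?k y)" if f: "f \<in> mspace ?N" and y: "y \<in> mspace Y" for f y
    using kuratowski_hull_coord[OF f k[OF y] y] y by (simp add: kuratowski_def)
  have iso: "mdist ?N (?k x) (?k y) = mdist Y x y" if xy: "x \<in> mspace Y" "y \<in> mspace Y" for x y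
    using le[OF xy] ge[OF k[OF xy(1)] xy(2)] xy by (simp add: kuratowski_def)
  interpret N: Metric_space "mspace ?N" "mdist ?N" by simp
  have "closedin N.mtopology (?k ` mspace Y)"
    unfolding N.closedin_metric
  proof (intro conjI allI impI)
    show "?k ` mspace Y \<subseteq> mspace ?N" using k by blast
    fix f assume f: "f \<in> mspace ?N - ?k ` mspace Y"
    then obtain y l where y: "y \<in> mspace Y" "0 < l" "\<And>z. z \<in> mspace Y \<Longrightarrow> l * mdist Y y z \<le> f z"
      unfolding Diff_iff mspace_kuratowski_hull by blast
    have fN: "f \<in> mspace ?N" using f by blast
    define \<rho> where "\<rho> = mdist ?N f (?k y)"
    have \<rho>: "0 < \<rho>" unfolding \<rho>_def using f y(1) k[OF y(1)] by (intro mdist_gt_0) auto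
    define s where "s = \<rho> / (1 + 1 / l)"
    have l1: "0 < 1 + 1 / l" using y(2) by (simp add: add_pos_pos)
    have "s * (1 + 1 / l) = \<rho>" unfolding s_def using l1 by simp
    then have s: "0 < s" "s + s / l = \<rho>" using \<rho> l1 by (simp_all add: s_def distrib_left)
    have "s \<le> mdist ?N f (?k z)" if z: "z \<in> mspace Y" for z
    proof (rule ccontr)
      assume "\<not> ?thesis"
      then have d: "mdist ?N f (?k z) < s" by simp
      then have "l * mdist Y y z < s" using ge[OF fN z] y(3)[OF z] by linarith
      then have "mdist Y z y < s / l" using y(2) by (simp add: field_simps mdist_commute)
      then have "\<rho> < s + s / l"
        using mdist_triangle[OF fN k[OF z] k[OF y(1)]] d le[OF z y(1)] unfolding \<rho>_def by linarith
      then show False using s(2) by simp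
    qed
    then show "\<exists>r>0. disjnt (?k ` mspace Y) (N.mball f r)"
      using s(1) by (intro exI[of _ s]) (force simp: disjnt_iff)
  qed
  then show ?thesis using k iso unfolding closed_isometric_embedding_def mtopology_of_def by auto
qed

lemma kuratowski_hull_locally_connected:
  "locally_connected_space (mtopology_of (kuratowski_hull Y))"
  unfolding locally_connected_space_im_kleinen
proof (intro allI impI, elim conjE)
  let ?N = "kuratowski_hull Y"
  interpret N: Metric_space "mspace ?N" "mdist ?N" by simp
  fix V f assume V: "openin (mtopology_of ?N) V" "f \<in> V"
  then obtain r where r: "0 < r" "N.mball f r \<subseteq> V" unfolding mtopology_of_def N.openin_mtopology by blast
  have f: "f \<in> mspace ?N" using V openin_subset by fastforce
  have "\<exists>C. connectedin (mtopology_of ?N) C \<and> C \<subseteq> V \<and> f \<in> C \<and> g \<in> C" if g: "g \<in> N.mball f r" for g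
  proof -
    have gN: "g \<in> mspace ?N" and fg: "mdist ?N f g < r" using g by auto
    define h where "h t = restrict (\<lambda>z. (1 - t) * f z + t * g z) (mspace Y)" for t
    obtain y l where y: "y \<in> mspace Y" "0 < l" "\<And>z. z \<in> mspace Y \<Longrightarrow> l * mdist Y y z \<le> f z"
      using f unfolding mspace_kuratowski_hull by blast
    obtain y' l' where y': "y' \<in> mspace Y" "0 < l'" "\<And>z. z \<in> mspace Y \<Longrightarrow> l' * mdist Y y' z \<le> g z"
      using gN unfolding mspace_kuratowski_hull by blast
    have ext: "f \<in> extensional (mspace Y)" "g \<in> extensional (mspace Y)" using f gN by (auto simp: mspace_kuratowski_hull)
    have h01: "h 0 = f" "h 1 = g"
      using ext by (auto simp: h_def fun_eq_iff extensional_def)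
    have pos: "0 \<le> f z" "0 \<le> g z" if "z \<in> mspace Y" for z
      using y(2,3) y'(2,3) that by (meson mdist_nonneg mult_nonneg_nonneg less_imp_le order_trans)+
    have hN: "h t \<in> mspace ?N" if t: "t \<in> {0..1}" for t
    proof (cases "t = 1")
      case True
      then show ?thesis using h01 gN by simp
    next
      case False
      obtain a b where ab: "\<And>z. z \<in> mspace Y \<Longrightarrow> \<bar>f z\<bar> \<le> a" "\<And>z. z \<in> mspace Y \<Longrightarrow> \<bar>g z\<bar> \<le> b"
        using f gN unfolding mspace_kuratowski_hull bounded_iff by fastforce
      have "\<bar>h t z\<bar> \<le> a + b" if z: "z \<in> mspace Y" for z
      proof -
        have "(1 - t) * f z \<le> 1 * f z" "t * g z \<le> 1 * g z" "0 \<le> (1 - t) * f z" "0 \<le> t * g z"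
          using t pos[OF z] by (auto simp: mult_left_le_one_le)
        then show ?thesis using ab[OF z] z by (simp add: h_def)
      qed
      then have "bounded (h t ` mspace Y)" by (auto intro!: boundedI)
      moreover have "(1 - t) * l * mdist Y y z \<le> h t z" if z: "z \<in> mspace Y" for z
      proof -
        have "(1 - t) * (l * mdist Y y z) \<le> (1 - t) * f z" using y(3)[OF z] t by (intro mult_left_mono) auto
        moreover have "0 \<le> t * g z" using t pos(2)[OF z] by simp
        ultimately show ?thesis using z by (simp add: h_def mult.assoc)
      qed
      moreover have "0 < (1 - t) * l" using t False y(2) by simp
      ultimately show ?thesis unfolding mspace_kuratowski_hull using y(1) by (auto simp: h_def)
    qed
    have hd: "mdist ?N (h s) (h t) \<le> \<bar>s - t\<bar> * mdist ?N f g" if st: "s \<in> {0..1}" "t \<in> {0..1}" for s t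
    proof (subst mdist_kuratowski_hull_le[OF hN[OF st(1)] hN[OF st(2)]], intro ballI)
      fix z assume z: "z \<in> mspace Y"
      have "h s z - h t z = (t - s) * (f z - g z)" using z by (simp add: h_def algebra_simps)
      then have "\<bar>h s z - h t z\<bar> = \<bar>s - t\<bar> * \<bar>f z - g z\<bar>" by (simp add: abs_mult abs_minus_commute)
      also have "\<dots> \<le> \<bar>s - t\<bar> * mdist ?N f g" using kuratowski_hull_coord[OF f gN z] by (intro mult_left_mono) auto
      finally show "\<bar>h s z - h t z\<bar> \<le> \<bar>s - t\<bar> * mdist ?N f g" .
    qed
    let ?I = "submetric euclidean_metric {0..1::real}"
    have "Lipschitz_continuous_map ?I ?N h"
      unfolding Lipschitz_continuous_map_def using hN hd
      by (intro conjI exI[of _ "mdist ?N f g"]) (auto simp: dist_real_def mult.commute)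
    then have "continuous_map (mtopology_of ?I) (mtopology_of ?N) h"
      by (rule Lipschitz_continuous_imp_continuous_map)
    moreover have "connectedin (mtopology_of ?I) {0..1}"
      by (simp add: mtopology_of_submetric connectedin_subtopology)
    ultimately have "connectedin (mtopology_of ?N) (h ` {0..1})" by (rule connectedin_continuous_map_image)
    moreover have "h ` {0..1} \<subseteq> V"
    proof
      fix k assume "k \<in> h ` {0..1}"
      then obtain t where t: "t \<in> {0..1}" "k = h t" by blast
      have "mdist ?N f (h t) \<le> t * mdist ?N f g" using hd[of 0 t] t h01 by simp
      also have "\<dots> \<le> 1 * mdist ?N f g" using t by (intro mult_right_mono) auto
      finally have "h t \<in> N.mball f r" using hN[OF t(1)] f fg by simp
      then show "k \<in> V" using r(2) t(2) by blast
    qed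
    moreover have "f \<in> h ` {0..1}" "g \<in> h ` {0..1}" using h01 by (force intro: image_eqI[of _ h 0] image_eqI[of _ h 1])+
    ultimately show ?thesis by blast
  qed
  moreover have "openin (mtopology_of ?N) (N.mball f r)" "f \<in> N.mball f r"
    using r(1) f by (simp_all add: mtopology_of_def)
  ultimately show "\<exists>U. openin (mtopology_of ?N) U \<and> f \<in> U \<and> U \<subseteq> V \<and>
      (\<forall>g\<in>U. \<exists>C. connectedin (mtopology_of ?N) C \<and> C \<subseteq> V \<and> f \<in> C \<and> g \<in> C)"
    using r(2) by blast
qed

text \<open>Transport of a metric to the second summand of a sum type, where ambient spaces are sought.\<close>

definition Inr_metric :: "'n metric \<Rightarrow> ('u + 'n) metric" where
  "Inr_metric N = metric (Inr ` mspace N, \<lambda>a b. mdist N (projr a) (projr b))"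

lemma
  fixes N :: "'n metric" and a b :: "'u + 'n"
  shows mspace_Inr_metric [simp]: "mspace (Inr_metric N :: ('u + 'n) metric) = Inr ` mspace N"
    and mdist_Inr_metric [simp]: "mdist (Inr_metric N) a b = mdist N (projr a) (projr b)"
proof -
  have "Metric_space (Inr ` mspace N :: ('u + 'n) set) (\<lambda>a b. mdist N (projr a) (projr b))"
    by unfold_locales (auto simp: mdist_commute intro: mdist_triangle)
  then show "mspace (Inr_metric N :: ('u + 'n) metric) = Inr ` mspace N"
      "mdist (Inr_metric N) a b = mdist N (projr a) (projr b)"
    unfolding Inr_metric_def by (simp_all add: Metric_space.mspace_metric Metric_space.mdist_metric)
qed

text \<open>An open subset of the locally connected space \<open>kuratowski_hull Y\<close> retracts onto the copy of \<open>Y\<close>.\<close>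

theorem metric_ANR_imp_locally_connected_space:
  fixes Y :: "'y metric"
  assumes anr: "metric_ANR TYPE('u + ('y \<Rightarrow> real)) Y"
    and bd: "\<And>y z. y \<in> mspace Y \<Longrightarrow> z \<in> mspace Y \<Longrightarrow> mdist Y y z \<le> B"
  shows "locally_connected_space (mtopology_of Y)"
proof -
  let ?N = "kuratowski_hull Y" and ?N' = "Inr_metric (kuratowski_hull Y) :: ('u + ('y \<Rightarrow> real)) metric"
  let ?j = "Inr :: ('y \<Rightarrow> real) \<Rightarrow> 'u + ('y \<Rightarrow> real)"
  have kur: "kuratowski Y \<in> mspace Y \<rightarrow> mspace ?N"
    "\<And>x y. x \<in> mspace Y \<Longrightarrow> y \<in> mspace Y \<Longrightarrow> mdist ?N (kuratowski Y x) (kuratowski Y y) = mdist Y x y"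
    "closedin (mtopology_of ?N) (kuratowski Y ` mspace Y)"
    using kuratowski_closed_isometric_embedding[of Y B, OF bd] by (auto simp: closed_isometric_embedding_def)
  interpret Metric_space12 "mspace ?N" "mdist ?N" "mspace ?N'" "mdist ?N'" by (rule Metric_space12_mspace_mdist)
  have hom: "homeomorphic_map (mtopology_of ?N) (mtopology_of ?N') ?j"
    unfolding mtopology_of_def by (rule isometry_imp_homeomorphic_map) auto
  have "closedin (mtopology_of ?N') (?j ` (kuratowski Y ` mspace Y))"
    using homeomorphic_map_closedness_eq[OF hom] kur(3) by blast
  then have "closed_isometric_embedding Y ?N' (?j \<circ> kuratowski Y)"
    using kur(1,2) unfolding closed_isometric_embedding_def by (auto simp: image_image)
  moreover have "locally_connected_space (mtopology_of ?N')"
    using kuratowski_hull_locally_connected homeomorphic_locally_connected_space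
      homeomorphic_map_imp_homeomorphic_space[OF hom] by blast
  ultimately show ?thesis using anr metric_ANR_imp_locally_connected by blast
qed

section \<open>The equivalences\<close>

theorem theorem1:
  fixes X :: "'a metric"
  assumes "mspace X \<noteq> {}"
  shows
    "(metric_ANR TYPE('u + ('a set \<Rightarrow> real)) (hyperspace X)
        \<longleftrightarrow> locally_connected_space (mtopology_of (hyperspace X))) \<and>
     (locally_connected_space (mtopology_of (hyperspace X))
        \<longleftrightarrow> uniform_ANR TYPE('u + ('a set \<Rightarrow> real)) (hyperspace X)) \<and>
     (uniform_ANR TYPE('u + ('a set \<Rightarrow> real)) (hyperspace X)
        \<longleftrightarrow> uniformly_locally_path_equi_connected (hyperspace X)) \<and>
     (uniformly_locally_path_equi_connected (hyperspace X)
        \<longleftrightarrow> locally_chain_connected (hyperspace X)) \<and>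
     (locally_chain_connected (hyperspace X)
        \<longleftrightarrow> locally_chain_connected_at (hyperspace X) (small_discrete_closed_sets X)) \<and>
     (locally_chain_connected_at (hyperspace X) (small_discrete_closed_sets X)
        \<longleftrightarrow> uniformly_locally_chain_equi_connected X) \<and>
     (uniformly_locally_chain_equi_connected X
        \<longleftrightarrow> uniformly_locally_trace_equi_connected X) \<and>
     (uniformly_locally_trace_equi_connected X
        \<longleftrightarrow> weakly_convexifiable X) \<and>
     (mcomplete_of X \<longrightarrow>
        (metric_ANR TYPE('u + ('a set \<Rightarrow> real)) (hyperspace X)
          \<longleftrightarrow> uniformly_locally_path_equi_connected X)) \<and>
     (uniformly_locally_compact X \<longrightarrow>
        (metric_ANR TYPE('u + ('a set \<Rightarrow> real)) (hyperspace X)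
          \<longleftrightarrow> uniformly_locally_path_equi_connected X) \<and>
        (metric_ANR TYPE('u + ('a set \<Rightarrow> real)) (hyperspace X)
          \<longleftrightarrow> (\<forall>H. discrete_closed_sets X \<subseteq> H \<and> H \<subseteq> mspace (hyperspace X) \<longrightarrow>
                uniform_ANR TYPE('u + ('a set \<Rightarrow> real)) (submetric (hyperspace X) H)))) \<and>
     (chain_equi_connected X \<longrightarrow>
        (metric_ANR TYPE('u + ('a set \<Rightarrow> real)) (hyperspace X)
          \<longleftrightarrow> metric_AR TYPE('u + ('a set \<Rightarrow> real)) (hyperspace X)) \<and>
        (metric_ANR TYPE('u + ('a set \<Rightarrow> real)) (hyperspace X)
          \<longleftrightarrow> uniform_AR TYPE('u + ('a set \<Rightarrow> real)) (hyperspace X)))"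
proof -
  let ?H = "hyperspace X"
  let ?anr = "metric_ANR TYPE('u + ('a set \<Rightarrow> real)) ?H"
  let ?uanr = "uniform_ANR TYPE('u + ('a set \<Rightarrow> real)) ?H"
  let ?is_trace = "\<exists>w e. trace_connected X w e"
  have "mdist ?H A B \<le> 1" for A B
    by (simp add: mdist_hyperspace enn2real_leI)
  then have anr_lc: "?anr \<Longrightarrow> locally_connected_space (mtopology_of ?H)"
    by (intro metric_ANR_imp_locally_connected_space[of ?H 1])
  have lc_lcc: "locally_connected_space (mtopology_of ?H) \<Longrightarrow> locally_chain_connected ?H"
    by (rule locally_connected_imp_locally_chain_connected)
  have lcc_small: "locally_chain_connected ?H \<Longrightarrow> locally_chain_connected_at ?H (small_discrete_closed_sets X)"
    by (erule locally_chain_connected_at_subset) (auto simp: small_discrete_closed_sets_def discrete_closed_sets_def)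
  have small_ulc: "locally_chain_connected_at ?H (small_discrete_closed_sets X) \<Longrightarrow> uniformly_locally_chain_equi_connected X"
    by (rule locally_chain_connected_imp_uniformly_locally_chain_equi_connected)
  have ulc_trace: "uniformly_locally_chain_equi_connected X \<Longrightarrow> ?is_trace"
    by (erule uniformly_locally_chain_equi_connected_imp_trace_connected) blast
  have trace_ult: "?is_trace \<Longrightarrow> uniformly_locally_trace_equi_connected X"
    using trace_connected_imp_uniformly_locally_trace_equi_connected by blast
  have ult_trace: "uniformly_locally_trace_equi_connected X \<Longrightarrow> ?is_trace"
    by (erule uniformly_locally_trace_equi_connected_imp_trace_connected) blast
  have trace_wc: "?is_trace \<Longrightarrow> weakly_convexifiable X"
    using trace_connected_imp_weakly_convexifiable by blast
  have wc_ulc: "weakly_convexifiable X \<Longrightarrow> uniformly_locally_chain_equi_connected X"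
    by (rule weakly_convexifiable_imp_uniformly_locally_chain_equi_connected)
  have trace_uanr: "?is_trace \<Longrightarrow> ?uanr"
    using trace_connected_imp_uniform_ANR_hyperspace assms by blast
  have uanr_anr: "?uanr \<Longrightarrow> ?anr" by (rule uniform_ANR_imp_metric_ANR)
  have trace_path: "?is_trace \<Longrightarrow> uniformly_locally_path_equi_connected ?H"
    using trace_connected_imp_uniformly_locally_path_equi_connected_hyperspace by blast
  have path_lcc: "locally_chain_connected ?H" if path: "uniformly_locally_path_equi_connected ?H"
  proof -
    obtain w e where "trace_connected ?H w e"
      by (rule uniformly_locally_path_equi_connected_imp_trace_connected[OF path])
    then have "uniformly_locally_chain_equi_connected ?H"
      by (intro weakly_convexifiable_imp_uniformly_locally_chain_equi_connected
          trace_connected_imp_weakly_convexifiable)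
    then show ?thesis by (rule uniformly_locally_chain_equi_connected_imp_locally_chain_connected)
  qed
  have anr_trace: "?anr \<longleftrightarrow> ?is_trace"
    using anr_lc lc_lcc lcc_small small_ulc ulc_trace trace_uanr uanr_anr by blast
  have complete: "?anr \<longleftrightarrow> uniformly_locally_path_equi_connected X" if "mcomplete_of X"
  proof -
    have "uniformly_locally_path_equi_connected X \<Longrightarrow> ?is_trace"
      by (erule uniformly_locally_path_equi_connected_imp_trace_connected) blast
    moreover have "?is_trace \<Longrightarrow> uniformly_locally_path_equi_connected X"
      using trace_connected_complete_imp_uniformly_locally_path_equi_connected that by blast
    ultimately show ?thesis using anr_trace by blast
  qed
  have between: "?anr \<longleftrightarrow> (\<forall>H. discrete_closed_sets X \<subseteq> H \<and> H \<subseteq> mspace ?H \<longrightarrow>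
      uniform_ANR TYPE('u + ('a set \<Rightarrow> real)) (submetric ?H H))" (is "_ \<longleftrightarrow> ?all")
    if ulc: "uniformly_locally_compact X"
  proof
    assume ?anr
    then obtain w e where tc: "trace_connected X w e" using anr_trace by blast
    show ?all
    proof (intro allI impI, elim conjE)
      fix H assume "discrete_closed_sets X \<subseteq> H" "H \<subseteq> mspace ?H"
      then show "uniform_ANR TYPE('u + ('a set \<Rightarrow> real)) (submetric ?H H)"
        by (intro uniformly_locally_compact_imp_uniform_ANR_between[OF tc ulc assms]) simp_all
    qed
  next
    assume all: ?all
    have "discrete_closed_sets X \<subseteq> mspace ?H" by (auto simp: discrete_closed_sets_def)
    then have "uniform_ANR TYPE('u + ('a set \<Rightarrow> real)) (submetric ?H (mspace ?H))" using all by blast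
    then have ?uanr by (simp only: submetric_mspace)
    then show ?anr by (rule uanr_anr)
  qed
  have equi: "(?anr \<longleftrightarrow> metric_AR TYPE('u + ('a set \<Rightarrow> real)) ?H) \<and> (?anr \<longleftrightarrow> uniform_AR TYPE('u + ('a set \<Rightarrow> real)) ?H)"
    if ce: "chain_equi_connected X"
  proof -
    have "?is_trace \<Longrightarrow> uniform_AR TYPE('u + ('a set \<Rightarrow> real)) ?H"
      using trace_connected_imp_uniform_AR_hyperspace assms ce by blast
    then show ?thesis using anr_trace uniform_AR_imp_metric_AR metric_AR_imp_metric_ANR by blast
  qed
  note cycle = anr_lc lc_lcc lcc_small small_ulc ulc_trace trace_ult ult_trace trace_wc wc_ulc trace_uanr
    uanr_anr trace_path path_lcc
  show ?thesis
  proof (intro conjI impI)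
    show "?anr \<longleftrightarrow> locally_connected_space (mtopology_of ?H)" using cycle by blast
    show "locally_connected_space (mtopology_of ?H) \<longleftrightarrow> ?uanr" using cycle by blast
    show "?uanr \<longleftrightarrow> uniformly_locally_path_equi_connected ?H" using cycle by blast
    show "uniformly_locally_path_equi_connected ?H \<longleftrightarrow> locally_chain_connected ?H" using cycle by blast
    show "locally_chain_connected ?H \<longleftrightarrow> locally_chain_connected_at ?H (small_discrete_closed_sets X)"
      using cycle by blast
    show "locally_chain_connected_at ?H (small_discrete_closed_sets X) \<longleftrightarrow> uniformly_locally_chain_equi_connected X"
      using cycle by blast
    show "uniformly_locally_chain_equi_connected X \<longleftrightarrow> uniformly_locally_trace_equi_connected X" using cycle by blast
    show "uniformly_locally_trace_equi_connected X \<longleftrightarrow> weakly_convexifiable X" using cycle by blast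
    assume "uniformly_locally_compact X"
    then show "?anr \<longleftrightarrow> uniformly_locally_path_equi_connected X"
      using complete uniformly_locally_compact_imp_mcomplete by blast
  qed (use complete between equi in blast)+
qed

end
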